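(* Let $d\ge1$ and let $V$ be a non-negative, stationary and ergodic potential on $\mathbb{R}^d$ with $\sup_{x\in B(0)}V(x,\cdot)\in L_{\mathbb{P}}(d,1)$, and suppose that there exist positive constants $\rho,\varepsilon$ and a measurable function $u:\Omega\to\mathbb{R}^d$ such that $\mathbb{P}$-a.s. $$\mathrm{Leb}\big(\{x\in\mathbb{R}^d: V(x,\omega)>\varepsilon\}\cap B(u(\omega),\rho)\big)>\varepsilon,\qquad\text{and}\qquad \mathbb{E}(|u(\cdot)|^d)<\infty .$$ Then, $\mathbb{P}$-a.s., as $x\to\infty$, $x\in\mathbb{R}^d$, $$\frac1{|x|}\,|a(0,x,\omega)-\alpha(x)|\to0 .$$ The same holds with $a(0,x,\omega)$ replaced by $-\log g(0,x,\omega)$.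
   Context: Potential. $(\Omega,\mathcal{F},\mathbb{P})$ is a probability space with expectation $\mathbb{E}$, and $(\tau_x;x\in\mathbb{R}^d)$ is a family of measurable maps on $\Omega$ with $\tau_x\circ\tau_y=\tau_{x+y}$, $(x,\omega)\mapsto\tau_x\omega$ measurable on $\mathbb{R}^d\times\Omega$, $\mathbb{P}$ invariant under every $\tau_x$, and ergodic: if $A\in\mathcal{F}$ satisfies $\tau_x(A)=A$ for all $x\in\mathbb{R}^d$ then $\mathbb{P}(A)\in\{0,1\}$. A non-negative, stationary and ergodic potential is a function $V(x,\omega):=V_0(\tau_x\omega)$, where $V_0:\Omega\to[0,\infty)$ is a random variable which is not identically zero. Notation. $B(y,R)=\{x:|x-y|<R\}$, $B(y)=B(y,1)$, $\overline B(y)$ is the closure of $B(y)$; $\mathrm{Leb}$ is Lebesgue measure on $\mathbb{R}^d$; $E[X,A]:=E[X\mathbf 1_A]$. $L_{\mathbb{P}}(d,1)$ is the Lorentz space of real random variables $f$ with $\|f\|_{d,1}=\int_0^1 f^*(s)s^{(1/d)-1}ds<\infty$, where $f^*:[0,1]\to\mathbb{R}^+$ is the non-increasing right-continuous function having the same distribution (under Lebesgue measure on $[0,1]$) as $|f|$ (under $\mathbb{P}$). $(Z_s)$ is standard Brownian motion on $\mathbb{R}^d$, $P_x$ the Wiener measure started at $x$ with expectation $E_x$; $H(y):=\inf\{t\ge0:Z_t\in\overline B(y)\}$; $e(x,y,\omega):=E_x[\exp(-\int_0^{H(y)}V(Z_s,\omega)ds),H(y)<\infty]$ and $a(x,y,\omega):=-\log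 e(x,y,\omega)$. Lyapunov exponent. $\alpha(\cdot)$ is the non-random semi-norm on $\mathbb{R}^d$ given, for each $x$, $\mathbb{P}$-a.s. by $\alpha(x)=\lim_{r\to\infty}\frac1ra(0,rx,\omega)$ (the limit exists and is non-random). Green function. The Green measure is $G(x,A,\omega):=E_x[\int_0^\infty\mathbf 1_A(Z_t)\exp(-\int_0^tV(Z_s,\omega)ds)dt]$ for Borel $A\subset\mathbb{R}^d$, and $g(x,\cdot,\omega)$ is its density with respect to Lebesgue measure, in the usual pointwise-defined version $g(x,y,\omega)=\int_0^\infty p(t,x,y)\,E^t_{x,y}[\exp(-\int_0^tV(Z_s,\omega)ds)]dt$, with $p$ the Brownian transition density and $E^t_{x,y}$ the expectation for the Brownian bridge from $x$ to $y$ in time $t$. *)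

theory Defs
  imports "HOL-Probability.Probability"
begin

section \<open>Stationary ergodic potentials\<close>

text \<open>Invariance of an event is expressed by preimages. If \<open>\<tau> 0\<close> is the identity, then
  \<open>\<tau> x -` A = \<tau> (- x) ` A\<close>, so this is the condition that \<open>\<tau> x ` A = A\<close> for all \<open>x\<close>.
  With preimages one need not require \<open>\<tau> 0\<close> to be the identity.\<close>

locale ergodic_flow = prob_space M for M :: "'o measure" +
  fixes \<tau> :: "'a::euclidean_space \<Rightarrow> 'o \<Rightarrow> 'o"
  assumes flow_measurable: "\<tau> x \<in> measurable M M"
    and flow_jointly_measurable: "(\<lambda>(x, \<omega>). \<tau> x \<omega>) \<in> measurable (borel \<Otimes>\<^sub>M M) M"
    and flow_add: "\<omega> \<in> space M \<Longrightarrow> \<tau> x (\<tau> y \<omega>) = \<tau> (x + y) \<omega>"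
    and flow_invariant: "distr M M (\<tau> x) = M"
    and flow_ergodic:
      "A \<in> sets M \<Longrightarrow> (\<And>x. \<tau> x -` A \<inter> space M = A) \<Longrightarrow> prob A = 0 \<or> prob A = 1"

locale ergodic_potential = ergodic_flow M \<tau>
  for M :: "'o measure" and \<tau> :: "'a::euclidean_space \<Rightarrow> 'o \<Rightarrow> 'o" +
  fixes V0 :: "'o \<Rightarrow> real"
  assumes potential_measurable: "V0 \<in> borel_measurable M"
    and potential_nonneg: "\<omega> \<in> space M \<Longrightarrow> 0 \<le> V0 \<omega>"
    and potential_not_zero: "\<exists>\<omega>\<in>space M. V0 \<omega> \<noteq> 0"

definition potential :: "('a \<Rightarrow> 'o \<Rightarrow> 'o) \<Rightarrow> ('o \<Rightarrow> real) \<Rightarrow> 'a \<Rightarrow> 'o \<Rightarrow> real" where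
  "potential \<tau> V0 x \<omega> = V0 (\<tau> x \<omega>)"


section \<open>The Lorentz space L(d,1)\<close>

text \<open>The rearrangement lives on the open unit interval: for unbounded \<open>f\<close> its value at 0
  would be infinite. It is unique there.\<close>

definition is_decreasing_rearrangement :: "'o measure \<Rightarrow> ('o \<Rightarrow> real) \<Rightarrow> (real \<Rightarrow> real) \<Rightarrow> bool" where
  "is_decreasing_rearrangement M f fs \<longleftrightarrow>
     antimono_on {0<..<1} fs \<and>
     (\<forall>s\<in>{0<..<1}. 0 \<le> fs s \<and> continuous (at_right s) fs) \<and>
     distr (restrict_space lborel {0<..<1}) borel fs = distr M borel (\<lambda>\<omega>. \<bar>f \<omega>\<bar>)"

definition lorentz_space :: "'o measure \<Rightarrow> nat \<Rightarrow> ('o \<Rightarrow> real) set" where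
  "lorentz_space M d = {f \<in> borel_measurable M. \<exists>fs. is_decreasing_rearrangement M f fs \<and>
     (\<integral>\<^sup>+s\<in>{0<..<1}. ennreal (fs s * s powr (1 / real d - 1)) \<partial>lborel) < \<infinity>}"


section \<open>Brownian motion and Brownian bridge\<close>

definition heat_kernel :: "real \<Rightarrow> 'a::euclidean_space \<Rightarrow> 'a \<Rightarrow> real" where
  "heat_kernel t x y = (2 * pi * t) powr (- real DIM('a) / 2) * exp (- (norm (x - y))\<^sup>2 / (2 * t))"

text \<open>Standard Brownian motion started at 0. Expectations under the Wiener measure started at \<open>x\<close>
  are expectations of functionals of the path \<open>\<lambda>t. x + B t w\<close>.\<close>

locale standard_brownian_motion = prob_space W for W :: "'w measure" +
  fixes B :: "real \<Rightarrow> 'w \<Rightarrow> 'a::euclidean_space"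
  assumes bm_measurable: "0 \<le> t \<Longrightarrow> B t \<in> borel_measurable W"
    and bm_start: "w \<in> space W \<Longrightarrow> B 0 w = 0"
    and bm_continuous: "w \<in> space W \<Longrightarrow> continuous_on {0..} (\<lambda>t. B t w)"
    and bm_gaussian: "0 \<le> s \<Longrightarrow> s < t \<Longrightarrow>
      distributed W lborel (\<lambda>w. B t w - B s w) (\<lambda>z. ennreal (heat_kernel (t - s) 0 z))"
    and bm_indep_increments: "\<And>(n::nat) (t::nat \<Rightarrow> real). 0 \<le> t 0 \<Longrightarrow> (\<And>i. i < n \<Longrightarrow> t i < t (Suc i)) \<Longrightarrow>
      indep_vars (\<lambda>_. borel) (\<lambda>i w. B (t (Suc i)) w - B (t i) w) {..<n}"

definition brownian_bridge ::
  "(real \<Rightarrow> 'w \<Rightarrow> 'a::euclidean_space) \<Rightarrow> real \<Rightarrow> 'a \<Rightarrow> 'a \<Rightarrow> real \<Rightarrow> 'w \<Rightarrow> 'a" where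
  "brownian_bridge B t x y s w = x + (s / t) *\<^sub>R (y - x) + (B s w - (s / t) *\<^sub>R B t w)"


section \<open>Travel cost, Lyapunov exponent and Green function\<close>

definition exp_neg :: "ennreal \<Rightarrow> ennreal" where
  "exp_neg a = (if a = \<infinity> then 0 else ennreal (exp (- enn2real a)))"

definition neg_log :: "ennreal \<Rightarrow> ereal" where
  "neg_log a = (if a = 0 then \<infinity> else if a = \<infinity> then -\<infinity> else ereal (- ln (enn2real a)))"

text \<open>The infimum is infinite if the path \<open>z\<close> never hits the ball.\<close>

definition hitting_time :: "(real \<Rightarrow> 'a::euclidean_space) \<Rightarrow> 'a \<Rightarrow> ennreal" where
  "hitting_time z y = (INF t\<in>{t. 0 \<le> t \<and> z t \<in> cball y 1}. ennreal t)"

text \<open>Here and below, \<open>U\<close> is a fixed realisation \<open>\<lambda>x. V x \<omega>\<close> of the potential.\<close>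

definition path_weight :: "('a \<Rightarrow> real) \<Rightarrow> (real \<Rightarrow> 'a) \<Rightarrow> ennreal \<Rightarrow> ennreal" where
  "path_weight U z T = exp_neg (\<integral>\<^sup>+s\<in>{s. 0 \<le> s \<and> ennreal s \<le> T}. ennreal (U (z s)) \<partial>lborel)"

definition hitting_weight ::
  "'w measure \<Rightarrow> (real \<Rightarrow> 'w \<Rightarrow> 'a::euclidean_space) \<Rightarrow> ('a \<Rightarrow> real) \<Rightarrow> 'a \<Rightarrow> 'a \<Rightarrow> ennreal" where
  "hitting_weight W B U x y =
     (\<integral>\<^sup>+w\<in>{w. hitting_time (\<lambda>t. x + B t w) y < \<infinity>}.
        path_weight U (\<lambda>t. x + B t w) (hitting_time (\<lambda>t. x + B t w) y) \<partial>W)"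

definition travel_cost ::
  "'w measure \<Rightarrow> (real \<Rightarrow> 'w \<Rightarrow> 'a::euclidean_space) \<Rightarrow> ('a \<Rightarrow> real) \<Rightarrow> 'a \<Rightarrow> 'a \<Rightarrow> ereal" where
  "travel_cost W B U x y = neg_log (hitting_weight W B U x y)"

definition green_function ::
  "'w measure \<Rightarrow> (real \<Rightarrow> 'w \<Rightarrow> 'a::euclidean_space) \<Rightarrow> ('a \<Rightarrow> real) \<Rightarrow> 'a \<Rightarrow> 'a \<Rightarrow> ennreal" where
  "green_function W B U x y =
     (\<integral>\<^sup>+t\<in>{0<..}. ennreal (heat_kernel t x y) *
        (\<integral>\<^sup>+w. path_weight U (\<lambda>s. brownian_bridge B t x y s w) (ennreal t) \<partial>W) \<partial>lborel)"

definition lyapunov_exponent ::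
  "'w measure \<Rightarrow> (real \<Rightarrow> 'w \<Rightarrow> 'a::euclidean_space) \<Rightarrow> 'o measure \<Rightarrow> ('a \<Rightarrow> 'o \<Rightarrow> 'o) \<Rightarrow>
    ('o \<Rightarrow> real) \<Rightarrow> 'a \<Rightarrow> real" where
  "lyapunov_exponent W B M \<tau> V0 x =
     (THE l. AE \<omega> in M.
        ((\<lambda>r. ereal (1 / r) * travel_cost W B (\<lambda>z. potential \<tau> V0 z \<omega>) 0 (r *\<^sub>R x))
           \<longlongrightarrow> ereal l) at_top)"

end

theory Submission
  imports Defs
begin

text \<open>The Brownian path is looked at only at integer times. With the Feynman-Kac kernel of the Brownian bridge, let
  \<open>h(x, y)\<close> be the weight of the paths from \<open>x\<close> that are in the unit ball at \<open>y\<close> at some integer time. These weights obey a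
  chain inequality that needs no stopping times, and \<open>- log h(0, y)\<close> differs from both \<open>a(0, y)\<close> and \<open>- log g(0, y)\<close> by
  \<open>o(|y|)\<close>: between integer times the path has Gaussian tails, the potential grows sublinearly, and the traps make the Green
  function comparable to the hitting weight. Essential infima over unit balls of starting points turn \<open>- log h\<close> into a
  subadditive cost.

  Averaging the cost of the broken line from \<open>z\<close> via \<open>y\<close> to \<open>x\<close> over \<open>y\<close> in a small ball bounds it by the dyadic sum of
  \<open>2 ^ k * |{s > 2 ^ k} \<inter> B(0, R)| powr (1 / d)\<close>, with \<open>s\<close> a local supremum of the potential. The Lorentz condition and a maximal
  inequality make the tails of this sum at most \<open>\<eta> R\<close>. Hence the cost is almost surely equicontinuous on the scale \<open>R\<close>, so
  its lower growth rate along a ray is invariant under the flow and therefore constant. A greedy covering of the ray and a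
  second maximal inequality show that the upper rate is the same, and finitely many directions give uniformity.\<close>

text \<open>Three obstacles shape the proof. Brownian motion is given by increments and continuity
  alone, without a filtration; so potentials are integrated along paths rebuilt from their rational
  values, and the Markov property becomes an identity of two measures on a countable product. Next,
  most information holds only Lebesgue-almost everywhere: a start point is forgotten after one step
  because kernels have densities, and the local bound of the potential holds for almost every
  translate. This is why costs are essential infima and why well-behaved points are found near a
  given point instead of at it. Finally, ergodicity is assumed for the whole flow and not for the
  translations along one ray, so averaging along a ray need not give a constant. Limits are
  therefore never taken from an ergodic theorem: a zero-one law fixes constants, and maximal
  inequalities applied to truncated functions, whose integrals tend to zero, give the rest.
  Dimension one is treated apart in the segment estimate and in the layer estimate, since both would
  lose a logarithm there.\<close>

abbreviation nn_lebesgue_integral :: "('a::euclidean_space => ennreal) => ennreal" (binder "\<L>" [10] 62) where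
 "nn_lebesgue_integral f \<equiv> integral\<^sup>N lborel f"

section \<open>Heat kernel\<close>

lemma heat_kernel_pos: "0 < t ==> 0 < heat_kernel t x y" by (simp add: heat_kernel_def)

lemma heat_kernel_nonneg [simp]: "0 <= heat_kernel t x y" by (simp add: heat_kernel_def)

lemma heat_kernel_add_right: "heat_kernel t (x + z) (y + z) = heat_kernel t x y" by (simp add: heat_kernel_def)

lemma heat_kernel_zero_diff: "heat_kernel t 0 (y - x) = heat_kernel t x y" by (simp add: heat_kernel_def norm_minus_commute)

lemma measurable_heat_kernel [measurable (raw)]:
 fixes f g :: "'b => 'a::euclidean_space"
 assumes [measurable]: "t \<in> borel_measurable N" "f \<in> borel_measurable N" "g \<in> borel_measurable N"
 shows "(\<lambda>p. heat_kernel (t p) (f p) (g p)) \<in> borel_measurable N" unfolding heat_kernel_def by measurable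

lemma nn_integral_lborel_shift:
 fixes f :: "'a::euclidean_space => ennreal"
 assumes [measurable]: "f \<in> borel_measurable borel"
 shows "(\<L> z. f (c + z)) = (\<L> z. f z)"
proof -
 have "(\<L> z. f z) = (\<integral>\<^sup>+z. f z \<partial>distr lborel borel (\<lambda>z. c + z))"
  using lborel_distr_plus[of c] by (metis (full_types))
 also have "... = (\<L> z. f (c + z))" by (subst nn_integral_distr) auto
 finally show ?thesis ..
qed

text \<open>Completing the square; this is the one-step case of the Cameron-Martin formula for a
  linear drift \<open>v\<close>.\<close>

lemma heat_kernel_girsanov:
 fixes x z v :: "'a::euclidean_space"
 assumes "0 < d"
 shows "heat_kernel d x z = heat_kernel d x (z + d *\<^sub>R v) * exp (((z + d *\<^sub>R v) - x) \<bullet> v - d * (norm v)\<^sup>2 / 2)"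
proof -
 have "(norm (x - z))\<^sup>2 = (norm (x - (z + d *\<^sub>R v)))\<^sup>2 - 2 * d * ((z + d *\<^sub>R v - x) \<bullet> v) + d\<^sup>2 * (norm v)\<^sup>2"
  unfolding power2_norm_eq_inner by (simp add: algebra_simps inner_commute power2_eq_square)
 hence "- (norm (x - z))\<^sup>2 / (2 * d) = - (norm (x - (z + d *\<^sub>R v)))\<^sup>2 / (2 * d)
   + (((z + d *\<^sub>R v) - x) \<bullet> v - d * (norm v)\<^sup>2 / 2)" using assms by (simp add: field_simps power2_eq_square)
 thus ?thesis unfolding heat_kernel_def by (simp only: exp_add mult.assoc)
qed

section \<open>Finite-dimensional distributions\<close>

text \<open>The terminal weight \<open>k\<close> receives the last time as well as the last
  position, so one recursion serves free paths (\<open>k = 1\<close>) and paths pinned at a later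
  time (\<open>k\<close> a heat kernel).\<close>

fun heat_chain :: "real => real list => (real => 'a::euclidean_space => ennreal) =>
  (real => 'a => ennreal) => 'a => ennreal" where
 "heat_chain s [] \<phi> k x = k s x"
| "heat_chain s (r # rs) \<phi> k x =
   (\<L> z. ennreal (heat_kernel (r - s) x z) * (\<phi> r z * heat_chain r rs \<phi> k z))"

text \<open>The parameter is mostly the end point of the path: the weights of a bridge depend on it,
  and it is integrated out with Tonelli.\<close>

lemma measurable_heat_chain_param:
 assumes "\<And>r. (\<lambda>(z, c). \<phi> r z c) \<in> borel_measurable (borel \<Otimes>\<^sub>M N)"
  and "\<And>r. (\<lambda>(z, c). k r z c) \<in> borel_measurable (borel \<Otimes>\<^sub>M N)"
 shows "(\<lambda>(z, c). heat_chain s ts (\<lambda>r z. \<phi> r z c) (\<lambda>r z. k r z c) z) \<in> borel_measurable (borel \<Otimes>\<^sub>M N)"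
proof (induction ts arbitrary: s)
 case Nil
 thus ?case using assms(2)[of s] by simp
next
 case (Cons r rs)
 note [measurable] = Cons[of r] assms(1)[of r]
 have 1: "(\<lambda>(p, z). heat_chain r rs (\<lambda>r z. \<phi> r z (snd p)) (\<lambda>r z. k r z (snd p)) z)
   \<in> borel_measurable ((borel \<Otimes>\<^sub>M N) \<Otimes>\<^sub>M lborel)"
  using measurable_compose[OF _ Cons[of r], of "\<lambda>(p, z). (z, snd p)" "(borel \<Otimes>\<^sub>M N) \<Otimes>\<^sub>M lborel"]
  by (simp add: case_prod_beta')
 have 2: "(\<lambda>(p, z). \<phi> r z (snd p)) \<in> borel_measurable ((borel \<Otimes>\<^sub>M N) \<Otimes>\<^sub>M lborel)"
  using measurable_compose[OF _ assms(1)[of r], of "\<lambda>(p, z). (z, snd p)" "(borel \<Otimes>\<^sub>M N) \<Otimes>\<^sub>M lborel"]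
  by (simp add: case_prod_beta')
 show ?case using 1 2 by (auto simp: case_prod_beta' intro!: lborel.borel_measurable_nn_integral)
qed

lemma measurable_heat_chain [measurable (raw)]:
 assumes [measurable]: "\<And>r. \<phi> r \<in> borel_measurable borel" "\<And>r. k r \<in> borel_measurable borel"
 shows "heat_chain s ts \<phi> k \<in> borel_measurable borel"
proof -
 have "(\<lambda>(z, c). heat_chain s ts \<phi> k z) \<in> borel_measurable (borel \<Otimes>\<^sub>M (count_space UNIV :: unit measure))"
  using measurable_heat_chain_param[of "\<lambda>r z c. \<phi> r z" "count_space UNIV :: unit measure" "\<lambda>r z c. k r z"] by simp
 from measurable_compose[OF _ this, of "\<lambda>z. (z, ())"] show ?thesis by simp
qed

lemma heat_chain_append:
 "heat_chain s (l1 @ r # l2) \<phi> k x = heat_chain s l1 \<phi>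
   (\<lambda>r' z'. \<L> z. ennreal (heat_kernel (r - r') z' z) * (\<phi> r z * heat_chain r l2 \<phi> k z)) x"
 by (induction l1 arbitrary: s x) auto

lemma heat_chain_nn_integral:
 fixes N :: "'b measure"
 assumes "sigma_finite_measure N"
 assumes \<phi>: "\<And>r. \<phi> r \<in> borel_measurable borel"
  and F: "\<And>r. (\<lambda>(z, c). F r z c) \<in> borel_measurable (borel \<Otimes>\<^sub>M N)"
 shows "heat_chain s l \<phi> (\<lambda>r z. \<integral>\<^sup>+c. F r z c \<partial>N) x = (\<integral>\<^sup>+c. heat_chain s l \<phi> (\<lambda>r z. F r z c) x \<partial>N)"
proof (induction l arbitrary: s x)
 case (Cons r rs)
 interpret sigma_finite_measure N by fact
 interpret pair_sigma_finite lborel N by unfold_locales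
 have [measurable]: "(\<lambda>(z, c). heat_chain r rs \<phi> (\<lambda>r z. F r z c) z) \<in> borel_measurable (borel \<Otimes>\<^sub>M N)"
  using measurable_heat_chain_param[of "\<lambda>r z c. \<phi> r z" N F] \<phi> F by simp
 note [measurable] = \<phi>
 have "heat_chain s (r # rs) \<phi> (\<lambda>r z. \<integral>\<^sup>+c. F r z c \<partial>N) x =
   (\<L> z. (\<integral>\<^sup>+c. ennreal (heat_kernel (r - s) x z) * (\<phi> r z * heat_chain r rs \<phi> (\<lambda>r z. F r z c) z) \<partial>N))"
  by (simp add: Cons nn_integral_cmult)
 also have "... = (\<integral>\<^sup>+c. (\<L> z. ennreal (heat_kernel (r - s) x z) * (\<phi> r z * heat_chain r rs \<phi> (\<lambda>r z. F r z c) z)) \<partial>N)"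
  by (intro Fubini'[symmetric]) measurable
 finally show ?case by simp
qed simp

lemma heat_chain_cong_k:
 assumes "\<And>r z. r \<in> set (s # l) ==> k r z = k' r z"
 shows "heat_chain s l \<phi> k x = heat_chain s l \<phi> k' x" using assms by (induction l arbitrary: s x) auto

lemma heat_chain_cmult:
 assumes [measurable]: "\<And>r. \<phi> r \<in> borel_measurable borel" "\<And>r. k r \<in> borel_measurable borel"
 shows "heat_chain s l \<phi> (\<lambda>r z. c * k r z) x = c * heat_chain s l \<phi> k x"
 by (induction l arbitrary: s x) (simp_all add: mult.left_commute[of _ c] nn_integral_cmult)

text \<open>Tilting by a linear drift multiplies a chain that is pinned at both ends by an exponential that
 depends only on the two end points.\<close>

lemma heat_chain_drift:
 fixes v :: "'a::euclidean_space"
 assumes [measurable]: "\<And>r. \<phi> r \<in> borel_measurable borel"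
  and "sorted_wrt (<) (s # ts @ [T])"
 shows "heat_chain s ts (\<lambda>r z. \<phi> r (a + z + r *\<^sub>R v)) (\<lambda>r z. ennreal (heat_kernel (T - r) z c)) x =
   heat_chain s ts \<phi> (\<lambda>r z. ennreal (heat_kernel (T - r) z (a + c + T *\<^sub>R v))) (a + x + s *\<^sub>R v) *
   ennreal (exp ((c - x + (T - s) *\<^sub>R v) \<bullet> v - (T - s) * (norm v)\<^sup>2 / 2))" using assms(2)
proof (induction ts arbitrary: s x)
 case Nil
 hence "0 < T - s" by simp
 from heat_kernel_girsanov[OF this, of x c v]
 have "heat_kernel (T - s) x c = heat_kernel (T - s) x (c + (T - s) *\<^sub>R v) *
   exp ((c - x + (T - s) *\<^sub>R v) \<bullet> v - (T - s) * (norm v)\<^sup>2 / 2)" by (simp add: algebra_simps)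
 also have "heat_kernel (T - s) x (c + (T - s) *\<^sub>R v) = heat_kernel (T - s) (a + x + s *\<^sub>R v) (a + c + T *\<^sub>R v)"
  using heat_kernel_add_right[of "T - s" x "a + s *\<^sub>R v" "c + (T - s) *\<^sub>R v"] by (simp add: algebra_simps)
 finally show ?case by (simp add: ennreal_mult)
next
 case (Cons r rs)
 hence rs: "s < r" and sr: "sorted_wrt (<) (r # rs @ [T])" by auto
 let ?w = "\<lambda>z. a + z + r *\<^sub>R v" and ?x = "a + x + s *\<^sub>R v"
 let ?H = "\<lambda>z. heat_chain r rs \<phi> (\<lambda>r z. ennreal (heat_kernel (T - r) z (a + c + T *\<^sub>R v))) z"
 let ?E = "exp ((c - x + (T - s) *\<^sub>R v) \<bullet> v - (T - s) * (norm v)\<^sup>2 / 2)"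
 have H [measurable]: "?H \<in> borel_measurable borel" by (rule measurable_heat_chain) measurable
 have [measurable]: "(\<lambda>z. ?H (?w z)) \<in> borel_measurable borel" by (rule measurable_compose[OF _ H]) simp
 let ?A = "\<lambda>z. (c - z + (T - r) *\<^sub>R v) \<bullet> v - (T - r) * (norm v)\<^sup>2 / 2"
 let ?B = "\<lambda>r z. heat_kernel (r - s) ?x (?w z)"
 let ?C = "\<lambda>r z. \<phi> r (?w z) * ?H (?w z)"
 have *: "ennreal (heat_kernel (r - s) x z) * (\<phi> r (?w z) * (?H (?w z) *
    ennreal (exp (?A z))))
   = ennreal (?B r z) * (?C r z) * ennreal ?E" for z
 proof -
  have "heat_kernel (r - s) x z * exp (?A z)
    = heat_kernel (r - s) x (z + (r - s) *\<^sub>R v) *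
     (exp ((z + (r - s) *\<^sub>R v - x) \<bullet> v - (r - s) * (norm v)\<^sup>2 / 2) *
      exp (?A z))" using heat_kernel_girsanov[of "r - s" x z v] rs by simp
  \<comment> \<open>The exponents telescope: the drift factor of this step times that of the
    remaining steps no longer contains \<open>z\<close>.\<close>
  also have "... = heat_kernel (r - s) x (z + (r - s) *\<^sub>R v) * ?E" unfolding exp_add[symmetric]
   by (rule arg_cong[of _ _ "\<lambda>e. _ * exp e"])
    (simp add: algebra_simps diff_divide_distrib add_divide_distrib power2_norm_eq_inner)
  also have "heat_kernel (r - s) x (z + (r - s) *\<^sub>R v) = heat_kernel (r - s) ?x (?w z)"
   using heat_kernel_add_right[of "r - s" x "a + s *\<^sub>R v" "z + (r - s) *\<^sub>R v"] by (simp add: algebra_simps)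
  finally have "ennreal (heat_kernel (r - s) x z) * ennreal (exp (?A z))
    = ennreal (?B r z) * ennreal ?E" by (simp add: ennreal_mult[symmetric])
  hence "ennreal (heat_kernel (r - s) x z) * ennreal (exp (?A z)) * (?C r z)
    = ennreal (?B r z) * ennreal ?E * (?C r z)" by (rule arg_cong)
  thus ?thesis by (simp only: mult_ac)
 qed
 have "heat_chain s (r # rs) (\<lambda>r z. \<phi> r (a + z + r *\<^sub>R v)) (\<lambda>r z. ennreal (heat_kernel (T - r) z c)) x
   = (\<L> z. ennreal (?B r z) * (?C r z) * ennreal ?E)" using Cons.IH[OF sr] * by simp
 also have "... = (\<L> z. ennreal (?B r z) * (?C r z)) * ennreal ?E"
  by (rule nn_integral_multc) measurable
 also have "(\<L> z. ennreal (?B r z) * (?C r z))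
   = (\<L> z. ennreal (heat_kernel (r - s) ?x z) * (\<phi> r z * ?H z))"
  using nn_integral_lborel_shift[of "\<lambda>z. ennreal (heat_kernel (r - s) ?x z) * (\<phi> r z * ?H z)" "a + r *\<^sub>R v"]
  by (simp add: algebra_simps)
 finally show ?case by simp
qed

section \<open>Brownian motion and Brownian bridges at finitely many times\<close>

context standard_brownian_motion
begin

abbreviation bm_expectation :: "('w => ennreal) => ennreal" (binder "\<E>" [10] 62) where
 "bm_expectation f \<equiv> integral\<^sup>N W f"

text \<open>Independence is assumed only for successive increments. Each \<open>B j - B r\<close> is
  a sum of those after the first, hence a function of a block of increments disjoint from
  \<open>B r - B s\<close>.\<close>

lemma indep_future:
 assumes "0 <= s" "s < r" "finite J" "\<And>j. j \<in> J ==> r < j"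
 shows "indep_var (PiM {r} (\<lambda>_. borel)) (\<lambda>w. \<lambda>j\<in>{r}. B r w - B s w) (PiM J (\<lambda>_. borel)) (\<lambda>w. \<lambda>j\<in>J. B j w - B r w)"
proof -
 define L where "L = sorted_list_of_set J"
 define n where "n = length L"
 define t where "t i = (s # r # L) ! i" for i
 define X where "X i w = B (t (Suc i)) w - B (t i) w" for i w
 define idx where "idx j = (LEAST i. i < n \<and> L ! i = j)" for j
 have L: "sorted_wrt (<) (s # r # L)" "set L = J" using assms unfolding L_def by (auto intro: order.strict_trans)
 have tmono: "t i < t (Suc i)" if "i < Suc n" for i using sorted_wrt_nth_less[OF L(1), of i "Suc i"] that unfolding t_def n_def by simp
 have idx: "idx j < n \<and> L ! (idx j) = j" if "j \<in> J" for j
  using that unfolding idx_def L(2)[symmetric] in_set_conv_nth n_def by (rule LeastI_ex)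
 have "indep_vars (\<lambda>_. borel) X {..<Suc n}" using bm_indep_increments[of t "Suc n"] tmono assms(1) unfolding X_def by (simp add: t_def)
 hence "indep_vars (\<lambda>_. borel) X {0..<Suc n}" by (simp add: lessThan_atLeast0)
 from indep_var_restrict[OF this, of "{0}" "{1..<Suc n}"]
 have iv: "indep_var (PiM {0} (\<lambda>_. borel)) (\<lambda>w. restrict (\<lambda>i. X i w) {0})
   (PiM {1..<Suc n} (\<lambda>_. borel)) (\<lambda>w. restrict (\<lambda>i. X i w) {1..<Suc n})" by auto
 have m1: "(\<lambda>y. \<lambda>j\<in>{r}. y 0) \<in> measurable (PiM {0} (\<lambda>_. borel :: 'a measure)) (PiM {r} (\<lambda>_. borel))"
  by (intro measurable_restrict measurable_component_singleton) simp
 \<comment> \<open>In the list \<open>s # r # L\<close> the time \<open>j\<close> has position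
   \<open>2 + idx j\<close>; increment 0 runs from \<open>s\<close> to \<open>r\<close>, so the sum
   from 1 starts at \<open>r\<close>.\<close>
 have m2: "(\<lambda>y. \<lambda>j\<in>J. \<Sum>i\<in>{1..<2 + idx j}. y i) \<in> measurable (PiM {1..<Suc n} (\<lambda>_. borel)) (PiM J (\<lambda>_. borel :: 'a measure))"
 proof (intro measurable_restrict borel_measurable_sum)
  fix j i assume "j \<in> J" "i \<in> {1..<2 + idx j}"
  thus "(\<lambda>y. y i) \<in> borel_measurable (PiM {1..<Suc n} (\<lambda>_. borel))"
   using idx[of j] by (intro measurable_component_singleton) auto
 qed
 from indep_var_compose[OF iv m1 m2]
 have "indep_var (PiM {r} (\<lambda>_. borel)) ((\<lambda>y. \<lambda>j\<in>{r}. y 0) \<circ> (\<lambda>w. restrict (\<lambda>i. X i w) {0})) (PiM J (\<lambda>_. borel))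
   ((\<lambda>y. \<lambda>j\<in>J. \<Sum>i\<in>{1..<2 + idx j}. y i) \<circ> (\<lambda>w. restrict (\<lambda>i. X i w) {1..<Suc n}))" .
 moreover have "(\<lambda>y. \<lambda>j\<in>{r}. y 0) \<circ> (\<lambda>w. restrict (\<lambda>i. X i w) {0}) = (\<lambda>w. \<lambda>j\<in>{r}. B r w - B s w)"
  by (auto simp: X_def t_def fun_eq_iff)
 moreover have "(\<lambda>y. \<lambda>j\<in>J. \<Sum>i\<in>{1..<2 + idx j}. y i) \<circ> (\<lambda>w. restrict (\<lambda>i. X i w) {1..<Suc n})
   = (\<lambda>w. \<lambda>j\<in>J. B j w - B r w)"
 proof (rule ext)
  fix w
  have "(\<Sum>i\<in>{1..<2 + idx j}. restrict (\<lambda>i. X i w) {1..<Suc n} i) = B j w - B r w" if "j \<in> J" for j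
  proof -
   have "(\<Sum>i\<in>{1..<2 + idx j}. restrict (\<lambda>i. X i w) {1..<Suc n} i) = (\<Sum>i\<in>{1..<2 + idx j}. B (t (Suc i)) w - B (t i) w)"
    using idx[OF that] by (intro sum.cong) (auto simp: X_def)
   also have "... = B (t (2 + idx j)) w - B (t 1) w" by (rule sum_Suc_diff') simp
   finally show ?thesis using idx[OF that] by (simp add: t_def)
  qed
  thus "((\<lambda>y. \<lambda>j\<in>J. \<Sum>i\<in>{1..<2 + idx j}. y i) \<circ> (\<lambda>w. restrict (\<lambda>i. X i w) {1..<Suc n})) w
    = (\<lambda>j\<in>J. B j w - B r w)" unfolding comp_def by (rule restrict_ext)
 qed
 ultimately show ?thesis by simp
qed

lemma nn_integral_future:
 assumes "0 <= s" "s < r" "finite J" "\<And>j. j \<in> J ==> r < j"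
  and [measurable]: "F \<in> borel_measurable (borel \<Otimes>\<^sub>M PiM J (\<lambda>_. borel))"
 shows "(\<E> w. F (B r w - B s w, \<lambda>j\<in>J. B j w - B r w)) =
  (\<L> z. ennreal (heat_kernel (r - s) 0 z) * (\<E> w. F (z, \<lambda>j\<in>J. B j w - B r w)))"
proof -
 let ?X = "\<lambda>w. B r w - B s w" and ?Y = "\<lambda>w. \<lambda>j\<in>J. B j w - B r w" and ?N = "PiM J (\<lambda>_. borel :: 'a measure)"
 let ?X' = "\<lambda>w. \<lambda>j\<in>{r}. B r w - B s w" and ?N' = "PiM {r} (\<lambda>_. borel :: 'a measure)"
 have iv: "indep_var ?N' ?X' ?N ?Y" by (rule indep_future) fact+
 have [measurable]: "?X' \<in> measurable W ?N'" "?Y \<in> measurable W ?N" using iv by (auto dest: indep_var_rv1 indep_var_rv2)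
 have [measurable]: "(\<lambda>y. y r) \<in> measurable ?N' borel" by (rule measurable_component_singleton) simp
 have [measurable]: "?X \<in> borel_measurable W" using bm_measurable assms by (intro borel_measurable_diff) auto
 have eq: "distr W ?N' ?X' \<Otimes>\<^sub>M distr W ?N ?Y = distr W (?N' \<Otimes>\<^sub>M ?N) (\<lambda>w. (?X' w, ?Y w))"
  using iv unfolding indep_var_distribution_eq by auto
 have d: "distr W lborel ?X = density lborel (\<lambda>z. ennreal (heat_kernel (r - s) 0 z))"
  using bm_gaussian[OF assms(1,2)] unfolding distributed_def by auto
 interpret Y: prob_space "distr W ?N ?Y" by (rule prob_space_distr) measurable
 have "(\<E> w. F (?X w, ?Y w)) = (\<integral>\<^sup>+p. F (fst p r, snd p) \<partial>distr W (?N' \<Otimes>\<^sub>M ?N) (\<lambda>w. (?X' w, ?Y w)))"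
  by (subst nn_integral_distr) auto
 also have "... = (\<integral>\<^sup>+z. \<integral>\<^sup>+y. F (z r, y) \<partial>distr W ?N ?Y \<partial>distr W ?N' ?X')"
  unfolding eq[symmetric] by (subst Y.nn_integral_fst[symmetric]) auto
 also have "... = (\<E> w. \<integral>\<^sup>+y. F (?X w, y) \<partial>distr W ?N ?Y)" by (subst nn_integral_distr) auto
 also have "... = (\<E> w. \<E> w'. F (?X w, ?Y w'))" by (intro nn_integral_cong, subst nn_integral_distr) auto
 also have "... = (\<integral>\<^sup>+z. \<E> w. F (z, ?Y w) \<partial>distr W lborel ?X)" by (subst nn_integral_distr) auto
 also have "... = (\<L> z. ennreal (heat_kernel (r - s) 0 z) * (\<E> w. F (z, ?Y w)))" unfolding d by (subst nn_integral_density) auto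
 finally show ?thesis .
qed

text \<open>The total mass is read off from the law of \<open>B t - B 0\<close>, a probability
  measure, so no Gaussian integral has to be computed.\<close>

lemma nn_integral_heat_kernel:
 fixes x :: 'a
 assumes "0 < t"
 shows "(\<L> z. ennreal (heat_kernel t x z)) = 1"
proof -
 have d: "distr W lborel (\<lambda>w. B t w - B 0 w) = density lborel (\<lambda>z. ennreal (heat_kernel t 0 z))"
  and [measurable]: "(\<lambda>w. B t w - B 0 w) \<in> measurable W lborel" using bm_gaussian[of 0 t] assms unfolding distributed_def by auto
 interpret D: prob_space "distr W lborel (\<lambda>w. B t w - B 0 w)" by (rule prob_space_distr) measurable
 have "(\<L> z. ennreal (heat_kernel t (0::'a) z)) = emeasure (density lborel (\<lambda>z. ennreal (heat_kernel t (0::'a) z))) UNIV"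
  by (subst emeasure_density) auto
 also have "... = 1" using D.emeasure_space_1 unfolding d by simp
 finally have "(\<L> z. ennreal (heat_kernel t (0::'a) z)) = 1" .
 moreover have "(\<L> z. ennreal (heat_kernel t 0 (- x + z))) = (\<L> z. ennreal (heat_kernel t (0::'a) z))"
  by (rule nn_integral_lborel_shift) measurable
 ultimately show ?thesis using heat_kernel_zero_diff[of t _ x] by (simp add: algebra_simps)
qed

text \<open>The end point \<open>c\<close> stays an explicit integration variable on which all
  weights may depend. That is what a bridge requires, since its intermediate values involve
  \<open>B T\<close>.\<close>

lemma fdd_with_end:
 fixes x :: 'a
 assumes "0 <= s" "sorted_wrt (<) (s # ts @ [T])"
  and "\<psi> \<in> borel_measurable borel"
  and phi: "\<And>r. (\<lambda>(z, c). \<phi> r z c) \<in> borel_measurable (borel \<Otimes>\<^sub>M borel)"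
 shows "(\<E> w. \<psi> (x + (B T w - B s w)) * (\<Prod>r\<in>set ts. \<phi> r (x + (B r w - B s w)) (x + (B T w - B s w))))
  = (\<L> c. \<psi> c * heat_chain s ts (\<lambda>r z. \<phi> r z c) (\<lambda>r z. ennreal (heat_kernel (T - r) z c)) x)" using assms(1-3)
proof (induction ts arbitrary: s x \<psi>)
 case Nil
 note [measurable] = Nil(3)
 have "(\<E> w. \<psi> (x + (B T w - B s w))) = (\<L> z. ennreal (heat_kernel (T - s) 0 z) * \<psi> (x + z))"
  using bm_gaussian[of s T] Nil by (subst distributed_nn_integral[symmetric, where f="\<lambda>z. ennreal (heat_kernel (T - s) 0 z)"]) auto
 also have "... = (\<L> z. ennreal (heat_kernel (T - s) x (x + z)) * \<psi> (x + z))" using heat_kernel_zero_diff[of "T - s" "x + z" x for z] by simp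
 also have "... = (\<L> z. ennreal (heat_kernel (T - s) x z) * \<psi> z)" by (rule nn_integral_lborel_shift) measurable
 finally show ?case by (simp add: mult.commute)
next
 case (Cons r rs)
 hence sr: "s < r" "0 <= r" and so: "sorted_wrt (<) (r # rs @ [T])" by auto
 note [measurable] = Cons.prems(3)
 define J where "J = insert T (set rs)"
 have J: "finite J" "\<And>j. j \<in> J ==> r < j" using so unfolding J_def by auto
 have rn: "r \<notin> set rs" using so by auto
 define F where "F = (\<lambda>(z, y). \<psi> (x + z + y T) * (\<phi> r (x + z) (x + z + y T) *
   (\<Prod>r'\<in>set rs. \<phi> r' (x + z + y r') (x + z + y T))))"
 have [measurable]: "(\<lambda>p. snd p j) \<in> borel_measurable (borel \<Otimes>\<^sub>M PiM J (\<lambda>_. borel :: 'a measure))" if "j \<in> J" for j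
  by (rule measurable_compose[OF measurable_snd measurable_component_singleton[OF that]])
 have phi2: "(\<lambda>p. \<phi> r (f p) (g p)) \<in> borel_measurable N"
  if "f \<in> borel_measurable N" "g \<in> borel_measurable N" for f g r and N :: "'q measure"
  using measurable_compose[OF measurable_Pair[OF that] phi[of r]] by simp
 have Fm: "F \<in> borel_measurable (borel \<Otimes>\<^sub>M PiM J (\<lambda>_. borel))" unfolding F_def case_prod_beta'
  by (intro borel_measurable_times_ennreal borel_measurable_prod_ennreal phi2
    measurable_compose[OF _ Cons.prems(3)] borel_measurable_add measurable_fst'' borel_measurable_const)
   (auto simp: J_def)
 have F_inner: "(\<E> w. F (z, \<lambda>j\<in>J. B j w - B r w)) =
   (\<L> c. \<psi> c * (\<phi> r (x + z) c * heat_chain r rs (\<lambda>r z. \<phi> r z c) (\<lambda>r z. ennreal (heat_kernel (T - r) z c)) (x + z)))" for z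
 proof -
  have [measurable]: "(\<lambda>c. \<phi> r (x + z) c) \<in> borel_measurable borel" by (rule phi2) auto
  have "(\<E> w. F (z, \<lambda>j\<in>J. B j w - B r w)) =
   (\<E> w. (\<lambda>c. \<psi> c * \<phi> r (x + z) c) (x + z + (B T w - B r w)) *
    (\<Prod>r'\<in>set rs. \<phi> r' (x + z + (B r' w - B r w)) (x + z + (B T w - B r w))))"
   unfolding F_def J_def by (intro nn_integral_cong) (auto simp: mult.assoc intro!: prod.cong)
  also have "... = (\<L> c. (\<psi> c * \<phi> r (x + z) c) * heat_chain r rs (\<lambda>r z. \<phi> r z c) (\<lambda>r z. ennreal (heat_kernel (T - r) z c)) (x + z))"
   by (rule Cons.IH[OF sr(2) so]) measurable
  finally show ?thesis by (simp add: mult.assoc)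
 qed
 define H where "H z c = \<psi> c * (\<phi> r z c * heat_chain r rs (\<lambda>r z. \<phi> r z c) (\<lambda>r z. ennreal (heat_kernel (T - r) z c)) z)" for z c
 have Hm: "(\<lambda>(z, c). H z c) \<in> borel_measurable (borel \<Otimes>\<^sub>M borel)" unfolding H_def case_prod_beta'
  using measurable_heat_chain_param[of \<phi> borel "\<lambda>r z c. ennreal (heat_kernel (T - r) z c)" r rs] phi
  by (intro borel_measurable_times_ennreal phi2) (auto simp: case_prod_beta')
 have Hm' [measurable]: "(\<lambda>p. H (f p) (g p)) \<in> borel_measurable N"
  if "f \<in> borel_measurable N" "g \<in> borel_measurable N" for f g and N :: "'q measure"
  using measurable_compose[OF measurable_Pair[OF that] Hm] by simp
 have "(\<E> w. \<psi> (x + (B T w - B s w)) * (\<Prod>r\<in>set (r # rs). \<phi> r (x + (B r w - B s w)) (x + (B T w - B s w))))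
   = (\<E> w. F (B r w - B s w, \<lambda>j\<in>J. B j w - B r w))"
  unfolding F_def J_def using rn by (intro nn_integral_cong) (auto simp: algebra_simps intro!: prod.cong)
 also have "... = (\<L> z. ennreal (heat_kernel (r - s) 0 z) * (\<E> w. F (z, \<lambda>j\<in>J. B j w - B r w)))"
  by (rule nn_integral_future[OF Cons.prems(1) sr(1) J Fm])
 also have "... = (\<L> z. ennreal (heat_kernel (r - s) x (x + z)) * (\<L> c. H (x + z) c))"
  unfolding F_inner H_def using heat_kernel_zero_diff[of "r - s" "x + z" x for z] by simp
 also have "... = (\<L> z. ennreal (heat_kernel (r - s) x z) * (\<L> c. H z c))" by (rule nn_integral_lborel_shift) measurable
 also have "... = (\<L> z. (\<L> c. ennreal (heat_kernel (r - s) x z) * H z c))" by (intro nn_integral_cong nn_integral_cmult[symmetric]) measurable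
 also have "... = (\<L> c. (\<L> z. ennreal (heat_kernel (r - s) x z) * H z c))" by (intro lborel_pair.Fubini'[symmetric]) measurable
 also have "... = (\<L> c. \<psi> c * heat_chain s (r # rs) (\<lambda>r z. \<phi> r z c) (\<lambda>r z. ennreal (heat_kernel (T - r) z c)) x)"
 proof (intro nn_integral_cong)
  fix c
  have "(\<lambda>z. heat_chain r rs (\<lambda>r z. \<phi> r z c) (\<lambda>r z. ennreal (heat_kernel (T - r) z c)) z) \<in> borel_measurable borel"
   by (intro measurable_heat_chain phi2) auto
  note [measurable] = this
  have [measurable]: "(\<lambda>z. \<phi> r z c) \<in> borel_measurable borel" by (rule phi2) auto
  show "(\<L> z. ennreal (heat_kernel (r - s) x z) * H z c) =
    \<psi> c * heat_chain s (r # rs) (\<lambda>r z. \<phi> r z c) (\<lambda>r z. ennreal (heat_kernel (T - r) z c)) x"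
   by (simp add: H_def mult.left_commute[of _ "\<psi> c"] nn_integral_cmult)
 qed
 finally show ?case .
qed

lemma fdd_free:
 fixes x :: 'a
 assumes "0 <= s" "sorted_wrt (<) (s # ts)" and [measurable]: "\<And>r. \<phi> r \<in> borel_measurable borel"
 shows "(\<E> w. (\<Prod>r\<in>set ts. \<phi> r (x + (B r w - B s w)))) = heat_chain s ts \<phi> (\<lambda>r z. 1) x"
proof -
 \<comment> \<open>Any time after all others will do: the path is pinned there and the pinning point
   is integrated out.\<close>
 define T where "T = Max (set (s # ts)) + 1"
 have T: "r < T" if "r \<in> set (s # ts)" for r using Max_ge[OF finite_set that] unfolding T_def by simp
 have so: "sorted_wrt (<) (s # ts @ [T])" using assms(2) T by (auto simp: sorted_wrt_append)
 have "(\<E> w. (\<Prod>r\<in>set ts. \<phi> r (x + (B r w - B s w)))) =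
  (\<L> c. heat_chain s ts \<phi> (\<lambda>r z. ennreal (heat_kernel (T - r) z c)) x)"
  using fdd_with_end[OF assms(1) so, of "\<lambda>_. 1" "\<lambda>r z c. \<phi> r z" x] by simp
 also have "... = heat_chain s ts \<phi> (\<lambda>r z. \<L> c. ennreal (heat_kernel (T - r) z c)) x"
  by (intro heat_chain_nn_integral[symmetric] lborel.sigma_finite_measure_axioms) measurable
 also have "... = heat_chain s ts \<phi> (\<lambda>r z. 1) x" by (intro heat_chain_cong_k nn_integral_heat_kernel) (use T in auto)
 finally show ?thesis .
qed

text \<open>Given \<open>B T = c\<close>, the bridge is the path plus a linear drift whose slope
  \<open>v c\<close> leads to \<open>y\<close>. Removing the drift turns a chain pinned at
  \<open>c\<close> into one pinned at \<open>y\<close>, at the price of a factor depending on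
  \<open>c\<close> alone.\<close>

lemma fdd_bridge:
 fixes x y :: 'a
 assumes so: "sorted_wrt (<) (0 # ts @ [T])" and [measurable]: "\<And>r. \<phi> r \<in> borel_measurable borel"
 shows "ennreal (heat_kernel T x y) * (\<E> w. (\<Prod>r\<in>set ts. \<phi> r (brownian_bridge B T x y r w)))
   = heat_chain 0 ts \<phi> (\<lambda>r z. ennreal (heat_kernel (T - r) z y)) x"
proof -
 have T: "0 < T" using so by simp
 define v where "v c = (1 / T) *\<^sub>R (y - x - c)" for c
 define C where "C = heat_chain 0 ts \<phi> (\<lambda>r z. ennreal (heat_kernel (T - r) z y)) x"
 have [measurable]: "v \<in> borel_measurable borel" unfolding v_def by measurable
 have bb: "brownian_bridge B T x y r w = x + (0 + (B r w - B 0 w)) + r *\<^sub>R v (0 + (B T w - B 0 w))"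
  if "w \<in> space W" for r w using bm_start[OF that] unfolding brownian_bridge_def v_def by (simp add: algebra_simps)
 have "(\<E> w. (\<Prod>r\<in>set ts. \<phi> r (brownian_bridge B T x y r w))) =
  (\<E> w. (\<lambda>_. 1) (0 + (B T w - B 0 w)) * (\<Prod>r\<in>set ts. (\<lambda>r z c. \<phi> r (x + z + r *\<^sub>R v c)) r (0 + (B r w - B 0 w)) (0 + (B T w - B 0 w))))"
  by (intro nn_integral_cong) (simp only: bb mult_1)
 also have "... = (\<L> c. (\<lambda>_. 1) c * heat_chain 0 ts (\<lambda>r z. (\<lambda>r z c. \<phi> r (x + z + r *\<^sub>R v c)) r z c) (\<lambda>r z. ennreal (heat_kernel (T - r) z c)) 0)"
  by (intro fdd_with_end) (use so in auto)
 also have "... = (\<L> c. C * ennreal (heat_kernel T (0::'a) c / heat_kernel T x y))"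
 proof (intro nn_integral_cong)
  fix c :: 'a
  have e: "x + c + T *\<^sub>R v c = y" unfolding v_def using T by (simp add: algebra_simps)
  have cv: "c + T *\<^sub>R v c = y - x" using e by (simp add: algebra_simps)
  have "2 * T * ((y - x) \<bullet> v c - T * (norm (v c))\<^sup>2 / 2) = (norm (y - x))\<^sup>2 - (norm c)\<^sup>2"
  proof -
   have 1: "T\<^sup>2 * (norm (v c))\<^sup>2 = (norm (y - x - c))\<^sup>2" using T by (simp add: v_def power_divide)
   have 2: "T * ((y - x) \<bullet> v c) = (y - x) \<bullet> (y - x - c)" using T by (simp add: v_def)
   have 3: "(norm (y - x - c))\<^sup>2 = (norm (y - x))\<^sup>2 - 2 * ((y - x) \<bullet> c) + (norm c)\<^sup>2"
    unfolding power2_norm_eq_inner by (simp add: inner_diff_left inner_diff_right inner_commute)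
   have 4: "(y - x) \<bullet> (y - x - c) = (norm (y - x))\<^sup>2 - (y - x) \<bullet> c"
    unfolding power2_norm_eq_inner by (simp add: inner_diff_left inner_diff_right inner_commute)
   have "2 * T * ((y - x) \<bullet> v c - T * (norm (v c))\<^sup>2 / 2) = 2 * (T * ((y - x) \<bullet> v c)) - T\<^sup>2 * (norm (v c))\<^sup>2"
    by (simp add: algebra_simps power2_eq_square)
   thus ?thesis unfolding 1 2 3 4 by simp
  qed
  hence "(y - x) \<bullet> v c - T * (norm (v c))\<^sup>2 / 2 = - (norm c)\<^sup>2 / (2 * T) - - (norm (y - x))\<^sup>2 / (2 * T)"
   using T by (simp add: field_simps)
  hence "exp ((y - x) \<bullet> v c - T * (norm (v c))\<^sup>2 / 2) = heat_kernel T (0::'a) c / heat_kernel T x y"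
   using T unfolding heat_kernel_def by (simp only: exp_diff) (simp add: norm_minus_commute)
  thus "1 * heat_chain 0 ts (\<lambda>r z. \<phi> r (x + z + r *\<^sub>R v c)) (\<lambda>r z. ennreal (heat_kernel (T - r) z c)) 0
   = C * ennreal (heat_kernel T (0::'a) c / heat_kernel T x y)"
   using heat_chain_drift[of \<phi> 0 ts T x "v c" c 0] so e cv unfolding C_def by simp
 qed
 \<comment> \<open>The factor is a multiple of the Gaussian density in \<open>c\<close>, which
   integrates to one.\<close>
 also have "... = C * ennreal (1 / heat_kernel T x y) * (\<L> c. ennreal (heat_kernel T (0::'a) c))" using heat_kernel_pos[OF T, of x y]
  by (simp add: nn_integral_cmult[symmetric] ennreal_mult[symmetric] mult.assoc)
 also have "... = C * ennreal (1 / heat_kernel T x y)" using nn_integral_heat_kernel[OF T] by simp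
 finally show ?thesis using heat_kernel_pos[OF T, of x y] unfolding C_def
  by (simp add: mult.left_commute[of "ennreal (heat_kernel T x y)"] ennreal_mult[symmetric])
qed

end

lemma prod_indicator_eq_if:
 assumes "finite J"
 shows "(\<Prod>r\<in>J. indicator (A r) (f r)) = (if \<forall>r\<in>J. f r \<in> A r then 1 else 0 :: ennreal)"
 using assms by (induction J rule: finite_induct) (auto simp: indicator_def)

section \<open>Gluing a bridge and a continuation at an intermediate time\<close>

context standard_brownian_motion
begin

lemma measurable_B_compose [measurable (raw)]:
 assumes "h \<in> measurable N W" "0 <= t"
 shows "(\<lambda>p. B t (h p)) \<in> borel_measurable N" by (rule measurable_compose[OF assms(1) bm_measurable[OF assms(2)]])

lemma measurable_bridge:
 assumes [measurable]: "f \<in> borel_measurable N" "g \<in> borel_measurable N" "h \<in> measurable N W" and "0 <= r" "0 <= t"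
 shows "(\<lambda>p. brownian_bridge B t (f p) (g p) r (h p)) \<in> borel_measurable N" using assms(4,5) unfolding brownian_bridge_def by measurable

text \<open>One statement yields both the semigroup property (\<open>X\<close> and \<open>Y\<close>
  bridges, \<open>\<kappa>\<close> heat kernels) and the Markov property (\<open>X\<close> and
  \<open>Y\<close> free paths, \<open>\<kappa> = 1\<close>). Both sides are integrals against finite
  measures on path space that agree on cylinders, because a heat chain through \<open>s\<close>
  splits there.\<close>

lemma glue_law:
 fixes x :: 'a and X :: "real => 'w => 'a"
 assumes I: "I \<subseteq> {0<..}" "s \<in> I"
  and Xm: "\<And>r. r \<in> I ==> X r \<in> borel_measurable W"
  and Ym: "\<And>r. r \<in> I ==> s < r ==> (\<lambda>(z, w). Y z r w) \<in> borel_measurable (borel \<Otimes>\<^sub>M W)"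
  and \<kappa>m [measurable]: "\<kappa> \<in> borel_measurable borel" and \<kappa>0: "\<kappa>0 < \<infinity>"
  and km [measurable]: "\<And>r. k r \<in> borel_measurable borel"
  and X: "\<And>ts A. sorted_wrt (<) ts ==> set ts \<subseteq> I ==> (\<And>r. A r \<in> sets borel) ==>
    \<kappa>0 * (\<E> w. (\<Prod>r\<in>set ts. indicator (A r) (X r w))) = heat_chain 0 ts (\<lambda>r. indicator (A r)) k x"
  and Y: "\<And>ts A z. sorted_wrt (<) (s # ts) ==> set ts \<subseteq> I ==> (\<And>r. A r \<in> sets borel) ==>
    \<kappa> z * (\<E> w. (\<Prod>r\<in>set ts. indicator (A r) (Y z r w))) = heat_chain s ts (\<lambda>r. indicator (A r)) k z"
  and F: "F \<in> borel_measurable (PiM I (\<lambda>_. borel))"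
 shows "\<kappa>0 * (\<E> w. F (\<lambda>r\<in>I. X r w)) = (\<L> z. ennreal (heat_kernel s x z) * (\<kappa> z * (\<E> w. \<integral>\<^sup>+w'.
   F (\<lambda>r\<in>I. if r < s then brownian_bridge B s x z r w else if r = s then z else Y z r w') \<partial>W)))"
proof -
 let ?P = "PiM I (\<lambda>_. borel :: 'a measure)"
 define G where "G = (\<lambda>(z, w, w'). \<lambda>r\<in>I. if r < s then brownian_bridge B s x z r w else if r = s then z else Y z r w')"
 let ?L = "lborel \<Otimes>\<^sub>M (W \<Otimes>\<^sub>M W)"
 have s0: "0 < s" using I by auto
 have Ym': "(\<lambda>p. Y (f p) r (h p)) \<in> borel_measurable N"
  if "r \<in> I" "s < r" "f \<in> borel_measurable N" "h \<in> measurable N W" for r f h and N :: "'q measure"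
  using measurable_compose[OF measurable_Pair[OF that(3,4)] Ym[OF that(1,2)]] by simp
 have Gm [measurable]: "G \<in> measurable ?L ?P"
 proof -
  have "(\<lambda>p. if r < s then brownian_bridge B s x (fst p) r (fst (snd p)) else if r = s then fst p else Y (fst p) r (snd (snd p)))
    \<in> borel_measurable ?L" if "r \<in> I" for r
  proof -
   consider "r < s" | "r = s" | "s < r" by linarith
   thus ?thesis
   proof cases
    case 1
    moreover have "0 <= r" using I that by (auto simp: less_imp_le)
    ultimately show ?thesis using s0 by (auto intro!: measurable_bridge)
   next
    case 3
    thus ?thesis using that by (auto intro!: Ym')
   qed auto
  qed
  thus ?thesis unfolding G_def case_prod_beta' by (intro measurable_restrict)
 qed
 define XI where "XI w = (\<lambda>r\<in>I. X r w)" for w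
 have XIm [measurable]: "XI \<in> measurable W ?P" unfolding XI_def using Xm by (intro measurable_restrict)
 \<comment> \<open>\<open>P\<close> and \<open>Q\<close> are the laws, weighted by
   \<open>\<kappa>0\<close> and by the kernels, of the original path and of the glued path.\<close>
 define P where "P = distr (density W (\<lambda>_. \<kappa>0)) ?P XI"
 define Q where "Q = distr (density ?L (\<lambda>p. ennreal (heat_kernel s x (fst p)) * \<kappa> (fst p))) ?P G"
 have XI2 [measurable]: "XI \<in> measurable (density W (\<lambda>_. \<kappa>0)) ?P" by simp
 have Pint: "(\<integral>\<^sup>+\<zeta>. f \<zeta> \<partial>P) = \<kappa>0 * (\<E> w. f (XI w))" if [measurable]: "f \<in> borel_measurable ?P" for f
  unfolding P_def by (subst nn_integral_distr, simp_all, subst nn_integral_density) (simp_all add: nn_integral_cmult)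
 interpret WP: pair_prob_space W W by unfold_locales
 have WW: "sigma_finite_measure (W \<Otimes>\<^sub>M W)" by (rule WP.P.sigma_finite_measure_axioms)
 have Qint: "(\<integral>\<^sup>+\<zeta>. f \<zeta> \<partial>Q) = (\<L> z. ennreal (heat_kernel s x z) * (\<kappa> z * (\<E> w. \<E> w'. f (G (z, w, w')))))"
  if [measurable]: "f \<in> borel_measurable ?P" for f
 proof -
  have fG [measurable]: "(\<lambda>p. f (G p)) \<in> borel_measurable ?L" by measurable
  have "(\<integral>\<^sup>+\<zeta>. f \<zeta> \<partial>Q) = (\<integral>\<^sup>+p. (ennreal (heat_kernel s x (fst p)) * \<kappa> (fst p)) * f (G p) \<partial>?L)"
   unfolding Q_def by (subst nn_integral_distr, simp_all, subst nn_integral_density) simp_all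
  also have "... = (\<L> z. \<integral>\<^sup>+v. (ennreal (heat_kernel s x z) * \<kappa> z) * f (G (z, v)) \<partial>(W \<Otimes>\<^sub>M W))"
   by (subst WP.P.nn_integral_fst[symmetric]) simp_all
  also have "... = (\<L> z. (ennreal (heat_kernel s x z) * \<kappa> z) * (\<integral>\<^sup>+v. f (G (z, v)) \<partial>(W \<Otimes>\<^sub>M W)))"
   by (intro nn_integral_cong nn_integral_cmult) (auto intro!: measurable_compose[OF _ fG])
  also have "... = (\<L> z. (ennreal (heat_kernel s x z) * \<kappa> z) * (\<E> w. \<E> w'. f (G (z, w, w'))))"
  proof (intro nn_integral_cong)
   fix z
   have "(\<lambda>v. f (G (z, v))) \<in> borel_measurable (W \<Otimes>\<^sub>M W)" by (rule measurable_compose[OF _ fG]) auto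
   from nn_integral_fst[OF this]
   show "(ennreal (heat_kernel s x z) * \<kappa> z) * (\<integral>\<^sup>+v. f (G (z, v)) \<partial>(W \<Otimes>\<^sub>M W)) =
    (ennreal (heat_kernel s x z) * \<kappa> z) * (\<E> w. \<E> w'. f (G (z, w, w')))" by simp
  qed
  finally show ?thesis by (simp add: mult.assoc)
 qed
 have "P = Q"
 proof (rule measure_eqI_PiM_infinite)
  show "sets P = sets ?P" "sets Q = sets ?P" unfolding P_def Q_def by simp_all
  have "emeasure P (space P) = \<kappa>0" using Pint[of "\<lambda>_. 1"] emeasure_space_1 by simp
  thus "finite_measure P" using \<kappa>0 by (intro finite_measureI) auto
 next
  fix A J assume J: "finite J" "J \<subseteq> I" and A: "\<And>i. i \<in> J ==> A i \<in> sets (borel :: 'a measure)"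
  \<comment> \<open>The time \<open>s\<close> need not be among the constrained times
    \<open>J\<close>; with the whole space as constraint it can be inserted anyway.\<close>
  define A' where "A' r = (if r \<in> J then A r else UNIV)" for r
  define L1 where "L1 = sorted_list_of_set {r \<in> J. r < s}"
  define L2 where "L2 = sorted_list_of_set {r \<in> J. s < r}"
  have A' [measurable]: "A' r \<in> sets borel" for r using A by (auto simp: A'_def)
  have sL: "set L1 = {r \<in> J. r < s}" "set L2 = {r \<in> J. s < r}" using J by (auto simp: L1_def L2_def)
  have so: "sorted_wrt (<) L1" "sorted_wrt (<) L2" by (auto simp: L1_def L2_def)
  have so': "sorted_wrt (<) (L1 @ s # L2)" using so sL by (auto simp: sorted_wrt_append)
  have si: "set (L1 @ s # L2) \<subseteq> I" using sL J I by auto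
  define \<phi> where "\<phi> r = (indicator (A' r) :: 'a => ennreal)" for r
  have \<phi>m [measurable]: "\<phi> r \<in> borel_measurable borel" for r unfolding \<phi>_def by measurable
  let ?E = "prod_emb I (\<lambda>_. borel :: 'a measure) J (Pi\<^sub>E J A)"
  have E: "?E \<in> sets ?P" using J A by (intro sets_PiM_I) auto
  have ind: "indicator ?E \<zeta> = (\<Prod>r\<in>set (L1 @ s # L2). \<phi> r (\<zeta> r))" if "\<zeta> \<in> space ?P" for \<zeta>
  proof -
   have "\<zeta> \<in> ?E \<longleftrightarrow> (\<forall>r\<in>set (L1 @ s # L2). \<zeta> r \<in> A' r)"
   proof -
    have "\<zeta> \<in> extensional I" using that by (simp add: space_PiM PiE_iff)
    hence "\<zeta> \<in> ?E \<longleftrightarrow> (\<forall>r\<in>J. \<zeta> r \<in> A r)" by (simp add: prod_emb_iff PiE_iff)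
    moreover have "set (L1 @ s # L2) = insert s J" unfolding set_append list.set(2) sL by auto
    ultimately show ?thesis by (auto simp: A'_def)
   qed
   thus ?thesis unfolding \<phi>_def by (subst prod_indicator_eq_if) (simp_all add: indicator_def)
  qed
  have i1: "emeasure P ?E = heat_chain 0 (L1 @ s # L2) \<phi> k x"
  proof -
   have "emeasure P ?E = (\<integral>\<^sup>+\<zeta>. indicator ?E \<zeta> \<partial>P)" using E by (simp add: P_def)
   also have "... = \<kappa>0 * (\<E> w. indicator ?E (XI w))" using E by (intro Pint) simp
   also have "(\<E> w. indicator ?E (XI w)) = (\<E> w. (\<Prod>r\<in>set (L1 @ s # L2). indicator (A' r) (X r w)))"
   proof (intro nn_integral_cong)
    fix w assume "w \<in> space W"
    hence "XI w \<in> space ?P" by (rule measurable_space[OF XIm])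
    from ind[OF this] show "indicator ?E (XI w) = (\<Prod>r\<in>set (L1 @ s # L2). (indicator (A' r) (X r w) :: ennreal))"
     unfolding \<phi>_def XI_def using si by (auto intro!: prod.cong)
   qed
   also have "\<kappa>0 * ... = heat_chain 0 (L1 @ s # L2) \<phi> k x" unfolding \<phi>_def by (rule X[OF so' si A'])
   finally show ?thesis .
  qed
  have i2: "emeasure Q ?E = (\<L> z. ennreal (heat_kernel s x z) * (\<kappa> z * (\<E> w. \<E> w'. indicator ?E (G (z, w, w')))))"
  proof -
   have "emeasure Q ?E = (\<integral>\<^sup>+\<zeta>. indicator ?E \<zeta> \<partial>Q)" using E by (simp add: Q_def)
   thus ?thesis using Qint[of "indicator ?E"] E by simp
  qed
  define c where "c z = \<phi> s z * heat_chain s L2 \<phi> k z" for z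
  have [measurable]: "c \<in> borel_measurable borel" unfolding c_def by measurable
  have i3: "ennreal (heat_kernel s x z) * (\<kappa> z * (\<E> w. \<E> w'. indicator ?E (G (z, w, w'))))
   = heat_chain 0 L1 \<phi> (\<lambda>r' z'. ennreal (heat_kernel (s - r') z' z) * c z) x" for z
  proof -
   have nn: "s \<notin> set L1" "s \<notin> set L2" "set L1 \<inter> set L2 = {}" unfolding sL by auto
   have Lp: "0 < r" if "r \<in> set L1 \<union> set L2" for r using that J(2) I(1) unfolding sL by auto
   have "(\<E> w. \<E> w'. indicator ?E (G (z, w, w'))) =
     (\<E> w. \<E> w'. (\<Prod>r\<in>set L1. \<phi> r (brownian_bridge B s x z r w)) * (\<phi> s z * (\<Prod>r\<in>set L2. \<phi> r (Y z r w'))))"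
   proof (intro nn_integral_cong)
    fix w w' assume "w \<in> space W" "w' \<in> space W"
    hence "(z, w, w') \<in> space ?L" by (simp add: space_pair_measure)
    hence "G (z, w, w') \<in> space ?P" by (rule measurable_space[OF Gm])
    from ind[OF this]
    have "indicator ?E (G (z, w, w')) = (\<Prod>r\<in>set L1. \<phi> r (G (z, w, w') r)) * (\<phi> s (G (z, w, w') s) * (\<Prod>r\<in>set L2. \<phi> r (G (z, w, w') r)))"
     using nn by (simp add: prod.union_disjoint Un_insert_right mult_ac)
    also have "(\<Prod>r\<in>set L1. \<phi> r (G (z, w, w') r)) = (\<Prod>r\<in>set L1. \<phi> r (brownian_bridge B s x z r w))"
     using sL si by (intro prod.cong) (auto simp: G_def)
    also have "(\<Prod>r\<in>set L2. \<phi> r (G (z, w, w') r)) = (\<Prod>r\<in>set L2. \<phi> r (Y z r w'))"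
     using sL si by (intro prod.cong) (auto simp: G_def)
    also have "G (z, w, w') s = z" using I by (simp add: G_def)
    finally show "indicator ?E (G (z, w, w')) = (\<Prod>r\<in>set L1. \<phi> r (brownian_bridge B s x z r w)) * (\<phi> s z * (\<Prod>r\<in>set L2. \<phi> r (Y z r w')))" .
   qed
   also have "... = (\<E> w. (\<Prod>r\<in>set L1. \<phi> r (brownian_bridge B s x z r w))) * (\<phi> s z * (\<E> w'. (\<Prod>r\<in>set L2. \<phi> r (Y z r w'))))"
   proof -
    have m2: "(\<lambda>w'. \<Prod>r\<in>set L2. \<phi> r (Y z r w')) \<in> borel_measurable W"
     using sL si by (intro borel_measurable_prod_ennreal measurable_compose[OF _ \<phi>m] Ym') auto
    have m1: "(\<lambda>w. \<Prod>r\<in>set L1. \<phi> r (brownian_bridge B s x z r w)) \<in> borel_measurable W"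
     using s0 Lp by (intro borel_measurable_prod_ennreal measurable_compose[OF _ \<phi>m] measurable_bridge) (auto simp: less_imp_le)
    show ?thesis using m1 m2 by (simp add: nn_integral_cmult nn_integral_multc)
   qed
   finally have "ennreal (heat_kernel s x z) * (\<kappa> z * (\<E> w. \<E> w'. indicator ?E (G (z, w, w')))) =
    (ennreal (heat_kernel s x z) * (\<E> w. (\<Prod>r\<in>set L1. \<phi> r (brownian_bridge B s x z r w)))) *
    (\<phi> s z * (\<kappa> z * (\<E> w'. (\<Prod>r\<in>set L2. \<phi> r (Y z r w')))))" by (simp add: mult_ac)
   also have "\<kappa> z * (\<E> w'. (\<Prod>r\<in>set L2. \<phi> r (Y z r w'))) = heat_chain s L2 \<phi> k z"
    unfolding \<phi>_def by (rule Y) (use so' si A' in \<open>auto simp: sorted_wrt_append\<close>)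
   also have "ennreal (heat_kernel s x z) * (\<E> w. (\<Prod>r\<in>set L1. \<phi> r (brownian_bridge B s x z r w)))
     = heat_chain 0 L1 \<phi> (\<lambda>r z'. ennreal (heat_kernel (s - r) z' z)) x"
    by (rule fdd_bridge) (use so so' Lp s0 sL in \<open>auto simp: sorted_wrt_append\<close>)
   also have "heat_chain 0 L1 \<phi> (\<lambda>r z'. ennreal (heat_kernel (s - r) z' z)) x * (\<phi> s z * heat_chain s L2 \<phi> k z)
     = heat_chain 0 L1 \<phi> (\<lambda>r' z'. ennreal (heat_kernel (s - r') z' z) * c z) x"
    using heat_chain_cmult[of \<phi> "\<lambda>r z'. ennreal (heat_kernel (s - r) z' z)" 0 L1 "c z" x] by (simp add: c_def mult.commute)
   finally show ?thesis .
  qed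
  have "heat_chain 0 (L1 @ s # L2) \<phi> k x = (\<L> z. heat_chain 0 L1 \<phi> (\<lambda>r' z'. ennreal (heat_kernel (s - r') z' z) * c z) x)"
   unfolding heat_chain_append c_def[symmetric] by (intro heat_chain_nn_integral lborel.sigma_finite_measure_axioms) measurable
  thus "emeasure P ?E = emeasure Q ?E" unfolding i1 i2 i3 .
 qed
 hence "(\<integral>\<^sup>+\<zeta>. F \<zeta> \<partial>P) = (\<integral>\<^sup>+\<zeta>. F \<zeta> \<partial>Q)" by simp
 thus ?thesis unfolding Pint[OF F] Qint[OF F] unfolding XI_def G_def by simp
qed

end

section \<open>Path functionals\<close>

lemma exp_neg_add: "exp_neg (a + b) = exp_neg a * exp_neg b"
 by (cases a; cases b) (auto simp: exp_neg_def ennreal_mult[symmetric] exp_add[symmetric] ennreal_plus[symmetric] simp del: ennreal_plus)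

lemma exp_neg_0 [simp]: "exp_neg 0 = 1" by (simp add: exp_neg_def)

lemma exp_neg_ennreal: "0 <= a ==> exp_neg (ennreal a) = ennreal (exp (- a))" by (simp add: exp_neg_def)

lemma exp_neg_mono: "a <= b ==> exp_neg b <= exp_neg a" by (cases a; cases b) (auto simp: exp_neg_def top_unique)

lemma exp_neg_le_1: "exp_neg a <= 1" using exp_neg_mono[of 0 a] by simp

lemma measurable_exp_neg [measurable]: "exp_neg \<in> borel_measurable borel" unfolding exp_neg_def[abs_def] by measurable

lemma path_weight_open:
 assumes "0 <= t"
 shows "path_weight U z (ennreal t) = exp_neg (\<integral>\<^sup>+s\<in>{0<..<t}. ennreal (U (z s)) \<partial>lborel)"
proof -
 have "(\<integral>\<^sup>+s\<in>{s. 0 <= s \<and> ennreal s <= ennreal t}. ennreal (U (z s)) \<partial>lborel) =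
  (\<integral>\<^sup>+s\<in>{0<..<t}. ennreal (U (z s)) \<partial>lborel)"
 proof (rule nn_integral_cong_AE)
  show "AE s in lborel. ennreal (U (z s)) * indicator {s. 0 <= s \<and> ennreal s <= ennreal t} s =
    ennreal (U (z s)) * indicator {0<..<t} s" using AE_lborel_singleton[of 0] AE_lborel_singleton[of t]
   by eventually_elim (use assms in \<open>auto simp: indicator_def\<close>)
 qed
 thus ?thesis unfolding path_weight_def by simp
qed

lemma path_weight_le_1: "path_weight U z T <= 1" unfolding path_weight_def by (rule exp_neg_le_1)

text \<open>Time 0 is left out because the starting point is always carried as a separate
  argument.\<close>

definition rational_times :: "real set" where
 "rational_times = \<rat> \<inter> {0<..}"

text \<open>Paths are recovered from their values at rational times through dyadic approximations from the left.\<close>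

definition dyadic_extension :: "(real => 'a::euclidean_space) => real => 'a" where
 "dyadic_extension \<zeta> s = lim (\<lambda>n. \<zeta> (of_int \<lfloor>s * 2 ^ n\<rfloor> / 2 ^ n))"

lemma dyadic_floor_tendsto: "(\<lambda>n. of_int \<lfloor>s * 2 ^ n\<rfloor> / 2 ^ n :: real) \<longlonglongrightarrow> s"
proof (rule real_tendsto_sandwich)
 show "\<forall>\<^sub>F n in sequentially. s - (1 / 2) ^ n <= of_int \<lfloor>s * 2 ^ n\<rfloor> / 2 ^ n"
 proof (intro always_eventually allI)
  fix n :: nat
  have "s * 2 ^ n - 1 <= of_int \<lfloor>s * 2 ^ n\<rfloor>" by linarith
  hence "(s * 2 ^ n - 1) / 2 ^ n <= of_int \<lfloor>s * 2 ^ n\<rfloor> / 2 ^ n" by (rule divide_right_mono) simp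
  thus "s - (1 / 2) ^ n <= of_int \<lfloor>s * 2 ^ n\<rfloor> / 2 ^ n" by (simp add: diff_divide_distrib power_one_over)
 qed
 show "\<forall>\<^sub>F n in sequentially. of_int \<lfloor>s * 2 ^ n\<rfloor> / 2 ^ n <= s"
  by (intro always_eventually allI) (simp add: field_simps)
 have "(\<lambda>n. (1 / 2 :: real) ^ n) \<longlonglongrightarrow> 0" by (rule LIMSEQ_power_zero) simp
 from tendsto_diff[OF tendsto_const[of s] this] show "(\<lambda>n. s - (1 / 2) ^ n) \<longlonglongrightarrow> s" by simp
qed simp

lemma dyadic_extension_eq:
 assumes "s \<in> {a<..<b}" "continuous_on {a<..<b} z"
  and eq: "\<And>r. r \<in> \<rat> ==> a < r ==> r < b ==> \<zeta> r = z r"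
 shows "dyadic_extension \<zeta> s = z s"
proof -
 let ?r = "\<lambda>n. of_int \<lfloor>s * 2 ^ n\<rfloor> / 2 ^ n :: real"
 have ev: "\<forall>\<^sub>F n in sequentially. ?r n \<in> {a<..<b}" using topological_tendstoD[OF dyadic_floor_tendsto _ assms(1)] by simp
 have "(\<lambda>n. z (?r n)) \<longlonglongrightarrow> z s" by (rule continuous_on_tendsto_compose[OF assms(2) dyadic_floor_tendsto assms(1) ev])
 moreover have "\<forall>\<^sub>F n in sequentially. z (?r n) = \<zeta> (?r n)" using ev by eventually_elim (auto simp: eq)
 ultimately have "(\<lambda>n. \<zeta> (?r n)) \<longlonglongrightarrow> z s" by (rule Lim_transform_eventually)
 thus ?thesis unfolding dyadic_extension_def by (rule limI)
qed

lemma measurable_PiM_eval: "(\<lambda>\<zeta>. \<zeta> r) \<in> borel_measurable (PiM I (\<lambda>_. borel))"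
proof (cases "r \<in> I")
 case False
 have "(\<lambda>\<zeta>. undefined) \<in> borel_measurable (PiM I (\<lambda>_. borel))" by simp
 thus ?thesis by (rule measurable_cong[THEN iffD2, rotated]) (use False in \<open>auto simp: space_PiM PiE_def extensional_def\<close>)
qed (rule measurable_component_singleton)

lemma measurable_dyadic_extension:
 "(\<lambda>p. dyadic_extension (fst p) (snd p)) \<in> borel_measurable (PiM I (\<lambda>_. borel :: 'a::euclidean_space measure) \<Otimes>\<^sub>M borel)"
 unfolding dyadic_extension_def
proof (rule borel_measurable_lim_metric)
 fix n :: nat
 have "(\<lambda>p. fst p (of_int i / 2 ^ n)) \<in> borel_measurable (PiM I (\<lambda>_. borel :: 'a measure) \<Otimes>\<^sub>M (borel :: real measure))" for i :: int
  by (rule measurable_compose[OF measurable_fst measurable_PiM_eval])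
 thus "(\<lambda>p. fst p (of_int \<lfloor>snd p * 2 ^ n\<rfloor> / 2 ^ n)) \<in> borel_measurable (PiM I (\<lambda>_. borel :: 'a measure) \<Otimes>\<^sub>M (borel :: real measure))"
  by (rule measurable_compose_countable) measurable
qed

lemma measurable_dyadic_extension' [measurable (raw)]:
 assumes "f \<in> measurable N (PiM I (\<lambda>_. borel :: 'a::euclidean_space measure))" "g \<in> borel_measurable N"
 shows "(\<lambda>p. dyadic_extension (f p) (g p)) \<in> borel_measurable N"
 using measurable_compose[OF measurable_Pair[OF assms] measurable_dyadic_extension] by simp

text \<open>\<open>path_weight\<close> as a functional of the values at the index times only, which
  makes it measurable on the product space although it integrates over all times.\<close>

definition interval_weight :: "('a::euclidean_space => real) => real => (real => 'a) => ennreal" where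
 "interval_weight U t \<zeta> = exp_neg (\<integral>\<^sup>+s\<in>{0<..<t}. ennreal (U (dyadic_extension \<zeta> s)) \<partial>lborel)"

lemma measurable_interval_weight:
 assumes [measurable]: "U \<in> borel_measurable borel"
 shows "interval_weight U t \<in> borel_measurable (PiM I (\<lambda>_. borel :: 'a::euclidean_space measure))"
 unfolding interval_weight_def[abs_def] by measurable

lemma interval_weight_eq_path_weight:
 assumes "0 <= t" "continuous_on {0<..<t} z" "\<And>r. r \<in> \<rat> ==> 0 < r ==> r < t ==> \<zeta> r = z r"
 shows "interval_weight U t \<zeta> = path_weight U z (ennreal t)"
proof -
 have "dyadic_extension \<zeta> s = z s" if "s \<in> {0<..<t}" for s by (rule dyadic_extension_eq[OF that assms(2)]) (use assms(3) in auto)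
 thus ?thesis unfolding path_weight_open[OF assms(1)] interval_weight_def
  by (intro arg_cong[of _ _ exp_neg] nn_integral_cong) (auto simp: indicator_def)
qed

text \<open>Nothing is assumed about the reconstructed path at the junction \<open>s\<close> itself;
  a single time does not contribute to the integral.\<close>

lemma interval_weight_glue:
 assumes [measurable]: "U \<in> borel_measurable borel"
  and st: "0 <= s" "0 <= t"
  and z1: "continuous_on {0<..<s} z1" "\<And>r. r \<in> \<rat> ==> 0 < r ==> r < s ==> \<zeta> r = z1 r"
  and z2: "continuous_on {0<..<t} z2" "\<And>r. r \<in> \<rat> ==> s < r ==> r < s + t ==> \<zeta> r = z2 (r - s)"
  and \<zeta>: "\<zeta> \<in> space (PiM I (\<lambda>_. borel :: 'a::euclidean_space measure))"
 shows "interval_weight U (s + t) \<zeta> = path_weight U z1 (ennreal s) * path_weight U z2 (ennreal t)"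
proof -
 have e1: "dyadic_extension \<zeta> r = z1 r" if "r \<in> {0<..<s}" for r by (rule dyadic_extension_eq[OF that z1(1)]) (use z1(2) in auto)
 have e2: "dyadic_extension \<zeta> (s + r) = z2 r" if "r \<in> {0<..<t}" for r
 proof -
  have "dyadic_extension \<zeta> (s + r) = (\<lambda>r. z2 (r - s)) (s + r)"
  proof (rule dyadic_extension_eq)
   show "s + r \<in> {s<..<s + t}" using that by simp
   show "continuous_on {s<..<s + t} (\<lambda>r. z2 (r - s))" by (rule continuous_on_compose2[OF z2(1)]) (auto intro!: continuous_intros)
  qed (use z2(2) in auto)
  thus ?thesis by simp
 qed
 have dm [measurable]: "dyadic_extension \<zeta> \<in> borel_measurable borel"
  using measurable_dyadic_extension'[of "\<lambda>_. \<zeta>" borel I "\<lambda>s. s"] \<zeta> by simp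
 define f where "f r = ennreal (U (dyadic_extension \<zeta> r))" for r
 have fm [measurable]: "f \<in> borel_measurable borel" unfolding f_def using measurable_compose[OF dm assms(1)] by simp
 have "(\<integral>\<^sup>+r\<in>{0<..<s + t}. f r \<partial>lborel) = (\<L> r. f r * indicator {0<..<s} r + f r * indicator {s<..<s + t} r)"
  using AE_lborel_singleton[of s] st by (intro nn_integral_cong_AE) (auto simp: indicator_def)
 also have "... = (\<integral>\<^sup>+r\<in>{0<..<s}. f r \<partial>lborel) + (\<integral>\<^sup>+r\<in>{s<..<s + t}. f r \<partial>lborel)"
  by (rule nn_integral_add) measurable
 also have "(\<integral>\<^sup>+r\<in>{s<..<s + t}. f r \<partial>lborel) = (\<L> r. (\<lambda>r. f r * indicator {s<..<s + t} r) (s + r))"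
  by (rule nn_integral_lborel_shift[symmetric]) measurable
 also have "... = (\<integral>\<^sup>+r\<in>{0<..<t}. ennreal (U (z2 r)) \<partial>lborel)"
  by (intro nn_integral_cong) (auto simp: indicator_def f_def e2)
 also have "(\<integral>\<^sup>+r\<in>{0<..<s}. f r \<partial>lborel) = (\<integral>\<^sup>+r\<in>{0<..<s}. ennreal (U (z1 r)) \<partial>lborel)"
  by (intro nn_integral_cong) (auto simp: indicator_def f_def e1)
 finally show ?thesis
  using st unfolding interval_weight_def f_def[symmetric] path_weight_open[OF st(1)] path_weight_open[OF st(2)] by (simp add: exp_neg_add)
qed

lemma heat_chain_shift:
 "heat_chain (a - s) (map (\<lambda>r. r - s) ts) \<phi> k x = heat_chain a ts (\<lambda>r. \<phi> (r - s)) (\<lambda>r. k (r - s)) x"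
 by (induction ts arbitrary: a x) simp_all

section \<open>Semigroup and Markov property of the Feynman-Kac kernel\<close>

context standard_brownian_motion
begin

text \<open>The integral kernel of the Schroedinger semigroup with generator half the Laplacian
  minus \<open>U\<close>; it is not normalised.\<close>

definition bridge_kernel :: "('a => real) => real => 'a => 'a => ennreal" where
 "bridge_kernel U t x y = ennreal (heat_kernel t x y) *
   (\<E> w. path_weight U (\<lambda>s. brownian_bridge B t x y s w) (ennreal t))"

lemma continuous_on_bridge:
 assumes "w \<in> space W" "0 <= t"
 shows "continuous_on {0..} (\<lambda>s. brownian_bridge B t x y s w)" unfolding brownian_bridge_def using assms(2)
 by (cases "t = 0") (auto intro!: continuous_intros bm_continuous[OF assms(1)])

lemma bridge_kernel_le: "bridge_kernel U t x y <= ennreal (heat_kernel t x y)"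
proof -
 have "(\<E> w. path_weight U (\<lambda>s. brownian_bridge B t x y s w) (ennreal t)) <= (\<E> w. 1)" by (intro nn_integral_mono path_weight_le_1)
 also have "... = 1" by (simp add: emeasure_space_1)
 finally show ?thesis unfolding bridge_kernel_def using mult_left_mono[of _ 1 "ennreal (heat_kernel t x y)"] by simp
qed

text \<open>A bridge conditioned on its position at time \<open>s\<close> consists of two
  independent bridges. Only \<open>s\<close> has to be rational, so that it is an index of the path
  space; the later time \<open>t\<close> is arbitrary, as the Green function needs.\<close>

lemma chapman_kolmogorov:
 assumes U [measurable]: "U \<in> borel_measurable borel" and st: "s \<in> \<rat>" "0 < s" "0 < t"
 shows "bridge_kernel U (s + t) x y = (\<L> z. bridge_kernel U s x z * bridge_kernel U t z y)"
proof -
 define I where "I = \<rat> \<inter> {0<..<s + t}"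
 have I: "I \<subseteq> {0<..}" "s \<in> I" using st by (auto simp: I_def)
 let ?G = "\<lambda>z w w'. \<lambda>r\<in>I. if r < s then brownian_bridge B s x z r w else if r = s then z else brownian_bridge B t z y (r - s) w'"
 have cont: "continuous_on {0<..<v} (\<lambda>r. brownian_bridge B u x y r w)" if "w \<in> space W" "0 <= u" for u v x y w
  by (rule continuous_on_subset[OF continuous_on_bridge[OF that]]) auto
 have "ennreal (heat_kernel (s + t) x y) * (\<E> w. interval_weight U (s + t) (\<lambda>r\<in>I. brownian_bridge B (s + t) x y r w))
  = (\<L> z. ennreal (heat_kernel s x z) * (ennreal (heat_kernel t z y) *
    (\<E> w. \<E> w'. interval_weight U (s + t) (?G z w w'))))"
 proof (rule glue_law[OF I, where k="\<lambda>r z. ennreal (heat_kernel (s + t - r) z y)"])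
  show "brownian_bridge B (s + t) x y r \<in> borel_measurable W" if "r \<in> I" for r using that st I by (intro measurable_bridge) auto
  show "(\<lambda>(z, w). brownian_bridge B t z y (r - s) w) \<in> borel_measurable (borel \<Otimes>\<^sub>M W)" if "r \<in> I" "s < r" for r
   unfolding case_prod_beta' using that st by (intro measurable_bridge) auto
  show "interval_weight U (s + t) \<in> borel_measurable (PiM I (\<lambda>_. borel))" by (rule measurable_interval_weight) fact
 next
  fix ts and A :: "real => 'a set" assume ts: "sorted_wrt (<) ts" "set ts \<subseteq> I" and A: "\<And>r. A r \<in> sets borel"
  show "ennreal (heat_kernel (s + t) x y) * (\<E> w. (\<Prod>r\<in>set ts. indicator (A r) (brownian_bridge B (s + t) x y r w))) =
   heat_chain 0 ts (\<lambda>r. indicator (A r)) (\<lambda>r z. ennreal (heat_kernel (s + t - r) z y)) x"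
   by (rule fdd_bridge) (use ts A st in \<open>auto simp: I_def sorted_wrt_append\<close>)
 next
  fix ts z and A :: "real => 'a set" assume ts: "sorted_wrt (<) (s # ts)" "set ts \<subseteq> I" and A: "\<And>r. A r \<in> sets borel"
  let ?ts = "map (\<lambda>r. r - s) ts" and ?\<phi> = "\<lambda>r. indicator (A (r + s)) :: 'a => ennreal"
  have "(\<E> w. (\<Prod>r\<in>set ts. indicator (A r) (brownian_bridge B t z y (r - s) w))) =
   (\<E> w. (\<Prod>r\<in>set ?ts. ?\<phi> r (brownian_bridge B t z y r w)))" by (simp add: prod.reindex inj_on_def)
  also have "ennreal (heat_kernel t z y) * ... = heat_chain 0 ?ts ?\<phi> (\<lambda>r z. ennreal (heat_kernel (t - r) z y)) z"
   by (rule fdd_bridge) (use ts A st in \<open>auto simp: I_def sorted_wrt_append sorted_wrt_map\<close>)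
  also have "... = heat_chain s ts (\<lambda>r. indicator (A r)) (\<lambda>r z. ennreal (heat_kernel (s + t - r) z y)) z"
   using heat_chain_shift[of s s ts ?\<phi> "\<lambda>r z. ennreal (heat_kernel (t - r) z y)" z] by (simp add: algebra_simps)
  finally show "ennreal (heat_kernel t z y) * (\<E> w. (\<Prod>r\<in>set ts. indicator (A r) (brownian_bridge B t z y (r - s) w))) =
   heat_chain s ts (\<lambda>r. indicator (A r)) (\<lambda>r z. ennreal (heat_kernel (s + t - r) z y)) z" .
 qed measurable
 also have "(\<E> w. interval_weight U (s + t) (\<lambda>r\<in>I. brownian_bridge B (s + t) x y r w)) =
   (\<E> w. path_weight U (\<lambda>s'. brownian_bridge B (s + t) x y s' w) (ennreal (s + t)))"
  by (intro nn_integral_cong interval_weight_eq_path_weight cont) (use st in \<open>auto simp: I_def\<close>)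
 also have "(\<L> z. ennreal (heat_kernel s x z) * (ennreal (heat_kernel t z y) *
    (\<E> w. \<E> w'. interval_weight U (s + t) (?G z w w')))) =
   (\<L> z. bridge_kernel U s x z * bridge_kernel U t z y)"
 proof (intro nn_integral_cong)
  fix z
  have pm: "(\<lambda>w. path_weight U (\<lambda>r. brownian_bridge B u a b r w) (ennreal u)) \<in> borel_measurable W" if "0 <= u" for u a b
  proof -
   have "(\<lambda>w. \<lambda>r\<in>rational_times. brownian_bridge B u a b r w) \<in> measurable W (PiM rational_times (\<lambda>_. borel))"
    using that by (intro measurable_restrict measurable_bridge) (auto simp: rational_times_def)
   from measurable_compose[OF this measurable_interval_weight[OF U]]
   show ?thesis by (rule measurable_cong[THEN iffD1, rotated])
     (rule interval_weight_eq_path_weight; use that in \<open>auto simp: cont rational_times_def\<close>)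
  qed
  have "(\<E> w. \<E> w'. interval_weight U (s + t) (?G z w w')) =
   (\<E> w. \<E> w'. path_weight U (\<lambda>r. brownian_bridge B s x z r w) (ennreal s) *
    path_weight U (\<lambda>r. brownian_bridge B t z y r w') (ennreal t))"
  proof (intro nn_integral_cong)
   fix w w' assume w: "w \<in> space W" "w' \<in> space W"
   show "interval_weight U (s + t) (?G z w w') = path_weight U (\<lambda>r. brownian_bridge B s x z r w) (ennreal s) *
    path_weight U (\<lambda>r. brownian_bridge B t z y r w') (ennreal t)" by (rule interval_weight_glue[OF U _ _ cont _ cont, where I=I])
     (use st w in \<open>auto simp: I_def space_PiM\<close>)
  qed
  also have "... = (\<E> w. path_weight U (\<lambda>r. brownian_bridge B s x z r w) (ennreal s)) *
    (\<E> w. path_weight U (\<lambda>r. brownian_bridge B t z y r w) (ennreal t))" using st pm by (simp add: nn_integral_cmult nn_integral_multc)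
  finally show "ennreal (heat_kernel s x z) * (ennreal (heat_kernel t z y) *
    (\<E> w. \<E> w'. interval_weight U (s + t) (?G z w w'))) = bridge_kernel U s x z * bridge_kernel U t z y"
   unfolding bridge_kernel_def by (simp add: mult_ac)
 qed
 finally show ?thesis unfolding bridge_kernel_def .
qed

text \<open>The gluing identity with free paths. The future enters only through its values at
  rational times, to which all later functionals are reduced.\<close>

lemma markov_property:
 assumes U [measurable]: "U \<in> borel_measurable borel" and s: "s \<in> \<rat>" "0 < s"
  and G: "(\<lambda>(z, \<zeta>). G z \<zeta>) \<in> borel_measurable (borel \<Otimes>\<^sub>M PiM rational_times (\<lambda>_. borel))"
 shows "(\<E> w. path_weight U (\<lambda>r. x + B r w) (ennreal s) * G (x + B s w) (\<lambda>r\<in>rational_times. x + B (s + r) w))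
  = (\<L> z. bridge_kernel U s x z * (\<E> w. G z (\<lambda>r\<in>rational_times. z + B r w)))"
proof -
 let ?I = rational_times
 have I: "?I \<subseteq> {0<..}" "s \<in> ?I" using s by (auto simp: rational_times_def)
 have Iadd: "s + r \<in> ?I" if "r \<in> ?I" for r using that s by (auto simp: rational_times_def)
 have G': "(\<lambda>p. G (f p) (g p)) \<in> borel_measurable N"
  if "f \<in> borel_measurable N" "g \<in> measurable N (PiM ?I (\<lambda>_. borel))" for f g and N :: "'q measure"
  using measurable_compose[OF measurable_Pair[OF that] G] by simp
 define F where "F \<zeta> = interval_weight U s \<zeta> * G (\<zeta> s) (\<lambda>r\<in>?I. \<zeta> (s + r))" for \<zeta>
 have Fm: "F \<in> borel_measurable (PiM ?I (\<lambda>_. borel))" unfolding F_def[abs_def]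
  by (intro borel_measurable_times_ennreal measurable_interval_weight U G' measurable_restrict measurable_PiM_eval)
 let ?G = "\<lambda>z w w'. \<lambda>r\<in>?I. if r < s then brownian_bridge B s x z r w else if r = s then z else z + B (r - s) w'"
 have cont: "continuous_on {0<..<v} (\<lambda>r. brownian_bridge B u x y r w)" if "w \<in> space W" "0 <= u" for u v x y w
  by (rule continuous_on_subset[OF continuous_on_bridge[OF that]]) auto
 have contB: "continuous_on {0<..<v} (\<lambda>r. x + B r w)" if "w \<in> space W" for v x w
  by (intro continuous_intros continuous_on_subset[OF bm_continuous[OF that]]) auto
 have "1 * (\<E> w. F (\<lambda>r\<in>?I. x + B r w))
  = (\<L> z. ennreal (heat_kernel s x z) * (1 * (\<E> w. \<E> w'. F (?G z w w'))))"
 proof (rule glue_law[OF I, where k="\<lambda>r z. 1"])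
  show "(\<lambda>w. x + B r w) \<in> borel_measurable W" if "r \<in> ?I" for r
   using that I by (intro borel_measurable_add bm_measurable borel_measurable_const) auto
  show "(\<lambda>(z, w). z + B (r - s) w) \<in> borel_measurable (borel \<Otimes>\<^sub>M W)" if "r \<in> ?I" "s < r" for r
   unfolding case_prod_beta' using that by (intro borel_measurable_add measurable_B_compose) auto
  show "F \<in> borel_measurable (PiM ?I (\<lambda>_. borel))" by fact
 next
  fix ts and A :: "real => 'a set" assume ts: "sorted_wrt (<) ts" "set ts \<subseteq> ?I" and A: "\<And>r. A r \<in> sets borel"
  have "(\<E> w. (\<Prod>r\<in>set ts. indicator (A r) (x + B r w))) =
   (\<E> w. (\<Prod>r\<in>set ts. indicator (A r) (x + (B r w - B 0 w)) :: ennreal))" by (intro nn_integral_cong) (simp add: bm_start)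
  also have "... = heat_chain 0 ts (\<lambda>r. indicator (A r)) (\<lambda>r z. 1) x" by (rule fdd_free) (use ts A I in auto)
  finally show "1 * (\<E> w. (\<Prod>r\<in>set ts. indicator (A r) (x + B r w))) =
   heat_chain 0 ts (\<lambda>r. indicator (A r)) (\<lambda>r z. 1) x" by simp
 next
  fix ts z and A :: "real => 'a set" assume ts: "sorted_wrt (<) (s # ts)" "set ts \<subseteq> ?I" and A: "\<And>r. A r \<in> sets borel"
  let ?ts = "map (\<lambda>r. r - s) ts" and ?\<phi> = "\<lambda>r. indicator (A (r + s)) :: 'a => ennreal"
  have "(\<E> w. (\<Prod>r\<in>set ts. indicator (A r) (z + B (r - s) w))) =
   (\<E> w. (\<Prod>r\<in>set ?ts. ?\<phi> r (z + (B r w - B 0 w))))" by (intro nn_integral_cong) (simp add: prod.reindex inj_on_def bm_start)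
  also have "... = heat_chain 0 ?ts ?\<phi> (\<lambda>r z. 1) z" by (rule fdd_free) (use ts A s in \<open>auto simp: sorted_wrt_map\<close>)
  also have "... = heat_chain s ts (\<lambda>r. indicator (A r)) (\<lambda>r z. 1) z"
   using heat_chain_shift[of s s ts ?\<phi> "\<lambda>r z. 1" z] by simp
  finally show "1 * (\<E> w. (\<Prod>r\<in>set ts. indicator (A r) (z + B (r - s) w))) =
   heat_chain s ts (\<lambda>r. indicator (A r)) (\<lambda>r z. 1) z" by simp
 qed simp_all
 also have "(\<E> w. F (\<lambda>r\<in>?I. x + B r w)) =
  (\<E> w. path_weight U (\<lambda>r. x + B r w) (ennreal s) * G (x + B s w) (\<lambda>r\<in>?I. x + B (s + r) w))"
 proof (intro nn_integral_cong)
  fix w assume w: "w \<in> space W"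
  have "interval_weight U s (\<lambda>r\<in>?I. x + B r w) = path_weight U (\<lambda>r. x + B r w) (ennreal s)"
   by (rule interval_weight_eq_path_weight[OF _ contB]) (use w s in \<open>auto simp: rational_times_def\<close>)
  moreover have "(\<lambda>r\<in>?I. (\<lambda>r\<in>?I. x + B r w) (s + r)) = (\<lambda>r\<in>?I. x + B (s + r) w)"
   using Iadd by (intro restrict_ext) simp
  ultimately show "F (\<lambda>r\<in>?I. x + B r w) = path_weight U (\<lambda>r. x + B r w) (ennreal s) * G (x + B s w) (\<lambda>r\<in>?I. x + B (s + r) w)"
   unfolding F_def using I(2) by simp
 qed
 also have "(\<L> z. ennreal (heat_kernel s x z) * (1 * (\<E> w. \<E> w'. F (?G z w w')))) =
  (\<L> z. bridge_kernel U s x z * (\<E> w. G z (\<lambda>r\<in>?I. z + B r w)))"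
 proof (intro nn_integral_cong)
  fix z
  have pm: "(\<lambda>w. path_weight U (\<lambda>r. brownian_bridge B s x z r w) (ennreal s)) \<in> borel_measurable W"
  proof -
   have "(\<lambda>w. \<lambda>r\<in>?I. brownian_bridge B s x z r w) \<in> measurable W (PiM ?I (\<lambda>_. borel))"
    using s by (intro measurable_restrict measurable_bridge) (auto simp: rational_times_def)
   from measurable_compose[OF this measurable_interval_weight[OF U]]
   show ?thesis by (rule measurable_cong[THEN iffD1, rotated])
     (rule interval_weight_eq_path_weight; use s in \<open>auto simp: cont rational_times_def\<close>)
  qed
  have gm: "(\<lambda>w. G z (\<lambda>r\<in>?I. z + B r w)) \<in> borel_measurable W"
   by (intro G' measurable_restrict borel_measurable_add bm_measurable) (auto simp: rational_times_def)
  have "(\<E> w. \<E> w'. F (?G z w w')) =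
   (\<E> w. \<E> w'. path_weight U (\<lambda>r. brownian_bridge B s x z r w) (ennreal s) * G z (\<lambda>r\<in>?I. z + B r w'))"
  proof (intro nn_integral_cong)
   fix w w' assume w: "w \<in> space W" "w' \<in> space W"
   have "interval_weight U s (?G z w w') = path_weight U (\<lambda>r. brownian_bridge B s x z r w) (ennreal s)"
    by (rule interval_weight_eq_path_weight[OF _ cont]) (use w s in \<open>auto simp: rational_times_def\<close>)
   moreover have "(\<lambda>r\<in>?I. ?G z w w' (s + r)) = (\<lambda>r\<in>?I. z + B r w')"
    using Iadd by (intro restrict_ext) (auto simp: rational_times_def)
   ultimately show "F (?G z w w') = path_weight U (\<lambda>r. brownian_bridge B s x z r w) (ennreal s) * G z (\<lambda>r\<in>?I. z + B r w')"
    unfolding F_def using I(2) by simp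
  qed
  also have "... = (\<E> w. path_weight U (\<lambda>r. brownian_bridge B s x z r w) (ennreal s)) * (\<E> w. G z (\<lambda>r\<in>?I. z + B r w))"
   using pm gm by (simp add: nn_integral_cmult nn_integral_multc)
  finally show "ennreal (heat_kernel s x z) * (1 * (\<E> w. \<E> w'. F (?G z w w'))) =
   bridge_kernel U s x z * (\<E> w. G z (\<lambda>r\<in>?I. z + B r w))" unfolding bridge_kernel_def by (simp add: mult_ac)
 qed
 finally show ?thesis by simp
qed

end

lemma ennreal_half: "(1 / 2 :: ennreal) = ennreal (1 / 2)" by (metis ennreal_1 ennreal_divide_numeral zero_le_one)

context standard_brownian_motion
begin

text \<open>The potential is a parameter because it will be random: events about costs need joint
  measurability in the realisation and the position.\<close>

lemma measurable_bridge_kernel: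
 assumes V: "(\<lambda>(\<omega>, x). V \<omega> x) \<in> borel_measurable (M \<Otimes>\<^sub>M borel)"
  and om: "om \<in> measurable N M" and fg: "f \<in> borel_measurable N" "g \<in> borel_measurable N" and t: "0 <= t"
 shows "(\<lambda>p. bridge_kernel (V (om p)) t (f p) (g p)) \<in> borel_measurable N"
proof -
 define \<zeta> where "\<zeta> p = (\<lambda>r\<in>rational_times. brownian_bridge B t (f (fst p)) (g (fst p)) r (snd p))" for p
 have [measurable]: "\<zeta> \<in> measurable (N \<Otimes>\<^sub>M W) (PiM rational_times (\<lambda>_. borel))"
  unfolding \<zeta>_def using fg t by (intro measurable_restrict measurable_bridge) (auto simp: rational_times_def)
 have V': "(\<lambda>q. V (om (a q)) (b q)) \<in> borel_measurable K"
  if "a \<in> measurable K N" "b \<in> borel_measurable K" for a b and K :: "'q measure"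
  using measurable_compose[OF measurable_Pair[OF measurable_compose[OF that(1) om] that(2)] V] by simp
 have "(\<lambda>(p, s). ennreal (V (om (fst p)) (dyadic_extension (\<zeta> p) s)) * indicator {0<..<t} s) \<in> borel_measurable ((N \<Otimes>\<^sub>M W) \<Otimes>\<^sub>M lborel)"
  unfolding case_prod_beta' by (intro borel_measurable_times_ennreal measurable_compose[OF V' measurable_ennreal]
   measurable_dyadic_extension') measurable
 hence "(\<lambda>p. exp_neg (\<integral>\<^sup>+s\<in>{0<..<t}. ennreal (V (om (fst p)) (dyadic_extension (\<zeta> p) s)) \<partial>lborel)) \<in> borel_measurable (N \<Otimes>\<^sub>M W)"
  by (intro measurable_compose[OF _ measurable_exp_neg] lborel.borel_measurable_nn_integral) simp
 hence "(\<lambda>p. interval_weight (V (om (fst p))) t (\<zeta> p)) \<in> borel_measurable (N \<Otimes>\<^sub>M W)"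
  unfolding interval_weight_def .
 hence "(\<lambda>(p, w). path_weight (V (om p)) (\<lambda>s. brownian_bridge B t (f p) (g p) s w) (ennreal t)) \<in> borel_measurable (N \<Otimes>\<^sub>M W)"
 proof (rule measurable_cong[THEN iffD1, rotated])
  fix p assume "p \<in> space (N \<Otimes>\<^sub>M W)"
  then obtain q w where p: "p = (q, w)" "w \<in> space W" by (auto simp: space_pair_measure)
  have c: "continuous_on {0<..<t} (\<lambda>s. brownian_bridge B t (f q) (g q) s w)"
   by (rule continuous_on_subset[OF continuous_on_bridge[OF p(2) t]]) auto
  have "interval_weight (V (om q)) t (\<zeta> (q, w)) = path_weight (V (om q)) (\<lambda>s. brownian_bridge B t (f q) (g q) s w) (ennreal t)"
   by (rule interval_weight_eq_path_weight[OF t c]) (auto simp: \<zeta>_def rational_times_def)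
  thus "interval_weight (V (om (fst p))) t (\<zeta> p) =
   (case p of (p, w) => path_weight (V (om p)) (\<lambda>s. brownian_bridge B t (f p) (g p) s w) (ennreal t))" using p by simp
 qed
 from borel_measurable_nn_integral[OF this]
 show ?thesis unfolding bridge_kernel_def using fg by simp
qed

lemma measurable_bridge_kernel_fixed:
 assumes "U \<in> borel_measurable borel" "f \<in> borel_measurable N" "g \<in> borel_measurable N" "0 <= t"
 shows "(\<lambda>p. bridge_kernel U t (f p) (g p)) \<in> borel_measurable N"
proof -
 have "(\<lambda>(\<omega> :: unit, x). U x) \<in> borel_measurable (count_space UNIV \<Otimes>\<^sub>M borel)" using assms(1) by simp
 from measurable_bridge_kernel[OF this _ assms(2-4), of "\<lambda>_. ()"] show ?thesis by simp
qed

lemma measurable_path_weight: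
 assumes [measurable]: "U \<in> borel_measurable borel" and "0 <= t"
 shows "(\<lambda>w. path_weight U (\<lambda>r. x + B r w) (ennreal t)) \<in> borel_measurable W"
proof -
 have "(\<lambda>w. \<lambda>r\<in>rational_times. x + B r w) \<in> measurable W (PiM rational_times (\<lambda>_. borel))"
  by (intro measurable_restrict borel_measurable_add bm_measurable) (auto simp: rational_times_def)
 from measurable_compose[OF this measurable_interval_weight[OF assms(1)]]
 show ?thesis
 proof (rule measurable_cong[THEN iffD1, rotated])
  fix w assume "w \<in> space W"
  thus "interval_weight U t (\<lambda>r\<in>rational_times. x + B r w) = path_weight U (\<lambda>r. x + B r w) (ennreal t)" using assms(2)
   by (intro interval_weight_eq_path_weight continuous_intros continuous_on_subset[OF bm_continuous])
    (auto simp: rational_times_def)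
 qed
qed

lemma feynman_kac:
 assumes U: "U \<in> borel_measurable borel" and s: "s \<in> \<rat>" "0 < s" and [measurable]: "f \<in> borel_measurable borel"
 shows "(\<E> w. path_weight U (\<lambda>r. x + B r w) (ennreal s) * f (x + B s w)) = (\<L> z. bridge_kernel U s x z * f z)"
 using markov_property[OF U s, of "\<lambda>z \<zeta>. f z" x] emeasure_space_1 by (simp add: case_prod_beta')

section \<open>Confinement and Gaussian tails of Brownian paths\<close>

lemma norm_le_of_rationals:
 fixes z :: "real => 'a" and s T b :: real
 assumes "continuous_on {0..} z" "0 <= s" "s <= T" "\<And>r. r \<in> \<rat> ==> 0 <= r ==> r <= T ==> norm (z r) <= b"
 shows "norm (z s) <= b"
proof -
 let ?r = "\<lambda>n. of_int \<lfloor>s * 2 ^ n\<rfloor> / 2 ^ n :: real"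
 have r: "0 <= ?r n" "?r n <= s" for n using assms(2) by (auto simp: field_simps)
 have "(\<lambda>n. z (?r n)) \<longlonglongrightarrow> z s"
  by (rule continuous_on_tendsto_compose[OF assms(1) dyadic_floor_tendsto]) (use r assms(2) in auto)
 hence "(\<lambda>n. norm (z (?r n))) \<longlonglongrightarrow> norm (z s)" by (rule tendsto_norm)
 thus ?thesis
 proof (rule LIMSEQ_le_const2, intro exI allI impI)
  fix n :: nat
  show "norm (z (?r n)) <= b" using r[of n] assms(3) by (intro assms(4)) auto
 qed
qed

text \<open>Every path is bounded on the compact interval by continuity, so these events exhaust the
  space as the radius grows; a qualitative choice of \<open>\<rho>\<close> is enough.\<close>

lemma confined_event:
 assumes "0 < T"
 obtains \<rho> A where "0 < \<rho>" "A \<in> sets W" "1 / 2 <= emeasure W A" "\<And>w s. w \<in> A ==> 0 <= s ==> s <= T ==> norm (B s w) <= \<rho>"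
proof -
 define A where "A n = {w \<in> space W. \<forall>r\<in>\<rat> \<inter> {0..T}. norm (B r w) <= real n}" for n
 have A: "A n \<in> sets W" for n
 proof -
  show ?thesis unfolding A_def
  proof (rule sets.sets_Collect_countable_All')
   show "countable (\<rat> \<inter> {0..T})" using countable_rat by blast
   fix r assume "r \<in> \<rat> \<inter> {0..T}"
   hence [measurable]: "B r \<in> borel_measurable W" by (intro bm_measurable) auto
   show "{w \<in> space W. norm (B r w) <= real n} \<in> sets W" by measurable
  qed
 qed
 have inc: "incseq A" unfolding A_def incseq_def by (auto intro: order_trans)
 have U: "(\<Union>n. A n) = space W"
 proof -
  have "\<exists>n. w \<in> A n" if "w \<in> space W" for w
  proof -
   have "compact ((\<lambda>t. B t w) ` {0..T})" by (intro compact_continuous_image continuous_on_subset[OF bm_continuous[OF that]]) auto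
   then obtain b where "\<forall>v\<in>(\<lambda>t. B t w) ` {0..T}. norm v <= b" using compact_imp_bounded bounded_iff by blast
   moreover obtain n where "b <= real n" using real_arch_simple by blast
   ultimately show ?thesis using that unfolding A_def by (force intro: order_trans)
  qed
  thus ?thesis using sets.sets_into_space[OF A] by blast
 qed
 have "(\<lambda>n. emeasure W (A n)) \<longlonglongrightarrow> emeasure W (\<Union>n. A n)" by (rule Lim_emeasure_incseq) (use A inc in auto)
 hence "(\<lambda>n. emeasure W (A n)) \<longlonglongrightarrow> 1" unfolding U emeasure_space_1 .
 moreover have "(1 / 2 :: ennreal) < 1" unfolding ennreal_half using ennreal_lessI[of 1 "1 / 2"] by simp
 ultimately have "\<forall>\<^sub>F n in sequentially. 1 / 2 < emeasure W (A n)" by (rule order_tendstoD(1))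
 then obtain n where n: "1 / 2 < emeasure W (A n)" by (auto simp: eventually_sequentially)
 show ?thesis
 proof (rule that[of "real n + 1" "A n"])
  show "1 / 2 <= emeasure W (A n)" using n by simp
  fix w s assume ws: "w \<in> A n" "0 <= s" "s <= T"
  hence "norm (B s w) <= real n" by (intro norm_le_of_rationals[OF bm_continuous[of w], of s T]) (auto simp: A_def)
  thus "norm (B s w) <= real n + 1" by simp
 qed (use A in auto)
qed

text \<open>With probability at least one half the bridge stays within twice the confinement radius
  of its chord, and the chord lies in the convex ball. The radius depends on \<open>T\<close> only,
  not on the potential or the end points.\<close>

lemma bridge_kernel_lower:
 assumes "0 < T"
 shows "\<exists>\<rho>>0. \<forall>U \<Lambda> x0 r t x y. 0 < t --> t <= T --> 0 <= \<Lambda> --> x \<in> cball x0 r --> y \<in> cball x0 r -->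
  (\<forall>z\<in>cball x0 (r + \<rho>). U z <= \<Lambda>) --> ennreal (heat_kernel t x y * exp (- (t * \<Lambda>)) / 2) <= bridge_kernel U t x y"
proof -
 obtain \<rho> A where \<rho>: "0 < \<rho>" "A \<in> sets W" "1 / 2 <= emeasure W A" "\<And>w s. w \<in> A ==> 0 <= s ==> s <= T ==> norm (B s w) <= \<rho>"
  using confined_event[OF assms] by blast
 show ?thesis
 proof (intro exI[of _ "2 * \<rho>"] conjI allI impI)
  show "0 < 2 * \<rho>" using \<rho> by simp
  fix U :: "'a => real" and \<Lambda> x0 r t x y
  assume t: "0 < t" "t <= T" and \<Lambda>: "0 <= \<Lambda>" and x: "x \<in> cball x0 r" and y: "y \<in> cball x0 r"
   and U: "\<forall>z\<in>cball x0 (r + 2 * \<rho>). U z <= \<Lambda>"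
  have pw: "ennreal (exp (- (t * \<Lambda>))) <= path_weight U (\<lambda>s. brownian_bridge B t x y s w) (ennreal t)" if "w \<in> A" for w
  proof -
   have "U (brownian_bridge B t x y s w) <= \<Lambda>" if "s \<in> {0<..<t}" for s
   proof -
    have s: "0 <= s / t" "s / t <= 1" using that t by auto
    have "x + (s / t) *\<^sub>R (y - x) \<in> cball x0 r"
    proof -
     have "(1 - s / t) *\<^sub>R x + (s / t) *\<^sub>R y \<in> cball x0 r" using x y s by (intro convexD[OF convex_cball]) auto
     thus ?thesis by (simp add: algebra_simps)
    qed
    moreover have "norm (B s w - (s / t) *\<^sub>R B t w) <= 2 * \<rho>"
    proof -
     have "norm (B s w) <= \<rho>" "norm (B t w) <= \<rho>" using \<rho>(4)[OF \<open>w \<in> A\<close>] that t by auto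
     moreover have "norm ((s / t) *\<^sub>R B t w) <= 1 * \<rho>" unfolding norm_scaleR using s calculation by (intro mult_mono) auto
     ultimately show ?thesis using norm_triangle_ineq4[of "B s w" "(s / t) *\<^sub>R B t w"] by linarith
    qed
    ultimately have "brownian_bridge B t x y s w \<in> cball x0 (r + 2 * \<rho>)" unfolding brownian_bridge_def mem_cball dist_norm
     using norm_triangle_ineq4[of "x0 - (x + (s / t) *\<^sub>R (y - x))" "B s w - (s / t) *\<^sub>R B t w"] by (simp add: algebra_simps)
    thus ?thesis using U by auto
   qed
   hence "(\<integral>\<^sup>+s\<in>{0<..<t}. ennreal (U (brownian_bridge B t x y s w)) \<partial>lborel) <= (\<L> s. ennreal \<Lambda> * indicator {0<..<t} s)"
    by (intro nn_integral_mono) (auto simp: indicator_def intro: ennreal_leI)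
   also have "... = ennreal (t * \<Lambda>)" using t \<Lambda> by (simp add: nn_integral_cmult_indicator ennreal_mult mult.commute)
   finally have "exp_neg (ennreal (t * \<Lambda>)) <= exp_neg (\<integral>\<^sup>+s\<in>{0<..<t}. ennreal (U (brownian_bridge B t x y s w)) \<partial>lborel)"
    by (rule exp_neg_mono)
   thus ?thesis using t \<Lambda> exp_neg_ennreal[of "t * \<Lambda>"] by (simp add: path_weight_open)
  qed
  have "ennreal (exp (- (t * \<Lambda>)) / 2) = ennreal (exp (- (t * \<Lambda>))) * (1 / 2)"
   unfolding ennreal_half by (subst ennreal_mult[symmetric]) simp_all
  also have "... <= ennreal (exp (- (t * \<Lambda>))) * emeasure W A" by (intro mult_left_mono \<rho>) simp
  also have "... = (\<E> w. ennreal (exp (- (t * \<Lambda>))) * indicator A w)" using \<rho> by (simp add: nn_integral_cmult_indicator)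
  also have "... <= (\<E> w. path_weight U (\<lambda>s. brownian_bridge B t x y s w) (ennreal t))"
   by (intro nn_integral_mono) (auto simp: indicator_def pw)
  finally have "ennreal (heat_kernel t x y) * ennreal (exp (- (t * \<Lambda>)) / 2) <= bridge_kernel U t x y"
   unfolding bridge_kernel_def by (rule mult_left_mono) simp
  thus "ennreal (heat_kernel t x y * exp (- (t * \<Lambda>)) / 2) <= bridge_kernel U t x y" by (simp add: ennreal_mult[symmetric])
 qed
qed

text \<open>Exponential Chebyshev inequality with the weight
  \<open>exp ((norm z)^2 / (4 * (r - s)))\<close>, which turns the kernel into a multiple of the
  kernel at twice the time.\<close>

lemma increment_tail:
 assumes "0 <= s" "s < r" "0 <= a"
 shows "emeasure W {w \<in> space W. a < norm (B r w - B s w)} <= ennreal (2 powr (real DIM('a) / 2) * exp (- a\<^sup>2 / (4 * (r - s))))"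
proof -
 let ?t = "r - s" and ?d = "real DIM('a) / 2"
 have t: "0 < ?t" using assms by simp
 have id: "heat_kernel ?t 0 z * exp ((norm z)\<^sup>2 / (4 * ?t)) = 2 powr ?d * heat_kernel (2 * ?t) (0::'a) z" for z
 proof -
  have "(2 * pi * ?t) powr - ?d = 2 powr ?d * (2 * pi * (2 * ?t)) powr - ?d"
  proof -
   have "(2 * pi * (2 * ?t)) powr - ?d = 2 powr - ?d * (2 * pi * ?t) powr - ?d" using t powr_mult[of 2 "2 * pi * ?t" "- ?d"] by (simp add: mult_ac)
   thus ?thesis by (simp add: powr_add[symmetric] mult.assoc[symmetric])
  qed
  moreover have "exp (- (norm z)\<^sup>2 / (2 * ?t)) * exp ((norm z)\<^sup>2 / (4 * ?t)) = exp (- (norm z)\<^sup>2 / (2 * (2 * ?t)))"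
  proof -
   have "- n / (2 * \<tau>) + n / (4 * \<tau>) = - n / (2 * (2 * \<tau>))" if "0 < \<tau>" for n \<tau> :: real
    using that by (simp add: field_simps)
   from this[OF t] show ?thesis unfolding exp_add[symmetric] by simp
  qed
  ultimately show ?thesis unfolding heat_kernel_def by (simp add: mult_ac)
 qed
 have [measurable]: "(\<lambda>w. B r w - B s w) \<in> borel_measurable W" using assms by (intro borel_measurable_diff bm_measurable) auto
 let ?A = "- a\<^sup>2 / (4 * ?t)"
 have "emeasure W {w \<in> space W. a < norm (B r w - B s w)} = (\<E> w. indicator {z. a < norm z} (B r w - B s w))"
 proof -
  have "{w \<in> space W. a < norm (B r w - B s w)} \<in> sets W" by measurable
  hence "emeasure W {w \<in> space W. a < norm (B r w - B s w)} = (\<E> w. indicator {w \<in> space W. a < norm (B r w - B s w)} w)" by simp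
  also have "... = (\<E> w. indicator {z. a < norm z} (B r w - B s w))" by (rule nn_integral_cong) (simp add: indicator_def)
  finally show ?thesis .
 qed
 also have "... = (\<L> z. ennreal (heat_kernel ?t (0::'a) z) * indicator {z. a < norm z} z)"
  using distributed_nn_integral[OF bm_gaussian[OF assms(1,2)], of "\<lambda>z. indicator {z. a < norm z} z"] by simp
 also have "... <= (\<L> z. ennreal (2 powr ?d * exp ?A) * ennreal (heat_kernel (2 * ?t) (0::'a) z))"
 proof (intro nn_integral_mono)
  fix z :: 'a
  show "ennreal (heat_kernel ?t 0 z) * indicator {z. a < norm z} z <= ennreal (2 powr ?d * exp ?A) * ennreal (heat_kernel (2 * ?t) (0::'a) z)"
  proof (cases "a < norm z")
   case True
   hence "a\<^sup>2 <= (norm z)\<^sup>2" using assms by (intro power_mono) auto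
   hence "1 <= exp ?A * exp ((norm z)\<^sup>2 / (4 * ?t))"
   proof -
    have "a\<^sup>2 / (4 * ?t) <= (norm z)\<^sup>2 / (4 * ?t)"
     using \<open>a\<^sup>2 <= (norm z)\<^sup>2\<close> t by (intro divide_right_mono) auto
    hence "0 <= - a\<^sup>2 / (4 * ?t) + (norm z)\<^sup>2 / (4 * ?t)" unfolding minus_divide_left[symmetric] by linarith
    thus ?thesis unfolding exp_add[symmetric] one_le_exp_iff .
   qed
   hence "heat_kernel ?t 0 z * 1 <= heat_kernel ?t 0 z * (exp ?A * exp ((norm z)\<^sup>2 / (4 * ?t)))"
    by (rule mult_left_mono) simp
   also have "... = exp ?A * (heat_kernel ?t 0 z * exp ((norm z)\<^sup>2 / (4 * ?t)))" by (simp add: mult_ac)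
   also have "... = 2 powr ?d * exp ?A * heat_kernel (2 * ?t) 0 z" unfolding id by simp
   finally show ?thesis using True by (simp add: ennreal_mult[symmetric] ennreal_leI)
  qed simp
 qed
 also have "... = ennreal (2 powr ?d * exp ?A)" using t by (subst nn_integral_cmult) (simp_all add: nn_integral_heat_kernel)
 finally show ?thesis .
qed

text \<open>Dyadic chaining: outside the event that some level-\<open>k\<close> increment exceeds
  its share \<open>a k\<close> of \<open>l\<close>, the shares add up along dyadic
  expansions.\<close>

lemma brownian_sup_tail:
 obtains C c where "1 <= C" "0 < c"
  "\<And>l::real. 0 <= l ==> \<exists>A\<in>sets W. emeasure W A <= ennreal (C * exp (- (c * l\<^sup>2))) \<and>
    (\<forall>w\<in>space W - A. \<forall>s\<in>{0..1}. norm (B s w) <= l)"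
proof -
 \<comment> \<open>Level-\<open>k\<close> increments have standard deviation of order
   \<open>q ^ k\<close>. The shares are \<open>Suc k\<close> times larger, so that the probabilities
   still sum after multiplication by the \<open>2 ^ k\<close> increments; \<open>S\<close>
   normalises the shares to total \<open>l\<close>.\<close>
 define q :: real where "q = 1 / sqrt 2"
 have q: "0 < q" "q < 1" "q\<^sup>2 = 1 / 2" by (auto simp: q_def power_divide)
 define S where "S = 1 / (1 - q)\<^sup>2"
 have S: "0 < S" "(\<lambda>k. real (Suc k) * q ^ k) sums S" using q geometric_deriv_sums[of q] by (auto simp: S_def)
 define D where "D = 2 powr (real DIM('a) / 2)"
 have D: "0 < D" by (simp add: D_def)
 define C where "C = 2 * D + exp 2"
 define c where "c = 1 / (4 * S\<^sup>2)"
 have main: "\<exists>A\<in>sets W. emeasure W A <= ennreal (C * exp (- (c * l\<^sup>2))) \<and>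
    (\<forall>w\<in>space W - A. \<forall>s\<in>{0..1}. norm (B s w) <= l)" if l: "0 <= l" for l :: real
 proof (cases "c * l\<^sup>2 < 2")
  case True
  \<comment> \<open>For small \<open>l\<close> the claimed bound exceeds one, owing to the summand
    \<open>exp 2\<close> of \<open>C\<close>.\<close>
  have "1 <= exp (2 - c * l\<^sup>2)" using True by simp
  also have "... = exp 2 * exp (- (c * l\<^sup>2))" by (simp add: exp_add[symmetric])
  also have "... <= C * exp (- (c * l\<^sup>2))" unfolding C_def using D by (intro mult_right_mono) auto
  finally have "ennreal 1 <= ennreal (C * exp (- (c * l\<^sup>2)))" by (rule ennreal_leI)
  thus ?thesis by (intro bexI[of _ "space W"]) (auto simp: emeasure_space_1)
 next
  case False
  define u where "u = c * l\<^sup>2"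
  have u: "2 <= u" using False by (simp add: u_def)
  define a where "a k = (l / S) * (real (Suc k) * q ^ k)" for k
  have a0: "0 <= a k" for k using l S q by (simp add: a_def)
  have asum: "a sums l" using sums_mult[OF S(2), of "l / S"] S(1) unfolding a_def by simp
  have apart: "sum a {..<n} <= l" for n using sum_le_suminf[of a "{..<n}"] asum a0 by (auto simp: sums_iff)
  have a2: "(a k)\<^sup>2 / (4 * (1 / 2 ^ k)) = u * (real (Suc k))\<^sup>2" for k
  proof -
   have "(q ^ k)\<^sup>2 = (q\<^sup>2) ^ k" by (metis power_mult mult.commute)
   hence "(q ^ k)\<^sup>2 = 1 / 2 ^ k" unfolding q(3) by (simp add: power_one_over)
   thus ?thesis using S(1) by (simp add: a_def u_def c_def power_mult_distrib power_divide)
  qed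
  define E where "E k i = {w \<in> space W. a k < norm (B ((real i + 1) / 2 ^ k) w - B (real i / 2 ^ k) w)}" for k i
  have Em: "E k i \<in> sets W" for k i
  proof -
   have [measurable]: "B ((real i + 1) / 2 ^ k) \<in> borel_measurable W" "B (real i / 2 ^ k) \<in> borel_measurable W"
    by (intro bm_measurable; simp)+
   show ?thesis unfolding E_def by measurable
  qed
  have Eb: "emeasure W (E k i) <= ennreal (D * exp (- (u * real (Suc k))))" for k i
  proof -
   have "emeasure W (E k i) <= ennreal (2 powr (real DIM('a) / 2) * exp (- (a k)\<^sup>2 / (4 * ((real i + 1) / 2 ^ k - real i / 2 ^ k))))"
    unfolding E_def by (rule increment_tail) (auto simp: a0 divide_strict_right_mono)
   also have "(real i + 1) / 2 ^ k - real i / 2 ^ k = 1 / 2 ^ k" by (simp add: diff_divide_distrib[symmetric])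
   also have "- (a k)\<^sup>2 / (4 * (1 / 2 ^ k)) = - (u * (real (Suc k))\<^sup>2)" unfolding a2[symmetric] by simp
   finally have 1: "emeasure W (E k i) <= ennreal (D * exp (- (u * (real (Suc k))\<^sup>2)))" unfolding D_def .
   have "u * real (Suc k) * 1 <= u * real (Suc k) * real (Suc k)" using u by (intro mult_left_mono) auto
   hence "D * exp (- (u * (real (Suc k))\<^sup>2)) <= D * exp (- (u * real (Suc k)))" using D by (simp add: power2_eq_square mult.assoc)
   from order_trans[OF 1 ennreal_leI[OF this]] show ?thesis .
  qed
  define A where "A = (\<Union>k. \<Union>i\<in>{..<2 ^ k}. E k i)"
  have Am: "A \<in> sets W" unfolding A_def using Em by auto
  have e4: "(4::real) <= exp 2"
  proof -
   have "(2::real) * 2 <= exp 1 * exp 1" using exp_ge_add_one_self[of 1] by (intro mult_mono) auto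
   thus ?thesis by (simp add: exp_add[symmetric])
  qed
  have eu: "2 * exp (- u) <= 1 / 2"
  proof -
   have "(4::real) <= exp u" by (rule order_trans[OF e4]) (use u in simp)
   thus ?thesis by (simp add: exp_minus field_simps)
  qed
  have "emeasure W A <= (\<Sum>k. emeasure W (\<Union>i\<in>{..<2 ^ k}. E k i))"
   unfolding A_def by (rule emeasure_subadditive_countably) (use Em in auto)
  also have "... <= (\<Sum>k. ennreal (D * exp (- u) * (1 / 2) ^ k))"
  proof (intro suminf_le)
   fix k :: nat
   have "emeasure W (\<Union>i\<in>{..<2 ^ k}. E k i) <= (\<Sum>i\<in>{..<2 ^ k}. emeasure W (E k i))"
    by (rule emeasure_subadditive_finite) (use Em in auto)
   also have "... <= (\<Sum>i\<in>{..<(2::nat) ^ k}. ennreal (D * exp (- (u * real (Suc k)))))" by (intro sum_mono Eb)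
   also have "... = ennreal (2 ^ k * (D * exp (- (u * real (Suc k)))))" using D by (simp add: ennreal_mult ennreal_power[symmetric] of_nat_power)
   also have "2 ^ k * (D * exp (- (u * real (Suc k)))) = D * exp (- u) * (2 * exp (- u)) ^ k"
    by (simp add: power_mult_distrib exp_of_nat_mult[symmetric] exp_add[symmetric] algebra_simps)
   also have "... <= D * exp (- u) * (1 / 2) ^ k" using D eu by (intro mult_left_mono power_mono) auto
   finally show "emeasure W (\<Union>i\<in>{..<2 ^ k}. E k i) <= ennreal (D * exp (- u) * (1 / 2) ^ k)" by (simp add: ennreal_leI)
  qed auto
  also have "... = ennreal (D * exp (- u) * 2)"
  proof (rule suminf_ennreal_eq)
   show "(\<lambda>k. D * exp (- u) * (1 / 2) ^ k) sums (D * exp (- u) * 2)"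
    using sums_mult[OF geometric_sums[of "1 / 2 :: real"], of "D * exp (- u)"] by simp
  qed (use D in auto)
  also have "... <= ennreal (C * exp (- (c * l\<^sup>2)))" unfolding u_def[symmetric] C_def by (intro ennreal_leI) (simp add: algebra_simps)
  finally have Ab: "emeasure W A <= ennreal (C * exp (- (c * l\<^sup>2)))" .
  have "norm (B s w) <= l" if w: "w \<in> space W - A" and s: "s \<in> {0..1}" for w s
  proof -
   have inc: "norm (B ((real i + 1) / 2 ^ k) w - B (real i / 2 ^ k) w) <= a k" if "i < 2 ^ k" for k i
    using w that unfolding A_def E_def by force
   \<comment> \<open>An odd multiple of the finer mesh is one increment to the right of an even one,
     which already belongs to the coarser mesh.\<close>
   have dy: "norm (B (real j / 2 ^ K) w) <= sum a {..K}" if "j <= 2 ^ K" for j K using that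
   proof (induction K arbitrary: j)
    case 0
    hence "j = 0 \<or> j = 1" by auto
    thus ?case using inc[of 0 0] bm_start[of w] w a0[of 0] by auto
   next
    case (Suc K)
    define i where "i = j div 2"
    have even_case: "norm (B (real (2 * i) / 2 ^ Suc K) w) <= sum a {..K}" using Suc.IH[of i] Suc.prems by (simp add: i_def)
    show ?case
    proof (cases "even j")
     case True
     hence "j = 2 * i" by (simp add: i_def)
     thus ?thesis using even_case a0[of "Suc K"] by simp
    next
     case False
     hence j: "j = 2 * i + 1" by (simp add: i_def)
     have "norm (B ((real (2 * i) + 1) / 2 ^ Suc K) w - B (real (2 * i) / 2 ^ Suc K) w) <= a (Suc K)" using Suc.prems j by (intro inc) auto
     thus ?thesis using even_case norm_triangle_sub[of "B ((real (2 * i) + 1) / 2 ^ Suc K) w" "B (real (2 * i) / 2 ^ Suc K) w"]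
      unfolding j by (simp add: algebra_simps)
    qed
   qed
   let ?r = "\<lambda>n. of_int \<lfloor>s * 2 ^ n\<rfloor> / 2 ^ n :: real"
   have r0: "0 <= ?r n" for n using s by (auto simp: field_simps)
   have "(\<lambda>n. B (?r n) w) \<longlonglongrightarrow> B s w"
    by (rule continuous_on_tendsto_compose[OF bm_continuous[of w] dyadic_floor_tendsto]) (use r0 s w in auto)
   hence "(\<lambda>n. norm (B (?r n) w)) \<longlonglongrightarrow> norm (B s w)" by (rule tendsto_norm)
   thus ?thesis
   proof (rule LIMSEQ_le_const2, intro exI allI impI)
    fix n :: nat
    define j where "j = nat \<lfloor>s * 2 ^ n\<rfloor>"
    have nn: "0 <= \<lfloor>s * 2 ^ n\<rfloor>" using s by simp
    have rj: "?r n = real j / 2 ^ n" using nn unfolding j_def by simp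
    have "s * 2 ^ n <= 2 ^ n" using s by simp
    hence "\<lfloor>s * 2 ^ n\<rfloor> <= 2 ^ n" unfolding floor_le_iff by (simp only: of_int_power of_int_numeral)
    hence "j <= 2 ^ n" unfolding j_def by (simp add: nat_le_iff)
    from dy[OF this] show "norm (B (?r n) w) <= l" unfolding rj using apart[of "Suc n"] by (simp add: lessThan_Suc_atMost)
   qed
  qed
  thus ?thesis using Am Ab by blast
 qed
 show ?thesis
 proof (rule that[OF _ _ main])
  show "1 <= C" using D exp_ge_add_one_self[of 2] by (simp add: C_def)
  show "0 < c" using S by (simp add: c_def)
 qed
qed

text \<open>An open condition at countably many times: a path that meets the closed unit ball at
  some time in [0, 1) is within distance 2 at a nearby rational time. So this measurable functional
  detects hits that happen between integer times.\<close>

definition near_hit :: "'a => (real => 'a) => ennreal" where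
 "near_hit y \<zeta> = (if \<exists>r\<in>rational_times. r < 1 \<and> norm (\<zeta> r - y) < 2 then 1 else 0)"

lemma countable_rational_times: "countable rational_times" using countable_rat unfolding rational_times_def by blast

lemma measurable_near_hit: "near_hit y \<in> borel_measurable (PiM rational_times (\<lambda>_. borel))"
proof -
 let ?P = "PiM rational_times (\<lambda>_. borel :: 'a measure)"
 have "{\<zeta> \<in> space ?P. \<exists>r\<in>rational_times. r < 1 \<and> norm (\<zeta> r - y) < 2} \<in> sets ?P"
 proof (rule sets.sets_Collect_countable_Ex'[OF _ countable_rational_times])
  fix r :: real
  have [measurable]: "(\<lambda>\<zeta>. \<zeta> r) \<in> borel_measurable ?P" by (rule measurable_PiM_eval)
  show "{\<zeta> \<in> space ?P. r < 1 \<and> norm (\<zeta> r - y) < 2} \<in> sets ?P" by measurable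
 qed
 thus ?thesis unfolding near_hit_def[abs_def] by (intro measurable_If) auto
qed

text \<open>To come within distance 2 of \<open>y\<close> the path has to travel at least
  \<open>norm (z - y) - 2\<close> in unit time.\<close>

lemma near_hit_tail:
 obtains C c where "1 <= C" "0 < c"
  "\<And>y z. (\<E> w. near_hit y (\<lambda>r\<in>rational_times. z + B r w)) <= ennreal (C * exp (- (c * (norm (z - y))\<^sup>2)))"
proof -
 obtain C c where C: "1 <= C" "0 < c" and tail: "\<And>l::real. 0 <= l ==> \<exists>A\<in>sets W. emeasure W A <= ennreal (C * exp (- (c * l\<^sup>2))) \<and>
    (\<forall>w\<in>space W - A. \<forall>s\<in>{0..1}. norm (B s w) <= l)" using brownian_sup_tail by blast
 show ?thesis
 \<comment> \<open>The constants come from \<open>(n - 2)^2 >= n^2 / 2 - 4\<close>, which absorbs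
   the shift by 2 into half of the exponent.\<close>
 proof (rule that[of "C * exp (4 * c)" "c / 2"])
  have "1 * 1 <= C * exp (4 * c)" using C by (intro mult_mono) auto
  thus "1 <= C * exp (4 * c)" by simp
  show "0 < c / 2" using C by simp
  fix y z :: 'a
  define n where "n = norm (z - y)"
  let ?A = "- (c / 2 * n\<^sup>2)"
  show "(\<E> w. near_hit y (\<lambda>r\<in>rational_times. z + B r w)) <= ennreal (C * exp (4 * c) * exp (- (c / 2 * (norm (z - y))\<^sup>2)))"
  proof (cases "n < 2")
   case True
   have "n\<^sup>2 <= 2\<^sup>2" using True by (intro power_mono) (auto simp: n_def)
   hence "c / 2 * n\<^sup>2 <= c / 2 * 4" using C by (intro mult_left_mono) auto
   hence "1 <= exp (4 * c - c / 2 * n\<^sup>2)" using C by simp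
   also have "... = exp (4 * c) * exp ?A" by (simp add: exp_add[symmetric])
   finally have "1 * 1 <= C * (exp (4 * c) * exp ?A)" using C by (intro mult_mono) auto
   hence "ennreal 1 <= ennreal (C * exp (4 * c) * exp ?A)" by (intro ennreal_leI) (simp add: mult.assoc)
   have "(\<E> w. near_hit y (\<lambda>r\<in>rational_times. z + B r w)) <= (\<E> w. 1)" by (intro nn_integral_mono) (auto simp: near_hit_def)
   also have "... = ennreal 1" by (simp add: emeasure_space_1)
   also note \<open>ennreal 1 <= _\<close>
   finally show ?thesis unfolding n_def .
  next
   case False
   obtain A where A: "A \<in> sets W" "emeasure W A <= ennreal (C * exp (- (c * (n - 2)\<^sup>2)))"
    "\<forall>w\<in>space W - A. \<forall>s\<in>{0..1}. norm (B s w) <= n - 2" using tail[of "n - 2"] False by auto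
   have "(\<E> w. near_hit y (\<lambda>r\<in>rational_times. z + B r w)) <= (\<E> w. indicator A w)"
   proof (intro nn_integral_mono)
    fix w assume w: "w \<in> space W"
    have "\<not> norm (z + B r w - y) < 2" if "w \<notin> A" "r \<in> rational_times" "r < 1" for r
    proof -
     have "norm (B r w) <= n - 2" using A(3) w that by (auto simp: rational_times_def)
     thus ?thesis using norm_triangle_ineq4[of "z + B r w - y" "B r w"] by (simp add: n_def algebra_simps)
    qed
    thus "near_hit y (\<lambda>r\<in>rational_times. z + B r w) <= indicator A w" by (auto simp: near_hit_def indicator_def)
   qed
   also have "... <= ennreal (C * exp (- (c * (n - 2)\<^sup>2)))" using A by simp
   also have "... <= ennreal (C * exp (4 * c) * exp ?A)"
   proof (rule ennreal_leI)
    have "0 <= (n - 4)\<^sup>2" by simp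
    hence "n\<^sup>2 / 2 - 4 <= (n - 2)\<^sup>2" by (simp add: power2_eq_square algebra_simps)
    from mult_left_mono[OF this, of c] C have "- (c * (n - 2)\<^sup>2) <= 4 * c + - (c / 2 * n\<^sup>2)" by (simp add: algebra_simps)
    hence "exp (- (c * (n - 2)\<^sup>2)) <= exp (4 * c) * exp ?A" unfolding exp_add[symmetric] by simp
    thus "C * exp (- (c * (n - 2)\<^sup>2)) <= C * exp (4 * c) * exp ?A" using C by (simp add: mult.assoc)
   qed
   finally show ?thesis by (simp add: n_def)
  qed
 qed
qed

text \<open>Split by the integer part \<open>n\<close> of the hitting time. Dropping the potential
  after time \<open>n\<close> only increases the weight, and the Markov property at the
  deterministic time \<open>n\<close> then gives the sum.\<close>

lemma hitting_weight_le:
 fixes x y :: 'a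
 assumes U: "U \<in> borel_measurable borel"
 defines "\<phi> \<equiv> \<lambda>z. \<E> w. near_hit y (\<lambda>r\<in>rational_times. z + B r w)"
 shows "hitting_weight W B U x y <= \<phi> x + (\<Sum>n. \<L> z. bridge_kernel U (real (Suc n)) x z * \<phi> z)"
proof -
 let ?H = "\<lambda>w. hitting_time (\<lambda>t. x + B t w) y"
 define h where "h n w = path_weight U (\<lambda>r. x + B r w) (ennreal (real n)) * near_hit y (\<lambda>r\<in>rational_times. x + B (real n + r) w)" for n w
 have pt: "path_weight U (\<lambda>t. x + B t w) (?H w) * indicator {w. ?H w < \<infinity>} w <= (\<Sum>n. h n w)" if w: "w \<in> space W" for w
 proof (cases "?H w < \<infinity>")
  case True
  hence ne: "?H w \<noteq> \<top>" by auto
  define H where "H = enn2real (?H w)"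
  have H: "?H w = ennreal H" "0 <= H" using ne by (simp_all add: H_def less_top)
  define n where "n = nat \<lfloor>H\<rfloor>"
  have n: "real n <= H" "H < real n + 1" using H(2) floor_correct[of H] unfolding n_def by auto
  have "?H w < ennreal (real n + 1)" unfolding H(1) by (rule ennreal_lessI) (use n in auto)
  \<comment> \<open>A visit before time \<open>n + 1\<close> suffices, so the infimum need not be
    shown to be attained.\<close>
  then obtain t where t: "0 <= t" "x + B t w \<in> cball y 1" "ennreal t < ennreal (real n + 1)" unfolding hitting_time_def INF_less_iff by auto
  have "?H w <= ennreal t" unfolding hitting_time_def using t by (intro INF_lower) auto
  hence tn: "real n <= t" "t < real n + 1" using H n t(1,3) unfolding ennreal_less_iff[OF t(1)] by auto
  have "\<exists>r\<in>rational_times. r < 1 \<and> norm (x + B (real n + r) w - y) < 2"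
  proof -
   let ?f = "\<lambda>s. x + B s w - y"
   have "continuous_on {0..} ?f" by (intro continuous_intros bm_continuous w)
   moreover have "norm (?f t) < 2" using t by (simp add: dist_norm norm_minus_commute)
   ultimately obtain d where d: "0 < d" "\<And>s. 0 <= s ==> dist s t < d ==> norm (?f s - ?f t) < 2 - norm (?f t)"
    unfolding continuous_on_iff using t(1) by (auto simp: dist_norm Ball_def) (metis diff_gt_0_iff_gt)
   have "max (t - real n) 0 < min (t - real n + d) 1" using tn d by auto
   then obtain r where r: "r \<in> \<rat>" "max (t - real n) 0 < r" "r < min (t - real n + d) 1" using Rats_dense_in_real by blast
   hence "norm (?f (real n + r) - ?f t) < 2 - norm (?f t)" using d(2)[of "real n + r"] by (auto simp: dist_real_def)
   hence "norm (?f (real n + r)) < 2" using norm_triangle_sub[of "?f (real n + r)" "?f t"] by linarith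
   thus ?thesis using r by (intro bexI[of _ r]) (auto simp: rational_times_def)
  qed
  hence nh: "near_hit y (\<lambda>r\<in>rational_times. x + B (real n + r) w) = 1" by (auto simp: near_hit_def)
  have "path_weight U (\<lambda>t. x + B t w) (?H w) <= path_weight U (\<lambda>t. x + B t w) (ennreal (real n))" unfolding path_weight_def
  proof (intro exp_neg_mono nn_integral_mono)
   fix s
   show "ennreal (U (x + B s w)) * indicator {s. 0 <= s \<and> ennreal s <= ennreal (real n)} s
    <= ennreal (U (x + B s w)) * indicator {s. 0 <= s \<and> ennreal s <= ?H w} s"
    unfolding H(1) using n H(2) by (auto simp: indicator_def)
  qed
  hence "path_weight U (\<lambda>t. x + B t w) (?H w) <= h n w" unfolding h_def nh by simp
  also have "... <= (\<Sum>n. h n w)" using sum_le_suminf[of "\<lambda>n. h n w" "{n}"] by simp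
  finally show ?thesis by (auto simp: indicator_def)
 qed simp
 have hm: "h n \<in> borel_measurable W" for n unfolding h_def
  by (intro borel_measurable_times_ennreal measurable_path_weight U measurable_compose[OF _ measurable_near_hit]
    measurable_restrict borel_measurable_add bm_measurable) (auto simp: rational_times_def)
 have step: "(\<E> w. h (Suc n) w) = (\<L> z. bridge_kernel U (real (Suc n)) x z * \<phi> z)" for n unfolding h_def \<phi>_def
  by (rule markov_property[OF U, of "real (Suc n)" "\<lambda>z \<zeta>. near_hit y \<zeta>"])
   (use measurable_near_hit in \<open>auto simp: case_prod_beta'\<close>)
 have "hitting_weight W B U x y <= (\<E> w. (\<Sum>n. h n w))" unfolding hitting_weight_def by (intro nn_integral_mono pt)
 also have "... = (\<Sum>n. \<E> w. h n w)" by (rule nn_integral_suminf[OF hm])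
 also have "... = (\<E> w. h 0 w) + (\<Sum>n. \<E> w. h (Suc n) w)"
  using sums_unique[OF sums_Suc[OF summable_sums[OF summableI], of "\<lambda>n. \<E> w. h n w"]] by (simp add: add.commute)
 also have "(\<E> w. h 0 w) = \<phi> x" unfolding h_def \<phi>_def using path_weight_open[of 0 U] by simp
 also have "(\<Sum>n. \<E> w. h (Suc n) w) = (\<Sum>n. \<L> z. bridge_kernel U (real (Suc n)) x z * \<phi> z)" unfolding step ..
 finally show ?thesis .
qed

text \<open>The weight of paths whose first integer time in \<open>A\<close> is \<open>n\<close>:
  the first-entrance decomposition of the skeleton chain, with the potential acting also between
  integer times.\<close>

primrec taboo :: "('a => real) => 'a set => nat => 'a => ennreal" where
 "taboo U A 0 x = indicator A x"
| "taboo U A (Suc n) x = indicator (- A) x * (\<L> z. bridge_kernel U 1 x z * taboo U A n z)"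

definition skeleton_pos :: "'a => (real => 'a) => nat => 'a" where
 "skeleton_pos z \<zeta> i = (if i = 0 then z else \<zeta> (real i))"

definition taboo_functional :: "('a => real) => 'a set => nat => 'a => (real => 'a) => ennreal" where
 "taboo_functional U A n z \<zeta> = interval_weight U (real n) \<zeta> *
   (if (\<forall>i<n. skeleton_pos z \<zeta> i \<notin> A) \<and> skeleton_pos z \<zeta> n \<in> A then 1 else 0)"

lemma measurable_taboo_functional:
 assumes U: "U \<in> borel_measurable borel" and A [measurable]: "A \<in> sets borel"
 shows "(\<lambda>(z, \<zeta>). taboo_functional U A n z \<zeta>) \<in> borel_measurable (borel \<Otimes>\<^sub>M PiM rational_times (\<lambda>_. borel))"
proof -
 let ?N = "borel \<Otimes>\<^sub>M PiM rational_times (\<lambda>_. borel :: 'a measure)"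
 have [measurable]: "(\<lambda>p. skeleton_pos (fst p) (snd p) i) \<in> borel_measurable ?N" for i
  by (cases "i = 0") (auto simp: skeleton_pos_def intro!: measurable_compose[OF measurable_snd measurable_PiM_eval])
 have [measurable]: "(\<lambda>p. interval_weight U (real n) (snd p)) \<in> borel_measurable ?N"
  by (rule measurable_compose[OF measurable_snd measurable_interval_weight[OF U]])
 show ?thesis unfolding taboo_functional_def case_prod_beta' by measurable
qed

text \<open>Path-space meaning of the recursion; the induction step splits off the first unit of
  time and applies the Markov property at time 1.\<close>

lemma nn_integral_taboo_functional:
 assumes U: "U \<in> borel_measurable borel" and A: "A \<in> sets borel"
 shows "(\<E> w. taboo_functional U A n x (\<lambda>r\<in>rational_times. x + B r w)) = taboo U A n x"
proof (induction n arbitrary: x)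
 case 0
 have "(\<E> w. taboo_functional U A 0 x (\<lambda>r\<in>rational_times. x + B r w)) = (\<E> w. indicator A x)"
  by (intro nn_integral_cong) (simp add: taboo_functional_def interval_weight_def skeleton_pos_def indicator_def)
 also have "... = taboo U A 0 x" by (simp add: emeasure_space_1)
 finally show ?case .
next
 case (Suc n)
 let ?\<zeta> = "\<lambda>w. \<lambda>r\<in>rational_times. x + B r w" and ?\<zeta>' = "\<lambda>w. \<lambda>r\<in>rational_times. x + B (1 + r) w"
 let ?B = "\<lambda>w. \<lambda>r. x + B r w"
 have step: "taboo_functional U A (Suc n) x (?\<zeta> w) = indicator (- A) x *
   (path_weight U (?B w) (ennreal 1) * taboo_functional U A n (x + B 1 w) (?\<zeta>' w))" if w: "w \<in> space W" for w
 proof -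
  have c1: "continuous_on {0<..<u} (?B w)" for u by (intro continuous_intros continuous_on_subset[OF bm_continuous[OF w]]) auto
  have c2: "continuous_on {0<..<u} (\<lambda>r. x + B (1 + r) w)" for u
   by (intro continuous_intros continuous_on_compose2[OF bm_continuous[OF w]]) auto
  have "interval_weight U (1 + real n) (?\<zeta> w) = path_weight U (?B w) (ennreal 1) * path_weight U (\<lambda>r. x + B (1 + r) w) (ennreal (real n))"
   by (rule interval_weight_glue[OF U _ _ c1 _ c2, where I=rational_times]) (auto simp: rational_times_def space_PiM)
  also have "path_weight U (\<lambda>r. x + B (1 + r) w) (ennreal (real n)) = interval_weight U (real n) (?\<zeta>' w)"
   by (rule interval_weight_eq_path_weight[OF _ c2, symmetric]) (auto simp: rational_times_def)
  finally have 1: "interval_weight U (real (Suc n)) (?\<zeta> w) = path_weight U (?B w) (ennreal 1) * interval_weight U (real n) (?\<zeta>' w)"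
   unfolding of_nat_Suc .
  have rt: "real i \<in> rational_times \<longleftrightarrow> i \<noteq> 0" for i by (auto simp: rational_times_def)
  have 2: "skeleton_pos x (?\<zeta> w) (Suc i) = skeleton_pos (x + B 1 w) (?\<zeta>' w) i" for i
   using rt[of "Suc i"] rt[of i] by (auto simp: skeleton_pos_def add.commute)
  have 3: "skeleton_pos x (?\<zeta> w) 0 = x" by (simp add: skeleton_pos_def)
  show ?thesis unfolding taboo_functional_def 1 All_less_Suc2 2 3 by (auto simp: indicator_def)
 qed
 have m: "(\<lambda>w. path_weight U (?B w) (ennreal 1) * taboo_functional U A n (x + B 1 w) (?\<zeta>' w)) \<in> borel_measurable W"
 proof (intro borel_measurable_times_ennreal measurable_path_weight U)
  have "(\<lambda>w. (x + B 1 w, ?\<zeta>' w)) \<in> measurable W (borel \<Otimes>\<^sub>M PiM rational_times (\<lambda>_. borel))"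
   by (intro measurable_Pair measurable_restrict borel_measurable_add bm_measurable) (auto simp: rational_times_def)
  from measurable_compose[OF this measurable_taboo_functional[OF assms]]
  show "(\<lambda>w. taboo_functional U A n (x + B 1 w) (?\<zeta>' w)) \<in> borel_measurable W" by simp
 qed simp
 let ?A = "\<E> w. path_weight U (?B w) (ennreal 1) * taboo_functional U A n (x + B 1 w) (?\<zeta>' w)"
 have "(\<E> w. taboo_functional U A (Suc n) x (?\<zeta> w)) =
   (\<E> w. indicator (- A) x * (path_weight U (?B w) (ennreal 1) * taboo_functional U A n (x + B 1 w) (?\<zeta>' w)))"
  by (intro nn_integral_cong step)
 also have "... = indicator (- A) x * ?A"
  by (rule nn_integral_cmult[OF m])
 also have "?A =
  (\<L> z. bridge_kernel U 1 x z * taboo U A n z)"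
  unfolding Suc.IH[symmetric] by (rule markov_property[OF U _ _ measurable_taboo_functional[OF assms]]) auto
 finally show ?case by simp
qed

text \<open>The first integer time in the ball is no earlier than the hitting time, so the potential
  collected up to it is at least as large. On each path at most one \<open>n\<close>
  contributes.\<close>

lemma hitting_weight_ge:
 assumes U: "U \<in> borel_measurable borel"
 shows "(\<Sum>n. taboo U (cball y 1) n x) <= hitting_weight W B U x y"
proof -
 let ?A = "cball y 1" and ?H = "\<lambda>w. hitting_time (\<lambda>t. x + B t w) y"
 let ?T = "\<lambda>n w. taboo_functional U ?A n x (\<lambda>r\<in>rational_times. x + B r w)"
 have A: "?A \<in> sets borel" by simp
 have m: "(\<lambda>w. ?T n w) \<in> borel_measurable W" for n
 proof -
  have "(\<lambda>w. (x, \<lambda>r\<in>rational_times. x + B r w)) \<in> measurable W (borel \<Otimes>\<^sub>M PiM rational_times (\<lambda>_. borel))"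
   by (intro measurable_Pair measurable_restrict borel_measurable_add bm_measurable) (auto simp: rational_times_def)
  from measurable_compose[OF this measurable_taboo_functional[OF U A]] show ?thesis by simp
 qed
 have "(\<Sum>n. taboo U ?A n x) = (\<Sum>n. \<E> w. ?T n w)" using nn_integral_taboo_functional[OF U A] by simp
 also have "... = (\<E> w. (\<Sum>n. ?T n w))" by (rule nn_integral_suminf[OF m, symmetric])
 also have "... <= hitting_weight W B U x y" unfolding hitting_weight_def
 proof (intro nn_integral_mono)
  fix w assume w: "w \<in> space W"
  have pos: "skeleton_pos x (\<lambda>r\<in>rational_times. x + B r w) i = x + B (real i) w" for i
   using bm_start[OF w] by (auto simp: skeleton_pos_def rational_times_def)
  show "(\<Sum>n. ?T n w) <= path_weight U (\<lambda>t. x + B t w) (?H w) * indicator {w. ?H w < \<infinity>} w"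
  proof (cases "\<exists>n. x + B (real n) w \<in> ?A")
   case False
   thus ?thesis by (simp add: taboo_functional_def pos)
  next
   case True
   define N where "N = (LEAST n. x + B (real n) w \<in> ?A)"
   have N: "x + B (real N) w \<in> ?A" using True unfolding N_def by (rule LeastI_ex)
   have Nl: "x + B (real i) w \<notin> ?A" if "i < N" for i using that not_less_Least unfolding N_def by blast
   have "?T n w = 0" if "n \<noteq> N" for n using that N Nl[of n] by (cases "n < N") (auto simp: taboo_functional_def pos)
   hence "(\<Sum>n. ?T n w) = ?T N w" by (subst suminf_finite[of "{N}"]) auto
   also have "... <= interval_weight U (real N) (\<lambda>r\<in>rational_times. x + B r w)" unfolding taboo_functional_def by auto
   also have "... = path_weight U (\<lambda>r. x + B r w) (ennreal (real N))"
    by (intro interval_weight_eq_path_weight continuous_intros continuous_on_subset[OF bm_continuous[OF w]])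
     (auto simp: rational_times_def)
   also have "... <= path_weight U (\<lambda>t. x + B t w) (?H w) * indicator {w. ?H w < \<infinity>} w"
   proof -
    have HN: "?H w <= ennreal (real N)" unfolding hitting_time_def using N by (intro INF_lower) auto
    also have "... < \<infinity>" by simp
    finally have "?H w < \<infinity>" .
    moreover have "path_weight U (\<lambda>r. x + B r w) (ennreal (real N)) <= path_weight U (\<lambda>t. x + B t w) (?H w)"
    proof -
     have "s <= real N" if "ennreal s <= ?H w" for s using order_trans[OF that HN] by (simp add: ennreal_le_iff)
     thus ?thesis unfolding path_weight_def by (intro exp_neg_mono nn_integral_mono) (auto simp: indicator_def)
    qed
    ultimately show ?thesis by simp
   qed
   finally show ?thesis .
  qed
 qed
 finally show ?thesis .
qed

text \<open>Convexity makes the bound linear in \<open>u\<close>, so an expected occupation time is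
  all that has to be estimated afterwards.\<close>

lemma exp_neg_chord:
 fixes e u :: real
 assumes "0 <= u" "u <= 1"
 shows "exp (- (e * u)) <= 1 - (1 - exp (- e)) * u"
proof -
 have "exp ((1 - u) * 0 + u * (- e)) <= (1 - u) * exp 0 + u * exp (- e)" using assms convex_onD[OF exp_convex, of u 0 "- e"] by simp
 thus ?thesis by (simp add: algebra_simps)
qed

text \<open>Time spent in \<open>K\<close> during the last unit of \<open>[0, n]\<close> is
  penalised at rate at least \<open>e\<close>. Its expectation is at least the volume of
  \<open>K\<close> times the smallest value of the heat kernel over these times and distances up to
  \<open>D\<close>; \<open>2 <= n\<close> keeps the times away from zero.\<close>

lemma trap_loss:
 fixes z :: 'a
 assumes U: "U \<in> borel_measurable borel" and K [measurable]: "K \<in> sets borel"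
  and KU: "\<And>v. v \<in> K ==> e <= U v" "0 <= e" and KD: "K \<subseteq> cball z D" "0 <= D"
  and Km: "ennreal m <= emeasure lborel K" "0 <= m" and T: "2 <= n"
 shows "(\<L> v. bridge_kernel U (real n) z v) +
   ennreal ((1 - exp (- e)) * (m * ((2 * pi * real n) powr (- real DIM('a) / 2) * exp (- (D\<^sup>2 / (2 * (real n - 1))))))) <= 1"
proof -
 define T where "T = real n"
 have T2: "2 <= T" using T by (simp add: T_def)
 define \<zeta> where "\<zeta> w = (\<lambda>r\<in>rational_times. z + B r w)" for w
 have [measurable]: "\<zeta> \<in> measurable W (PiM rational_times (\<lambda>_. borel))"
  unfolding \<zeta>_def by (intro measurable_restrict borel_measurable_add bm_measurable) (auto simp: rational_times_def)
 define J where "J = {T - 1<..<T}"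
 define Oc where "Oc w = (\<L> s. indicator K (dyadic_extension (\<zeta> w) s) * indicator J s)" for w
 have Xm: "(\<lambda>(w, s). indicator K (dyadic_extension (\<zeta> w) s) * indicator J s :: ennreal) \<in> borel_measurable (W \<Otimes>\<^sub>M lborel)"
  unfolding case_prod_beta' J_def by measurable
 have Om [measurable]: "Oc \<in> borel_measurable W" unfolding Oc_def using lborel.borel_measurable_nn_integral[OF Xm] by simp
 have ext: "dyadic_extension (\<zeta> w) s = z + B s w" if "w \<in> space W" "0 < s" for w s
 proof (rule dyadic_extension_eq[where a=0 and b="s + 1"])
  show "continuous_on {0<..<s + 1} (\<lambda>s. z + B s w)" by (intro continuous_intros continuous_on_subset[OF bm_continuous[OF that(1)]]) auto
 qed (use that in \<open>auto simp: \<zeta>_def rational_times_def\<close>)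
 define c where "c = 1 - exp (- e)"
 have c: "0 <= c" using KU(2) by (simp add: c_def)
 let ?B = "\<lambda>w. \<lambda>r. z + B r w"
 \<comment> \<open>The occupation time \<open>Oc w\<close> is at most 1, the length of
   \<open>J\<close>, as the chord inequality requires.\<close>
 have pt: "path_weight U (?B w) (ennreal T) * 1 + ennreal c * Oc w <= 1" if w: "w \<in> space W" for w
 proof -
  have "Oc w <= (\<L> s. indicator J s)" unfolding Oc_def by (intro nn_integral_mono) (auto simp: indicator_def)
  also have "... = 1" unfolding J_def by simp
  finally have O1: "Oc w <= 1" .
  then obtain u where u: "Oc w = ennreal u" "0 <= u" by (cases "Oc w") (auto simp: top_unique)
  have u1: "u <= 1" using O1 u by simp
  have "ennreal (e * u) = (\<L> s. ennreal e * (indicator K (dyadic_extension (\<zeta> w) s) * indicator J s))"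
   using measurable_compose[OF measurable_Pair1' Xm, of w] w
   by (subst nn_integral_cmult) (simp_all add: u(1)[symmetric] Oc_def[symmetric] ennreal_mult KU(2) u(2))
  also have "... <= (\<integral>\<^sup>+s\<in>{0<..<T}. ennreal (U (z + B s w)) \<partial>lborel)"
   by (intro nn_integral_mono) (use T2 KU w in \<open>auto simp: indicator_def J_def ext intro!: ennreal_leI\<close>)
  finally have "path_weight U (?B w) (ennreal T) <= exp_neg (ennreal (e * u))"
   using T2 by (subst path_weight_open) (auto intro!: exp_neg_mono)
  also have "... = ennreal (exp (- (e * u)))" using KU u by (simp add: exp_neg_ennreal)
  also have "... <= ennreal (1 - c * u)" unfolding c_def by (intro ennreal_leI exp_neg_chord u u1)
  finally have "path_weight U (?B w) (ennreal T) + ennreal (c * u) <= ennreal (1 - c * u) + ennreal (c * u)"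
   by (rule add_right_mono)
  also have "c * u <= 1 * 1" using c u u1 by (intro mult_mono) (auto simp: c_def)
  hence "ennreal (1 - c * u) + ennreal (c * u) = 1" using c u by (simp add: ennreal_plus[symmetric] del: ennreal_plus)
  finally show ?thesis using u c by (simp add: ennreal_mult)
 qed
 define \<kappa> where "\<kappa> = (2 * pi * T) powr (- real DIM('a) / 2) * exp (- (D\<^sup>2 / (2 * (T - 1))))"
 have hk: "\<kappa> <= heat_kernel s z v" if "s \<in> J" "v \<in> K" for s v
 proof -
  have s: "T - 1 < s" "s < T" "1 < s" using that T2 by (auto simp: J_def)
  have nv: "norm (z - v) <= D" using that KD by (auto simp: dist_norm)
  have "(2 * pi * T) powr (- real DIM('a) / 2) <= (2 * pi * s) powr (- real DIM('a) / 2)" using s by (intro powr_mono2') auto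
  moreover have "exp (- (D\<^sup>2 / (2 * (T - 1)))) <= exp (- (norm (z - v))\<^sup>2 / (2 * s))"
  proof -
   have "(norm (z - v))\<^sup>2 / (2 * s) <= D\<^sup>2 / (2 * (T - 1))" using s T2 nv by (intro frac_le power_mono) auto
   thus ?thesis by simp
  qed
  ultimately show ?thesis unfolding \<kappa>_def heat_kernel_def by (intro mult_mono) auto
 qed
 have \<kappa>0: "0 <= \<kappa>" by (simp add: \<kappa>_def)
 interpret WL: pair_sigma_finite W lborel by unfold_locales
 let ?A = "\<lambda>s. \<E> w. indicator K (dyadic_extension (\<zeta> w) s) * indicator J s"
 have "ennreal (m * \<kappa>) = (\<L> s. ennreal (m * \<kappa>) * indicator J s)" unfolding J_def by (simp add: nn_integral_cmult_indicator)
 also have "... <= (\<L> s. (?A s))"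
 proof (intro nn_integral_mono)
  fix s
  show "ennreal (m * \<kappa>) * indicator J s <= (?A s)"
  proof (cases "s \<in> J")
   case True
   hence s: "0 < s" using T2 by (auto simp: J_def)
   have "ennreal (m * \<kappa>) = ennreal \<kappa> * ennreal m" using \<kappa>0 Km by (simp add: ennreal_mult mult.commute)
   also have "... <= ennreal \<kappa> * emeasure lborel K" by (intro mult_left_mono Km) simp
   also have "... = (\<L> v. ennreal \<kappa> * indicator K v)" by (simp add: nn_integral_cmult_indicator)
   also have "... <= (\<L> v. ennreal (heat_kernel (s - 0) z v) * (indicator K v * 1))"
    by (intro nn_integral_mono) (use hk[OF True] in \<open>auto simp: indicator_def intro!: ennreal_leI\<close>)
   also have "... = (\<E> w. indicator K (z + (B s w - B 0 w)))" using fdd_free[of 0 "[s]" "\<lambda>_. indicator K" z] s by simp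
   also have "... = (?A s)"
    by (intro nn_integral_cong) (use True s in \<open>auto simp: ext bm_start\<close>)
   finally show ?thesis using True by simp
  qed simp
 qed
 also have "... = (\<E> w. Oc w)" unfolding Oc_def using WL.Fubini'[OF Xm] by simp
 finally have OE: "ennreal (m * \<kappa>) <= (\<E> w. Oc w)" .
 have pwm [measurable]: "(\<lambda>w. path_weight U (?B w) (ennreal T)) \<in> borel_measurable W"
  using T2 by (intro measurable_path_weight U) simp
 have fk: "(\<E> w. path_weight U (?B w) (ennreal T) * 1) = (\<L> v. bridge_kernel U T z v * 1)"
  unfolding T_def using T by (intro feynman_kac[OF U, where f="\<lambda>_. 1"]) auto
 have "(\<L> v. bridge_kernel U T z v) + ennreal (c * (m * \<kappa>)) \<le>
   (\<E> w. path_weight U (?B w) (ennreal T) * 1) + ennreal c * (\<E> w. Oc w)"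
  using fk OE c Km \<kappa>0 by (auto simp: ennreal_mult intro!: add_mono mult_left_mono)
 also have "... = (\<E> w. path_weight U (?B w) (ennreal T) * 1 + ennreal c * Oc w)"
  by (simp add: nn_integral_add nn_integral_cmult)
 also have "... <= (\<E> w. 1)" by (intro nn_integral_mono pt)
 also have "... = 1" by (simp add: emeasure_space_1)
 finally show ?thesis unfolding T_def c_def \<kappa>_def .
qed

end

section \<open>Hitting weights of the integer-time skeleton\<close>

locale bm_environment = standard_brownian_motion W B
 for W :: "'w measure" and B :: "real => 'w => 'a::euclidean_space" +
 fixes U :: "'a => real"
 assumes U_measurable: "U \<in> borel_measurable borel"
begin

definition propagate :: "real => ('a => ennreal) => 'a => ennreal" where
 "propagate t f x = (\<L> z. bridge_kernel U t x z * f z)"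

definition skeleton_hit :: "'a set => 'a => ennreal" where
 "skeleton_hit A x = (\<Sum>n. taboo U A n x)"

lemma measurable_bk [measurable (raw)]:
 assumes "f \<in> borel_measurable N" "g \<in> borel_measurable N" "0 <= t"
 shows "(\<lambda>p. bridge_kernel U t (f p) (g p)) \<in> borel_measurable N" by (rule measurable_bridge_kernel_fixed[OF U_measurable assms])

lemma measurable_propagate [measurable (raw)]:
 assumes [measurable]: "f \<in> borel_measurable borel" and t: "0 <= t"
 shows "propagate t f \<in> borel_measurable borel"
proof -
 have [measurable]: "(\<lambda>p. bridge_kernel U t (fst p) (snd p)) \<in> borel_measurable (borel \<Otimes>\<^sub>M lborel)"
  using t by (intro measurable_bk) auto
 have "(\<lambda>(x, z). bridge_kernel U t x z * f z) \<in> borel_measurable (borel \<Otimes>\<^sub>M lborel)"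
  unfolding case_prod_beta' by measurable
 from lborel.borel_measurable_nn_integral[OF this] show ?thesis unfolding propagate_def[abs_def] by simp
qed

lemma propagate_mono:
 assumes "AE z in lborel. f z <= g z"
 shows "propagate t f x <= propagate t g x"
 unfolding propagate_def using assms by (intro nn_integral_mono_AE) (auto elim!: eventually_mono intro: mult_left_mono)

lemma propagate_cmult:
 assumes "f \<in> borel_measurable borel" "0 <= t"
 shows "propagate t (\<lambda>z. c * f z) x = c * propagate t f x"
 using assms unfolding propagate_def by (simp add: mult.left_commute[of _ c] nn_integral_cmult)

lemma propagate_sum:
 assumes "\<And>i. f i \<in> borel_measurable borel" "0 <= t"
 shows "propagate t (\<lambda>z. \<Sum>i\<in>I. f i z) x = (\<Sum>i\<in>I. propagate t (f i) x)"
 using assms unfolding propagate_def by (simp add: sum_distrib_left nn_integral_sum)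

lemma propagate_suminf:
 assumes "\<And>i. f i \<in> borel_measurable borel" "0 <= t"
 shows "propagate t (\<lambda>z. \<Sum>i. f i z) x = (\<Sum>i. propagate t (f i) x)" unfolding propagate_def ennreal_suminf_cmult[symmetric]
 by (rule nn_integral_suminf) (use assms in measurable)

lemma propagate_one_le:
 assumes "0 < t"
 shows "propagate t (\<lambda>_. 1) x <= 1"
proof -
 have "propagate t (\<lambda>_. 1) x <= (\<L> z. ennreal (heat_kernel t x z))"
  unfolding propagate_def by (intro nn_integral_mono) (simp add: bridge_kernel_le)
 thus ?thesis using nn_integral_heat_kernel[OF assms] by simp
qed

lemma propagate_le_const:
 assumes "AE z in lborel. f z <= c" "0 < t"
 shows "propagate t f x <= c"
proof -
 have "propagate t f x <= propagate t (\<lambda>_. c * 1) x" using assms by (intro propagate_mono) auto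
 also have "... = c * propagate t (\<lambda>_. 1) x" using assms by (intro propagate_cmult) auto
 also have "... <= c * 1" by (intro mult_left_mono propagate_one_le assms) simp
 finally show ?thesis by simp
qed

lemma propagate_semigroup:
 assumes [measurable]: "f \<in> borel_measurable borel" and s: "s \<in> \<rat>" "0 < s" and t: "0 < t"
 shows "propagate (s + t) f x = propagate s (propagate t f) x"
proof -
 have [measurable]: "(\<lambda>p. bridge_kernel U s (fst p) (snd p)) \<in> borel_measurable (borel \<Otimes>\<^sub>M lborel)"
  "(\<lambda>p. bridge_kernel U t (fst p) (snd p)) \<in> borel_measurable (lborel \<Otimes>\<^sub>M lborel)"
  "bridge_kernel U s x \<in> borel_measurable borel" "\<And>z. (\<lambda>y. bridge_kernel U t y z) \<in> borel_measurable borel"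
  "\<And>y. bridge_kernel U t y \<in> borel_measurable borel" using s t by (auto intro!: measurable_bk)
 have "propagate (s + t) f x = (\<L> z. (\<L> y. bridge_kernel U s x y * bridge_kernel U t y z * f z))"
  unfolding propagate_def by (simp add: chapman_kolmogorov[OF U_measurable s t] nn_integral_multc)
 also have "... = (\<L> y. (\<L> z. bridge_kernel U s x y * bridge_kernel U t y z * f z))" by (rule lborel_pair.Fubini'[symmetric])
   (use s t in \<open>auto intro!: borel_measurable_times_ennreal measurable_bk measurable_compose[OF _ assms(1)] simp: case_prod_beta'\<close>)
 also have "... = propagate s (propagate t f) x" unfolding propagate_def by (simp add: mult.assoc nn_integral_cmult)
 finally show ?thesis .
qed

lemma measurable_taboo [measurable]: "A \<in> sets borel ==> taboo U A n \<in> borel_measurable borel"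
proof (induction n)
 case 0
 thus ?case by (simp add: borel_measurable_indicator taboo.simps(1)[abs_def])
next
 case (Suc n)
 have "taboo U A (Suc n) = (\<lambda>x. indicator (- A) x * propagate 1 (taboo U A n) x)" by (rule ext) (simp add: propagate_def)
 moreover have "propagate 1 (taboo U A n) \<in> borel_measurable borel" by (rule measurable_propagate) (use Suc in auto)
 ultimately show ?case using Suc.prems by (simp add: borel_measurable_times_ennreal)
qed

lemma measurable_skeleton_hit [measurable]: "A \<in> sets borel ==> skeleton_hit A \<in> borel_measurable borel"
 unfolding skeleton_hit_def[abs_def] by (intro borel_measurable_suminf_order measurable_taboo)

lemma taboo_Suc: "taboo U A (Suc n) x = indicator (- A) x * propagate 1 (taboo U A n) x" by (simp add: propagate_def)

lemma taboo_partial_sum: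
 assumes "A \<in> sets borel"
 shows "(\<Sum>i<Suc n. taboo U A i x) = indicator A x + indicator (- A) x * propagate 1 (\<lambda>z. \<Sum>i<n. taboo U A i z) x"
 using assms by (simp add: sum.lessThan_Suc_shift taboo_Suc propagate_sum sum_distrib_left[symmetric] del: sum.lessThan_Suc taboo.simps(2))

lemma skeleton_hit_eq:
 assumes "A \<in> sets borel"
 shows "skeleton_hit A x = indicator A x + indicator (- A) x * propagate 1 (skeleton_hit A) x"
proof -
 have "skeleton_hit A x = taboo U A 0 x + (\<Sum>n. taboo U A (Suc n) x)" unfolding skeleton_hit_def
  using sums_unique[OF sums_Suc[OF summable_sums[OF summableI], of "\<lambda>n. taboo U A n x"]] by (simp add: add.commute)
 also have "(\<Sum>n. taboo U A (Suc n) x) = indicator (- A) x * propagate 1 (skeleton_hit A) x"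
  using assms unfolding skeleton_hit_def[abs_def] by (simp add: taboo_Suc propagate_suminf ennreal_suminf_cmult del: taboo.simps(2))
 finally show ?thesis by simp
qed

lemma taboo_partial_le_1:
 assumes A: "A \<in> sets borel"
 shows "(\<Sum>i<n. taboo U A i x) <= 1"
proof (induction n arbitrary: x)
 case (Suc n)
 have "propagate 1 (\<lambda>z. \<Sum>i<n. taboo U A i z) x <= 1" by (rule propagate_le_const) (use Suc in auto)
 thus ?case unfolding taboo_partial_sum[OF A] by (auto simp: indicator_def)
qed simp

lemma skeleton_hit_le_1: "A \<in> sets borel ==> skeleton_hit A x <= 1"
 unfolding skeleton_hit_def by (intro suminf_le_const summableI taboo_partial_le_1)

lemma skeleton_hit_inside: "A \<in> sets borel ==> x \<in> A ==> skeleton_hit A x = 1" by (simp add: skeleton_hit_eq)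

lemma skeleton_hit_outside: "A \<in> sets borel ==> x \<notin> A ==> skeleton_hit A x = propagate 1 (skeleton_hit A) x"
 by (subst skeleton_hit_eq) auto

text \<open>The hitting weight is superharmonic for the skeleton: stepping before testing for
  \<open>A\<close> can only lose weight, both inside \<open>A\<close>, where it equals 1, and
  outside.\<close>

lemma propagate_skeleton_hit_le:
 assumes A: "A \<in> sets borel" and n: "0 < n"
 shows "propagate (real n) (skeleton_hit A) x <= skeleton_hit A x" using n
proof (induction n arbitrary: x)
 case (Suc n)
 have 1: "propagate 1 (skeleton_hit A) x <= skeleton_hit A x" for x
 proof (cases "x \<in> A")
  case True
  have "propagate 1 (skeleton_hit A) x <= 1" by (rule propagate_le_const) (auto simp: skeleton_hit_le_1 A)
  thus ?thesis using True A by (simp add: skeleton_hit_inside)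
 qed (simp add: skeleton_hit_outside A)
 show ?case
 proof (cases "n = 0")
  case False
  have "propagate (real (Suc n)) (skeleton_hit A) x = propagate 1 (propagate (real n) (skeleton_hit A)) x"
   using propagate_semigroup[of "skeleton_hit A" 1 "real n" x] False A by (simp add: add.commute)
  also have "... <= propagate 1 (skeleton_hit A) x" using Suc.IH False by (intro propagate_mono) auto
  also note 1
  finally show ?thesis .
 qed (simp add: 1)
qed simp

lemma skeleton_hit_ge_propagate:
 assumes A: "A \<in> sets borel" and n: "0 < n"
 shows "propagate (real n) (indicator A) x <= skeleton_hit A x"
proof -
 have "propagate (real n) (indicator A) x <= propagate (real n) (skeleton_hit A) x"
  using A by (intro propagate_mono) (auto simp: indicator_def skeleton_hit_inside)
 thus ?thesis using propagate_skeleton_hit_le[OF assms] order_trans by blast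
qed

text \<open>Stands in for restarting at the entrance into \<open>A\<close>, by induction over the
  number of steps. From \<open>x\<close> outside \<open>A\<close> the entrance happens after at
  least one step, hence with a density, and a bound for almost every point of \<open>A\<close> is
  sufficient.\<close>

lemma skeleton_hit_chain:
 assumes A: "A \<in> sets borel" and C: "C \<in> sets borel"
  and m: "AE z in lborel. z \<in> A --> m <= skeleton_hit C z" and x: "x \<notin> A"
 shows "m * skeleton_hit A x <= skeleton_hit C x"
proof -
 have *: "x \<notin> A ==> m * (\<Sum>i<n. taboo U A i x) <= skeleton_hit C x" for n x
 proof (induction n arbitrary: x)
  case (Suc n)
  have "m * (\<Sum>i<Suc n. taboo U A i x) = m * propagate 1 (\<lambda>z. \<Sum>i<n. taboo U A i z) x"
   unfolding taboo_partial_sum[OF A] using Suc.prems by simp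
  also have "... = propagate 1 (\<lambda>z. m * (\<Sum>i<n. taboo U A i z)) x" using A by (intro propagate_cmult[symmetric]) auto
  also have "... <= propagate 1 (skeleton_hit C) x"
  proof (rule propagate_mono)
   show "AE z in lborel. m * (\<Sum>i<n. taboo U A i z) <= skeleton_hit C z" using m
   proof eventually_elim
    case (elim z)
    show ?case
    proof (cases "z \<in> A")
     case True
     have "m * (\<Sum>i<n. taboo U A i z) <= m * 1" by (intro mult_left_mono taboo_partial_le_1 A) simp
     thus ?thesis using elim True by simp
    qed (rule Suc.IH)
   qed
  qed
  also have "... <= skeleton_hit C x" using propagate_skeleton_hit_le[OF C, of 1 x] by simp
  finally show ?case .
 qed simp
 have "m * skeleton_hit A x = (\<Sum>i. m * taboo U A i x)" unfolding skeleton_hit_def by simp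
 also have "... <= skeleton_hit C x" using *[OF x] by (intro suminf_le_const summableI) (simp add: sum_distrib_left[symmetric])
 finally show ?thesis .
qed

text \<open>\<open>c\<close> bounds minus the logarithm of the essential infimum of the hitting
  weight over a unit ball of starts. As a relation it makes sense before any finite cost is known to
  exist.\<close>

definition reach :: "'a => 'a => real => bool" where
 "reach x y c \<longleftrightarrow> (AE z in lborel. z \<in> cball x 1 --> ennreal (exp (- c)) <= skeleton_hit (cball y 1) z)"

lemma reach_mono: "reach x y c ==> c <= c' ==> reach x y c'"
 unfolding reach_def by (erule eventually_mono) (auto elim!: order_trans[rotated] intro!: ennreal_leI)

lemma reach_self: "0 <= c ==> reach x x c" unfolding reach_def by (auto simp: skeleton_hit_inside)

lemma reach_nonneg:
 assumes "reach x y c"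
 shows "0 <= c"
proof (rule ccontr)
 assume "\<not> 0 <= c"
 hence "1 < exp (- c)" by simp
 hence "ennreal 1 < ennreal (exp (- c))" by (intro ennreal_lessI) auto
 hence "\<not> ennreal (exp (- c)) <= skeleton_hit (cball y 1) z" for z using skeleton_hit_le_1[of "cball y 1" z] by (auto dest: order_trans)
 hence "AE z in lborel. z \<notin> cball x 1" using assms unfolding reach_def by simp
 hence "emeasure lborel (cball x 1) = 0" by (subst (asm) AE_iff_measurable[of "cball x 1"]) auto
 moreover have "0 < emeasure lborel (cball x 1)" by (simp add: emeasure_cball)
 ultimately show False by simp
qed

text \<open>Almost-everywhere bounds compose by the chain inequality. Starts in the unit ball at
  \<open>y\<close> are treated apart, since that inequality needs a start outside the intermediate
  set.\<close>

lemma reach_trans: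
 assumes 1: "reach x y c" and 2: "reach y z c'"
 shows "reach x z (c + c')" unfolding reach_def using 1[unfolded reach_def] 2[unfolded reach_def]
proof eventually_elim
 case (elim v)
 show ?case
 proof
  assume v: "v \<in> cball x 1"
  show "ennreal (exp (- (c + c'))) <= skeleton_hit (cball z 1) v"
  proof (cases "v \<in> cball y 1")
   case True
   have "ennreal (exp (- (c + c'))) <= ennreal (exp (- c'))" using reach_nonneg[OF 1] by (intro ennreal_leI) simp
   thus ?thesis using elim(2) True order_trans by blast
  next
   case False
   have "ennreal (exp (- (c + c'))) = ennreal (exp (- c')) * ennreal (exp (- c))"
    by (simp add: ennreal_mult[symmetric] exp_add[symmetric] add.commute)
   also have "... <= ennreal (exp (- c')) * skeleton_hit (cball y 1) v" using elim(1) v by (intro mult_left_mono) auto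
   also have "... <= skeleton_hit (cball z 1) v" using 2 False unfolding reach_def by (intro skeleton_hit_chain) auto
   finally show ?thesis .
  qed
 qed
qed

end

lemma power_le_exp:
 fixes x :: real
 assumes "0 <= x" "0 < m"
 shows "x ^ m <= real m ^ m * exp x"
proof -
 have "(x / real m) ^ m <= (1 + x / real m) ^ m" using assms by (intro power_mono) auto
 also have "... <= exp x" using assms by (intro exp_ge_one_plus_x_over_n_power_n) auto
 finally show ?thesis using assms by (simp add: power_divide field_simps)
qed

lemma ennreal_suminf_swap:
 fixes f :: "nat => nat => ennreal"
 shows "(\<Sum>n. \<Sum>k. f n k) = (\<Sum>k. \<Sum>n. f n k)"
proof -
 have "(\<Sum>n. \<Sum>k. f n k) = (\<integral>\<^sup>+n. (\<Sum>k. f n k) \<partial>count_space UNIV)" by (simp add: nn_integral_count_space_nat)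
 also have "... = (\<Sum>k. \<integral>\<^sup>+n. f n k \<partial>count_space UNIV)" by (rule nn_integral_suminf) simp
 finally show ?thesis by (simp add: nn_integral_count_space_nat)
qed

text \<open>A lower bound for the weight of landing in a unit ball at time \<open>t\<close> from at
  most distance \<open>D\<close>, without potential; the division by 2 is the probability of
  confinement.\<close>

definition ball_factor :: "'a::euclidean_space itself => real => real => real" where
 "ball_factor _ t D = (2 * pi * t) powr (- real DIM('a) / 2) * exp (- D\<^sup>2 / (2 * t)) / 2 * unit_ball_vol (real DIM('a))"

lemma ball_factor_pos: "0 < t ==> 0 < ball_factor TYPE('a::euclidean_space) t D" by (simp add: ball_factor_def)

section \<open>Costs of single steps and change of the starting point\<close>

context standard_brownian_motion
begin

definition confinement_radius :: "real => real" where
 "confinement_radius T = (SOME \<rho>. 0 < \<rho> \<and> (\<forall>U \<Lambda> x0 r t x y. 0 < t --> t <= T --> 0 <= \<Lambda> --> x \<in> cball x0 r --> y \<in> cball x0 r -->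
  (\<forall>z\<in>cball x0 (r + \<rho>). U z <= \<Lambda>) --> ennreal (heat_kernel t x y * exp (- (t * \<Lambda>)) / 2) <= bridge_kernel U t x y))"

lemma confinement_radius:
 assumes "0 < T"
 shows "0 < confinement_radius T"
  and "\<And>U \<Lambda> x0 r t x y. 0 < t ==> t <= T ==> 0 <= \<Lambda> ==> x \<in> cball x0 r ==> y \<in> cball x0 r ==>
  (\<And>z. z \<in> cball x0 (r + confinement_radius T) ==> U z <= \<Lambda>) ==>
  ennreal (heat_kernel t x y * exp (- (t * \<Lambda>)) / 2) <= bridge_kernel U t x y"
 using someI_ex[OF bridge_kernel_lower[OF assms, simplified Bex_def]] unfolding confinement_radius_def by blast+

text \<open>A start in the unit ball at \<open>x\<close> and a landing point in the unit ball at
  \<open>y\<close> with \<open>dist x y <= 1\<close> are at distance at most 1 + 2 = 3. Truncation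
  at 0 makes it a usable cost.\<close>

definition step_cost :: real where
 "step_cost = max 0 (- ln (ball_factor TYPE('a) 1 3))"

definition step_radius :: real where
 "step_radius = 2 + confinement_radius 2"

end

context bm_environment
begin

lemma propagate_ball_ge:
 assumes t: "0 < t" "t <= T" and \<Lambda>: "0 <= \<Lambda>" "\<And>z. z \<in> cball x0 (r + confinement_radius T) ==> U z <= \<Lambda>"
  and r: "x \<in> cball x0 r" "cball y 1 \<subseteq> cball x0 r" and D: "\<And>z. z \<in> cball y 1 ==> norm (x - z) <= D"
 shows "ennreal (ball_factor TYPE('a) t D * exp (- (t * \<Lambda>))) <= propagate t (indicator (cball y 1)) x"
proof -
 let ?k = "(2 * pi * t) powr (- real DIM('a) / 2) * exp (- D\<^sup>2 / (2 * t)) * exp (- (t * \<Lambda>)) / 2"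
 have "ennreal (ball_factor TYPE('a) t D * exp (- (t * \<Lambda>))) = ennreal ?k * emeasure lborel (cball y 1)"
  by (simp add: emeasure_cball ball_factor_def ennreal_mult[symmetric] mult_ac)
 also have "... = (\<L> z. ennreal ?k * indicator (cball y 1) z)" by (simp add: nn_integral_cmult_indicator)
 also have "... <= propagate t (indicator (cball y 1)) x" unfolding propagate_def
 proof (intro nn_integral_mono)
  fix z
  show "ennreal ?k * indicator (cball y 1) z <= bridge_kernel U t x z * indicator (cball y 1) z"
  proof (cases "z \<in> cball y 1")
   case True
   have "norm (x - z) <= D" using D True by blast
   hence "(norm (x - z))\<^sup>2 / (2 * t) <= D\<^sup>2 / (2 * t)" using t by (intro divide_right_mono power_mono) auto
   hence "?k <= heat_kernel t x z * exp (- (t * \<Lambda>)) / 2"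
    unfolding heat_kernel_def by (intro divide_right_mono mult_right_mono mult_left_mono) auto
   hence "ennreal ?k <= ennreal (heat_kernel t x z * exp (- (t * \<Lambda>)) / 2)" by (rule ennreal_leI)
   also have "... <= bridge_kernel U t x z" by (rule confinement_radius(2)[OF _ t \<Lambda>(1) r(1) _ \<Lambda>(2)]) (use t r True in auto)
   finally show ?thesis using True by simp
  qed simp
 qed
 finally show ?thesis .
qed

lemma propagate_step_ge:
 assumes \<Lambda>: "0 <= \<Lambda>" "\<And>z. z \<in> cball x step_radius ==> U z <= \<Lambda>" and y: "dist x y <= 1" and v: "v \<in> cball x 1"
 shows "ennreal (exp (- (step_cost + \<Lambda>))) <= propagate 1 (indicator (cball y 1)) v"
proof -
 have cy: "cball y 1 \<subseteq> cball x 2"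
 proof
  fix z assume "z \<in> cball y 1"
  thus "z \<in> cball x 2" using y dist_triangle[of x z y] by (simp add: dist_commute)
 qed
 have "exp (- step_cost) <= ball_factor TYPE('a) 1 3" using ball_factor_pos[of 1, where 'a='a] unfolding step_cost_def
  by (smt (verit) exp_ln exp_le_cancel_iff)
 hence "exp (- (step_cost + \<Lambda>)) <= ball_factor TYPE('a) 1 3 * exp (- (1 * \<Lambda>))"
  using mult_right_mono[of "exp (- step_cost)" _ "exp (- \<Lambda>)"] by (simp add: exp_add[symmetric])
 hence "ennreal (exp (- (step_cost + \<Lambda>))) <= ennreal (ball_factor TYPE('a) 1 3 * exp (- (1 * \<Lambda>)))" by (rule ennreal_leI)
 also have "... <= propagate 1 (indicator (cball y 1)) v"
 proof (rule propagate_ball_ge[where T=2 and r=2 and ?x0.0=x])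
  show "v \<in> cball x 2" using v by simp
  show "norm (v - z) <= 3" if "z \<in> cball y 1" for z using cy that v dist_triangle[of v z x] by (auto simp: dist_norm[symmetric] dist_commute)
 qed (use cy \<Lambda> in \<open>auto simp: step_radius_def\<close>)
 finally show ?thesis .
qed

lemma reach_step:
 assumes "0 <= \<Lambda>" "\<And>z. z \<in> cball x step_radius ==> U z <= \<Lambda>" "dist x y <= 1"
 shows "reach x y (step_cost + \<Lambda>)" unfolding reach_def
 using order_trans[OF propagate_step_ge[OF assms] skeleton_hit_ge_propagate[of "cball y 1" 1, simplified]] by auto

text \<open>\<open>reach\<close> says nothing about an individual start such as \<open>x\<close>.
  One initial step into the unit ball spreads the start over a set where the almost-everywhere bound
  applies.\<close>

lemma skeleton_hit_ge_reach:
 assumes "0 <= \<Lambda>" "\<And>z. z \<in> cball x step_radius ==> U z <= \<Lambda>" and b: "reach x y b"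
 shows "ennreal (exp (- (b + step_cost + \<Lambda>))) <= skeleton_hit (cball y 1) x"
proof -
 have "ennreal (exp (- (b + step_cost + \<Lambda>))) = ennreal (exp (- b)) * ennreal (exp (- (step_cost + \<Lambda>)))"
  by (simp add: ennreal_mult[symmetric] exp_add[symmetric])
 also have "... <= ennreal (exp (- b)) * propagate 1 (indicator (cball x 1)) x" by (intro mult_left_mono propagate_step_ge assms) auto
 also have "... = propagate 1 (\<lambda>z. ennreal (exp (- b)) * indicator (cball x 1) z) x"
  by (rule propagate_cmult[symmetric]) (auto intro!: borel_measurable_indicator)
 also have "... <= propagate 1 (skeleton_hit (cball y 1)) x"
  by (rule propagate_mono) (use b[unfolded reach_def] in \<open>auto elim!: eventually_mono simp: indicator_def\<close>)
 also have "... <= skeleton_hit (cball y 1) x" using propagate_skeleton_hit_le[of "cball y 1" 1 x] by simp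
 finally show ?thesis .
qed

lemma heat_kernel_tail:
 assumes "0 <= r"
 shows "(\<L> z. ennreal (heat_kernel 1 0 z) * indicator {z :: 'a. r < norm z} z) <= ennreal (2 powr (real DIM('a) / 2) * exp (- r\<^sup>2 / 4))"
proof -
 have [measurable]: "(\<lambda>w. B 1 w - B 0 w) \<in> borel_measurable W" by (intro borel_measurable_diff bm_measurable) auto
 have E: "{w \<in> space W. r < norm (B 1 w - B 0 w)} \<in> sets W" by measurable
 have "(\<L> z. ennreal (heat_kernel 1 0 z) * indicator {z :: 'a. r < norm z} z) = (\<E> w. indicator {z. r < norm z} (B 1 w - B 0 w))"
  using distributed_nn_integral[OF bm_gaussian[of 0 1], of "\<lambda>z. indicator {z. r < norm z} z"] by simp
 also have "... = (\<E> w. indicator {w \<in> space W. r < norm (B 1 w - B 0 w)} w)" by (rule nn_integral_cong) (simp add: indicator_def)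
 also have "... = emeasure W {w \<in> space W. r < norm (B 1 w - B 0 w)}" using E by simp
 also have "... <= ennreal (2 powr (real DIM('a) / 2) * exp (- r\<^sup>2 / (4 * (1 - 0))))" by (rule increment_tail) (use assms in auto)
 finally show ?thesis by simp
qed

text \<open>A start point can be moved within a unit ball: the walk is compared after one step from the old start and
 two steps from the new one, up to distance \<open>r\<close>, beyond which the Gaussian tail is negligible.\<close>

lemma reach_of_skeleton_hit:
 fixes c :: real
 defines "d \<equiv> real DIM('a)"
 defines "r \<equiv> sqrt (8 * (c + d + 2))"
 assumes c: "0 <= c" "ennreal (exp (- c)) <= skeleton_hit (cball y 1) 0" and y: "2 < norm y"
  and \<Lambda>: "0 <= \<Lambda>" "\<And>z. z \<in> cball 0 (r + confinement_radius 2) ==> U z <= \<Lambda>"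
 shows "reach 0 y (c + (d + 2) + 2 * \<Lambda>)"
proof -
 let ?h = "skeleton_hit (cball y 1)" and ?q = "\<lambda>z::'a. ennreal (heat_kernel 1 0 z)"
 have d1: "1 <= d" unfolding d_def using DIM_positive[where 'a='a] by simp
 have r2: "r\<^sup>2 = 8 * (c + d + 2)" using c d1 by (simp add: r_def)
 have r1: "1 <= r" using c d1 unfolding r_def by (simp add: real_le_rsqrt)
 have l2: "ln 2 <= (1::real)" using ln_le_minus_one[of 2] by simp
 define I where "I = (\<L> z. ?q z * (?h z * indicator {z. norm z <= r} z))"
 have "0 \<notin> cball y 1" using y by simp
 have "ennreal (exp (- c)) <= propagate 1 ?h 0" using c(2) skeleton_hit_outside[OF _ \<open>0 \<notin> cball y 1\<close>] by simp
 also have "... <= (\<L> z. ?q z * (?h z * indicator {z. norm z <= r} z) + ?q z * indicator {z. r < norm z} z)" unfolding propagate_def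
 proof (intro nn_integral_mono)
  fix z
  show "bridge_kernel U 1 0 z * ?h z <= ?q z * (?h z * indicator {z. norm z <= r} z) + ?q z * indicator {z. r < norm z} z"
  proof (cases "norm z <= r")
   case True
   thus ?thesis using mult_right_mono[OF bridge_kernel_le[of U 1 0 z]] by simp
  next
   case False
   have "bridge_kernel U 1 0 z * ?h z <= ?q z * 1" by (intro mult_mono bridge_kernel_le skeleton_hit_le_1) auto
   thus ?thesis using False by simp
  qed
 qed
 also have "... = I + (\<L> z. ?q z * indicator {z. r < norm z} z)" unfolding I_def by (rule nn_integral_add) measurable
 also have "... <= I + ennreal (2 powr (d / 2) * exp (- r\<^sup>2 / 4))" unfolding d_def using r1 by (intro add_left_mono heat_kernel_tail) simp
 \<comment> \<open>\<open>r\<close> is chosen with \<open>r^2 = 8 * (c + d + 2)\<close> exactly so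
   that the part beyond \<open>r\<close> accounts for at most half of
   \<open>exp (- c)\<close>.\<close>
 also have "2 powr (d / 2) * exp (- r\<^sup>2 / 4) <= exp (- c) / 2"
 proof -
  have "2 powr (d / 2) * exp (- r\<^sup>2 / 4) = exp (d / 2 * ln 2 - 2 * (c + d + 2))"
  proof -
   have "- r\<^sup>2 / 4 = - 2 * (c + d + 2)" unfolding r2 by simp
   thus ?thesis by (simp add: powr_def exp_add[symmetric])
  qed
  also have "... <= exp (- c - ln 2)"
  proof -
   have "d / 2 * ln 2 <= d / 2 * 1" using d1 l2 by (intro mult_left_mono) auto
   hence "d / 2 * ln 2 - 2 * (c + d + 2) <= - c - ln 2" using c(1) d1 l2 by argo
   thus ?thesis by (simp only: exp_le_cancel_iff)
  qed
  also have "... = exp (- c) / 2" by (simp add: exp_diff)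
  finally show ?thesis .
 qed
 finally have 1: "ennreal (exp (- c)) <= I + ennreal (exp (- c) / 2)" by (simp add: add_left_mono ennreal_leI)
 have I: "ennreal (exp (- c) / 2) <= I"
 proof (cases I)
  case (real i)
  hence "exp (- c) <= i + exp (- c) / 2" using 1 by (simp add: ennreal_plus[symmetric] del: ennreal_plus)
  thus ?thesis using real by (simp add: ennreal_leI)
 qed simp
 have main: "ennreal (exp (- (c + (d + 2) + 2 * \<Lambda>))) <= ?h x" if x: "x \<in> cball 0 1" for x
 proof -
  let ?k = "2 powr (- d / 2) * exp (- 1 / 2) * exp (- (2 * \<Lambda>)) / 2"
  \<comment> \<open>Doubling the time halves the Gaussian exponent, and
    \<open>(1 + norm z)^2 <= 2 + 2 * (norm z)^2\<close> makes up for the displacement of the start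
    by at most 1.\<close>
  have key: "ennreal ?k * ?q z <= bridge_kernel U 2 x z" if z: "norm z <= r" for z
  proof -
   have "norm (x - z) <= 1 + norm z" using x norm_triangle_ineq4[of x z] by simp
   hence "(norm (x - z))\<^sup>2 <= (1 + norm z)\<^sup>2" by (intro power_mono) auto
   also have "... <= 2 + 2 * (norm z)\<^sup>2" using sum_squares_bound[of 1 "norm z"] by (simp add: power2_sum)
   finally have e: "- (norm z)\<^sup>2 / 2 - 1 / 2 <= - (norm (x - z))\<^sup>2 / 4" by simp
   have "?k * heat_kernel 1 0 z = (2 powr (- d / 2) * (2 * pi) powr (- d / 2)) * exp (- (norm z)\<^sup>2 / 2 - 1 / 2) * exp (- (2 * \<Lambda>)) / 2"
   proof -
    have "exp (- 1 / 2) * exp (- (norm z)\<^sup>2 / (2 * 1)) = exp (- (norm z)\<^sup>2 / 2 - 1 / 2)" unfolding exp_add[symmetric] by simp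
    moreover have "?k * heat_kernel 1 0 z = (2 powr (- d / 2) * (2 * pi) powr (- d / 2)) *
      (exp (- 1 / 2) * exp (- (norm z)\<^sup>2 / (2 * 1))) * exp (- (2 * \<Lambda>)) / 2" unfolding heat_kernel_def d_def by simp
    ultimately show ?thesis by (simp only:)
   qed
   also have "... <= (2 powr (- d / 2) * (2 * pi) powr (- d / 2)) * exp (- (norm (x - z))\<^sup>2 / 4) * exp (- (2 * \<Lambda>)) / 2"
    using e by (intro divide_right_mono mult_right_mono mult_left_mono) auto
   also have "2 powr (- d / 2) * (2 * pi) powr (- d / 2) = (2 * pi * 2) powr (- d / 2)"
    using powr_mult[of "2 * pi" 2 "- d / 2"] by (simp only: mult.commute)
   also have "(2 * pi * 2) powr (- d / 2) * exp (- (norm (x - z))\<^sup>2 / 4) = heat_kernel 2 x z" unfolding heat_kernel_def d_def by simp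
   finally have "ennreal (?k * heat_kernel 1 0 z) <= ennreal (heat_kernel 2 x z * exp (- (2 * \<Lambda>)) / 2)" by (rule ennreal_leI)
   also have "... <= bridge_kernel U 2 x z" by (rule confinement_radius(2)[where T=2 and ?x0.0=0 and r=r]) (use \<Lambda> x z r1 in auto)
   finally show ?thesis by (simp add: ennreal_mult[symmetric])
  qed
  have "exp (- (c + (d + 2) + 2 * \<Lambda>)) <= ?k * (exp (- c) / 2)"
  proof -
   have "?k * (exp (- c) / 2) = exp (- d / 2 * ln 2 - 1 / 2 - 2 * \<Lambda> - c - 2 * ln 2)"
   proof -
    have e2: "exp (- (2 * ln 2)) = (1 / 4 :: real)" unfolding exp_minus exp_double by simp
    have "?k * (exp (- c) / 2) = exp (- d / 2 * ln 2) * exp (- 1 / 2) * exp (- (2 * \<Lambda>)) * exp (- c) * (1 / 4)" by (simp add: powr_def)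
    thus ?thesis unfolding e2[symmetric] exp_add[symmetric] by (simp add: algebra_simps)
   qed
   moreover have "d / 2 * ln 2 <= d / 2 * 1" using d1 l2 by (intro mult_left_mono) auto
   hence "- (c + (d + 2) + 2 * \<Lambda>) <= - d / 2 * ln 2 - 1 / 2 - 2 * \<Lambda> - c - 2 * ln 2" using d1 l2 by argo
   ultimately show ?thesis by simp
  qed
  hence "ennreal (exp (- (c + (d + 2) + 2 * \<Lambda>))) <= ennreal ?k * ennreal (exp (- c) / 2)"
   by (simp add: ennreal_mult[symmetric] ennreal_leI)
  also have "... <= ennreal ?k * I" by (intro mult_left_mono I) simp
  also have "... = (\<L> z. ennreal ?k * (?q z * (?h z * indicator {z. norm z <= r} z)))"
   unfolding I_def by (rule nn_integral_cmult[symmetric]) measurable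
  also have "... <= propagate 2 ?h x" unfolding propagate_def
  proof (intro nn_integral_mono)
   fix z
   show "ennreal ?k * (?q z * (?h z * indicator {z. norm z <= r} z)) <= bridge_kernel U 2 x z * ?h z"
    using mult_right_mono[OF key, of z "?h z"] by (cases "norm z <= r") (auto simp: mult.assoc)
  qed
  also have "... <= ?h x" using propagate_skeleton_hit_le[of "cball y 1" 2 x] by simp
  finally show ?thesis .
 qed
 thus ?thesis unfolding reach_def by simp
qed

end

lemma sum_lessThan_add:
 fixes f :: "nat => 'b::comm_monoid_add"
 shows "(\<Sum>n<m + k. f n) = (\<Sum>n<m. f n) + (\<Sum>n<k. f (m + n))" by (induction k) (simp_all add: add.assoc)

section \<open>The Green function of the skeleton and the effect of traps\<close>

context bm_environment
begin

text \<open>Time 0 has to be the identity, whereas \<open>propagate 0\<close> is the zero operator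
  because \<open>0 powr a = 0\<close>.\<close>

definition iterate :: "nat => ('a => ennreal) => 'a => ennreal" where
 "iterate n f = (if n = 0 then f else propagate (real n) f)"

lemma measurable_iterate [measurable (raw)]: "f \<in> borel_measurable borel ==> iterate n f \<in> borel_measurable borel"
 unfolding iterate_def by (auto intro: measurable_propagate)

lemma iterate_add:
 assumes "f \<in> borel_measurable borel"
 shows "iterate (m + n) f x = iterate m (iterate n f) x" using propagate_semigroup[of f "real m" "real n" x] assms by (auto simp: iterate_def)

lemma iterate_one: "f \<in> borel_measurable borel ==> iterate 1 (iterate n f) x = iterate (Suc n) f x" using iterate_add[of f 1 n x] by simp

lemma iterate_mono: "(\<And>z. f z <= g z) ==> iterate n f x <= iterate n g x" unfolding iterate_def by (auto intro!: propagate_mono)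

lemma iterate_cmult:
 assumes "f \<in> borel_measurable borel"
 shows "iterate n (\<lambda>z. c * f z) x = c * iterate n f x" using assms unfolding iterate_def by (auto simp: propagate_cmult)

lemma iterate_sum:
 assumes "\<And>i. f i \<in> borel_measurable borel"
 shows "iterate n (\<lambda>z. \<Sum>i\<in>I. f i z) x = (\<Sum>i\<in>I. iterate n (f i) x)"
 using assms unfolding iterate_def by (auto simp: propagate_sum)

lemma iterate_suminf:
 assumes "\<And>i. f i \<in> borel_measurable borel"
 shows "iterate n (\<lambda>z. \<Sum>i. f i z) x = (\<Sum>i. iterate n (f i) x)" using assms unfolding iterate_def by (auto simp: propagate_suminf)

lemma iterate_le_const: "(\<And>z. f z <= c) ==> iterate n f x <= c" unfolding iterate_def by (auto intro!: propagate_le_const)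

text \<open>A first visit is one of all visits.\<close>

lemma skeleton_hit_le_green:
 assumes A: "A \<in> sets borel"
 shows "skeleton_hit A x <= (\<Sum>n. iterate n (indicator A) x)"
proof -
 have m [measurable]: "indicator A \<in> borel_measurable borel" using A by (rule borel_measurable_indicator)
 have "(\<Sum>i<n. taboo U A i x) <= (\<Sum>i<n. iterate i (indicator A) x)" for n x
 proof (induction n arbitrary: x)
  case (Suc n)
  have "(\<Sum>i<Suc n. taboo U A i x) <= indicator A x + iterate 1 (\<lambda>z. \<Sum>i<n. taboo U A i z) x"
   unfolding taboo_partial_sum[OF A] iterate_def by (intro add_left_mono) (auto simp: indicator_def)
  also have "... <= indicator A x + iterate 1 (\<lambda>z. \<Sum>i<n. iterate i (indicator A) z) x" by (intro add_left_mono iterate_mono Suc.IH)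
  also have "iterate 1 (\<lambda>z. \<Sum>i<n. iterate i (indicator A) z) x = (\<Sum>i<n. iterate (Suc i) (indicator A) x)"
   by (subst iterate_sum) (simp_all only: iterate_one[OF m] measurable_iterate[OF m])
  finally show ?case by (simp add: sum.lessThan_Suc_shift iterate_def del: sum.lessThan_Suc)
 qed simp
 note partial = this
 have "(\<Sum>i<n. taboo U A i x) <= (\<Sum>n. iterate n (indicator A) x)" for n
 proof (rule order_trans[OF partial])
  show "(\<Sum>i<n. iterate i (indicator A) x) <= (\<Sum>n. iterate n (indicator A) x)"
   by (rule sum_le_suminf) (rule summableI, rule finite_lessThan, rule zero_le)
 qed
 thus ?thesis unfolding skeleton_hit_def by (intro suminf_le_const summableI)
qed

text \<open>Every visit to \<open>A\<close> starts a block of \<open>T\<close> steps that is survived with weight at most \<open>1 - \<delta>\<close>, so the number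
 of visits is dominated by a geometric series of blocks.\<close>

lemma green_le_skeleton_hit:
 assumes A: "A \<in> sets borel" and T: "0 < T" and \<delta>: "0 < \<delta>"
  and loss: "\<And>z. z \<in> A ==> propagate (real T) (\<lambda>_. 1) z + ennreal \<delta> <= 1"
 shows "(\<Sum>n. iterate n (indicator A) x) <= ennreal (real T / \<delta>) * skeleton_hit A x"
proof -
 have m [measurable]: "indicator A \<in> borel_measurable borel" using A by (rule borel_measurable_indicator)
 define G where "G N x = (\<Sum>n<N. iterate n (indicator A) x)" for N x
 have Gm: "G N \<in> borel_measurable borel" for N unfolding G_def by measurable
 have G_Suc: "G (Suc N) x = indicator A x + propagate 1 (G N) x" for N x
 proof -
  have "propagate 1 (G N) x = iterate 1 (G N) x" by (simp add: iterate_def)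
  also have "... = (\<Sum>n<N. iterate (Suc n) (indicator A) x)"
   unfolding G_def by (subst iterate_sum) (simp_all only: iterate_one[OF m] measurable_iterate[OF m])
  finally show ?thesis unfolding G_def by (simp add: sum.lessThan_Suc_shift iterate_def del: sum.lessThan_Suc)
 qed
 have GN: "G N x <= of_nat N" for N x
 proof -
  have "G N x <= (\<Sum>n<N. 1)" unfolding G_def by (intro sum_mono iterate_le_const) (auto simp: indicator_def)
  thus ?thesis by simp
 qed
 have Gmono: "G i x <= G j x" if "i <= j" for i j x unfolding G_def using that by (intro sum_mono2) auto
 have bound: "G N z <= ennreal (real T / \<delta>)" if "z \<in> A" for N z
 proof -
  \<comment> \<open>Only the first \<open>N\<close> times are counted, so \<open>s\<close> is finite
    and can be cancelled later; the final bound does not depend on \<open>N\<close>.\<close>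
  define s where "s = (SUP z\<in>A. G N z)"
  have "s <= of_nat N" unfolding s_def by (intro SUP_least GN)
  then obtain s' where s': "s = ennreal s'" "0 <= s'" by (cases s) (auto simp: top_unique)
  \<comment> \<open>Maximum principle: nothing is counted before the first visit to
    \<open>A\<close>, and from there on at most \<open>s\<close>.\<close>
  have hit: "G j x <= s * skeleton_hit A x" if "j <= N" for j x using that
  proof (induction j arbitrary: x)
   case (Suc j)
   show ?case
   proof (cases "x \<in> A")
    case True
    have "G (Suc j) x <= G N x" by (rule Gmono) fact
    also have "... <= s" unfolding s_def by (intro SUP_upper True)
    finally show ?thesis by (simp add: skeleton_hit_inside A True)
   next
    case False
    have "G (Suc j) x = propagate 1 (G j) x" using False by (simp add: G_Suc)
    also have "... <= propagate 1 (\<lambda>z. s * skeleton_hit A z) x" using Suc by (intro propagate_mono) auto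
    also have "... = s * propagate 1 (skeleton_hit A) x" using A by (intro propagate_cmult) auto
    finally show ?thesis by (simp add: skeleton_hit_outside A False)
   qed
  qed (simp add: G_def)
  have "G N z <= ennreal (real T + s' - s' * \<delta>)" if z: "z \<in> A" for z
  proof -
   \<comment> \<open>The first \<open>T\<close> steps count at most \<open>T\<close> visits;
     whatever comes later carries the loss \<open>\<delta>\<close>. This gives
     \<open>s * \<delta> <= T\<close>.\<close>
   have "G N z <= G (T + N) z" by (rule Gmono) simp
   also have "... = G T z + (\<Sum>n<N. iterate (T + n) (indicator A) z)" unfolding G_def by (rule sum_lessThan_add)
   also have "... = G T z + iterate T (G N) z"
   proof -
    have "iterate T (G N) z = (\<Sum>n<N. iterate T (iterate n (indicator A)) z)"
     unfolding G_def by (rule iterate_sum) (rule measurable_iterate[OF m])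
    thus ?thesis by (simp only: iterate_add[OF m])
   qed
   also have "... <= of_nat T + iterate T (\<lambda>_. s * 1) z"
   proof (intro add_mono GN iterate_mono)
    fix x
    have "G N x <= s * skeleton_hit A x" by (rule hit) simp
    also have "... <= s * 1" by (intro mult_left_mono skeleton_hit_le_1 A) simp
    finally show "G N x <= s * 1" .
   qed
   also have "iterate T (\<lambda>_. s * 1) z = s * propagate (real T) (\<lambda>_. 1) z" using T by (subst iterate_cmult) (auto simp: iterate_def)
   finally have "G N z + s * ennreal \<delta> <= of_nat T + s * propagate (real T) (\<lambda>_. 1) z + s * ennreal \<delta>" by (rule add_right_mono)
   also have "... = of_nat T + s * (propagate (real T) (\<lambda>_. 1) z + ennreal \<delta>)" by (simp add: distrib_left add.assoc)
   also have "... <= of_nat T + s * 1" by (intro add_left_mono mult_left_mono loss z) simp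
   finally have 1: "G N z + ennreal (s' * \<delta>) <= ennreal (real T + s')"
    using s' \<delta> by (simp add: ennreal_mult ennreal_of_nat_eq_real_of_nat)
   obtain g where g: "G N z = ennreal g" "0 <= g" using GN[of N z] by (cases "G N z") (auto simp: top_unique)
   have "g + s' * \<delta> <= real T + s'" using 1 s' \<delta> g by (simp add: ennreal_plus[symmetric] del: ennreal_plus)
   thus ?thesis unfolding g by (intro ennreal_leI) simp
  qed note each = this
  have "s <= ennreal (real T + s' - s' * \<delta>)" unfolding s_def by (intro SUP_least each)
  moreover have "0 <= real T + s' - s' * \<delta>"
  proof -
   have "ennreal \<delta> <= 1" using loss[OF that] by (metis add_increasing zero_le order_trans order_refl)
   hence "\<delta> <= 1" by simp
   hence "s' * \<delta> <= s' * 1" using s' by (intro mult_left_mono)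
   thus ?thesis by simp
  qed
  ultimately have "s' * \<delta> <= real T" using s' by simp
  hence "s' <= real T / \<delta>" using \<delta> by (simp add: field_simps)
  moreover have "G N z <= s" unfolding s_def by (intro SUP_upper that)
  ultimately show ?thesis using s' by (simp add: ennreal_leI order_trans)
 qed
 have "G N x <= ennreal (real T / \<delta>) * skeleton_hit A x" for N x
 proof (induction N arbitrary: x)
  case (Suc N)
  show ?case
  proof (cases "x \<in> A")
   case True
   thus ?thesis using bound[OF True, of "Suc N"] by (simp add: skeleton_hit_inside A)
  next
   case False
   have "G (Suc N) x = propagate 1 (G N) x" using False by (simp add: G_Suc)
   also have "... <= propagate 1 (\<lambda>z. ennreal (real T / \<delta>) * skeleton_hit A z) x" using Suc by (intro propagate_mono) auto
   also have "... = ennreal (real T / \<delta>) * propagate 1 (skeleton_hit A) x" using A by (intro propagate_cmult) auto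
   finally show ?thesis by (simp add: skeleton_hit_outside A False)
  qed
 qed (simp add: G_def)
 thus ?thesis unfolding G_def by (intro suminf_le_const summableI)
qed

end

lemma le_suminf_ennreal: "f j <= (\<Sum>n. f n :: ennreal)" using sum_le_suminf[OF summableI, of "{j}" f] by simp

lemma summable_gaussian_exp:
 fixes a :: real
 assumes "0 < a"
 shows "summable (\<lambda>j. exp (- (a * (real j)\<^sup>2) + real j))"
proof (rule summable_comparison_test')
 show "summable (\<lambda>j. exp (1 / a) * exp (- 1) ^ j :: real)" by (intro summable_mult summable_geometric) simp
 fix j :: nat assume "0 <= j"
 have "0 <= a * (real j - 1 / a)\<^sup>2" using assms by simp
 hence "- (a * (real j)\<^sup>2) + 2 * real j <= 1 / a"
  using assms by (simp add: power2_diff power_divide algebra_simps) (simp add: power2_eq_square)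
 hence "exp (- (a * (real j)\<^sup>2) + real j) <= exp (1 / a + real j * (- 1))" by simp
 also have "... = exp (1 / a) * exp (- 1) ^ j" by (simp only: exp_add exp_of_nat_mult)
 finally show "norm (exp (- (a * (real j)\<^sup>2) + real j)) <= exp (1 / a) * exp (- 1) ^ j" by simp
qed

context bm_environment
begin

text \<open>With a waiting time comparable to the distance of the trap, the Gaussian exponent
  \<open>D^2 / T\<close> is only linear in \<open>D\<close>; half of \<open>exp D\<close> pays for
  it and the other half for the powers of \<open>T\<close>.\<close>

lemma loss_ratio_bound:
 fixes D \<epsilon> :: real and T :: nat
 defines "m \<equiv> DIM('a) + 1"
 defines "\<delta> \<equiv> (1 - exp (- \<epsilon>)) * (\<epsilon> * ((2 * pi * real T) powr (- real DIM('a) / 2) * exp (- (D\<^sup>2 / (2 * (real T - 1))))))"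
 assumes \<epsilon>: "0 < \<epsilon>" and D: "0 <= D" and T: "D + 2 <= real T" "real T <= D + 3"
 shows "0 < \<delta>" "real T / \<delta> <= (real m ^ m * (4 * pi) ^ m * exp (3 / 2) / ((1 - exp (- \<epsilon>)) * \<epsilon>)) * exp D"
proof -
 have T2: "2 <= real T" using T D by simp
 let ?x = "2 * pi * real T" and ?d = "real DIM('a) / 2" and ?g = "(1 - exp (- \<epsilon>)) * \<epsilon>"
 have x1: "1 <= ?x" using T2 pi_gt3 mult_mono[of 1 "2 * pi" 1 "real T"] by simp
 have x0: "0 < ?x" using x1 by linarith
 have g: "0 < ?g" using \<epsilon> by simp
 show \<delta>: "0 < \<delta>" unfolding \<delta>_def using \<epsilon> x0 T2 by (intro mult_pos_pos) auto
 have "D\<^sup>2 / (2 * (real T - 1)) <= D / 2"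
 proof -
  have "D * D <= D * (real T - 1)" using D T by (intro mult_left_mono) auto
  thus ?thesis using T2 by (simp add: field_simps power2_eq_square)
 qed
 hence e1: "exp (D\<^sup>2 / (2 * (real T - 1))) <= exp (D / 2)" by simp
 have "real T / \<delta> = real T * (?x powr ?d * exp (D\<^sup>2 / (2 * (real T - 1)))) / ?g"
 proof -
  have 1: "?x powr (- real DIM('a) / 2) = 1 / (?x powr ?d)" by (simp only: powr_minus_divide minus_divide_left[symmetric])
  have 2: "exp (- (D\<^sup>2 / (2 * (real T - 1)))) = 1 / exp (D\<^sup>2 / (2 * (real T - 1)))" by (simp only: exp_minus inverse_eq_divide)
  have "t / (a * (e * ((1 / p) * (1 / q)))) = t * (p * q) / (a * e)" for t a e p q :: real by simp
  thus ?thesis unfolding \<delta>_def 1 2 .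
 qed
 also have "... <= ?x * (?x ^ DIM('a) * exp (D / 2)) / ?g"
 proof (intro divide_right_mono mult_mono e1)
  show "real T <= ?x" using T2 pi_gt3 mult_right_mono[of 1 "2 * pi" "real T"] by simp
  have "?x powr ?d <= ?x powr (real DIM('a))" using x1 by (intro powr_mono) auto
  thus "?x powr ?d <= ?x ^ DIM('a)" using x0 by (simp add: powr_realpow)
 qed (use g in auto)
 also have "?x * (?x ^ DIM('a) * exp (D / 2)) = (4 * pi) ^ m * (real T / 2) ^ m * exp (D / 2)"
 proof -
  have "?x * (?x ^ DIM('a) * exp (D / 2)) = ?x ^ m * exp (D / 2)" unfolding m_def by (simp only: power_add power_one_right mult_ac)
  moreover have "?x ^ m = (4 * pi) ^ m * (real T / 2) ^ m" 
  proof -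
   have "?x = (4 * pi) * (real T / 2)" by simp
   thus ?thesis by (metis power_mult_distrib)
  qed
  ultimately show ?thesis by (simp only:)
 qed
 also have "... <= (4 * pi) ^ m * (real m ^ m * exp (real T / 2)) * exp (D / 2)"
  by (intro mult_right_mono mult_left_mono power_le_exp) (auto simp: m_def)
 also have "exp (real T / 2) <= exp (3 / 2) * exp (D / 2)" using T by (simp add: exp_add[symmetric])
 also have "(4 * pi) ^ m * (real m ^ m * (exp (3 / 2) * exp (D / 2))) * exp (D / 2) = real m ^ m * (4 * pi) ^ m * exp (3 / 2) * exp D"
  by (simp add: exp_add[symmetric])
 finally show "real T / \<delta> <= (real m ^ m * (4 * pi) ^ m * exp (3 / 2) / ?g) * exp D"
  using g by (simp add: divide_right_mono mult_left_mono mult_right_mono)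
qed

text \<open>From the ball of radius \<open>r\<close> the centre ball is reached within
  \<open>n\<close> steps. A large \<open>n\<close> makes the Gaussian price as flat in
  \<open>r\<close> as desired.\<close>

lemma skeleton_hit_ball_le:
 assumes n: "0 < n" and \<Lambda>: "0 <= \<Lambda>" "\<And>z. z \<in> cball y (r + confinement_radius (real n)) ==> U z <= \<Lambda>"
  and r: "1 <= r" and x: "x \<notin> cball y r"
 shows "skeleton_hit (cball y r) x <= ennreal (exp ((r + 1)\<^sup>2 / (2 * real n) + real n * \<Lambda>) / ball_factor TYPE('a) (real n) 0) * skeleton_hit (cball y 1) x"
proof -
 let ?b = "ball_factor TYPE('a) (real n) 0"
 have b: "0 < ?b" using n by (intro ball_factor_pos) simp
 let ?m = "ball_factor TYPE('a) (real n) (r + 1) * exp (- (real n * \<Lambda>))"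
 have m: "?m = ?b * exp (- ((r + 1)\<^sup>2 / (2 * real n) + real n * \<Lambda>))"
  by (simp add: ball_factor_def exp_add[symmetric] exp_diff exp_minus field_simps)
 have "ennreal ?m <= skeleton_hit (cball y 1) z" if z: "z \<in> cball y r" for z
 proof -
  have "ennreal ?m <= propagate (real n) (indicator (cball y 1)) z"
  proof (rule propagate_ball_ge[where r=r and ?x0.0=y and T="real n"])
   show "cball y 1 \<subseteq> cball y r" using r by auto
   show "norm (z - v) <= r + 1" if "v \<in> cball y 1" for v
    using that z dist_triangle[of z v y] by (simp add: dist_norm[symmetric] dist_commute)
  qed (use n \<Lambda> z in auto)
  also have "... <= skeleton_hit (cball y 1) z" using n by (intro skeleton_hit_ge_propagate) auto
  finally show ?thesis .
 qed
 hence "ennreal ?m * skeleton_hit (cball y r) x <= skeleton_hit (cball y 1) x" using x by (intro skeleton_hit_chain) auto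
 hence "ennreal (1 / ?m) * (ennreal ?m * skeleton_hit (cball y r) x) <= ennreal (1 / ?m) * skeleton_hit (cball y 1) x"
  by (rule mult_left_mono) simp
 moreover have "ennreal (1 / ?m) * ennreal ?m = 1" using b unfolding m by (simp add: ennreal_mult[symmetric])
 moreover have "1 / ?m = exp ((r + 1)\<^sup>2 / (2 * real n) + real n * \<Lambda>) / ?b"
  unfolding m using b by (simp only: exp_minus) (simp add: field_simps)
 ultimately show ?thesis by (simp add: mult.assoc[symmetric])
qed

text \<open>Cut the Gaussian into layers around \<open>y\<close>. The Green function of each layer
  is controlled by its hitting weight because of the trap near \<open>y\<close>, and that hitting
  weight by the one of the unit ball. Each price grows more slowly than the Gaussian decays, up to a
  factor \<open>exp (\<eta> * norm y)\<close>.\<close>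

lemma gaussian_green_bound:
 assumes G1: "\<And>\<kappa>. 0 < \<kappa> ==> \<exists>R0. \<forall>R\<ge>R0. \<forall>w\<in>cball 0 (3 * R). U w <= \<kappa> * R"
  and \<epsilon>: "0 < \<epsilon>" and \<rho>: "0 < \<rho>"
  and G2: "\<And>\<kappa>. 0 < \<kappa> ==> \<exists>R0. \<forall>y. R0 <= norm y -->
    (\<exists>v. dist v y <= \<kappa> * norm y \<and> ennreal \<epsilon> < emeasure lborel ({x. \<epsilon> < U x} \<inter> ball v \<rho>))"
  and G3: "\<exists>C0 R0. \<forall>y. R0 <= norm y --> ennreal (exp (- (C0 * norm y))) <= skeleton_hit (cball y 1) 0"
  and c: "0 < c" and C: "0 <= C" and \<eta>: "0 < \<eta>"
 shows "\<exists>R0. \<forall>y. R0 <= norm y -->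
   (\<Sum>n. iterate n (\<lambda>z. ennreal (C * exp (- (c * (norm (z - y))\<^sup>2)))) 0) <= ennreal (exp (\<eta> * norm y)) * skeleton_hit (cball y 1) 0"
proof -
 \<comment> \<open>\<open>4 / c <= n\<close> keeps the price of shrinking layer \<open>j\<close>
   below \<open>c * j^2 / 4 + c\<close>, so three quarters of the Gaussian exponent remain for
   \<open>w\<close>.\<close>
 define n where "n = nat \<lceil>4 / c\<rceil> + 1"
 have n: "0 < n" "4 / c <= real n" unfolding n_def using c by (auto simp: of_nat_nat) linarith
 define b where "b = ball_factor TYPE('a) (real n) 0"
 have b: "0 < b" unfolding b_def using n by (intro ball_factor_pos) simp
 define m where "m = DIM('a) + 1"
 define C3 where "C3 = real m ^ m * (4 * pi) ^ m * exp (3 / 2) / ((1 - exp (- \<epsilon>)) * \<epsilon>)"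
 have C3: "0 <= C3" unfolding C3_def using \<epsilon> by simp
 define A0 where "A0 = C * C3 * exp (1 + \<rho>) * max 1 (exp c / b)"
 have A0: "0 <= A0" unfolding A0_def using C C3 by simp
 define w where "w j = exp (- (3 / 4 * c * (real j)\<^sup>2) + real j)" for j
 have w: "summable w" unfolding w_def using c by (intro summable_gaussian_exp) simp
 have w0: "0 <= w j" for j by (simp add: w_def)
 define S where "S = suminf w"
 have S: "0 <= S" unfolding S_def by (intro suminf_nonneg w w0)
 \<comment> \<open>The exponent collects \<open>n * \<kappa> * R\<close> from the potential during
   \<open>n\<close> steps and \<open>\<kappa> * R\<close> from the distance of the trap: together
   \<open>\<eta> / 2 * R\<close>.\<close>
 define \<kappa> where "\<kappa> = \<eta> / (2 * (real n + 1))"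
 have \<kappa>: "0 < \<kappa>" "(real n + 1) * \<kappa> = \<eta> / 2" using \<eta> by (auto simp: \<kappa>_def field_simps)
 obtain R1 where R1: "\<And>R w. R1 <= R ==> w \<in> cball 0 (3 * R) ==> U w <= \<kappa> * R" using G1[OF \<kappa>(1)] by blast
 obtain R2 where R2: "\<And>y. R2 <= norm y ==> (\<exists>v. dist v y <= \<kappa> * norm y \<and> ennreal \<epsilon> < emeasure lborel ({x. \<epsilon> < U x} \<inter> ball v \<rho>))"
  using G2[OF \<kappa>(1)] by blast
 obtain C0' R3 where R3': "\<And>y. R3 <= norm y ==> ennreal (exp (- (C0' * norm y))) <= skeleton_hit (cball y 1) 0" using G3 by blast
 define C0 where "C0 = max 0 C0'"
 have R3: "ennreal (exp (- (C0 * norm y))) <= skeleton_hit (cball y 1) 0" if "R3 <= norm y" for y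
 proof -
  have "C0' * norm y <= C0 * norm y" unfolding C0_def by (intro mult_right_mono) auto
  hence "ennreal (exp (- (C0 * norm y))) <= ennreal (exp (- (C0' * norm y)))" by (intro ennreal_leI) simp
  thus ?thesis using R3'[OF that] order_trans by blast
 qed
 define R0 where "R0 = Max {R1, R2, R3, confinement_radius (real n), 2, 16 * C0 / c, 2 * (A0 * S) / \<eta>}"
 show ?thesis
 proof (intro exI[of _ R0] allI impI)
  fix y :: 'a assume y: "R0 <= norm y"
  define R where "R = norm y"
  have mem: "r <= R" if "r \<in> {R1, R2, R3, confinement_radius (real n), 2, 16 * C0 / c, 2 * (A0 * S) / \<eta>}" for r
   using order_trans[OF Max_ge[OF _ that] y[unfolded R0_def]] unfolding R_def by blast
  have R: "R1 <= R" "R2 <= R" "R3 <= R" "confinement_radius (real n) <= R" "2 <= R" "16 * C0 / c <= R" "2 * (A0 * S) / \<eta> <= R"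
   by (rule mem, simp only: insert_iff simp_thms)+
  let ?h = "skeleton_hit (cball y 1) 0"
  let ?e = "\<lambda>j. c * (real j)\<^sup>2 / 4 + real n * \<kappa> * R" and ?f = "\<lambda>j. (real (Suc j) + 1)\<^sup>2 / (2 * real n) + real n * (\<kappa> * R)" and ?C = "\<lambda>j. cball y (real (Suc j))"
  let ?g = "\<lambda>j. max 1 (exp c / b) * exp (?e j)" and ?b = "\<lambda>j. C * exp (- (c * (real j)\<^sup>2))" and ?a = "\<lambda>j. A0 * exp (\<eta> / 2 * R) * w j"
  obtain v where v: "dist v y <= \<kappa> * R" "ennreal \<epsilon> < emeasure lborel ({x. \<epsilon> < U x} \<inter> ball v \<rho>)"
   using R2[of y] R unfolding R_def by blast
  define K where "K = {x. \<epsilon> < U x} \<inter> ball v \<rho>"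
  have K: "K \<in> sets borel" unfolding K_def using U_measurable by measurable
  \<comment> \<open>Bounds the distance from a point of layer \<open>j\<close> to a point of the
    trap: layer radius, distance of the trap centre from \<open>y\<close>, trap radius.\<close>
  define D where "D j = real (Suc j) + \<kappa> * R + \<rho>" for j
  define T where "T j = nat \<lceil>D j\<rceil> + 2" for j
  define \<delta> where "\<delta> j = (1 - exp (- \<epsilon>)) * (\<epsilon> * ((2 * pi * real (T j)) powr (- real DIM('a) / 2) * exp (- ((D j)\<^sup>2 / (2 * (real (T j) - 1))))))" for j
  have D0: "0 <= D j" for j unfolding D_def using \<kappa> R \<rho> by simp
  have T: "D j + 2 <= real (T j)" "real (T j) <= D j + 3" for j unfolding T_def using D0[of j] by (auto simp: of_nat_nat; linarith)+
  note ratio = loss_ratio_bound[OF \<epsilon> D0 T, folded \<delta>_def m_def, folded C3_def]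
  have green: "(\<Sum>n. iterate n (indicator (?C j)) 0) <= ennreal (C3 * exp (D j)) * skeleton_hit (?C j) 0" for j
  proof -
   have "(\<Sum>n. iterate n (indicator (?C j)) 0) <= ennreal (real (T j) / \<delta> j) * skeleton_hit (?C j) 0"
   proof (rule green_le_skeleton_hit[OF _ _ ratio(1)])
    fix z assume z: "z \<in> ?C j"
    have KD: "K \<subseteq> cball z (D j)"
    proof
     fix k assume "k \<in> K"
     hence "dist v k < \<rho>" by (simp add: K_def)
     thus "k \<in> cball z (D j)" using z v(1) dist_triangle[of z k v] dist_triangle[of z v y] by (simp add: D_def dist_commute)
    qed
    have "2 <= T j" by (simp add: T_def)
    from trap_loss[OF U_measurable K _ _ KD D0 _ _ this, of \<epsilon> \<epsilon>]
    show "propagate (real (T j)) (\<lambda>_. 1) z + ennreal (\<delta> j) <= 1"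
     using \<epsilon> v(2) unfolding propagate_def \<delta>_def by (auto simp: K_def)
   qed (auto simp: T_def)
   also have "... <= ennreal (C3 * exp (D j)) * skeleton_hit (?C j) 0" by (intro mult_right_mono ennreal_leI ratio) simp
   finally show ?thesis .
  qed
  have hit: "skeleton_hit (?C j) 0 <= ennreal (?g j) * ?h" for j
  \<comment> \<open>Layers not reaching \<open>R\<close> are shrunk to the unit ball. In the others
    \<open>j >= R / 2\<close>, and a quarter of the Gaussian exponent beats the linear exponent
    \<open>C0 * R\<close> of the hitting weight.\<close>
  proof (cases "real (Suc j) < R")
   case True
   have "skeleton_hit (?C j) 0 <= ennreal (exp (?f j) / b) * ?h" unfolding b_def
   proof (rule skeleton_hit_ball_le[OF n(1)])
    fix z assume "z \<in> cball y (real (Suc j) + confinement_radius (real n))"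
    hence "norm z <= 3 * R" using True R norm_triangle_sub[of z y] by (simp add: dist_norm norm_minus_commute R_def)
    thus "U z <= \<kappa> * R" using R1 R by simp
   qed (use \<kappa> R True in \<open>auto simp: R_def\<close>)
   also have "... <= ennreal (?g j) * ?h"
   proof (intro mult_right_mono ennreal_leI)
    have "(real (Suc j) + 1)\<^sup>2 / (2 * real n) <= (real (Suc j) + 1)\<^sup>2 * (c / 8)"
    proof -
     have "1 / (2 * real n) <= c / 8" using n c by (simp add: field_simps)
     from mult_left_mono[OF this, of "(real (Suc j) + 1)\<^sup>2"] show ?thesis by simp
    qed
    also have "... <= (2 * (real j)\<^sup>2 + 8) * (c / 8)"
    proof (rule mult_right_mono)
     have "0 <= (real j - 2)\<^sup>2" by simp
     thus "(real (Suc j) + 1)\<^sup>2 <= 2 * (real j)\<^sup>2 + 8" by (simp add: power2_eq_square algebra_simps)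
    qed (use c in simp)
    also have "... = c + c * (real j)\<^sup>2 / 4" by (simp add: algebra_simps)
    finally have "exp (?f j) <= exp c * exp (?e j)" unfolding exp_add[symmetric] by (simp add: mult.assoc)
    hence "exp (?f j) / b <= (exp c / b) * exp (?e j)" using b by (simp add: divide_right_mono)
    also have "... <= ?g j" by (intro mult_right_mono) auto
    finally show "exp (?f j) / b <= ?g j" .
   qed simp
   finally show ?thesis .
  next
   case False
   hence j: "R / 2 <= real j" using R by simp
   have "C0 * R <= c * (real j)\<^sup>2 / 4"
   proof -
    have "16 * C0 <= R * c" using R(6) c by (simp add: field_simps)
    hence "16 * C0 * R <= R * c * R" using R by (intro mult_right_mono) auto
    hence "C0 * R <= c * (R / 2)\<^sup>2 / 4" by (simp add: power2_eq_square field_simps)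
    also have "... <= c * (real j)\<^sup>2 / 4" using j R c by (intro divide_right_mono mult_left_mono power_mono) auto
    finally show ?thesis .
   qed
   moreover have "0 <= real n * \<kappa> * R" using \<kappa> R by simp
   ultimately have "0 <= ?e j - C0 * R" by linarith
   hence "exp 0 <= exp (?e j - C0 * R)" by (simp only: exp_le_cancel_iff)
   hence "1 * 1 <= max 1 (exp c / b) * exp (?e j - C0 * R)" by (intro mult_mono) auto
   also have "... = (?g j) * exp (- (C0 * R))" by (simp only: diff_conv_add_uminus exp_add mult.assoc)
   finally have "ennreal 1 <= ennreal ((?g j) * exp (- (C0 * R)))" by (intro ennreal_leI) simp
   also have "... = ennreal (?g j) * ennreal (exp (- (C0 * R)))" by (rule ennreal_mult) auto
   also have "... <= ennreal (?g j) * ?h" using R3[of y] R by (intro mult_left_mono) (auto simp: R_def)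
   finally show ?thesis using skeleton_hit_le_1[of "?C j" 0] by simp
  qed
  have cm: "indicator (?C j) \<in> borel_measurable borel" for j by (rule borel_measurable_indicator) simp
  let ?\<phi> = "\<lambda>z. ennreal (C * exp (- (c * (norm (z - y))\<^sup>2)))"
  have \<phi>: "?\<phi> z <= (\<Sum>j. ennreal (?b j) * indicator (?C j) z)" for z
  proof -
   define j where "j = nat \<lfloor>norm (z - y)\<rfloor>"
   have j: "real j <= norm (z - y)" "norm (z - y) <= real (Suc j)"
   proof -
    have rj: "real j = of_int \<lfloor>norm (z - y)\<rfloor>" unfolding j_def by simp
    show "real j <= norm (z - y)" "norm (z - y) <= real (Suc j)" unfolding of_nat_Suc rj using floor_correct[of "norm (z - y)"] by linarith+
   qed
   have "(real j)\<^sup>2 <= (norm (z - y))\<^sup>2" using j by (intro power_mono) auto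
   hence "?\<phi> z <= ennreal (?b j)" using c C by (intro ennreal_leI mult_left_mono) auto
   also have "... = ennreal (?b j) * indicator (?C j) z" using j by (simp add: dist_norm norm_minus_commute)
   also have "... <= (\<Sum>j. ennreal (?b j) * indicator (?C j) z)" by (rule le_suminf_ennreal)
   finally show ?thesis .
  qed
  have "(\<Sum>n. iterate n ?\<phi> 0) <= (\<Sum>n. iterate n (\<lambda>z. \<Sum>j. ennreal (?b j) * indicator (?C j) z) 0)"
   by (intro suminf_le iterate_mono \<phi> summableI)
  also have "... = (\<Sum>n. \<Sum>j. ennreal (?b j) * iterate n (indicator (?C j)) 0)"
  proof -
   have "iterate n (\<lambda>z. \<Sum>j. ennreal (?b j) * indicator (?C j) z) 0 =
     (\<Sum>j. iterate n (\<lambda>z. ennreal (?b j) * indicator (?C j) z) 0)" for n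
    by (rule iterate_suminf) (intro borel_measurable_times_ennreal cm borel_measurable_const)
   thus ?thesis by (simp only: iterate_cmult[OF cm])
  qed
  also have "... = (\<Sum>j. ennreal (?b j) * (\<Sum>n. iterate n (indicator (?C j)) 0))" by (subst ennreal_suminf_swap) simp
  also have "... <= (\<Sum>j. ennreal (?a j) * ?h)"
  proof (intro suminf_le summableI)
   fix j
   have "ennreal (?b j) * (\<Sum>n. iterate n (indicator (?C j)) 0) \<le>
    ennreal (?b j) * (ennreal (C3 * exp (D j)) * (ennreal (?g j) * ?h))" by (intro mult_left_mono order_trans[OF green] hit) auto
   also have "... = ennreal ((?b j) * ((C3 * exp (D j)) * (?g j))) * ?h" using C C3 by (subst (1 2) ennreal_mult) (auto simp: mult.assoc)
   also have "(?b j) * ((C3 * exp (D j)) * (?g j))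
    = A0 * exp (\<eta> / 2 * R) * w j"
   proof -
    have e: "exp (- (c * (real j)\<^sup>2)) * exp (D j) * exp (?e j) = exp (1 + \<rho>) * exp (\<eta> / 2 * R) * w j"
     unfolding w_def exp_add[symmetric] D_def \<kappa>(2)[symmetric] by (simp add: algebra_simps)
    have "(?b j) * ((C3 * exp (D j)) * (?g j))
     = C * C3 * max 1 (exp c / b) * (exp (- (c * (real j)\<^sup>2)) * exp (D j) * exp (?e j))" by (simp only: mult_ac)
    also have "... = A0 * exp (\<eta> / 2 * R) * w j" unfolding e A0_def by (simp only: mult_ac)
    finally show ?thesis .
   qed
   finally show "ennreal (?b j) * (\<Sum>n. iterate n (indicator (?C j)) 0) <= ennreal (?a j) * ?h" .
  qed
  also have "... = (\<Sum>j. ennreal (?a j)) * ?h" by simp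
  also have "(\<Sum>j. ennreal (?a j)) = ennreal (A0 * exp (\<eta> / 2 * R) * S)" unfolding S_def using A0 w0 w
   by (intro suminf_ennreal_eq sums_mult summable_sums) auto
  also have "ennreal (A0 * exp (\<eta> / 2 * R) * S) * ?h <= ennreal (exp (\<eta> * R)) * ?h"
  proof (intro mult_right_mono ennreal_leI)
   have "A0 * S <= \<eta> / 2 * R" using R(7) \<eta> by (simp add: field_simps)
   also have "... <= exp (\<eta> / 2 * R)" using exp_ge_add_one_self[of "\<eta> / 2 * R"] by linarith
   finally have "A0 * S * exp (\<eta> / 2 * R) <= exp (\<eta> / 2 * R) * exp (\<eta> / 2 * R)" by (intro mult_right_mono) auto
   also have "... = exp (\<eta> * R)" unfolding exp_add[symmetric] by simp
   finally show "A0 * exp (\<eta> / 2 * R) * S <= exp (\<eta> * R)" by (simp add: mult_ac)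
  qed simp
  finally show "(\<Sum>n. iterate n ?\<phi> 0) <= ennreal (exp (\<eta> * norm y)) * ?h" unfolding R_def .
 qed
qed

end

text \<open>Away from the diagonal the singular prefactor at \<open>t = 0\<close> is absorbed by
  part of the Gaussian exponent, which is at least \<open>1 / (2 * t)\<close>.\<close>

lemma heat_kernel_short_time:
 fixes y :: "'a::euclidean_space"
 assumes t: "0 < t" "t < 2" and y: "1 <= norm y"
 shows "heat_kernel t 0 y <= (4 * real DIM('a)) ^ DIM('a) * exp (- ((norm y)\<^sup>2 / 8))"
proof -
 let ?d = "DIM('a)" and ?s = "1 / t"
 have s: "0 < ?s" "1 / 2 < ?s" using t by (auto simp: field_simps)
 have d: "0 < ?d" by simp
 have "(2 * pi * t) powr (- real ?d / 2) <= t powr (- real ?d / 2)" using t pi_gt3 by (intro powr_mono2') auto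
 also have "... = ?s powr (real ?d / 2)"
 proof -
  have "t powr (- real ?d / 2) = 1 / t powr (real ?d / 2)" using powr_minus_divide[of t "real ?d / 2"] by simp
  thus ?thesis using t by (simp add: powr_divide)
 qed
 also have "... <= (4 * real ?d) ^ ?d * exp (?s / 4)"
 proof (cases "1 <= ?s")
  case True
  have "?s powr (real ?d / 2) <= ?s powr (real ?d)" using True by (intro powr_mono) auto
  also have "... = 4 ^ ?d * (?s / 4) ^ ?d" using s by (simp add: powr_realpow power_divide)
  also have "... <= 4 ^ ?d * (real ?d ^ ?d * exp (?s / 4))" using s d by (intro mult_left_mono power_le_exp) auto
  finally show ?thesis by (simp add: power_mult_distrib mult.assoc)
 next
  case False
  have "?s powr (real ?d / 2) <= 1 powr (real ?d / 2)" using False s by (intro powr_mono2) auto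
  moreover have "1 * 1 <= (4 * real ?d) ^ ?d * exp (?s / 4)"
  proof (rule mult_mono)
   show "1 <= (4 * real ?d) ^ ?d" using d by (intro one_le_power) linarith
  qed (use s in auto)
  ultimately show ?thesis by simp
 qed
 finally have 1: "(2 * pi * t) powr (- real ?d / 2) <= (4 * real ?d) ^ ?d * exp (?s / 4)" .
 have y2: "1 <= (norm y)\<^sup>2" using y by simp
 have "?s / 4 + (norm y)\<^sup>2 / 8 <= (norm y)\<^sup>2 / (2 * t)"
 proof -
  have "?s * 1 <= ?s * (norm y)\<^sup>2" using s y2 by (intro mult_left_mono) auto
  moreover have "1 / 2 * (norm y)\<^sup>2 <= ?s * (norm y)\<^sup>2" using s by (intro mult_right_mono) auto
  moreover have "(norm y)\<^sup>2 / (2 * t) = ?s * (norm y)\<^sup>2 / 2" by simp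
  moreover have "a / 4 + b / 8 <= c" if "a * 1 <= p" "1 / 2 * b <= p" "c = p / 2" for a b c p :: real using that by linarith
  ultimately show ?thesis by blast
 qed
 hence "exp (?s / 4 + - ((norm y)\<^sup>2 / (2 * t))) <= exp (- ((norm y)\<^sup>2 / 8))" by simp
 hence 2: "exp (?s / 4) * exp (- ((norm y)\<^sup>2 / (2 * t))) <= exp (- ((norm y)\<^sup>2 / 8))" by (simp only: exp_add)
 have "heat_kernel t 0 y = (2 * pi * t) powr (- real ?d / 2) * exp (- ((norm y)\<^sup>2 / (2 * t)))" unfolding heat_kernel_def by simp
 also have "... <= (4 * real ?d) ^ ?d * exp (?s / 4) * exp (- ((norm y)\<^sup>2 / (2 * t)))" by (intro mult_right_mono 1) simp
 also have "... <= (4 * real ?d) ^ ?d * exp (- ((norm y)\<^sup>2 / 8))" unfolding mult.assoc by (intro mult_left_mono 2) simp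
 finally show ?thesis .
qed

lemma nn_integral_step_function:
 "(\<L> t. (\<Sum>n. a n * indicator {real n + 1..<real n + 2} t)) = (\<Sum>n. a n :: ennreal)"
proof -
 have "(\<L> t. (\<Sum>n. a n * indicator {real n + 1..<real n + 2} t)) =
  (\<Sum>n. \<L> t. a n * indicator {real n + 1..<real n + 2} t)" by (rule nn_integral_suminf) simp
 thus ?thesis by (simp add: nn_integral_cmult_indicator)
qed

section \<open>Comparison with hitting weight and Green function in continuous time\<close>

context bm_environment
begin

lemma hitting_weight_le_green:
 assumes G: "\<And>z. (\<E> w. near_hit y (\<lambda>r\<in>rational_times. z + B r w)) <= \<phi> z"
 shows "hitting_weight W B U x y <= (\<Sum>n. iterate n \<phi> x)"
proof -
 let ?N = "\<lambda>z. \<E> w. near_hit y (\<lambda>r\<in>rational_times. z + B r w)"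
 have "hitting_weight W B U x y <= ?N x + (\<Sum>n. \<L> z. bridge_kernel U (real (Suc n)) x z * ?N z)"
  by (rule hitting_weight_le[OF U_measurable])
 also have "... <= iterate 0 \<phi> x + (\<Sum>n. iterate (Suc n) \<phi> x)" unfolding iterate_def propagate_def
  by (intro add_mono suminf_le summableI) (auto intro!: nn_integral_mono mult_left_mono G)
 also have "... = (\<Sum>n. iterate n \<phi> x)"
  using sums_unique[OF sums_Suc[OF summable_sums[OF summableI], of "\<lambda>n. iterate n \<phi> x"]] by (simp add: add.commute)
 finally show ?thesis .
qed

lemma bridge_kernel_step:
 assumes "0 < n" "real n < t"
 shows "bridge_kernel U t x y = propagate (real n) (\<lambda>z. bridge_kernel U (t - real n) z y) x"
 using chapman_kolmogorov[OF U_measurable, of "real n" "t - real n" x y] assms unfolding propagate_def by simp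

lemma green_function_eq:
 "green_function W B U x y = (\<L> t. bridge_kernel U t x y * indicator {0<..} t)" unfolding green_function_def bridge_kernel_def ..

text \<open>Write \<open>t = n + s\<close> with an integer \<open>n\<close> and
  \<open>1 <= s < 2\<close>: the last kernel is then bounded by a fixed Gaussian. Times below 2,
  where this leaves no first step, are estimated directly.\<close>

lemma green_function_le:
 assumes y: "1 <= norm y"
 shows "green_function W B U 0 y <= ennreal (2 * ((4 * real DIM('a)) ^ DIM('a) * exp (- ((norm y)\<^sup>2 / 8)))) +
   (\<Sum>n. iterate n (\<lambda>z. ennreal (exp (- (1 / 4 * (norm (z - y))\<^sup>2)))) 0)"
proof -
 let ?H = "(4 * real DIM('a)) ^ DIM('a) * exp (- ((norm y)\<^sup>2 / 8))"
 let ?\<psi> = "\<lambda>z. ennreal (exp (- (1 / 4 * (norm (z - y))\<^sup>2)))"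
 have H: "0 <= ?H" by simp
 have pt: "bridge_kernel U t 0 y * indicator {0<..} t \<le>
   ennreal ?H * indicator {0..<2::real} t + (\<Sum>n. iterate n ?\<psi> 0 * indicator {real n + 1..<real n + 2} t)" for t :: real
 proof (cases "0 < t")
  case t: True
  show ?thesis
  proof (cases "t < 2")
   case True
   have "bridge_kernel U t 0 y <= ennreal ?H"
    by (rule order_trans[OF bridge_kernel_le]) (use heat_kernel_short_time[OF t True y] in \<open>rule ennreal_leI\<close>)
   thus ?thesis using True t by (simp add: add_increasing2)
  next
   case False
   define n where "n = nat \<lfloor>t\<rfloor> - 1"
   have n: "real n + 1 <= t" "t < real n + 2" "0 < n"
   proof -
    have "2 <= \<lfloor>t\<rfloor>" using False by linarith
    hence "int n = \<lfloor>t\<rfloor> - 1" unfolding n_def by arith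
    hence "real n = of_int \<lfloor>t\<rfloor> - 1" by (metis of_int_diff of_int_of_nat_eq of_int_1)
    thus "real n + 1 <= t" "t < real n + 2" by linarith+
    show "0 < n" using \<open>2 <= \<lfloor>t\<rfloor>\<close> unfolding n_def by linarith
   qed
   have \<tau>: "1 <= t - real n" "t - real n < 2" using n by auto
   have "bridge_kernel U t 0 y = propagate (real n) (\<lambda>z. bridge_kernel U (t - real n) z y) 0" by (rule bridge_kernel_step) (use n in auto)
   also have "... <= propagate (real n) ?\<psi> 0"
   proof (intro propagate_mono AE_I2)
    fix z
    have "heat_kernel (t - real n) z y <= 1 * exp (- (1 / 4 * (norm (z - y))\<^sup>2))" unfolding heat_kernel_def
    proof (rule mult_mono)
     have "1 * 1 <= 2 * pi * (t - real n)" using \<tau> pi_gt3 by (intro mult_mono) auto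
     hence "(2 * pi * (t - real n)) powr (- real DIM('a) / 2) <= 1 powr (- real DIM('a) / 2)" by (intro powr_mono2') auto
     thus "(2 * pi * (t - real n)) powr (- real DIM('a) / 2) <= 1" by simp
     have "(norm (z - y))\<^sup>2 / 4 <= (norm (z - y))\<^sup>2 / (2 * (t - real n))" using \<tau> by (intro divide_left_mono) auto
     thus "exp (- (norm (z - y))\<^sup>2 / (2 * (t - real n))) <= exp (- (1 / 4 * (norm (z - y))\<^sup>2))" by simp
    qed auto
    hence "ennreal (heat_kernel (t - real n) z y) <= ?\<psi> z" by (intro ennreal_leI) simp
    thus "bridge_kernel U (t - real n) z y <= ?\<psi> z" using bridge_kernel_le order_trans by blast
   qed
   also have "... = iterate n ?\<psi> 0 * indicator {real n + 1..<real n + 2} t" using n by (simp add: iterate_def)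
   also have "... <= (\<Sum>n. iterate n ?\<psi> 0 * indicator {real n + 1..<real n + 2} t)" by (rule le_suminf_ennreal)
   finally show ?thesis using t by (simp add: add_increasing)
  qed
 qed simp
 have "green_function W B U 0 y <= (\<L> t. ennreal ?H * indicator {0..<2::real} t + (\<Sum>n. iterate n ?\<psi> 0 * indicator {real n + 1..<real n + 2} t))"
  unfolding green_function_eq by (intro nn_integral_mono pt)
 also have "... = (\<L> t. ennreal ?H * indicator {0..<2::real} t) + (\<L> t. (\<Sum>n. iterate n ?\<psi> 0 * indicator {real n + 1..<real n + 2} t))"
  by (rule nn_integral_add) measurable
 also have "(\<L> t. ennreal ?H * indicator {0..<2::real} t) = ennreal (2 * ?H)"
 proof -
  have "(\<L> t. ennreal ?H * indicator {0..<2::real} t) = ennreal ?H * emeasure lborel {0..<2::real}" by (rule nn_integral_cmult_indicator) simp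
  also have "emeasure lborel {0..<2::real} = ennreal 2" by simp
  also have "ennreal ?H * ennreal 2 = ennreal (?H * 2)" by (rule ennreal_mult[symmetric]) auto
  finally show ?thesis by (simp only: mult.commute)
 qed
 finally show ?thesis unfolding nn_integral_step_function .
qed

text \<open>With the same decomposition of time, the last piece, of length in [1, 2), leads from the
  unit ball to \<open>y\<close> at a price that depends on \<open>\<Lambda>\<close> only.\<close>

lemma green_function_ge:
 assumes y: "1 < norm y" and \<Lambda>: "0 <= \<Lambda>" "\<And>z. z \<in> cball y (1 + confinement_radius 2) ==> U z <= \<Lambda>"
 shows "ennreal ((4 * pi) powr (- real DIM('a) / 2) * exp (- 1 / 2) * exp (- (2 * \<Lambda>)) / 2) * skeleton_hit (cball y 1) 0 <= green_function W B U 0 y"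
proof -
 let ?m = "(4 * pi) powr (- real DIM('a) / 2) * exp (- 1 / 2) * exp (- (2 * \<Lambda>)) / 2" and ?i = "indicator (cball y 1) :: 'a => ennreal"
 have im: "?i \<in> borel_measurable borel" by (rule borel_measurable_indicator) simp
 have pt: "(\<Sum>n. ennreal ?m * iterate n ?i 0 * indicator {real n + 1..<real n + 2} t) <= bridge_kernel U t 0 y * indicator {0<..} t" for t :: real
 proof (cases "2 <= t")
  case False
  \<comment> \<open>The term \<open>n = 0\<close> is an indicator at the origin, which lies outside
    the unit ball at \<open>y\<close>.\<close>
  have "ennreal ?m * iterate n ?i 0 * indicator {real n + 1..<real n + 2} t = 0" for n using False y by (cases "n = 0") (auto simp: iterate_def)
  hence "(\<Sum>n. ennreal ?m * iterate n ?i 0 * indicator {real n + 1..<real n + 2} t) = (\<Sum>n. 0)" by (simp only:)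
  also have "... = 0" by simp
  finally show ?thesis by (simp only: zero_le)
 next
  case True
  define n where "n = nat \<lfloor>t\<rfloor> - 1"
  have n: "real n + 1 <= t" "t < real n + 2" "0 < n"
  proof -
   have "2 <= \<lfloor>t\<rfloor>" using True by linarith
   hence "int n = \<lfloor>t\<rfloor> - 1" unfolding n_def by arith
    hence "real n = of_int \<lfloor>t\<rfloor> - 1" by (metis of_int_diff of_int_of_nat_eq of_int_1)
   thus "real n + 1 <= t" "t < real n + 2" by linarith+
   show "0 < n" using \<open>2 <= \<lfloor>t\<rfloor>\<close> unfolding n_def by linarith
  qed
  have \<tau>: "1 <= t - real n" "t - real n < 2" using n by auto
  have "(\<Sum>k. ennreal ?m * iterate k ?i 0 * indicator {real k + 1..<real k + 2} t) = ennreal ?m * iterate n ?i 0 * indicator {real n + 1..<real n + 2} t"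
  proof -
   define f where "f k = ennreal ?m * iterate k ?i 0 * indicator {real k + 1..<real k + 2} t" for k
   have "f k = 0" if "k \<noteq> n" for k
   proof -
    have "t \<notin> {real k + 1..<real k + 2}"
    proof
     assume "t \<in> {real k + 1..<real k + 2}"
     hence "real k < real n + 1" "real n < real k + 1" using n by auto
     hence "k = n" by linarith
     thus False using that by simp
    qed
    thus ?thesis by (simp add: f_def)
   qed
   hence "(\<Sum>k. f k) = f n" using suminf_finite[of "{n}" f] by simp
   thus ?thesis unfolding f_def .
  qed
  also have "... = propagate (real n) (\<lambda>z. ennreal ?m * ?i z) 0" using n im by (simp add: propagate_cmult iterate_def)
  also have "... <= propagate (real n) (\<lambda>z. bridge_kernel U (t - real n) z y) 0"
  proof (intro propagate_mono AE_I2)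
   fix z
   show "ennreal ?m * ?i z <= bridge_kernel U (t - real n) z y"
   proof (cases "z \<in> cball y 1")
    case True
    have "(4 * pi) powr (- real DIM('a) / 2) * exp (- 1 / 2) <= heat_kernel (t - real n) z y" unfolding heat_kernel_def
    proof (rule mult_mono)
     show "(4 * pi) powr (- real DIM('a) / 2) <= (2 * pi * (t - real n)) powr (- real DIM('a) / 2)" using \<tau> by (intro powr_mono2') auto
     have "(norm (z - y))\<^sup>2 <= 1\<^sup>2" using True by (intro power_mono) (auto simp: dist_norm norm_minus_commute)
     hence "(norm (z - y))\<^sup>2 / (2 * (t - real n)) <= 1 / 2" using \<tau> by (intro frac_le) auto
     thus "exp (- 1 / 2) <= exp (- (norm (z - y))\<^sup>2 / (2 * (t - real n)))" by simp
    qed auto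
    moreover have "exp (- (2 * \<Lambda>)) <= exp (- ((t - real n) * \<Lambda>))" using \<tau> \<Lambda> by (simp add: mult_right_mono)
    ultimately have "?m <= heat_kernel (t - real n) z y * exp (- ((t - real n) * \<Lambda>)) / 2" by (intro divide_right_mono mult_mono) auto
    hence "ennreal ?m <= ennreal (heat_kernel (t - real n) z y * exp (- ((t - real n) * \<Lambda>)) / 2)" by (rule ennreal_leI)
    also have "... <= bridge_kernel U (t - real n) z y"
     by (rule confinement_radius(2)[where T=2 and ?x0.0=y and r=1]) (use \<Lambda> \<tau> True in auto)
    finally show ?thesis using True by simp
   qed simp
  qed
  also have "... = bridge_kernel U t 0 y" by (rule bridge_kernel_step[symmetric]) (use n in auto)
  finally show ?thesis using True by simp
 qed
 have "ennreal ?m * skeleton_hit (cball y 1) 0 <= ennreal ?m * (\<Sum>n. iterate n ?i 0)" by (intro mult_left_mono skeleton_hit_le_green) auto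
 also have "... = (\<L> t. (\<Sum>n. ennreal ?m * iterate n ?i 0 * indicator {real n + 1..<real n + 2} t))"
  unfolding nn_integral_step_function by simp
 also have "... <= green_function W B U 0 y" unfolding green_function_eq by (intro nn_integral_mono pt)
 finally show ?thesis .
qed

text \<open>Meaningful only if some \<open>c\<close> is reached, as the infimum of the empty set is
  unspecified; in good environments this is always the case.\<close>

definition reach_cost :: "'a => 'a => real" where
 "reach_cost x y = Inf {c. reach x y c}"

lemma reach_cost_le: "reach x y c ==> reach_cost x y <= c"
 unfolding reach_cost_def by (rule cInf_lower) (auto intro!: bdd_belowI[of _ 0] reach_nonneg)

text \<open>The infimum is attained: a sequence decreasing to it needs only countably many null sets
  of starting points.\<close>

lemma reach_reach_cost:
 assumes "reach x y c"
 shows "reach x y (reach_cost x y)"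
proof -
 have ev: "reach x y (reach_cost x y + 1 / real (Suc n))" for n
 proof -
  have "Inf {c. reach x y c} < reach_cost x y + 1 / real (Suc n)" by (simp add: reach_cost_def)
  with assms have "\<exists>c'\<in>{c. reach x y c}. c' < reach_cost x y + 1 / real (Suc n)" by (intro cInf_lessD) auto
  thus ?thesis by (auto intro: reach_mono)
 qed
 have "AE z in lborel. \<forall>n. z \<in> cball x 1 --> ennreal (exp (- (reach_cost x y + 1 / real (Suc n)))) <= skeleton_hit (cball y 1) z"
  using ev unfolding reach_def AE_all_countable by blast
 thus ?thesis unfolding reach_def
 proof eventually_elim
  case (elim z)
  show ?case
  proof
   assume z: "z \<in> cball x 1"
   have "(\<lambda>n. ennreal (exp (- (reach_cost x y + 1 / real (Suc n))))) \<longlonglongrightarrow> ennreal (exp (- (reach_cost x y + 0)))"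
    by (intro tendsto_ennrealI tendsto_intros LIMSEQ_inverse_real_of_nat[unfolded inverse_eq_divide])
   thus "ennreal (exp (- reach_cost x y)) <= skeleton_hit (cball y 1) z"
    by (intro LIMSEQ_le_const2[where X="\<lambda>n. ennreal (exp (- (reach_cost x y + 1 / real (Suc n))))"]) (use elim z in auto)
  qed
 qed
qed

lemma reach_cost_triangle:
 assumes "reach x y c" "reach y z c'"
 shows "reach_cost x z <= reach_cost x y + reach_cost y z"
 by (rule reach_cost_le[OF reach_trans[OF reach_reach_cost[OF assms(1)] reach_reach_cost[OF assms(2)]]])

end

text \<open>Properties of one realisation of the potential; all comparisons of costs are
  deterministic consequences of them. The factor 3 leaves room for balls of radius up to
  \<open>2 * R\<close> around points at distance \<open>R\<close>.\<close>

locale good_environment = bm_environment W B U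
 for W :: "'w measure" and B :: "real => 'w => 'a::euclidean_space" and U :: "'a => real" +
 fixes \<epsilon> \<rho> :: real
 assumes sublinear: "0 < \<kappa> ==> \<exists>R0. \<forall>R\<ge>R0. \<forall>w\<in>cball 0 (3 * R). U w <= \<kappa> * R"
  and trap_pos: "0 < \<epsilon>" "0 < \<rho>"
  and traps: "0 < \<kappa> ==> \<exists>R0. \<forall>y. R0 <= norm y -->
    (\<exists>v. dist v y <= \<kappa> * norm y \<and> ennreal \<epsilon> < emeasure lborel ({x. \<epsilon> < U x} \<inter> ball v \<rho>))"
  and local_reach: "0 < \<eta> ==> \<exists>\<eta>'>0. \<exists>R0. \<forall>R\<ge>R0. \<forall>z x. norm z <= R --> norm x <= R --> dist z x <= \<eta>' * R --> reach z x (\<eta> * R)"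
begin

lemma locally_bounded: "\<exists>\<Lambda>\<ge>0. \<forall>w\<in>cball 0 r. U w <= \<Lambda>"
proof -
 obtain R0 where R0: "\<forall>R\<ge>R0. \<forall>w\<in>cball 0 (3 * R). U w <= 1 * R" using sublinear[of 1] by auto
 define R where "R = max R0 (max 0 r)"
 have "cball 0 r \<subseteq> cball (0::'a) (3 * R)" by (rule subset_cball) (simp add: R_def; linarith)
 moreover have "R0 <= R" "0 <= R" by (auto simp: R_def)
 ultimately show ?thesis using R0 by (intro exI[of _ R]) (auto simp: subset_iff)
qed

text \<open>The segment to \<open>y\<close> is cut into a fixed number \<open>N\<close> of pieces so
  short that local reachability prices each of them at \<open>norm y\<close>.\<close>

lemma reach_linear: "\<exists>C\<ge>0. \<exists>R0>0. \<forall>y. R0 <= norm y --> reach 0 y (C * norm y)"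
proof -
 obtain h R0 where h: "0 < h" and R0: "\<And>R z x. R0 <= R ==> norm z <= R ==> norm x <= R ==> dist z x <= h * R ==> reach z x (1 * R)"
  using local_reach[OF zero_less_one] by blast
 define N where "N = nat \<lceil>1 / h\<rceil> + 1"
 have N: "0 < N" "1 / real N <= h"
 proof -
  have "1 / h <= real N" unfolding N_def using h by (simp add: of_nat_nat) linarith
  moreover show "0 < N" by (simp add: N_def)
  ultimately show "1 / real N <= h" using h by (simp add: field_simps)
 qed
 show ?thesis
 proof (rule exI[of _ "real N"], rule conjI, simp, rule exI[of _ "max 1 R0"], rule conjI, simp, intro allI impI)
  fix y :: 'a assume y: "max 1 R0 <= norm y"
  let ?A = "\<lambda>i. (real (Suc i) / real N) *\<^sub>R y"
  let ?B = "\<lambda>i. (real i / real N) *\<^sub>R y"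
  have st: "reach (?B i) (?A i) (norm y)" if "i < N" for i
  proof -
   have "reach (?B i) (?A i) (1 * norm y)"
   proof (rule R0)
    have *: "norm ((real k / real N) *\<^sub>R y) <= norm y" if "k <= N" for k
    proof -
     have "real k / real N <= 1" using that N by simp
     hence "real k / real N * norm y <= 1 * norm y" by (rule mult_right_mono) simp
     thus ?thesis by simp
    qed
    show "norm (?B i) <= norm y" "norm (?A i) <= norm y"
     using that by (intro *; simp)+
    have "dist (?B i) (?A i) = 1 / real N * norm y"
     unfolding dist_norm scaleR_left_diff_distrib[symmetric] norm_scaleR using N by (simp add: field_simps)
    also have "... <= h * norm y" using N by (intro mult_right_mono) auto
    finally show "dist (?B i) (?A i) <= h * norm y" .
   qed (use y in simp)
   thus ?thesis by simp
  qed
  have "i <= N ==> reach 0 (?B i) (real i * norm y)" for i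
  proof (induction i)
   case 0
   thus ?case using reach_self[of 0 0] by simp
  next
   case (Suc i)
   hence "reach 0 (?A i) (real i * norm y + norm y)" by (intro reach_trans[OF Suc.IH st]) auto
   thus ?case by (simp add: algebra_simps)
  qed
  from this[of N] show "reach 0 y (real N * norm y)" using N by simp
 qed
qed

lemma skeleton_hit_ge_cost:
 "\<exists>c\<ge>0. \<forall>y b. reach 0 y b --> ennreal (exp (- (b + c))) <= skeleton_hit (cball y 1) 0"
proof -
 obtain \<Lambda> where \<Lambda>: "0 <= \<Lambda>" "\<forall>w\<in>cball 0 step_radius. U w <= \<Lambda>" using locally_bounded by blast
 show ?thesis
 proof (intro exI[of _ "step_cost + \<Lambda>"] conjI allI impI)
  show "0 <= step_cost + \<Lambda>" using \<Lambda> by (simp add: step_cost_def)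
  fix y b assume "reach 0 y b"
  thus "ennreal (exp (- (b + (step_cost + \<Lambda>)))) <= skeleton_hit (cball y 1) 0"
   using skeleton_hit_ge_reach[of \<Lambda> 0 y b] \<Lambda> by (simp add: add.assoc)
 qed
qed

lemma skeleton_hit_exponential:
 "\<exists>C0 R0. \<forall>y. R0 <= norm y --> ennreal (exp (- (C0 * norm y))) <= skeleton_hit (cball y 1) 0"
proof -
 obtain C R0 where C: "0 <= C" "\<And>y. R0 <= norm y ==> reach 0 y (C * norm y)" using reach_linear by blast
 obtain c where c: "0 <= c" "\<And>y b. reach 0 y b ==> ennreal (exp (- (b + c))) <= skeleton_hit (cball y 1) 0"
  using skeleton_hit_ge_cost by blast
 show ?thesis
 proof (rule exI[of _ "C + c"], rule exI[of _ "max R0 1"], intro allI impI)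
  fix y :: 'a assume y: "max R0 1 <= norm y"
  have "c * 1 <= c * norm y" using y c by (intro mult_left_mono) auto
  hence "ennreal (exp (- ((C + c) * norm y))) <= ennreal (exp (- (C * norm y + c)))" by (intro ennreal_leI) (simp add: algebra_simps)
  also have "... <= skeleton_hit (cball y 1) 0" using y by (intro c(2) C(2)) simp
  finally show "ennreal (exp (- ((C + c) * norm y))) <= skeleton_hit (cball y 1) 0" .
 qed
qed

text \<open>If \<open>c\<close> exceeds the linear bound there is nothing to do. Otherwise the
  radius \<open>r\<close>, of order \<open>sqrt c\<close>, is below \<open>norm y\<close>, and on
  that scale the potential is a small multiple of \<open>norm y\<close>.\<close>

lemma reach_from_skeleton_hit:
 assumes \<kappa>: "0 < \<kappa>"
 shows "\<exists>R0. \<forall>y c. R0 <= norm y --> 0 <= c --> ennreal (exp (- c)) <= skeleton_hit (cball y 1) 0 --> reach 0 y (c + \<kappa> * norm y)"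
proof -
 obtain C R1 where C: "0 <= C" "\<And>y. R1 <= norm y ==> reach 0 y (C * norm y)" using reach_linear by blast
 obtain R2 where R2: "\<And>R w. R2 <= R ==> w \<in> cball 0 (3 * R) ==> U w <= (\<kappa> / 4) * R" using sublinear[of "\<kappa> / 4"] \<kappa> by (metis divide_pos_pos zero_less_numeral)
 define d where "d = real DIM('a)"
 have d: "0 <= d" by (simp add: d_def)
 define R0 where "R0 = max (max R1 R2) (max (max 3 (confinement_radius 2)) (max (8 * (C + d + 2)) (2 * (d + 2) / \<kappa>)))"
 show ?thesis
 proof (intro exI[of _ R0] allI impI)
  fix y :: 'a and c :: real
  assume y: "R0 <= norm y" and c: "0 <= c" "ennreal (exp (- c)) <= skeleton_hit (cball y 1) 0"
  define R where "R = norm y"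
  have R: "R1 <= R" "R2 <= R" "3 <= R" "confinement_radius 2 <= R" "8 * (C + d + 2) <= R" "2 * (d + 2) / \<kappa> <= R"
   using y unfolding R0_def R_def max.bounded_iff by blast+
  show "reach 0 y (c + \<kappa> * norm y)"
  proof (cases "c <= C * R")
   case False
   have "reach 0 y (C * R)" unfolding R_def by (rule C(2)) (use R in \<open>simp add: R_def\<close>)
   thus ?thesis by (rule reach_mono) (use False \<kappa> R in \<open>simp add: R_def add_increasing2\<close>)
  next
   case True
   have "8 * (c + d + 2) <= 8 * (C + d + 2) * R"
   proof -
    have "(d + 2) * 1 <= (d + 2) * R" using d R by (intro mult_left_mono) auto
    thus ?thesis using True by (simp add: algebra_simps)
   qed
   also have "... <= R * R" using R by (intro mult_right_mono) auto
   finally have sq: "sqrt (8 * (c + d + 2)) <= R" using R by (intro real_le_lsqrt) (auto simp: power2_eq_square)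
   have "reach 0 y (c + (d + 2) + 2 * ((\<kappa> / 4) * R))" unfolding d_def
   proof (rule reach_of_skeleton_hit[OF c])
    show "2 < norm y" using R by (simp add: R_def)
    show "0 <= \<kappa> / 4 * R" using \<kappa> R by simp
    fix z :: 'a assume "z \<in> cball 0 (sqrt (8 * (c + real DIM('a) + 2)) + confinement_radius 2)"
    hence "z \<in> cball 0 (3 * R)" using sq R by (simp add: d_def)
    thus "U z <= \<kappa> / 4 * R" using R2 R by blast
   qed
   moreover have "d + 2 <= \<kappa> * R / 2" using R(6) \<kappa> by (simp add: field_simps)
   ultimately show ?thesis by (elim reach_mono) (simp add: R_def)
  qed
 qed
qed

lemma skeleton_hit_cost_bounds:
 assumes \<kappa>: "0 < \<kappa>"
 shows "\<exists>R0. \<forall>y. R0 <= norm y --> (\<exists>b. reach 0 y b) \<and>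
  ennreal (exp (- (reach_cost 0 y + \<kappa> * norm y))) <= skeleton_hit (cball y 1) 0 \<and>
  skeleton_hit (cball y 1) 0 <= ennreal (exp (- (reach_cost 0 y - \<kappa> * norm y)))"
proof -
 obtain C R1 where C: "0 <= C" "\<And>y. R1 <= norm y ==> reach 0 y (C * norm y)" using reach_linear by blast
 obtain c where c: "0 <= c" "\<And>y b. reach 0 y b ==> ennreal (exp (- (b + c))) <= skeleton_hit (cball y 1) 0"
  using skeleton_hit_ge_cost by blast
 obtain R2 where R2: "\<And>y c. R2 <= norm y ==> 0 <= c ==> ennreal (exp (- c)) <= skeleton_hit (cball y 1) 0 ==> reach 0 y (c + \<kappa> * norm y)"
  using reach_from_skeleton_hit[OF \<kappa>] by blast
 show ?thesis
 proof (rule exI[of _ "max (max R1 R2) (c / \<kappa>)"], intro allI impI conjI)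
  fix y :: 'a assume y: "max (max R1 R2) (c / \<kappa>) <= norm y"
  have r: "reach 0 y (C * norm y)" using C(2) y by simp
  thus "\<exists>b. reach 0 y b" by blast
  have rc: "reach 0 y (reach_cost 0 y)" by (rule reach_reach_cost[OF r])
  have "c <= \<kappa> * norm y" using y \<kappa> by (simp add: field_simps)
  hence "ennreal (exp (- (reach_cost 0 y + \<kappa> * norm y))) <= ennreal (exp (- (reach_cost 0 y + c)))" by (intro ennreal_leI) simp
  also have low: "... <= skeleton_hit (cball y 1) 0" by (rule c(2)[OF rc])
  finally show "ennreal (exp (- (reach_cost 0 y + \<kappa> * norm y))) <= skeleton_hit (cball y 1) 0" .
  define h where "h = enn2real (skeleton_hit (cball y 1) 0)"
  have h1: "skeleton_hit (cball y 1) 0 <= 1" by (rule skeleton_hit_le_1) simp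
  have h: "skeleton_hit (cball y 1) 0 = ennreal h" unfolding h_def using h1 by (cases "skeleton_hit (cball y 1) 0") (auto simp: top_unique)
  have "ennreal (exp (- (reach_cost 0 y + c))) <= ennreal h" using low h by simp
  hence h0: "0 < h" by (metis exp_gt_zero ennreal_le_iff2 less_le_trans not_le)
  have "h <= 1" using h1 h h0 by simp
  hence "reach 0 y (- ln h + \<kappa> * norm y)" using h0 y h by (intro R2) auto
  hence "reach_cost 0 y <= - ln h + \<kappa> * norm y" by (rule reach_cost_le)
  hence "exp (ln h) <= exp (- (reach_cost 0 y - \<kappa> * norm y))" by simp
  thus "skeleton_hit (cball y 1) 0 <= ennreal (exp (- (reach_cost 0 y - \<kappa> * norm y)))"
   unfolding h using h0 by (intro ennreal_leI) simp
 qed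
qed

lemma neg_log_bounds:
 assumes "ennreal (exp (- b)) <= F" "F <= ennreal (exp (- a))"
 shows "ereal a <= neg_log F" "neg_log F <= ereal b"
proof -
 obtain f where f: "F = ennreal f" "0 <= f" using assms(2) by (cases F) (auto simp: top_unique)
 have fb: "exp (- b) <= f" using assms(1) f by simp
 hence f0: "0 < f" using exp_gt_zero[of "- b"] by linarith
 have fa: "f <= exp (- a)" using assms(2) f by simp
 have nl: "neg_log F = ereal (- ln f)" using f f0 by (simp add: neg_log_def)
 have "ln f <= - a" using fa f0 by (metis ln_exp ln_mono)
 moreover have "- b <= ln f" using fb f0 by (metis exp_gt_zero ln_exp ln_mono)
 ultimately show "ereal a <= neg_log F" "neg_log F <= ereal b" unfolding nl by auto
qed

text \<open>The lower bound of the hitting weight needs only integer times; for the upper bound,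
  hits between integer times are covered by a Gaussian around \<open>y\<close> and its Green
  function.\<close>

lemma travel_cost_bounds:
 assumes \<kappa>: "0 < \<kappa>"
 shows "\<exists>R0. \<forall>y. R0 <= norm y -->
  ereal (reach_cost 0 y - \<kappa> * norm y) <= travel_cost W B U 0 y \<and> travel_cost W B U 0 y <= ereal (reach_cost 0 y + \<kappa> * norm y)"
proof -
 obtain C c where C: "1 <= C" "0 < c" and hit: "\<And>y z. (\<integral>\<^sup>+w. near_hit y (\<lambda>r\<in>rational_times. z + B r w) \<partial>W) <= ennreal (C * exp (- (c * (norm (z - y))\<^sup>2)))"
  using near_hit_tail by blast
 have "\<exists>R0. \<forall>y. R0 <= norm y -->
   (\<Sum>n. iterate n (\<lambda>z. ennreal (C * exp (- (c * (norm (z - y))\<^sup>2)))) 0) <= ennreal (exp (\<kappa> / 2 * norm y)) * skeleton_hit (cball y 1) 0"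
  by (rule gaussian_green_bound[OF sublinear trap_pos traps skeleton_hit_exponential]) (use C \<kappa> in auto)
 then obtain R1 where R1: "\<And>y. R1 <= norm y ==>
   (\<Sum>n. iterate n (\<lambda>z. ennreal (C * exp (- (c * (norm (z - y))\<^sup>2)))) 0) <= ennreal (exp (\<kappa> / 2 * norm y)) * skeleton_hit (cball y 1) 0" by blast
 obtain R2 where R2: "\<And>y. R2 <= norm y ==> ennreal (exp (- (reach_cost 0 y + \<kappa> / 2 * norm y))) <= skeleton_hit (cball y 1) 0 \<and>
  skeleton_hit (cball y 1) 0 <= ennreal (exp (- (reach_cost 0 y - \<kappa> / 2 * norm y)))"
  using skeleton_hit_cost_bounds[of "\<kappa> / 2"] \<kappa> by auto
 show ?thesis
 proof (intro exI[of _ "max R1 R2"] allI impI)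
  fix y :: 'a assume y: "max R1 R2 <= norm y"
  let ?F = "hitting_weight W B U 0 y" and ?h = "skeleton_hit (cball y 1) 0"
  have "ennreal (exp (- (reach_cost 0 y + \<kappa> * norm y))) <= ennreal (exp (- (reach_cost 0 y + \<kappa> / 2 * norm y)))"
   using \<kappa> by (intro ennreal_leI) simp
  also have "... <= ?h" using R2 y by simp
  also have "... <= ?F" unfolding skeleton_hit_def by (rule hitting_weight_ge[OF U_measurable])
  finally have lo: "ennreal (exp (- (reach_cost 0 y + \<kappa> * norm y))) <= ?F" .
  have "?F <= (\<Sum>n. iterate n (\<lambda>z. ennreal (C * exp (- (c * (norm (z - y))\<^sup>2)))) 0)" by (rule hitting_weight_le_green[OF hit])
  also have "... <= ennreal (exp (\<kappa> / 2 * norm y)) * ?h" using R1 y by simp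
  also have "... <= ennreal (exp (\<kappa> / 2 * norm y)) * ennreal (exp (- (reach_cost 0 y - \<kappa> / 2 * norm y)))"
   using R2 y by (intro mult_left_mono) auto
  also have "... = ennreal (exp (- (reach_cost 0 y - \<kappa> * norm y)))" by (simp add: ennreal_mult[symmetric] exp_add[symmetric])
  finally have up: "?F <= ennreal (exp (- (reach_cost 0 y - \<kappa> * norm y)))" .
  show "ereal (reach_cost 0 y - \<kappa> * norm y) <= travel_cost W B U 0 y \<and> travel_cost W B U 0 y <= ereal (reach_cost 0 y + \<kappa> * norm y)"
   unfolding travel_cost_def using neg_log_bounds[OF lo up] by simp
 qed
qed

lemma green_function_bounds:
 assumes \<kappa>: "0 < \<kappa>"
 shows "\<exists>R0. \<forall>y. R0 <= norm y -->
  ereal (reach_cost 0 y - \<kappa> * norm y) <= neg_log (green_function W B U 0 y) \<and> neg_log (green_function W B U 0 y) <= ereal (reach_cost 0 y + \<kappa> * norm y)"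
proof -
 have "\<exists>R0. \<forall>y. R0 <= norm y -->
   (\<Sum>n. iterate n (\<lambda>z. ennreal (1 * exp (- (1 / 4 * (norm (z - y))\<^sup>2)))) 0) <= ennreal (exp (\<kappa> / 4 * norm y)) * skeleton_hit (cball y 1) 0"
  by (rule gaussian_green_bound[OF sublinear trap_pos traps skeleton_hit_exponential]) (use \<kappa> in auto)
 then obtain R1 where R1: "\<And>y. R1 <= norm y ==>
   (\<Sum>n. iterate n (\<lambda>z. ennreal (exp (- (1 / 4 * (norm (z - y))\<^sup>2)))) 0) <= ennreal (exp (\<kappa> / 4 * norm y)) * skeleton_hit (cball y 1) 0" by auto
 obtain R2 where R2: "\<And>y. R2 <= norm y ==> ennreal (exp (- (reach_cost 0 y + \<kappa> / 2 * norm y))) <= skeleton_hit (cball y 1) 0 \<and>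
  skeleton_hit (cball y 1) 0 <= ennreal (exp (- (reach_cost 0 y - \<kappa> / 2 * norm y)))"
  using skeleton_hit_cost_bounds[of "\<kappa> / 2"] \<kappa> by auto
 obtain C0' R3 where C0': "\<And>y. R3 <= norm y ==> ennreal (exp (- (C0' * norm y))) <= skeleton_hit (cball y 1) 0"
  using skeleton_hit_exponential by blast
 obtain R4 where R4: "\<And>R w. R4 <= R ==> w \<in> cball 0 (3 * R) ==> U w <= (\<kappa> / 8) * R" using sublinear[of "\<kappa> / 8"] \<kappa> by (metis divide_pos_pos zero_less_numeral)
 define D where "D = 2 * (4 * real DIM('a)) ^ DIM('a)"
 have D: "0 < D" by (simp add: D_def)
 define C0 where "C0 = max 0 C0'"
 define m where "m = (4 * pi) powr (- real DIM('a) / 2) * exp (- 1 / 2) / 2"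
 have m: "0 < m" by (simp add: m_def)
 define R0 where "R0 = max (max (max R1 R2) (max R3 R4)) (max (max 2 (confinement_radius 2)) (max (max (16 * C0) (16 * ln D)) (max (4 * ln 2 / \<kappa>) (- 4 * ln m / \<kappa>))))"
 show ?thesis
 proof (intro exI[of _ R0] allI impI)
  fix y :: 'a assume y: "R0 <= norm y"
  define R where "R = norm y"
  have R: "R1 <= R" "R2 <= R" "R3 <= R" "R4 <= R" "2 <= R" "confinement_radius 2 <= R" "16 * C0 <= R" "16 * ln D <= R"
   "4 * ln 2 / \<kappa> <= R" "- 4 * ln m / \<kappa> <= R" using y unfolding R0_def R_def max.bounded_iff by blast+
  let ?F = "green_function W B U 0 y" and ?h = "skeleton_hit (cball y 1) 0"
  have lm: "- ln m <= \<kappa> / 4 * R" "ln 2 <= \<kappa> / 4 * R" using R(9,10) \<kappa> by (simp_all add: field_simps)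
  let ?A = "reach_cost 0 y + \<kappa> / 2 * R"
  let ?C = "2 * (\<kappa> / 8 * R)"
  have "ennreal (exp (- (reach_cost 0 y + \<kappa> * R))) <= ennreal (m * exp (- ?C) * exp (- ?A))"
  proof (rule ennreal_leI)
   have "m = exp (ln m)" using m by simp
   hence "m * exp (- ?C) * exp (- ?A) = exp (ln m + - ?C + - ?A)"
    by (simp only: exp_add)
   moreover have "- (reach_cost 0 y + \<kappa> * R) <= ln m + - ?C + - ?A"
    using lm(1) by (simp add: field_simps)
   ultimately show "exp (- (reach_cost 0 y + \<kappa> * R)) <= m * exp (- ?C) * exp (- ?A)"
    by simp
  qed
  also have "... = ennreal (m * exp (- ?C)) * ennreal (exp (- ?A))"
   using m by (intro ennreal_mult) auto
  also have "... <= ennreal (m * exp (- ?C)) * ?h" using R2[of y] R(2) unfolding R_def by (intro mult_left_mono) auto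
  also have "... = ennreal ((4 * pi) powr (- real DIM('a) / 2) * exp (- 1 / 2) * exp (- ?C) / 2) * ?h"
   unfolding m_def by (simp add: mult_ac)
  also have "... <= ?F"
  proof (rule green_function_ge)
   show "1 < norm y" using R by (simp add: R_def)
   show "0 <= \<kappa> / 8 * R" using \<kappa> R by simp
   fix z assume "z \<in> cball y (1 + confinement_radius 2)"
   hence "norm z <= 3 * R" using R norm_triangle_sub[of z y] by (simp add: dist_norm norm_minus_commute R_def)
   thus "U z <= \<kappa> / 8 * R" using R4 R by simp
  qed
  finally have lo: "ennreal (exp (- (reach_cost 0 y + \<kappa> * R))) <= ?F" .
  \<comment> \<open>The contribution of times below 2 is Gaussian in \<open>R\<close>, hence smaller
    than the hitting weight, which decays at most exponentially.\<close>
  have "D * exp (- (R\<^sup>2 / 8)) <= exp (- (C0' * R))"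
  proof -
   have "D = exp (ln D)" using D by simp
   hence "D * exp (- (R\<^sup>2 / 8)) = exp (ln D + - (R\<^sup>2 / 8))" by (simp only: exp_add)
   moreover have "C0 * R <= R\<^sup>2 / 16"
   proof -
    have "16 * C0 * R <= R * R" using R by (intro mult_right_mono) auto
    thus ?thesis by (simp add: power2_eq_square)
   qed
   moreover have "ln D <= R\<^sup>2 / 16"
   proof -
    have "R * 1 <= R * R" using R by (intro mult_left_mono) auto
    thus ?thesis using R(8) by (simp add: power2_eq_square)
   qed
   moreover have "C0' * R <= C0 * R" unfolding C0_def using R by (intro mult_right_mono) auto
   ultimately show ?thesis by simp
  qed
  hence short: "ennreal (2 * ((4 * real DIM('a)) ^ DIM('a) * exp (- ((norm y)\<^sup>2 / 8)))) <= ?h"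
   using C0'[of y] R(3) unfolding D_def R_def by (auto simp: mult.assoc intro: order_trans[OF ennreal_leI])
  let ?B = "reach_cost 0 y - \<kappa> / 2 * R"
  have "?F <= ennreal (2 * ((4 * real DIM('a)) ^ DIM('a) * exp (- ((norm y)\<^sup>2 / 8)))) +
    (\<Sum>n. iterate n (\<lambda>z. ennreal (exp (- (1 / 4 * (norm (z - y))\<^sup>2)))) 0)"
   by (rule green_function_le) (use R in \<open>simp add: R_def\<close>)
  also have "... <= ?h + ennreal (exp (\<kappa> / 4 * R)) * ?h" using R1[of y] R(1) unfolding R_def by (intro add_mono short) auto
  also have "... <= ennreal (exp (\<kappa> / 4 * R)) * ?h + ennreal (exp (\<kappa> / 4 * R)) * ?h"
  proof (rule add_right_mono)
   have "1 <= ennreal (exp (\<kappa> / 4 * R))" using \<kappa> R by simp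
   from mult_right_mono[OF this, of ?h] show "?h <= ennreal (exp (\<kappa> / 4 * R)) * ?h" by simp
  qed
  also have "... = ennreal (2 * exp (\<kappa> / 4 * R)) * ?h" by (simp add: mult_2[symmetric] ennreal_mult mult.assoc)
  also have "... <= ennreal (2 * exp (\<kappa> / 4 * R)) * ennreal (exp (- ?B))"
   using R2[of y] R(2) unfolding R_def by (intro mult_left_mono) auto
  also have "... = ennreal (2 * exp (\<kappa> / 4 * R) * exp (- ?B))" by (intro ennreal_mult[symmetric]) auto
  also have "... <= ennreal (exp (- (reach_cost 0 y - \<kappa> * R)))"
  proof (rule ennreal_leI)
   have "2 * exp (\<kappa> / 4 * R) * exp (- ?B) = exp (ln 2 + \<kappa> / 4 * R + - ?B)"
    by (simp only: exp_add) simp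
   moreover have "ln 2 + \<kappa> / 4 * R + - ?B <= - (reach_cost 0 y - \<kappa> * R)" using lm(2) by argo
   ultimately show "2 * exp (\<kappa> / 4 * R) * exp (- ?B) <= exp (- (reach_cost 0 y - \<kappa> * R))"
    by (simp only: exp_le_cancel_iff)
  qed
  finally have up: "?F <= ennreal (exp (- (reach_cost 0 y - \<kappa> * R)))" .
  show "ereal (reach_cost 0 y - \<kappa> * norm y) <= neg_log ?F \<and> neg_log ?F <= ereal (reach_cost 0 y + \<kappa> * norm y)"
   using neg_log_bounds[OF lo up] unfolding R_def by simp
 qed
qed

end

section \<open>Averages along random segments\<close>

lemma powr_inverse_power:
 assumes "0 <= x" "0 < n"
 shows "(x powr (1 / real n)) ^ n = x" using assms by (cases "x = 0") (auto simp: powr_power)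

lemma nn_integral_affine:
 fixes f :: "'a::euclidean_space => ennreal"
 assumes [measurable]: "f \<in> borel_measurable borel" and c: "c \<noteq> 0"
 shows "ennreal (\<bar>c\<bar> ^ DIM('a)) * (\<L> y. f (b + c *\<^sub>R y)) = (\<L> y. f y)"
 by (subst (2) lborel_affine[OF c, of b]) (simp add: nn_integral_density nn_integral_distr nn_integral_cmult)

lemma nn_integral_unit_interval_reflect:
 assumes [measurable]: "g \<in> borel_measurable borel"
 shows "(\<integral>\<^sup>+t\<in>{0..1}. g (1 - t) \<partial>lborel) = (\<integral>\<^sup>+t\<in>{0..1::real}. g t \<partial>lborel)"
proof -
 have "(\<L> t. g t * indicator {0..1::real} t) = ennreal \<bar>- 1\<bar> * (\<L> t. g (1 + (- 1) * t) * indicator {0..1} (1 + (- 1) * t))"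
  by (rule nn_integral_real_affine) auto
 also have "... = (\<L> t. g (1 - t) * indicator {0..1} t)" by (auto intro!: nn_integral_cong simp: indicator_def)
 finally show ?thesis ..
qed

text \<open>The square makes the integral linear in \<open>a\<close>. The first power, as in
  dimension one, would leave a logarithm.\<close>

lemma nn_integral_min_square_le:
 fixes a :: real
 assumes a: "0 <= a"
 shows "(\<L> t. ennreal (min 1 ((a / t)\<^sup>2)) * indicator {0<..1} t) <= ennreal (2 * a)"
proof (cases "a = 0")
 case False
 hence a: "0 < a" using a by simp
 have "(\<L> t. ennreal (min 1 ((a / t)\<^sup>2)) * indicator {0<..1} t)
   <= (\<L> t. indicator {0..a} t + ennreal (a\<^sup>2 / t\<^sup>2) * indicator {a..} t)"
 proof (intro nn_integral_mono)
  fix t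
  consider "t <= 0" | "0 < t" "t <= a" | "a < t" by linarith
  thus "ennreal (min 1 ((a / t)\<^sup>2)) * indicator {0<..1} t <= indicator {0..a} t + ennreal (a\<^sup>2 / t\<^sup>2) * indicator {a..} t"
  proof cases
   case 2
   have "ennreal (min 1 ((a / t)\<^sup>2)) <= ennreal 1" by (rule ennreal_leI) simp
   thus ?thesis using 2 by (auto simp: indicator_def add_increasing2)
  next
   case 3
   have "ennreal (min 1 ((a / t)\<^sup>2)) <= ennreal (a\<^sup>2 / t\<^sup>2)" by (rule ennreal_leI) (simp add: power_divide)
   thus ?thesis using 3 by (auto simp: indicator_def)
  qed simp
 qed
 also have "... = (\<L> t. indicator {0..a} t) + (\<L> t. ennreal (a\<^sup>2 / t\<^sup>2) * indicator {a..} t)" by (rule nn_integral_add) auto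
 also have "(\<L> t. ennreal (a\<^sup>2 / t\<^sup>2) * indicator {a..} t) = ennreal (0 - - (a\<^sup>2 / a))"
 proof (rule nn_integral_FTC_atLeast[where F="\<lambda>t. - (a\<^sup>2 / t)" and T=0])
  fix t assume "a <= t"
  thus "((\<lambda>t. - (a\<^sup>2 / t)) has_real_derivative a\<^sup>2 / t\<^sup>2) (at t)"
   using a by (auto intro!: derivative_eq_intros simp: power2_eq_square)
 next
  have "((\<lambda>t. - (a\<^sup>2 * inverse t)) \<longlongrightarrow> - (a\<^sup>2 * 0)) at_top"
   by (intro tendsto_minus tendsto_mult_left tendsto_inverse_0_at_top filterlim_ident)
  thus "((\<lambda>t. - (a\<^sup>2 / t)) \<longlongrightarrow> 0) at_top" by (simp add: divide_inverse)
 qed auto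
 also have "(\<L> t. indicator {0..a} t) = ennreal a" using a by simp
 also have "0 - - (a\<^sup>2 / a) = a" using a by (simp add: power2_eq_square)
 finally show ?thesis using a by (simp add: ennreal_plus[symmetric] del: ennreal_plus)
qed simp

lemma segment_in_ball:
 assumes "p \<in> ball 0 R" "y \<in> ball 0 R" "t \<in> {0..1::real}"
 shows "p + t *\<^sub>R (y - p) \<in> ball (0::'a::euclidean_space) R"
proof -
 have "(1 - t) *\<^sub>R p + t *\<^sub>R y \<in> ball 0 R" using assms by (intro convexD[OF convex_ball]) auto
 thus ?thesis by (simp add: algebra_simps)
qed

text \<open>The time at parameter \<open>t\<close> sees \<open>E\<close> through a ball shrunk by \<open>t\<close>.\<close>

lemma segment_average_indicator:
 fixes p :: "'a::euclidean_space"
 assumes d: "2 <= DIM('a)" and E [measurable]: "E \<in> sets borel"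
  and p: "p \<in> ball 0 R" and D: "D \<in> sets borel" "D \<subseteq> ball 0 R" "emeasure lborel D = ennreal \<delta>" "0 < \<delta>"
  and a: "0 <= a" "emeasure lborel (E \<inter> ball 0 R) = ennreal (a ^ DIM('a) * \<delta>)"
 shows "(\<integral>\<^sup>+t\<in>{0..1}. (\<integral>\<^sup>+y\<in>D. indicator E (p + t *\<^sub>R (y - p)) \<partial>lborel) \<partial>lborel) <= ennreal (\<delta> * (2 * a))"
proof -
 have D' [measurable]: "D \<in> sets borel" by fact
 let ?A = "\<lambda>t y. p + t *\<^sub>R (y - p)"
 have inner: "(\<integral>\<^sup>+y\<in>D. indicator E (?A t y) \<partial>lborel) <= ennreal \<delta> * ennreal (min 1 ((a / t)\<^sup>2))" if t: "t \<in> {0<..1}" for t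
 proof -
  have t0: "0 < t" using t by simp
  have m: "(\<lambda>y. indicator (E \<inter> ball 0 R) y :: ennreal) \<in> borel_measurable borel" by (intro borel_measurable_indicator) auto
  have 1: "(\<integral>\<^sup>+y\<in>D. indicator E (?A t y) \<partial>lborel) <= ennreal \<delta>"
  proof -
   have "(\<integral>\<^sup>+y\<in>D. indicator E (?A t y) \<partial>lborel) <= (\<L> y. indicator D y)"
    by (intro nn_integral_mono) (auto simp: indicator_def)
   thus ?thesis using D by simp
  qed
  \<comment> \<open>The map from \<open>y\<close> to \<open>p + t (y - p)\<close> has Jacobian
    \<open>t ^ d\<close> and keeps \<open>D\<close> inside the ball by convexity.\<close>
  have "ennreal (t ^ DIM('a)) * (\<integral>\<^sup>+y\<in>D. indicator E (?A t y) \<partial>lborel)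
   <= ennreal (\<bar>t\<bar> ^ DIM('a)) * (\<L> y. indicator (E \<inter> ball 0 R) ((p - t *\<^sub>R p) + t *\<^sub>R y))" using t0
  proof (intro mult_mono nn_integral_mono)
   fix y
   have "p + t *\<^sub>R (y - p) \<in> ball 0 R" if "y \<in> D" using segment_in_ball[OF p] D t that by auto
   thus "indicator E (?A t y) * indicator D y <= (indicator (E \<inter> ball 0 R) ((p - t *\<^sub>R p) + t *\<^sub>R y) :: ennreal)"
    by (auto simp: indicator_def algebra_simps)
  qed auto
  also have "... = (\<L> y. indicator (E \<inter> ball 0 R) y)" using t0 by (intro nn_integral_affine[OF m]) simp
  also have "... = ennreal (a ^ DIM('a) * \<delta>)" using a by simp
  finally have "ennreal (1 / t ^ DIM('a)) * (ennreal (t ^ DIM('a)) * (\<integral>\<^sup>+y\<in>D. indicator E (?A t y) \<partial>lborel)) <= ennreal (1 / t ^ DIM('a)) * ennreal (a ^ DIM('a) * \<delta>)"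
   by (rule mult_left_mono) simp
  moreover have "ennreal (1 / t ^ DIM('a)) * ennreal (t ^ DIM('a)) = 1" using t0 by (simp add: ennreal_mult[symmetric])
  moreover have "ennreal (1 / t ^ DIM('a)) * ennreal (a ^ DIM('a) * \<delta>) = ennreal (\<delta> * (a / t) ^ DIM('a))"
   using t0 a D by (subst ennreal_mult[symmetric]) (auto simp: power_divide)
  ultimately have 2: "(\<integral>\<^sup>+y\<in>D. indicator E (?A t y) \<partial>lborel) <= ennreal (\<delta> * (a / t) ^ DIM('a))"
   by (simp add: mult.assoc[symmetric])
  show ?thesis
  proof (cases "1 <= (a / t)\<^sup>2")
   case True
   thus ?thesis using 1 by (simp add: min_def)
  next
   case False
   have at: "0 <= a / t" using a t0 by simp
   have "a / t <= 1" using False at by (meson one_le_power linear)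
   \<comment> \<open>Here the dimension is at least two: a base below 1 allows the exponent to be
     lowered to 2.\<close>
   hence "(a / t) ^ DIM('a) <= (a / t) ^ 2" using at d by (intro power_decreasing) auto
   hence "\<delta> * (a / t) ^ DIM('a) <= \<delta> * min 1 ((a / t)\<^sup>2)" using False D by (intro mult_left_mono) auto
   hence "ennreal (\<delta> * (a / t) ^ DIM('a)) <= ennreal \<delta> * ennreal (min 1 ((a / t)\<^sup>2))"
    using D by (simp add: ennreal_mult[symmetric] ennreal_leI)
   with 2 show ?thesis by (rule order_trans)
  qed
 qed
 have "(\<integral>\<^sup>+t\<in>{0..1}. (\<integral>\<^sup>+y\<in>D. indicator E (?A t y) \<partial>lborel) \<partial>lborel)
  <= (\<L> t. ennreal \<delta> * (ennreal (min 1 ((a / t)\<^sup>2)) * indicator {0<..1} t))"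
 proof (rule nn_integral_mono_AE, rule AE_mp[OF AE_lborel_singleton[of 0]], intro AE_I2 impI)
  fix t :: real assume "t \<noteq> 0"
  thus "(\<integral>\<^sup>+y\<in>D. indicator E (?A t y) \<partial>lborel) * indicator {0..1} t \<le>
    ennreal \<delta> * (ennreal (min 1 ((a / t)\<^sup>2)) * indicator {0<..1} t)"
   using inner[of t] by (cases "t \<in> {0..1}") (auto simp del: min_def)
 qed
 also have "... = ennreal \<delta> * (\<L> t. ennreal (min 1 ((a / t)\<^sup>2)) * indicator {0<..1} t)" by (rule nn_integral_cmult) measurable
 also have "... <= ennreal \<delta> * ennreal (2 * a)" by (intro mult_left_mono nn_integral_min_square_le a) simp
 also have "... = ennreal (\<delta> * (2 * a))" using D a by (simp add: ennreal_mult)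
 finally show ?thesis .
qed

text \<open>The dyadic layer-cake bound of \<open>x\<close> above level \<open>2 ^ K\<close>; low
  levels are left out because only tails can be made small.\<close>

definition dyadic_excess :: "nat => real => ennreal" where
 "dyadic_excess K x = (\<Sum>k. ennreal (2 ^ (K + k)) * indicator {2 ^ (K + k)<..} x)"

lemma measurable_dyadic_excess [measurable]: "dyadic_excess K \<in> borel_measurable borel" unfolding dyadic_excess_def[abs_def] by measurable

lemma le_dyadic_excess: "ennreal x <= ennreal (2 ^ K) + dyadic_excess K x"
proof -
 have "\<exists>n. x <= 2 ^ (K + n)"
 proof -
  obtain n where "x < 2 ^ n" using real_arch_pow[of 2 x] by auto
  also have "(2::real) ^ n <= 2 ^ (K + n)" by (rule power_increasing) auto
  finally show ?thesis by (auto intro: less_imp_le)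
 qed
 define n where "n = (LEAST n. x <= 2 ^ (K + n))"
 have n: "x <= 2 ^ (K + n)" unfolding n_def by (rule LeastI_ex) fact
 have l: "2 ^ (K + k) < x" if "k < n" for k using that not_less_Least unfolding n_def by (metis not_le)
 have "(2::real) ^ (K + n) = 2 ^ K + (\<Sum>k<n. 2 ^ (K + k))" by (induction n) (simp_all add: add_ac)
 hence "ennreal x <= ennreal (2 ^ K + (\<Sum>k<n. 2 ^ (K + k)))" using n by (intro ennreal_leI) simp
 also have "... = ennreal (2 ^ K) + (\<Sum>k<n. ennreal (2 ^ (K + k)))" by (subst ennreal_plus) (auto intro!: sum_nonneg)
 also have "(\<Sum>k<n. ennreal (2 ^ (K + k))) = (\<Sum>k<n. ennreal (2 ^ (K + k)) * indicator {2 ^ (K + k)<..} x)" using l by (intro sum.cong) auto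
 also have "... <= dyadic_excess K x" unfolding dyadic_excess_def by (rule sum_le_suminf) auto
 finally show ?thesis by (simp add: add_left_mono)
qed

text \<open>The indicator estimate for each layer, summed. The root with exponent
  \<open>1 / d\<close> is the source of the Lorentz condition.\<close>

lemma segment_average:
 fixes p :: "'a::euclidean_space" and s :: "'a => real" and K :: nat
 assumes d: "2 <= DIM('a)" and s [measurable]: "s \<in> borel_measurable borel"
  and p: "p \<in> ball 0 R" and D: "D \<in> sets borel" "D \<subseteq> ball 0 R" "emeasure lborel D = ennreal \<delta>" "0 < \<delta>"
 defines "m \<equiv> \<lambda>k. measure lborel ({v. 2 ^ (K + k) < s v} \<inter> ball 0 R)"
 shows "(\<integral>\<^sup>+y\<in>D. (\<integral>\<^sup>+t\<in>{0..1}. ennreal (s (p + t *\<^sub>R (y - p))) \<partial>lborel) \<partial>lborel)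
  <= ennreal \<delta> * (ennreal (2 ^ K) + (\<Sum>k. ennreal (2 ^ (K + k)) * ennreal (2 * (m k / \<delta>) powr (1 / real DIM('a)))))"
proof -
 have D' [measurable]: "D \<in> sets borel" by fact
 let ?q = "\<lambda>t y. p + t *\<^sub>R (y - p)"
 have em: "emeasure lborel ({v. 2 ^ (K + k) < s v} \<inter> ball 0 R) = ennreal (m k)" for k unfolding m_def
 proof (rule emeasure_eq_ennreal_measure)
  have "emeasure lborel ({v. 2 ^ (K + k) < s v} \<inter> ball 0 R) <= emeasure lborel (ball (0::'a) R)" by (rule emeasure_mono) auto
  also have "... < \<infinity>" by (rule emeasure_lborel_ball_finite)
  finally show "emeasure lborel ({v. 2 ^ (K + k) < s v} \<inter> ball 0 R) \<noteq> top" by simp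
 qed
 have layer: "(\<integral>\<^sup>+t\<in>{0..1}. (\<integral>\<^sup>+y\<in>D. indicator {2 ^ (K + k)<..} (s (?q t y)) \<partial>lborel) \<partial>lborel) <= ennreal \<delta> * ennreal (2 * (m k / \<delta>) powr (1 / real DIM('a)))" for k
 proof -
  let ?E = "{v. 2 ^ (K + k) < s v}" and ?a = "(m k / \<delta>) powr (1 / real DIM('a))"
  have "0 <= m k / \<delta>" using D by (simp add: m_def)
  hence "?a ^ DIM('a) = m k / \<delta>" by (rule powr_inverse_power) simp
  hence "?a ^ DIM('a) * \<delta> = m k" using D by simp
  hence "(\<integral>\<^sup>+t\<in>{0..1}. (\<integral>\<^sup>+y\<in>D. indicator ?E (?q t y) \<partial>lborel) \<partial>lborel) <= ennreal (\<delta> * (2 * ?a))"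
   by (intro segment_average_indicator[OF d _ p D]) (auto simp: em)
  also have "... = ennreal \<delta> * ennreal (2 * ?a)" using D by (simp add: ennreal_mult)
  finally show ?thesis by (simp add: indicator_def)
 qed
 have ind: "(\<L> y. (\<L> t. h (s (?q t y)) * indicator {0..1::real} t) * indicator D y)
   = (\<L> t. (\<L> y. h (s (?q t y)) * indicator D y) * indicator {0..1} t)"
  if [measurable]: "h \<in> borel_measurable borel" for h :: "real => ennreal"
 proof -
  have "(\<L> y. (\<L> t. h (s (?q t y)) * indicator {0..1::real} t) * indicator D y)
    = (\<L> y. (\<L> t. h (s (?q t y)) * indicator {0..1::real} t * indicator D y))"
   by (intro nn_integral_cong nn_integral_multc[symmetric]) measurable
  also have "... = (\<L> t. (\<L> y. h (s (?q t y)) * indicator {0..1::real} t * indicator D y))" by (rule lborel_pair.Fubini') measurable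
  also have "... = (\<L> t. (\<L> y. h (s (?q t y)) * indicator D y * indicator {0..1::real} t))" by (intro nn_integral_cong) (simp add: mult_ac)
  also have "... = (\<L> t. (\<L> y. h (s (?q t y)) * indicator D y) * indicator {0..1} t)" by (intro nn_integral_cong nn_integral_multc) measurable
  finally show ?thesis .
 qed
 let ?e = "\<lambda>x. ennreal (2 ^ K) + dyadic_excess K x"
 have "(\<integral>\<^sup>+y\<in>D. (\<integral>\<^sup>+t\<in>{0..1}. ennreal (s (?q t y)) \<partial>lborel) \<partial>lborel)
  <= (\<integral>\<^sup>+y\<in>D. (\<integral>\<^sup>+t\<in>{0..1::real}. ?e (s (?q t y)) \<partial>lborel) \<partial>lborel)"
  by (intro nn_integral_mono mult_right_mono le_dyadic_excess) auto
 also have "... = (\<integral>\<^sup>+t\<in>{0..1}. (\<integral>\<^sup>+y\<in>D. ?e (s (?q t y)) \<partial>lborel) \<partial>lborel)" by (rule ind) measurable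
 also have "... = (\<integral>\<^sup>+t\<in>{0..1}. (\<L> y. ennreal (2 ^ K) * indicator D y) + (\<integral>\<^sup>+y\<in>D. dyadic_excess K (s (?q t y)) \<partial>lborel) \<partial>lborel)"
  by (intro nn_integral_cong arg_cong2[of _ _ _ _ "(*)"] refl, subst nn_integral_add[symmetric]) (auto simp: distrib_right)
 also have "... = (\<L> t. (ennreal (2 ^ K) * ennreal \<delta>) * indicator {0..1::real} t + (\<integral>\<^sup>+y\<in>D. dyadic_excess K (s (?q t y)) \<partial>lborel) * indicator {0..1} t)"
  using D by (simp add: nn_integral_cmult_indicator distrib_right)
 also have "... = ennreal (2 ^ K) * ennreal \<delta> + (\<integral>\<^sup>+t\<in>{0..1}. (\<integral>\<^sup>+y\<in>D. dyadic_excess K (s (?q t y)) \<partial>lborel) \<partial>lborel)"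
  by (subst nn_integral_add) (auto simp: nn_integral_cmult_indicator)
 also have "(\<integral>\<^sup>+t\<in>{0..1}. (\<integral>\<^sup>+y\<in>D. dyadic_excess K (s (?q t y)) \<partial>lborel) \<partial>lborel)
  = (\<L> t. (\<Sum>k. ennreal (2 ^ (K + k)) * ((\<integral>\<^sup>+y\<in>D. indicator {2 ^ (K + k)<..} (s (?q t y)) \<partial>lborel) * indicator {0..1::real} t)))"
 proof (intro nn_integral_cong)
  fix t :: real
  have "(\<integral>\<^sup>+y\<in>D. dyadic_excess K (s (?q t y)) \<partial>lborel) = (\<L> y. (\<Sum>k. ennreal (2 ^ (K + k)) * (indicator {2 ^ (K + k)<..} (s (?q t y)) * indicator D y)))"
   unfolding dyadic_excess_def by (simp add: ennreal_suminf_multc[symmetric] mult.assoc)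
  also have "... = (\<Sum>k. \<L> y. ennreal (2 ^ (K + k)) * (indicator {2 ^ (K + k)<..} (s (?q t y)) * indicator D y))"
   by (rule nn_integral_suminf) measurable
  also have "... = (\<Sum>k. ennreal (2 ^ (K + k)) * (\<integral>\<^sup>+y\<in>D. indicator {2 ^ (K + k)<..} (s (?q t y)) \<partial>lborel))"
   by (intro suminf_cong nn_integral_cmult) measurable
  finally show "(\<integral>\<^sup>+y\<in>D. dyadic_excess K (s (?q t y)) \<partial>lborel) * indicator {0..1} t =
   (\<Sum>k. ennreal (2 ^ (K + k)) * ((\<integral>\<^sup>+y\<in>D. indicator {2 ^ (K + k)<..} (s (?q t y)) \<partial>lborel) * indicator {0..1} t))"
   by (simp add: ennreal_suminf_multc[symmetric] mult.assoc)
 qed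
 also have "... = (\<Sum>k. \<L> t. ennreal (2 ^ (K + k)) * ((\<integral>\<^sup>+y\<in>D. indicator {2 ^ (K + k)<..} (s (?q t y)) \<partial>lborel) * indicator {0..1::real} t))"
  by (rule nn_integral_suminf) measurable
 also have "... = (\<Sum>k. ennreal (2 ^ (K + k)) * (\<integral>\<^sup>+t\<in>{0..1}. (\<integral>\<^sup>+y\<in>D. indicator {2 ^ (K + k)<..} (s (?q t y)) \<partial>lborel) \<partial>lborel))"
  by (intro suminf_cong nn_integral_cmult) measurable
 also have "... <= (\<Sum>k. ennreal (2 ^ (K + k)) * (ennreal \<delta> * ennreal (2 * (m k / \<delta>) powr (1 / real DIM('a)))))"
  by (intro suminf_le summableI mult_left_mono layer) auto
 also have "... = ennreal \<delta> * (\<Sum>k. ennreal (2 ^ (K + k)) * ennreal (2 * (m k / \<delta>) powr (1 / real DIM('a))))"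
  by (simp add: mult.left_commute[of _ "ennreal \<delta>"])
 finally show ?thesis by (simp add: distrib_left mult.commute add_left_mono)
qed

text \<open>Lets line integrals in an abstract one-dimensional space be computed as integrals over
  the reals.\<close>

lemma lborel_line:
 assumes d: "DIM('a::euclidean_space) = 1" and e: "e \<in> (Basis :: 'a set)"
 shows "distr lborel borel (\<lambda>t. t *\<^sub>R e) = (lborel :: 'a measure)"
proof -
 have B: "(Basis :: 'a set) = {e}" using d e by (metis card_1_singletonE singletonD)
 have ee: "e \<bullet> e = 1" using e by (simp add: inner_Basis)
 have rep: "x = (x \<bullet> e) *\<^sub>R e" for x :: 'a using euclidean_representation[of x] unfolding B by simp
 have "lborel = distr lborel borel (\<lambda>t. t *\<^sub>R e)"
 proof (rule lborel_eqI)
  fix l u :: 'a assume lu: "\<And>b. b \<in> Basis ==> l \<bullet> b <= u \<bullet> b"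
  have "(\<lambda>t. t *\<^sub>R e) -` box l u \<inter> space lborel = {l \<bullet> e<..<u \<bullet> e}" unfolding box_def B using ee by auto
  thus "emeasure (distr lborel borel (\<lambda>t. t *\<^sub>R e)) (box l u) = ennreal (\<Prod>b\<in>Basis. (u - l) \<bullet> b)"
   using lu[OF e] unfolding B by (subst emeasure_distr) (auto simp: inner_diff_left)
 qed simp
 thus ?thesis ..
qed

lemma line_segment_integral_le:
 fixes f :: "'a::euclidean_space => ennreal"
 assumes d: "DIM('a) = 1" and [measurable]: "f \<in> borel_measurable borel"
  and z: "z \<in> ball 0 R" "x \<in> ball 0 R"
 shows "ennreal (dist z x) * (\<integral>\<^sup>+t\<in>{0..1::real}. f (z + t *\<^sub>R (x - z)) \<partial>lborel) <= (\<integral>\<^sup>+v\<in>ball 0 R. f v \<partial>lborel)"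
proof (cases "z = x")
 case False
 obtain e where B: "(Basis :: 'a set) = {e}" using d by (metis card_1_singletonE)
 have e: "e \<in> Basis" unfolding B by simp
 define c where "c = (x - z) \<bullet> e"
 have xz: "x - z = c *\<^sub>R e" using euclidean_representation[of "x - z"] unfolding B c_def by simp
 have c: "c \<noteq> 0" using False xz by auto
 have dc: "dist z x = \<bar>c\<bar>" using xz e by (metis dist_commute dist_norm mult.right_neutral norm_Basis norm_scaleR)
 let ?g = "\<lambda>v. f v * indicator (ball 0 R) v"
 have gm [measurable]: "?g \<in> borel_measurable borel" by (intro borel_measurable_times_ennreal borel_measurable_indicator assms(2)) auto
 have "(\<integral>\<^sup>+t\<in>{0..1::real}. f (z + t *\<^sub>R (x - z)) \<partial>lborel) <= (\<L> t. ?g (z + (0 + c * t) *\<^sub>R e))"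
 proof (intro nn_integral_mono)
  fix t :: real
  have "z + t *\<^sub>R (x - z) \<in> ball 0 R" if "t \<in> {0..1}" using segment_in_ball[OF z that] .
  thus "f (z + t *\<^sub>R (x - z)) * indicator {0..1} t <= ?g (z + (0 + c * t) *\<^sub>R e)"
   unfolding xz by (auto simp: indicator_def mult.commute)
 qed
 hence "ennreal (dist z x) * (\<integral>\<^sup>+t\<in>{0..1::real}. f (z + t *\<^sub>R (x - z)) \<partial>lborel) <= ennreal \<bar>c\<bar> * (\<L> t. ?g (z + (0 + c * t) *\<^sub>R e))"
  unfolding dc by (rule mult_left_mono) simp
 also have "... = (\<L> t. ?g (z + t *\<^sub>R e))" by (rule nn_integral_real_affine[OF _ c, symmetric]) measurable
 also have "... = (\<integral>\<^sup>+v. ?g (z + v) \<partial>distr lborel borel (\<lambda>t. t *\<^sub>R e))" by (subst nn_integral_distr) auto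
 also have "... = (\<L> v. ?g v)" unfolding lborel_line[OF d e] by (rule nn_integral_lborel_shift) fact
 finally show ?thesis .
qed simp

lemma AE_line_segment:
 assumes d: "DIM('a::euclidean_space) = 1" and P: "AE v in lborel. P (v :: 'a)"
  and zx: "z \<noteq> x"
 shows "AE t in lborel. t \<in> {0..1::real} --> P (z + t *\<^sub>R (x - z))"
proof -
 obtain N where N: "{v \<in> space lborel. \<not> P v} \<subseteq> N" "emeasure lborel N = 0" "N \<in> sets lborel" using AE_E[OF P] by blast
 have Nm [measurable]: "N \<in> sets borel" using N by simp
 define R where "R = norm z + norm x + 1"
 have "ennreal (dist z x) * (\<integral>\<^sup>+t\<in>{0..1::real}. indicator N (z + t *\<^sub>R (x - z)) \<partial>lborel) <= (\<integral>\<^sup>+v\<in>ball 0 R. indicator N v \<partial>lborel)"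
 proof (rule line_segment_integral_le[OF d])
  show "z \<in> ball 0 R" "x \<in> ball 0 R" unfolding R_def using norm_ge_zero[of x] norm_ge_zero[of z] by (simp_all del: norm_ge_zero)
 qed measurable
 also have "... <= (\<L> v. indicator N v)" by (intro nn_integral_mono) (auto simp: indicator_def)
 also have "... = 0" using N by simp
 finally have "(\<integral>\<^sup>+t\<in>{0..1::real}. indicator N (z + t *\<^sub>R (x - z)) \<partial>lborel) = 0" using zx by simp
 hence "AE t in lborel. indicator N (z + t *\<^sub>R (x - z)) * indicator {0..1::real} t = (0::ennreal)"
  by (subst (asm) nn_integral_0_iff_AE) measurable
 thus ?thesis by eventually_elim (use N in \<open>auto simp: indicator_def split: if_splits\<close>)
qed

text \<open>A null set may contain a given segment, but from a fixed \<open>p\<close> almost every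
  end point gives a segment that meets it in a null set of times: dilations preserve null
  sets.\<close>

lemma AE_AE_segment:
 assumes P: "AE v in lborel. P (v :: 'a::euclidean_space)"
 shows "AE y in lborel. AE t in lborel. t \<in> {0..1::real} --> P (p + t *\<^sub>R (y - p))"
proof -
 obtain N where N: "{v \<in> space lborel. \<not> P v} \<subseteq> N" "emeasure lborel N = 0" "N \<in> sets lborel" using AE_E[OF P] by blast
 have Nm [measurable]: "N \<in> sets borel" using N by simp
 let ?A = "\<lambda>t y. p + t *\<^sub>R (y - p)"
 have "(\<L> t. (\<L> y. indicator N (?A t y)) * indicator {0..1::real} t) = 0"
 proof -
  have zero: "(\<L> y. indicator N (?A t y)) = (0::ennreal)" if t: "t \<noteq> 0" for t
  proof -
   have "ennreal (\<bar>t\<bar> ^ DIM('a)) * (\<L> y. indicator N ((p - t *\<^sub>R p) + t *\<^sub>R y)) = (\<L> y. indicator N y)"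
    by (rule nn_integral_affine[OF _ t]) (intro borel_measurable_indicator Nm)
   thus ?thesis using N t by (simp add: algebra_simps)
  qed
  have "AE t in lborel. (\<L> y. indicator N (?A t y)) * indicator {0..1::real} t = (0::ennreal)"
  proof (rule AE_mp[OF AE_lborel_singleton[of 0]], intro AE_I2 impI)
   fix t :: real assume "t \<noteq> 0"
   thus "(\<L> y. indicator N (?A t y)) * indicator {0..1::real} t = (0::ennreal)" using zero by simp
  qed
  thus ?thesis by (subst nn_integral_0_iff_AE) measurable
 qed
 moreover have "(\<L> y. (\<L> t. indicator N (?A t y) * indicator {0..1::real} t)) =
  (\<L> t. (\<L> y. indicator N (?A t y) * indicator {0..1::real} t))" by (rule lborel_pair.Fubini') measurable
 moreover have "(\<L> y. indicator N (?A t y) * indicator {0..1::real} t) = (\<L> y. indicator N (?A t y)) * indicator {0..1::real} t" for t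
  by (rule nn_integral_multc) measurable
 ultimately have "(\<L> y. (\<L> t. indicator N (?A t y) * indicator {0..1::real} t)) = (0::ennreal)" by simp
 hence "AE y in lborel. (\<L> t. indicator N (?A t y) * indicator {0..1::real} t) = (0::ennreal)"
  by (subst (asm) nn_integral_0_iff_AE) measurable
 thus ?thesis
 proof eventually_elim
  case (elim y)
  hence "AE t in lborel. indicator N (?A t y) * indicator {0..1::real} t = (0::ennreal)"
   by (subst (asm) nn_integral_0_iff_AE) measurable
  thus ?case by eventually_elim (use N in \<open>auto simp: indicator_def split: if_splits\<close>)
 qed
qed

context bm_environment
begin

text \<open>Cut the segment into \<open>n\<close> pieces of length at most 1. On a piece every
  typical value of \<open>s\<close> dominates the potential around the piece, hence so does their
  average, which is \<open>n\<close> times the integral over the piece.\<close>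

lemma reach_segment:
 fixes n :: nat
 assumes s [measurable]: "s \<in> borel_measurable borel" and s0: "\<And>v. 0 <= s v"
  and good: "AE t in lborel. t \<in> {0..1::real} --> (\<forall>w\<in>ball (z + t *\<^sub>R (x - z)) (step_radius + 2). U w <= s (z + t *\<^sub>R (x - z)))"
  and n: "0 < n" "dist z x <= real n"
  and I: "(\<integral>\<^sup>+t\<in>{0..1}. ennreal (s (z + t *\<^sub>R (x - z))) \<partial>lborel) <= ennreal I" "0 <= I"
 shows "reach z x (real n * (step_cost + I))"
proof -
 define g where "g t = ennreal (s (z + t *\<^sub>R (x - z)))" for t
 have gm [measurable]: "g \<in> borel_measurable borel" unfolding g_def by measurable
 define X where "X i = z + (real i / real n) *\<^sub>R (x - z)" for i
 define A where "A k = (\<L> t. g t * indicator {0..<real k / real n} t)" for k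
 define J where "J k = (\<L> t. g t * indicator {real k / real n..<real (Suc k) / real n} t)" for k
 have AS: "A (Suc k) = A k + J k" for k
 proof -
  have "g t * indicator {0..<real (Suc k) / real n} t = g t * indicator {0..<real k / real n} t + g t * indicator {real k / real n..<real (Suc k) / real n} t" for t
  proof -
   have le: "real k / real n <= real (Suc k) / real n" by (simp add: divide_right_mono)
   have "0 <= t" if "real k / real n <= t" by (rule order_trans[OF _ that]) simp
   thus ?thesis using le by (auto simp: indicator_def)
  qed
  thus ?thesis unfolding A_def J_def by (simp add: nn_integral_add)
 qed
 have AI: "A k <= ennreal I" if "k <= n" for k
 proof -
  have "real k / real n <= 1" using that n by simp
  hence "A k <= (\<integral>\<^sup>+t\<in>{0..1}. g t \<partial>lborel)"
   unfolding A_def by (intro nn_integral_mono) (auto simp: indicator_def)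
  thus ?thesis using I(1) unfolding g_def by (rule order_trans)
 qed
 have dX: "dist (X i) (z + t *\<^sub>R (x - z)) <= 1" if "t \<in> {real i / real n..real (Suc i) / real n}" for i t
 proof -
  have "dist (X i) (z + t *\<^sub>R (x - z)) = \<bar>real i / real n - t\<bar> * dist z x"
   unfolding X_def dist_norm by (simp add: scaleR_left_diff_distrib[symmetric] norm_minus_commute)
  also have "... <= (1 / real n) * real n"
  proof (intro mult_mono n)
   have "real (Suc i) / real n = real i / real n + 1 / real n" by (simp add: add_divide_distrib)
   thus "\<bar>real i / real n - t\<bar> <= 1 / real n" using that by auto
  qed auto
  finally show ?thesis using n by simp
 qed
 have step: "reach (X i) (X (Suc i)) (step_cost + real n * enn2real (J i))" if i: "i < n" for i
 proof (rule reach_step)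
  have "J i <= A (Suc i)" unfolding AS by simp
  also have "... <= ennreal I" using AI[of "Suc i"] i by simp
  finally have Jf: "J i < top" by (simp add: le_less_trans)
  show "0 <= real n * enn2real (J i)" by simp
  show "dist (X i) (X (Suc i)) <= 1" using dX[of "real (Suc i) / real n" i] n by (simp add: X_def divide_right_mono)
  fix w assume w: "w \<in> cball (X i) step_radius"
  show "U w <= real n * enn2real (J i)"
  proof (cases "U w <= 0")
   case False
   have "ennreal (U w * (1 / real n)) = (\<L> t. ennreal (U w) * indicator {real i / real n..<real (Suc i) / real n} t)"
    using False n by (simp add: nn_integral_cmult_indicator ennreal_mult'' diff_divide_distrib[symmetric] divide_right_mono del: of_nat_Suc) (simp add: ennreal_mult[symmetric])
   also have "... <= J i" unfolding J_def
   proof (rule nn_integral_mono_AE, use good in eventually_elim)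
    case (elim t)
    show ?case
    proof (cases "t \<in> {real i / real n..<real (Suc i) / real n}")
     case True
     have "real (Suc i) / real n <= 1" using i by simp
     moreover have "0 <= t" by (rule order_trans[of _ "real i / real n"]) (use True in auto)
     ultimately have t: "t \<in> {0..1}" using True by auto
     have "dist (X i) (z + t *\<^sub>R (x - z)) <= 1" using dX[of t i] True by auto
     \<comment> \<open>\<open>w\<close> is within \<open>step_radius\<close> of \<open>X i\<close>
       and \<open>X i\<close> within 1 of the segment point; the margin 2 makes the inclusion in the
       open ball strict.\<close>
     hence "w \<in> ball (z + t *\<^sub>R (x - z)) (step_radius + 2)"
      using w dist_triangle[of "z + t *\<^sub>R (x - z)" w "X i"] by (simp add: dist_commute)
     hence "U w <= s (z + t *\<^sub>R (x - z))" using elim t by blast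
     thus ?thesis using True by (simp add: g_def ennreal_leI)
    qed simp
   qed
   also have "... = ennreal (enn2real (J i))" using Jf by simp
   finally have "U w * (1 / real n) <= enn2real (J i)" by (simp add: ennreal_le_iff)
   thus ?thesis using n by (simp add: field_simps)
  qed (simp add: order_trans[OF _ mult_nonneg_nonneg])
 qed
 have "k <= n ==> reach z (X k) (real k * step_cost + real n * enn2real (A k))" for k
 proof (induction k)
  case 0
  thus ?case by (simp add: X_def A_def reach_self)
 next
  case (Suc k)
  have "reach z (X (Suc k)) ((real k * step_cost + real n * enn2real (A k)) + (step_cost + real n * enn2real (J k)))"
   using Suc by (intro reach_trans[OF Suc.IH step]) auto
  moreover have "enn2real (A (Suc k)) = enn2real (A k) + enn2real (J k)"
  proof -
   have "A (Suc k) < top" using AI[of "Suc k"] Suc.prems by (simp add: le_less_trans)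
   hence "A k < top" "J k < top" unfolding AS by auto
   thus ?thesis unfolding AS by (rule enn2real_plus)
  qed
  ultimately show ?case by (simp add: algebra_simps)
 qed
 from this[of n] have "reach z x (real n * step_cost + real n * enn2real (A n))" using n by (simp add: X_def)
 moreover have "enn2real (A n) <= I" using AI[of n] I by (simp add: enn2real_leI)
 hence "real n * step_cost + real n * enn2real (A n) <= real n * (step_cost + I)" by (simp add: distrib_left mult_left_mono)
 ultimately show ?thesis by (rule reach_mono)
qed

end

lemma AE_reflect:
 assumes P: "AE t in lborel. P (t :: real)"
 shows "AE t in lborel. P (1 - t)"
proof -
 obtain N where N: "{v \<in> space lborel. \<not> P v} \<subseteq> N" "emeasure lborel N = 0" "N \<in> sets lborel" using AE_E[OF P] by blast
 have Nm [measurable]: "N \<in> sets borel" using N by simp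
 have "(\<L> t. indicator N t) = ennreal \<bar>- 1\<bar> * (\<L> t. indicator N (1 + (- 1) * t))" by (rule nn_integral_real_affine) auto
 hence "(\<L> t. indicator N (1 - t :: real)) = (0 :: ennreal)" using N by simp
 hence "AE t in lborel. indicator N (1 - t :: real) = (0 :: ennreal)" by (subst (asm) nn_integral_0_iff_AE) measurable
 thus ?thesis by eventually_elim (use N in \<open>auto simp: indicator_def split: if_splits\<close>)
qed

lemma emeasure_ball_Int_eq_measure:
 "emeasure lborel (E \<inter> ball (0::'a::euclidean_space) R) = ennreal (measure lborel (E \<inter> ball 0 R))"
proof (cases "E \<inter> ball 0 R \<in> sets lborel")
 case True
 show ?thesis
 proof (rule emeasure_eq_ennreal_measure)
  have "emeasure lborel (E \<inter> ball 0 R) <= emeasure lborel (ball (0::'a) R)" by (rule emeasure_mono) auto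
  also have "... < \<infinity>" by (rule emeasure_lborel_ball_finite)
  finally show "emeasure lborel (E \<inter> ball 0 R) \<noteq> top" by simp
 qed
qed (simp add: emeasure_notin_sets measure_notin_sets)

text \<open>The L(d,1) quantity of \<open>s\<close> on a ball in dyadic form, without the layers
  below \<open>2 ^ K\<close>.\<close>

abbreviation layer_sum :: "('a::euclidean_space => real) => nat => real => ennreal" where
 "layer_sum s K R \<equiv> \<Sum>k. ennreal (2 ^ (K + k)) * ennreal (measure lborel ({v. 2 ^ (K + k) < s v} \<inter> ball 0 R) powr (1 / real DIM('a)))"

section \<open>Equicontinuity of the cost on large scales\<close>

context bm_environment
begin

text \<open>The straight segment from \<open>z\<close> to \<open>x\<close> may run through high
  potential. A broken line via a typical \<open>y\<close> in a ball comparable to their distance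
  avoids this, and averaging over \<open>y\<close> shows that a suitable one exists.\<close>

lemma local_reach_high_dim:
 assumes d: "2 <= DIM('a)"
  and s [measurable]: "s \<in> borel_measurable borel" and s0: "\<And>v. 0 <= s v"
  and good: "AE v in lborel. \<forall>w\<in>ball v (step_radius + 2). U w <= s v"
  and exc: "\<And>\<eta>. 0 < \<eta> ==> \<exists>K R0. \<forall>R\<ge>R0. layer_sum s K R <= ennreal (\<eta> * R)"
  and \<eta>: "0 < \<eta>"
 shows "\<exists>\<eta>'>0. \<exists>R0. \<forall>R\<ge>R0. \<forall>z x. norm z <= R --> norm x <= R --> dist z x <= \<eta>' * R --> reach z x (\<eta> * R)"
proof -
 let ?d = "real DIM('a)"
 define v where "v = unit_ball_vol ?d"
 have v: "0 < v" unfolding v_def by simp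
 define c0 where "c0 = v powr (1 / ?d)"
 have c0: "0 < c0" unfolding c0_def using v by simp
 \<comment> \<open>Each leg has at most \<open>3 * L\<close> pieces and cost integral
   \<open>3 * q\<close>; the layer part of the product is \<open>54 * \<eta>1 * R / c0\<close>, here
   a quarter of \<open>\<eta> * R\<close>.\<close>
 define \<eta>1 where "\<eta>1 = \<eta> * c0 / 216"
 have \<eta>1: "0 < \<eta>1" unfolding \<eta>1_def using \<eta> c0 by simp
 obtain K R1 where R1: "\<And>R. R1 <= R ==> layer_sum s K R <= ennreal (\<eta>1 * R)" using exc[OF \<eta>1] by blast
 define Q0 where "Q0 = step_cost + 3 * 2 ^ K"
 have sc: "0 <= step_cost" by (simp add: step_cost_def)
 have Q0: "0 < Q0" unfolding Q0_def using sc by (simp add: add_nonneg_pos)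
 define h where "h = min 1 (\<eta> / (12 * Q0))"
 have h: "0 < h" "h <= 1" "h <= \<eta> / (12 * Q0)" unfolding h_def using \<eta> Q0 by auto
 define R0 where "R0 = max (max R1 1) (12 * Q0 / \<eta>)"
 have main: "reach z x (\<eta> * R)" if R: "R0 <= R" and zx: "norm z <= R" "norm x <= R" "dist z x <= h * R" for R z x
 proof -
  have R': "R1 <= R" "1 <= R" "12 * Q0 / \<eta> <= R" using R unfolding R0_def max.bounded_iff by blast+
  define L where "L = max 1 (h * R)"
  have L: "1 <= L" "dist z x <= L" "L <= R" using zx R' h mult_right_mono[of h 1 R] by (auto simp: L_def)
  have LQ: "12 * L * Q0 <= \<eta> * R"
  proof -
   have "1 <= \<eta> * R / (12 * Q0)" using R'(3) \<eta> Q0 by (simp add: field_simps)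
   moreover have "h * R <= \<eta> / (12 * Q0) * R" using h R' by (intro mult_right_mono) auto
   ultimately have "L <= \<eta> * R / (12 * Q0)" unfolding L_def by simp
   thus ?thesis using Q0 by (simp add: field_simps)
  qed
  define D where "D = ball z L"
  define \<delta> where "\<delta> = v * L ^ DIM('a)"
  have \<delta>: "0 < \<delta>" unfolding \<delta>_def using v L by simp
  have D: "D \<in> sets borel" "D \<subseteq> ball 0 (3 * R)" "emeasure lborel D = ennreal \<delta>"
  proof -
   show "D \<in> sets borel" by (simp add: D_def)
   show "D \<subseteq> ball 0 (3 * R)"
   proof
    fix y assume "y \<in> D"
    hence "norm y < norm z + L" using norm_triangle_sub[of y z] by (simp add: D_def dist_norm norm_minus_commute)
    thus "y \<in> ball 0 (3 * R)" using zx L R' by simp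
   qed
   show "emeasure lborel D = ennreal \<delta>" unfolding D_def \<delta>_def v_def using L by (subst emeasure_ball) auto
  qed
  have D' [measurable]: "D \<in> sets borel" by (rule D)
  have pB: "z \<in> ball 0 (3 * R)" "x \<in> ball 0 (3 * R)" using zx R' by auto
  define m where "m k = measure lborel ({v. 2 ^ (K + k) < s v} \<inter> ball 0 (3 * R))" for k
  define q where "q = 2 ^ K + 6 * \<eta>1 * R / (c0 * L)"
  have q0: "0 < q" unfolding q_def using \<eta>1 R' c0 L by (intro add_pos_nonneg) auto
  define J where "J p y = (\<integral>\<^sup>+t\<in>{0..1::real}. ennreal (s (p + t *\<^sub>R (y - p))) \<partial>lborel)" for p y
  have Jm [measurable]: "J p \<in> borel_measurable borel" for p unfolding J_def[abs_def] by measurable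
  have avg: "(\<integral>\<^sup>+y\<in>D. J p y \<partial>lborel) <= ennreal (\<delta> * q)" if p: "p \<in> ball 0 (3 * R)" for p
  proof -
   have pw: "ennreal (2 * (m k / \<delta>) powr (1 / ?d)) = ennreal (2 / (c0 * L)) * ennreal (m k powr (1 / ?d))" for k
   proof -
    have "\<delta> powr (1 / ?d) = c0 * L"
    proof -
     have "(L ^ DIM('a)) powr (1 / ?d) = L" using L by (simp add: powr_realpow[symmetric] powr_powr)
     thus ?thesis unfolding \<delta>_def c0_def by (simp add: powr_mult)
    qed
    hence "2 * (m k / \<delta>) powr (1 / ?d) = 2 / (c0 * L) * m k powr (1 / ?d)" by (simp add: powr_divide)
    thus ?thesis using c0 L by (simp add: ennreal_mult[symmetric])
   qed
   have "(\<integral>\<^sup>+y\<in>D. J p y \<partial>lborel) <= ennreal \<delta> * (ennreal (2 ^ K) + (\<Sum>k. ennreal (2 ^ (K + k)) * ennreal (2 * (m k / \<delta>) powr (1 / ?d))))"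
    unfolding J_def m_def by (rule segment_average[OF d s p D \<delta>])
   also have "(\<Sum>k. ennreal (2 ^ (K + k)) * ennreal (2 * (m k / \<delta>) powr (1 / ?d))) = ennreal (2 / (c0 * L)) * (\<Sum>k. ennreal (2 ^ (K + k)) * ennreal (m k powr (1 / ?d)))"
    unfolding pw by (simp add: mult.left_commute[of _ "ennreal (2 / (c0 * L))"])
   also have "... <= ennreal (2 / (c0 * L)) * ennreal (\<eta>1 * (3 * R))"
    unfolding m_def using R1[of "3 * R"] R' by (intro mult_left_mono) auto
   also have "... = ennreal (6 * \<eta>1 * R / (c0 * L))" using c0 L \<eta>1 R' by (subst ennreal_mult[symmetric]) (auto simp: mult_ac)
   also have "ennreal (2 ^ K) + ennreal (6 * \<eta>1 * R / (c0 * L)) = ennreal q"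
    unfolding q_def using c0 L \<eta>1 R' by (intro ennreal_plus[symmetric]) auto
   also have "ennreal \<delta> * ennreal q = ennreal (\<delta> * q)" using \<delta> q0 by (intro ennreal_mult[symmetric]) auto
   finally show ?thesis by (simp add: add_left_mono mult_left_mono)
  qed
  let ?good = "\<lambda>p y. AE t in lborel. t \<in> {0..1::real} --> (\<forall>w\<in>ball (p + t *\<^sub>R (y - p)) (step_radius + 2). U w <= s (p + t *\<^sub>R (y - p)))"
  have gz: "AE y in lborel. ?good z y" by (rule AE_AE_segment[OF good])
  have gx: "AE y in lborel. ?good x y" by (rule AE_AE_segment[OF good])
  \<comment> \<open>The two integrals average to at most \<open>2 * q\<close> over \<open>D\<close>,
    so they cannot exceed \<open>3 * q\<close> for almost every \<open>y\<close>.\<close>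
  obtain y where y: "y \<in> D" "?good z y" "?good x y" "J z y + J x y <= ennreal (3 * q)"
  proof (rule ccontr)
   assume no: "\<not> thesis"
   have "AE y in lborel. y \<in> D --> ennreal (3 * q) <= J z y + J x y" using gz gx
   proof eventually_elim
    case (elim y)
    show ?case
    proof (intro impI)
     assume "y \<in> D"
     hence "\<not> J z y + J x y <= ennreal (3 * q)" using that[OF _ elim] no by blast
     thus "ennreal (3 * q) <= J z y + J x y" using linear by blast
    qed
   qed
   hence "(\<L> y. ennreal (3 * q) * indicator D y) <= (\<L> y. (J z y + J x y) * indicator D y)"
    by (intro nn_integral_mono_AE) (auto elim!: eventually_mono simp: indicator_def)
   also have "... = (\<integral>\<^sup>+y\<in>D. J z y \<partial>lborel) + (\<integral>\<^sup>+y\<in>D. J x y \<partial>lborel)"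
    by (subst nn_integral_add[symmetric]) (auto simp: distrib_right)
   also have "... <= ennreal (\<delta> * q) + ennreal (\<delta> * q)" by (intro add_mono avg pB)
   also have "... = ennreal (2 * (\<delta> * q))" using \<delta> q0 by (subst ennreal_plus[symmetric]) auto
   also have "(\<L> y. ennreal (3 * q) * indicator D y) = ennreal (3 * q) * ennreal \<delta>" using D by (simp add: nn_integral_cmult_indicator)
   also have "... = ennreal (3 * q * \<delta>)" using \<delta> q0 by (intro ennreal_mult[symmetric]) auto
   finally have "3 * q * \<delta> <= 2 * (\<delta> * q)" using \<delta> q0 by (subst (asm) ennreal_le_iff) auto
   moreover have "0 < \<delta> * q" using \<delta> q0 by simp
   ultimately show False by (simp add: mult_ac)
  qed
  define n where "n = nat \<lceil>2 * L\<rceil>"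
  have n: "2 * L <= real n" "real n <= 3 * L" "0 < n"
  proof -
   show 1: "2 * L <= real n" unfolding n_def using L by (simp add: of_nat_nat)
   have "real n = of_int \<lceil>2 * L\<rceil>" unfolding n_def using L by (simp add: of_nat_nat)
   hence "real n < 2 * L + 1" by linarith
   thus "real n <= 3 * L" using L by simp
   show "0 < n" using 1 L by linarith
  qed
  have dzy: "dist z y <= L" using y(1) by (simp add: D_def)
  have zy: "reach z y (real n * (step_cost + 3 * q))"
  proof (rule reach_segment[OF s s0 y(2) n(3)])
   show "dist z y <= real n" using dzy n L by linarith
   have "J z y <= J z y + J x y" by simp
   thus "(\<integral>\<^sup>+t\<in>{0..1}. ennreal (s (z + t *\<^sub>R (y - z))) \<partial>lborel) <= ennreal (3 * q)"
    using y(4) unfolding J_def by (rule order_trans)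
  qed (use q0 in simp)
  have refl: "y + t *\<^sub>R (x - y) = x + (1 - t) *\<^sub>R (y - x)" for t by (simp add: algebra_simps)
  have yx: "reach y x (real n * (step_cost + 3 * q))"
  proof (rule reach_segment[OF s s0 _ n(3)])
   show "AE t in lborel. t \<in> {0..1::real} --> (\<forall>w\<in>ball (y + t *\<^sub>R (x - y)) (step_radius + 2). U w <= s (y + t *\<^sub>R (x - y)))"
    using AE_reflect[OF y(3)] unfolding refl by eventually_elim auto
   show "dist y x <= real n" using dzy L(2) n dist_triangle[of y x z] by (simp add: dist_commute)
   have "(\<integral>\<^sup>+t\<in>{0..1}. ennreal (s (y + t *\<^sub>R (x - y))) \<partial>lborel) = J x y" unfolding refl J_def
    using nn_integral_unit_interval_reflect[of "\<lambda>t. ennreal (s (x + t *\<^sub>R (y - x)))"] by simp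
   also have "... <= J z y + J x y" by simp
   also note y(4)
   finally show "(\<integral>\<^sup>+t\<in>{0..1}. ennreal (s (y + t *\<^sub>R (x - y))) \<partial>lborel) <= ennreal (3 * q)" .
  qed (use q0 in simp)
  have "reach z x (real n * (step_cost + 3 * q) + real n * (step_cost + 3 * q))" by (rule reach_trans[OF zy yx])
  thus ?thesis
  proof (rule reach_mono)
   have "real n * (step_cost + 3 * q) <= 3 * L * (step_cost + 3 * q)" using n sc q0 by (intro mult_right_mono) auto
   also have "... = 3 * L * Q0 + 54 * \<eta>1 * R / c0" unfolding q_def Q0_def using L c0 by (simp add: field_simps)
   also have "54 * \<eta>1 * R / c0 = \<eta> * R / 4" unfolding \<eta>1_def using c0 by simp
   also have "3 * L * Q0 + \<eta> * R / 4 <= \<eta> * R / 2" using LQ by (simp add: mult.commute[of \<eta>])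
   finally show "real n * (step_cost + 3 * q) + real n * (step_cost + 3 * q) <= \<eta> * R" by simp
  qed
 qed
 show ?thesis using h main by blast
qed

text \<open>On a line there is no detour and none is needed: the segment integral is bounded by the
  integral over the whole ball, a layer sum with exponent 1. Short segments are single
  steps.\<close>

lemma local_reach_dim_one:
 assumes d: "DIM('a) = 1"
  and s [measurable]: "s \<in> borel_measurable borel" and s0: "\<And>v. 0 <= s v"
  and good: "AE v in lborel. \<forall>w\<in>ball v (step_radius + 2). U w <= s v"
  and sub: "\<And>\<kappa>. 0 < \<kappa> ==> \<exists>R0. \<forall>R\<ge>R0. \<forall>w\<in>cball 0 (3 * R). U w <= \<kappa> * R"
  and exc: "\<And>\<eta>. 0 < \<eta> ==> \<exists>K R0. \<forall>R\<ge>R0. layer_sum s K R <= ennreal (\<eta> * R)"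
  and \<eta>: "0 < \<eta>"
 shows "\<exists>\<eta>'>0. \<exists>R0. \<forall>R\<ge>R0. \<forall>z x. norm z <= R --> norm x <= R --> dist z x <= \<eta>' * R --> reach z x (\<eta> * R)"
proof -
 have \<eta>1: "0 < \<eta> / 16" using \<eta> by simp
 obtain K R1 where R1: "\<And>R. R1 <= R ==> layer_sum s K R <= ennreal (\<eta> / 16 * R)" using exc[OF \<eta>1] by blast
 have \<eta>2: "0 < \<eta> / 2" using \<eta> by simp
 obtain R2 where R2: "\<And>R w. R2 <= R ==> w \<in> cball 0 (3 * R) ==> U w <= \<eta> / 2 * R" using sub[OF \<eta>2] by blast
 define Q0 where "Q0 = step_cost + 2 ^ K"
 have sc: "0 <= step_cost" by (simp add: step_cost_def)
 have Q0: "0 < Q0" unfolding Q0_def using sc by (simp add: add_nonneg_pos)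
 define h where "h = \<eta> / (4 * Q0)"
 have h: "0 < h" unfolding h_def using \<eta> Q0 by auto
 define R0 where "R0 = max (max (max R1 R2) 1) (max (2 * step_cost / \<eta>) step_radius)"
 have main: "reach z x (\<eta> * R)" if R: "R0 <= R" and zx: "norm z <= R" "norm x <= R" "dist z x <= h * R" for R z x
 proof -
  have R': "R1 <= R" "R2 <= R" "1 <= R" "2 * step_cost / \<eta> <= R" "step_radius <= R"
   using R unfolding R0_def max.bounded_iff by blast+
  show ?thesis
  proof (cases "dist z x <= 1")
   case True
   have "reach z x (step_cost + \<eta> / 2 * R)"
   proof (rule reach_step)
    show "0 <= \<eta> / 2 * R" using \<eta> R' by simp
    fix w assume "w \<in> cball z step_radius"
    hence "norm w <= 3 * R" using zx R' norm_triangle_sub[of w z] by (simp add: dist_norm norm_minus_commute)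
    thus "U w <= \<eta> / 2 * R" using R2 R' by simp
   qed fact
   moreover have "step_cost <= \<eta> / 2 * R" using R'(4) \<eta> by (simp add: field_simps)
   ultimately show ?thesis by (elim reach_mono) simp
  next
   case False
   define l where "l = dist z x"
   have l: "1 < l" using False by (simp add: l_def)
   have znx: "z \<noteq> x" using False by auto
   let ?p = "\<lambda>t. z + t *\<^sub>R (x - z)"
   have B: "z \<in> ball 0 (2 * R)" "x \<in> ball 0 (2 * R)" using zx R' by auto
   let ?e = "\<lambda>v. dyadic_excess K (s v)"
   have "ennreal l * (\<integral>\<^sup>+t\<in>{0..1::real}. ?e (?p t) \<partial>lborel) <= (\<integral>\<^sup>+v\<in>ball 0 (2 * R). ?e v \<partial>lborel)"
    unfolding l_def by (rule line_segment_integral_le[OF d _ B]) measurable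
   also have "... = (\<L> v. (\<Sum>k. ennreal (2 ^ (K + k)) * indicator ({v. 2 ^ (K + k) < s v} \<inter> ball 0 (2 * R)) v))"
    unfolding dyadic_excess_def
    by (intro nn_integral_cong) (simp add: ennreal_suminf_multc[symmetric] mult.assoc indicator_inter_arith[symmetric] indicator_def cong: suminf_cong)
   also have "... = (\<Sum>k. \<L> v. ennreal (2 ^ (K + k)) * indicator ({v. 2 ^ (K + k) < s v} \<inter> ball 0 (2 * R)) v)"
    by (rule nn_integral_suminf) (intro borel_measurable_times_ennreal borel_measurable_indicator borel_measurable_const; simp)
   also have "... = layer_sum s K (2 * R)" by (intro suminf_cong, subst nn_integral_cmult_indicator) (simp_all add: emeasure_ball_Int_eq_measure d)
   also have "... <= ennreal (\<eta> / 16 * (2 * R))" using R' by (intro R1) simp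
   finally have 1: "ennreal l * (\<integral>\<^sup>+t\<in>{0..1::real}. ?e (?p t) \<partial>lborel) <= ennreal (\<eta> * R / 8)" by (simp add: mult.commute)
   have ex: "(\<integral>\<^sup>+t\<in>{0..1::real}. ?e (?p t) \<partial>lborel) <= ennreal (\<eta> * R / (8 * l))"
   proof -
    have "ennreal (1 / l) * (ennreal l * (\<integral>\<^sup>+t\<in>{0..1::real}. ?e (?p t) \<partial>lborel)) <= ennreal (1 / l) * ennreal (\<eta> * R / 8)"
     by (intro mult_left_mono 1) simp
    moreover have "ennreal (1 / l) * ennreal l = 1" using l by (simp add: ennreal_mult[symmetric])
    moreover have "ennreal (1 / l) * ennreal (\<eta> * R / 8) = ennreal (\<eta> * R / (8 * l))"
     using l \<eta> R' by (subst ennreal_mult[symmetric]) (auto simp: mult_ac)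
    ultimately show ?thesis by (simp add: mult.assoc[symmetric])
   qed
   define I where "I = 2 ^ K + \<eta> * R / (8 * l)"
   have I0: "0 <= I" unfolding I_def using \<eta> R' l by simp
   have "(\<integral>\<^sup>+t\<in>{0..1}. ennreal (s (?p t)) \<partial>lborel) <= (\<L> t. ennreal (2 ^ K) * indicator {0..1::real} t + ?e (?p t) * indicator {0..1} t)"
    unfolding distrib_right[symmetric] by (intro nn_integral_mono mult_right_mono le_dyadic_excess) auto
   also have "... = (\<L> t. ennreal (2 ^ K) * indicator {0..1::real} t) + (\<integral>\<^sup>+t\<in>{0..1::real}. ?e (?p t) \<partial>lborel)"
    by (rule nn_integral_add) measurable
   also have "... <= ennreal (2 ^ K) + ennreal (\<eta> * R / (8 * l))" by (intro add_mono ex) (simp add: nn_integral_cmult_indicator)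
   also have "... = ennreal I" unfolding I_def using \<eta> R' l by (intro ennreal_plus[symmetric]) auto
   finally have I: "(\<integral>\<^sup>+t\<in>{0..1}. ennreal (s (?p t)) \<partial>lborel) <= ennreal I" .
   define n where "n = nat \<lceil>l\<rceil>"
   have n: "l <= real n" "real n <= 2 * l" "0 < n"
   proof -
    show 1: "l <= real n" unfolding n_def using l by (simp add: of_nat_nat)
    have "real n = of_int \<lceil>l\<rceil>" unfolding n_def using l by (simp add: of_nat_nat)
    hence "real n < l + 1" by linarith
    thus "real n <= 2 * l" using l by simp
    show "0 < n" using 1 l by linarith
   qed
   have "reach z x (real n * (step_cost + I))"
    by (rule reach_segment[OF s s0 AE_line_segment[OF d good znx] n(3) _ I I0]) (use n in \<open>simp add: l_def\<close>)
   thus ?thesis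
   proof (rule reach_mono)
    have "real n * (step_cost + I) <= 2 * l * (step_cost + I)" using n sc I0 by (intro mult_right_mono) auto
    also have "... = 2 * l * Q0 + \<eta> * R / 4" unfolding I_def Q0_def using l by (simp add: field_simps)
    also have "2 * l * Q0 <= 2 * (h * R) * Q0" using zx(3) Q0 unfolding l_def by (intro mult_right_mono mult_left_mono) auto
    also have "2 * (h * R) * Q0 = \<eta> * R / 2" unfolding h_def using Q0 by simp
    also have "\<eta> * R / 2 + \<eta> * R / 4 <= \<eta> * R" using \<eta> R' by simp
    finally show "real n * (step_cost + I) <= \<eta> * R" by simp
   qed
  qed
 qed
 show ?thesis using h main by blast
qed

lemma local_reach_of_averages:
 assumes "s \<in> borel_measurable borel" "\<And>v. 0 <= s v"
  and "AE v in lborel. \<forall>w\<in>ball v (step_radius + 2). U w <= s v"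
  and "\<And>\<kappa>. 0 < \<kappa> ==> \<exists>R0. \<forall>R\<ge>R0. \<forall>w\<in>cball 0 (3 * R). U w <= \<kappa> * R"
  and "\<And>\<eta>. 0 < \<eta> ==> \<exists>K R0. \<forall>R\<ge>R0. layer_sum s K R <= ennreal (\<eta> * R)"
  and "0 < \<eta>"
 shows "\<exists>\<eta>'>0. \<exists>R0. \<forall>R\<ge>R0. \<forall>z x. norm z <= R --> norm x <= R --> dist z x <= \<eta>' * R --> reach z x (\<eta> * R)"
proof (cases "DIM('a) = 1")
 case True
 show ?thesis by (rule local_reach_dim_one[OF True assms])
next
 case False
 moreover have "0 < DIM('a)" by simp
 ultimately have "2 <= DIM('a)" by linarith
 from local_reach_high_dim[OF this assms(1-3,5,6)] show ?thesis by blast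
qed

end

section \<open>Maximal inequalities for the flow\<close>

lemma sets_ball [measurable]: "ball (v :: 'a::metric_space) r \<in> sets borel" by simp

context ergodic_flow
begin

abbreviation flow_expectation :: "('o \<Rightarrow> ennreal) \<Rightarrow> ennreal" (binder "\<M>" [10] 62) where
 "flow_expectation f \<equiv> integral\<^sup>N M f"

lemma measurable_flow [measurable (raw)]:
 assumes "f \<in> borel_measurable N" "g \<in> measurable N M"
 shows "(\<lambda>p. \<tau> (f p) (g p)) \<in> measurable N M" using measurable_compose[OF measurable_Pair[OF assms] flow_jointly_measurable] by simp

lemma flow_space: "\<omega> \<in> space M ==> \<tau> x \<omega> \<in> space M" using measurable_space[OF flow_measurable] .

lemma AE_flow_at:
 assumes "AE \<omega> in M. P \<omega>"
 shows "AE \<omega> in M. P (\<tau> v \<omega>)"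
proof -
 obtain N where N: "{\<omega>\<in>space M. \<not> P \<omega>} \<subseteq> N" "N \<in> sets M" "emeasure M N = 0"
  using assms by (auto simp: eventually_ae_filter null_sets_def)
 have "emeasure M (\<tau> v -` N \<inter> space M) = emeasure (distr M M (\<tau> v)) N"
  by (rule emeasure_distr[symmetric]) (use N flow_measurable in auto)
 hence "emeasure M (\<tau> v -` N \<inter> space M) = 0" using N by (simp add: flow_invariant)
 moreover have "\<tau> v -` N \<inter> space M \<in> sets M" using N flow_measurable by auto
 ultimately show ?thesis using N flow_space[of _ v] by (intro AE_I[of _ _ "\<tau> v -` N \<inter> space M"]) auto
qed

lemma pair_sigma_finite_lborel: "pair_sigma_finite M (lborel :: 'a measure)"
 by (simp add: pair_sigma_finite_def sigma_finite_lborel sigma_finite_measure_axioms)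

lemma AE_flow:
 assumes "AE \<omega> in M. P \<omega>"
 shows "AE \<omega> in M. AE v in lborel. P (\<tau> v \<omega>)"
proof -
 interpret pair_sigma_finite M "lborel :: 'a measure" by (rule pair_sigma_finite_lborel)
 obtain N where N [measurable]: "N \<in> sets M" and N': "{\<omega>\<in>space M. \<not> P \<omega>} \<subseteq> N" "emeasure M N = 0"
  using assms by (auto simp: eventually_ae_filter null_sets_def)
 have "AE \<omega> in M. \<omega> \<notin> N" using N N' by (intro AE_not_in) (auto simp: null_sets_def)
 hence "AE v in (lborel :: 'a measure). AE \<omega> in M. \<tau> v \<omega> \<notin> N"
  using AE_flow_at[where P="\<lambda>\<omega>. \<omega> \<notin> N"] by simp
 hence "AE \<omega> in M. AE v in lborel. \<tau> v \<omega> \<notin> N"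
 proof (subst AE_commute)
  have [measurable]: "(\<lambda>p. \<tau> (snd p) (fst p)) \<in> measurable (M \<Otimes>\<^sub>M lborel) M" by (rule measurable_flow) auto
  show "{p \<in> space (M \<Otimes>\<^sub>M lborel). \<tau> (snd p) (fst p) \<notin> N} \<in> sets (M \<Otimes>\<^sub>M lborel)" by measurable
 qed
 with AE_space show ?thesis
 proof eventually_elim
  case (elim \<omega>)
  with N' flow_space show ?case by (auto elim!: eventually_mono)
 qed
qed

lemma nn_integral_flow:
 assumes [measurable]: "f \<in> borel_measurable M"
 shows "(\<M> \<omega>. f (\<tau> v \<omega>)) = (\<M> \<omega>. f \<omega>)"
proof -
 note [measurable] = flow_measurable
 have "(\<M> \<omega>. f \<omega>) = (\<integral>\<^sup>+\<omega>. f \<omega> \<partial>distr M M (\<tau> v))" by (simp add: flow_invariant)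
 also have "... = (\<M> \<omega>. f (\<tau> v \<omega>))" by (subst nn_integral_distr) auto
 finally show ?thesis ..
qed

lemma AE_ex_avoid:
 assumes "\<And>K. D K \<in> events" "(\<lambda>K::nat. emeasure M (D K)) \<longlonglongrightarrow> 0"
 shows "AE \<omega> in M. \<exists>K. \<omega> \<notin> D K"
proof (rule AE_I[of _ _ "\<Inter>K. D K"])
 have "emeasure M (\<Inter>K. D K) <= emeasure M (D K)" for K using assms by (intro emeasure_mono) auto
 thus "emeasure M (\<Inter>K. D K) = 0" using LIMSEQ_le_const[OF assms(2), of "emeasure M (\<Inter>K. D K)"] by simp
qed (use assms in auto)

end

text \<open>Vitali covering: disjoint balls on which the average is large have fivefold enlargements
  covering \<open>E\<close>. The bound \<open>m\<close> on the radii makes the covering lemma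
  applicable and confines the balls to a fixed ball.\<close>

lemma Hardy_Littlewood:
 fixes h :: "'a::euclidean_space => ennreal"
 assumes [measurable]: "h \<in> borel_measurable borel" and \<theta>: "0 < \<theta>"
  and E: "\<And>v. v \<in> E ==> \<exists>n\<in>{1..m}. ennreal (\<theta> * real n ^ DIM('a)) < (\<L> w. h w * indicator (ball v (real n)) w)"
  and EB: "E \<subseteq> ball 0 N" "E \<in> sets borel"
 shows "ennreal \<theta> * emeasure lborel E <= ennreal (5 ^ DIM('a) * unit_ball_vol (real DIM('a))) *
  (\<L> w. h w * indicator (ball 0 (N + real m)) w)"
proof -
 let ?d = "DIM('a)" and ?c = "5 ^ DIM('a) * unit_ball_vol (real DIM('a))"
 define n where "n v = (SOME n. n \<in> {1..m} \<and> ennreal (\<theta> * real n ^ ?d) < (\<L> w. h w * indicator (ball v (real n)) w))" for v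
 have n: "n v \<in> {1..m}" "ennreal (\<theta> * real (n v) ^ ?d) < (\<L> w. h w * indicator (ball v (real (n v))) w)"
  if "v \<in> E" for v using someI_ex[OF E[OF that, unfolded Bex_def]] unfolding n_def by auto
 obtain C where C: "countable C" "C \<subseteq> E" "pairwise (\<lambda>v w. disjnt (cball v (real (n v))) (cball w (real (n w)))) C"
  "E \<subseteq> (\<Union>v\<in>C. cball v (5 * real (n v)))"
 proof (rule Vitali_covering_lemma_cballs[where S=E and K=E and a="\<lambda>v. v" and r="\<lambda>v. real (n v)" and B="real m"])
  show "E \<subseteq> (\<Union>v\<in>E. cball v (real (n v)))" by auto
  show "0 < real (n v) \<and> real (n v) <= real m" if "v \<in> E" for v using n(1)[OF that] by auto
 qed
 let ?A = "\<lambda>v. cball v (5 * real (n v))"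
 have ind: "indicator E x <= (\<integral>\<^sup>+v. indicator (?A v) x \<partial>count_space C)" for x :: 'a
 proof (cases "x \<in> E")
  case True
  then obtain v where "v \<in> C" "x \<in> cball v (5 * real (n v))" using C(4) by auto
  thus ?thesis using nn_integral_ge_point[of v C "\<lambda>v. indicator (?A v) x"] by (auto simp: indicator_def)
 qed simp
 have disj: "(\<integral>\<^sup>+v. h w * indicator (ball v (real (n v))) w \<partial>count_space C) <= h w * indicator (ball 0 (N + real m)) w" for w
 proof (cases "\<exists>v\<in>C. w \<in> ball v (real (n v))")
  case True
  then obtain v where v: "v \<in> C" "w \<in> ball v (real (n v))" by auto
  have u: "w \<notin> ball v' (real (n v'))" if "v' \<in> C - {v}" for v'
   using pairwiseD[OF C(3), of v v'] v that by (auto simp: disjnt_iff) (meson less_imp_le)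
  have "(\<integral>\<^sup>+v. h w * indicator (ball v (real (n v))) w \<partial>count_space C) = h w"
   by (subst nn_integral_count_space'[of "{v}"]) (use u v in auto)
  moreover have "w \<in> ball 0 (N + real m)"
  proof -
   have "v \<in> E" using C(2) v by auto
   hence "norm v < N" "real (n v) <= real m" using EB(1) n(1)[of v] by auto
   moreover have "norm w <= norm v + dist v w" using norm_triangle_ineq[of v "w - v"] by (simp add: dist_norm norm_minus_commute)
   ultimately show ?thesis using v by simp
  qed
  ultimately show ?thesis using v by (simp del: sum.insert sum.empty)
 next
  case False
  hence "(\<integral>\<^sup>+v. h w * indicator (ball v (real (n v))) w \<partial>count_space C) = (\<integral>\<^sup>+v. 0 \<partial>count_space C)"
   by (intro nn_integral_cong) auto
  thus ?thesis by simp
 qed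
 have vol: "ennreal \<theta> * emeasure lborel (?A v) <= ennreal ?c * (\<L> w. h w * indicator (ball v (real (n v))) w)"
  if "v \<in> C" for v
 proof -
  have "ennreal \<theta> * emeasure lborel (?A v) = ennreal ?c * ennreal (\<theta> * real (n v) ^ ?d)"
   using \<theta> by (subst emeasure_cball) (auto simp: ennreal_mult[symmetric] power_mult_distrib mult_ac)
  also have "... <= ennreal ?c * (\<L> w. h w * indicator (ball v (real (n v))) w)"
   using n(2)[of v] C(2) that by (intro mult_left_mono less_imp_le) auto
  finally show ?thesis .
 qed
 have "ennreal \<theta> * emeasure lborel E = ennreal \<theta> * (\<L> x. indicator E x)" using EB(2) by simp
 also have "... <= ennreal \<theta> * (\<L> x. \<integral>\<^sup>+v. indicator (?A v) x \<partial>count_space C)"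
  by (intro mult_left_mono nn_integral_mono ind) auto
 also have "... = ennreal \<theta> * (\<integral>\<^sup>+v. emeasure lborel (?A v) \<partial>count_space C)"
  using C(1) by (subst nn_integral_count_space_nn_integral) (auto intro!: borel_measurable_indicator)
 also have "... = (\<integral>\<^sup>+v. ennreal \<theta> * emeasure lborel (?A v) \<partial>count_space C)"
  by (simp add: nn_integral_cmult)
 also have "... <= (\<integral>\<^sup>+v. ennreal ?c * (\<L> w. h w * indicator (ball v (real (n v))) w) \<partial>count_space C)"
  by (intro nn_integral_mono vol) simp
 also have "... = ennreal ?c * (\<L> w. \<integral>\<^sup>+v. h w * indicator (ball v (real (n v))) w \<partial>count_space C)"
  using C(1) by (subst nn_integral_count_space_nn_integral) (auto simp: nn_integral_cmult)
 also have "... <= ennreal ?c * (\<L> w. h w * indicator (ball 0 (N + real m)) w)" by (intro mult_left_mono nn_integral_mono disj) auto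
 finally show ?thesis .
qed

context ergodic_flow
begin

text \<open>Transference: the covering argument is applied to orbits and then averaged.\<close>

lemma maximal_inequality:
 fixes f :: "'o => ennreal"
 assumes [measurable]: "f \<in> borel_measurable M" and \<theta>: "0 < \<theta>"
 defines "A \<equiv> {\<omega>\<in>space M. \<exists>n\<ge>1. ennreal (\<theta> * real n ^ DIM('a)) < (\<L> w. f (\<tau> w \<omega>) * indicator (ball (0::'a) (real n)) w)}"
 shows "A \<in> events"
  and "ennreal \<theta> * emeasure M A <= ennreal (10 ^ DIM('a) * unit_ball_vol (real DIM('a))) * (\<M> \<omega>. f \<omega>)"
proof -
 let ?d = "DIM('a)" and ?b = "unit_ball_vol (real DIM('a))"
 interpret pair_sigma_finite M "lborel :: 'a measure" by (rule pair_sigma_finite_lborel)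
 have mf: "(\<lambda>(\<omega>, v). g (\<tau> v \<omega>) * indicator (ball (0::'a) r) v) \<in> borel_measurable (M \<Otimes>\<^sub>M lborel)"
  if [measurable]: "g \<in> borel_measurable M" for g :: "'o => ennreal" and r unfolding case_prod_beta
  by (intro borel_measurable_times_ennreal measurable_compose[OF measurable_snd borel_measurable_indicator]) (auto intro!: measurable_flow measurable_compose[OF _ that])
 define J where "J n \<omega> = (\<L> w. f (\<tau> w \<omega>) * indicator (ball (0::'a) (real n)) w)" for n \<omega>
 have J [measurable]: "J n \<in> borel_measurable M" for n unfolding J_def[abs_def] by (rule lborel.borel_measurable_nn_integral[OF mf]) simp
 \<comment> \<open>Bounding the radii by \<open>m\<close> makes the event depend on a finite piece
   of the orbit; \<open>m\<close> tends to infinity at the end.\<close>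
 define A' where "A' m = {\<omega>\<in>space M. \<exists>n\<in>{1..m}. ennreal (\<theta> * real n ^ ?d) < J n \<omega>}" for m
 have A' [measurable]: "A' m \<in> events" for m unfolding A'_def by measurable
 have AU: "A = (\<Union>m. A' m)" unfolding A_def A'_def J_def by fastforce
 thus "A \<in> events" by auto
 have bound: "ennreal \<theta> * emeasure M (A' m) <= ennreal (10 ^ ?d * ?b) * (\<M> \<omega>. f \<omega>)" if m: "m >= 1" for m
 proof -
  have vol: "(\<M> \<omega>. \<L> v. g (\<tau> v \<omega>) * indicator (ball (0::'a) r) v) = ennreal (?b * r ^ ?d) * (\<M> \<omega>. g \<omega>)"
   if [measurable]: "g \<in> borel_measurable M" and r: "0 <= r" for g r
  proof -
   have "(\<M> \<omega>. \<L> v. g (\<tau> v \<omega>) * indicator (ball (0::'a) r) v)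
     = (\<L> v. \<M> \<omega>. g (\<tau> v \<omega>) * indicator (ball (0::'a) r) v)"
    by (rule Fubini'[symmetric]) (rule mf, measurable)
   also have "... = (\<L> v. (\<M> \<omega>. g \<omega>) * indicator (ball (0::'a) r) v)"
   proof (intro nn_integral_cong)
    fix v :: 'a
    have "(\<M> \<omega>. g (\<tau> v \<omega>) * indicator (ball (0::'a) r) v) = (\<M> \<omega>. g (\<tau> v \<omega>)) * indicator (ball (0::'a) r) v"
     by (rule nn_integral_multc) measurable
    thus "(\<M> \<omega>. g (\<tau> v \<omega>) * indicator (ball (0::'a) r) v) = (\<M> \<omega>. g \<omega>) * indicator (ball (0::'a) r) v"
     using nn_integral_flow[of g v] by simp
   qed
   also have "... = ennreal (?b * r ^ ?d) * (\<M> \<omega>. g \<omega>)"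
    using r by (subst nn_integral_cmult_indicator) (auto simp: emeasure_ball mult.commute)
   finally show ?thesis .
  qed
  have HL: "ennreal \<theta> * (\<L> v. indicator (A' m) (\<tau> v \<omega>) * indicator (ball (0::'a) (real m)) v)
    <= ennreal (5 ^ ?d * ?b) * (\<L> v. f (\<tau> v \<omega>) * indicator (ball (0::'a) (real m + real m)) v)"
   if \<omega> [measurable]: "\<omega> \<in> space M" for \<omega>
  proof -
   have [measurable]: "(\<lambda>v. \<tau> v \<omega>) \<in> measurable borel M" by (rule measurable_flow) (use \<omega> in auto)
   define E where "E = {v\<in>ball 0 (real m). \<tau> v \<omega> \<in> A' m}"
   have E: "E \<in> sets borel" unfolding E_def by measurable
   have shift: "J n (\<tau> v \<omega>) = (\<L> w. f (\<tau> w \<omega>) * indicator (ball v (real n)) w)" for n v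
   proof -
    have "(\<L> w. f (\<tau> (v + w) \<omega>) * indicator (ball v (real n)) (v + w)) = (\<L> w. f (\<tau> w \<omega>) * indicator (ball v (real n)) w)"
     by (rule nn_integral_lborel_shift) measurable
    thus ?thesis using \<omega> by (simp add: J_def flow_add add.commute[of _ v] indicator_def dist_norm)
   qed
   have "(\<L> v. indicator (A' m) (\<tau> v \<omega>) * indicator (ball (0::'a) (real m)) v) = (\<L> v. indicator E v)"
    by (intro nn_integral_cong) (auto simp: E_def indicator_def)
   hence "(\<L> v. indicator (A' m) (\<tau> v \<omega>) * indicator (ball (0::'a) (real m)) v) = emeasure lborel E" using E by simp
   moreover have "ennreal \<theta> * emeasure lborel E <= ennreal (5 ^ ?d * ?b) * (\<L> v. f (\<tau> v \<omega>) * indicator (ball (0::'a) (real m + real m)) v)"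
   proof (rule Hardy_Littlewood[OF _ \<theta> _ _ E])
    show "(\<lambda>v. f (\<tau> v \<omega>)) \<in> borel_measurable borel" by measurable
    show "E \<subseteq> ball 0 (real m)" unfolding E_def by blast
    fix v assume "v \<in> E"
    hence "\<exists>n\<in>{1..m}. ennreal (\<theta> * real n ^ ?d) < J n (\<tau> v \<omega>)" unfolding E_def A'_def by blast
    thus "\<exists>n\<in>{1..m}. ennreal (\<theta> * real n ^ ?d) < (\<L> w. f (\<tau> w \<omega>) * indicator (ball v (real n)) w)"
     unfolding shift .
   qed
   ultimately show ?thesis by simp
  qed
  have [measurable]: "(\<lambda>\<omega>. \<L> v. g (\<tau> v \<omega>) * indicator (ball (0::'a) r) v) \<in> borel_measurable M"
   if "g \<in> borel_measurable M" for g :: "'o => ennreal" and r by (rule lborel.borel_measurable_nn_integral[OF mf[OF that]])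
  have "ennreal (?b * real m ^ ?d) * (ennreal \<theta> * emeasure M (A' m))
   = ennreal \<theta> * (\<M> \<omega>. \<L> v. indicator (A' m) (\<tau> v \<omega>) * indicator (ball (0::'a) (real m)) v)"
   by (subst vol) (auto simp: mult_ac)
  also have "... = (\<M> \<omega>. ennreal \<theta> * (\<L> v. indicator (A' m) (\<tau> v \<omega>) * indicator (ball (0::'a) (real m)) v))"
   by (rule nn_integral_cmult[symmetric]) measurable
  also have "... <= (\<M> \<omega>. ennreal (5 ^ ?d * ?b) * (\<L> v. f (\<tau> v \<omega>) * indicator (ball (0::'a) (real m + real m)) v))"
   by (intro nn_integral_mono HL) 
  also have "... = ennreal (5 ^ ?d * ?b) * (\<M> \<omega>. \<L> v. f (\<tau> v \<omega>) * indicator (ball (0::'a) (real m + real m)) v)"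
   by (rule nn_integral_cmult) measurable
  also have "... = ennreal (5 ^ ?d * ?b) * (ennreal (?b * (real m + real m) ^ ?d) * (\<M> \<omega>. f \<omega>))"
   by (subst vol) auto
  \<comment> \<open>Centres in the ball of radius \<open>m\<close> involve the orbit up to radius
    \<open>2 * m\<close>; the ratio of volumes turns \<open>5 ^ d\<close> into
    \<open>10 ^ d\<close>.\<close>
  also have "... = ennreal (?b * real m ^ ?d) * (ennreal (10 ^ ?d * ?b) * (\<M> \<omega>. f \<omega>))"
  proof -
   have "(real m + real m) ^ ?d = 2 ^ ?d * real m ^ ?d" by (simp add: power_mult_distrib flip: mult_2)
   moreover have "(10::real) ^ ?d = 5 ^ ?d * 2 ^ ?d" by (simp flip: power_mult_distrib)
   ultimately have "ennreal (5 ^ ?d * ?b) * ennreal (?b * (real m + real m) ^ ?d) = ennreal (?b * real m ^ ?d) * ennreal (10 ^ ?d * ?b)"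
    by (simp add: ennreal_mult[symmetric] mult_ac)
   thus ?thesis by (metis mult.assoc)
  qed
  finally show ?thesis using m by (subst (asm) ennreal_mult_le_mult_iff) (auto simp: ennreal_eq_0_iff not_le)
 qed
 have "incseq A'" unfolding A'_def by (intro monoI) (auto; fastforce)
 hence "(\<lambda>m. emeasure M (A' m)) \<longlonglongrightarrow> emeasure M A" unfolding AU by (intro Lim_emeasure_incseq) auto
 hence "(\<lambda>m. ennreal \<theta> * emeasure M (A' m)) \<longlonglongrightarrow> ennreal \<theta> * emeasure M A"
  by (intro ennreal_tendsto_cmult) auto
 thus "ennreal \<theta> * emeasure M A <= ennreal (10 ^ ?d * ?b) * (\<M> \<omega>. f \<omega>)"
  by (rule LIMSEQ_le_const2) (use bound in blast)
qed

end

text \<open>The rearrangement exceeds \<open>2 ^ k\<close> on an interval as long as the tail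
  probability \<open>m k\<close>. Integrating the decreasing weight over that interval gives at
  least \<open>m k powr (1 / d)\<close>, and summing the layers costs a factor 2.\<close>

lemma (in prob_space) summable_lorentz_tails:
 assumes f: "f \<in> lorentz_space M d" and d: "1 <= d"
 shows "summable (\<lambda>k. 2 ^ k * prob {\<omega>\<in>space M. 2 ^ k < \<bar>f \<omega>\<bar>} powr (1 / real d))"
proof -
 from f obtain fs where [measurable]: "f \<in> borel_measurable M" and fs: "is_decreasing_rearrangement M f fs"
  and fin: "(\<integral>\<^sup>+s\<in>{0<..<1}. ennreal (fs s * s powr (1 / real d - 1)) \<partial>lborel) < \<infinity>"
  unfolding lorentz_space_def by auto
 let ?I = "{0<..<1::real}" and ?R = "restrict_space lborel {0<..<1::real}"
 have anti: "antimono_on ?I fs" and nn: "\<And>s. s \<in> ?I ==> 0 <= fs s" and dis: "distr ?R borel fs = distr M borel (\<lambda>\<omega>. \<bar>f \<omega>\<bar>)"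
  using fs unfolding is_decreasing_rearrangement_def by auto
 have "mono_on ?I (\<lambda>s. - fs s)" using anti by (auto simp: monotone_on_def)
 hence "(\<lambda>s. - fs s) \<in> borel_measurable (restrict_space borel ?I)" by (rule borel_measurable_mono_on_fnc)
 hence fsm [measurable]: "fs \<in> borel_measurable ?R"
  using borel_measurable_uminus_eq[of fs ?R] by (simp add: measurable_cong_sets[OF sets_restrict_space_cong[OF sets_lborel] refl])
 define m where "m k = prob {\<omega>\<in>space M. 2 ^ k < \<bar>f \<omega>\<bar>}" for k :: nat
 have m: "ennreal (m k) = emeasure lborel {s\<in>?I. 2 ^ k < fs s}" for k
 proof -
  have "ennreal (m k) = emeasure (distr M borel (\<lambda>\<omega>. \<bar>f \<omega>\<bar>)) {2 ^ k<..}"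
   by (subst emeasure_distr) (auto simp: m_def emeasure_eq_measure intro!: arg_cong[where f=prob])
  also have "... = emeasure ?R (fs -` {2 ^ k<..} \<inter> space ?R)" unfolding dis[symmetric] by (subst emeasure_distr) auto
  also have "... = emeasure lborel {s\<in>?I. 2 ^ k < fs s}"
   by (subst emeasure_restrict_space) (auto simp: space_restrict_space intro!: arg_cong[where f="emeasure lborel"])
  finally show ?thesis .
 qed
 have m01: "0 <= m k" "m k <= 1" for k by (auto simp: m_def)
 have gt: "2 ^ k < fs s" if s: "0 < s" "s < m k" for s k
 proof (rule ccontr)
  assume "\<not> 2 ^ k < fs s"
  have s1: "s \<in> ?I" using s m01(2)[of k] by auto
  have "{t\<in>?I. 2 ^ k < fs t} \<subseteq> {0<..<s}"
  proof
   fix t assume t: "t \<in> {t\<in>?I. 2 ^ k < fs t}"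
   have "\<not> s <= t" using t s1 \<open>\<not> 2 ^ k < fs s\<close> monotone_onD[OF anti s1, of t] by auto
   thus "t \<in> {0<..<s}" using t by auto
  qed
  hence "ennreal (m k) <= emeasure lborel {0<..<s}" unfolding m by (intro emeasure_mono) auto
  thus False using s by simp
 qed
 have lower: "ennreal (m k powr (1 / real d)) <= (\<L> s. ennreal (s powr (1 / real d - 1)) * indicator {0<..<m k} s)" for k
 proof (cases "m k = 0")
  case False
  hence mk: "0 < m k" using m01(1)[of k] by simp
  have "ennreal (m k powr (1 / real d)) = ennreal (m k powr (1 / real d - 1)) * emeasure lborel {0<..<m k}"
   using mk by (simp add: ennreal_mult[symmetric] powr_diff)
  also have "... = (\<L> s. ennreal (m k powr (1 / real d - 1)) * indicator {0<..<m k} s)" by (simp add: nn_integral_cmult_indicator)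
  also have "... <= (\<L> s. ennreal (s powr (1 / real d - 1)) * indicator {0<..<m k} s)"
   using d by (intro nn_integral_mono) (auto split: split_indicator intro!: ennreal_leI powr_mono2')
  finally show ?thesis .
 qed simp
 \<comment> \<open>The sum is geometric up to the last \<open>n\<close> with \<open>s < m n\<close>,
   and there \<open>2 ^ n < fs s\<close>.\<close>
 have dyadic: "(\<Sum>k. ennreal (2 ^ k) * indicator {0<..<m k} s) <= ennreal (2 * fs s) * indicator ?I s" for s
 proof (cases "s \<in> ?I")
  case True
  show ?thesis
  proof (rule suminf_le_const[OF summableI])
   fix n :: nat
   show "(\<Sum>k<n. ennreal (2 ^ k) * indicator {0<..<m k} s) <= ennreal (2 * fs s) * indicator ?I s"
   proof (induction n)
    case (Suc n)
    show ?case
    proof (cases "s < m n")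
     case True
     have "(\<Sum>k<Suc n. ennreal (2 ^ k) * indicator {0<..<m k} s) <= (\<Sum>k<Suc n. ennreal (2 ^ k))"
      by (intro sum_mono) (auto split: split_indicator)
     also have "... = ennreal (\<Sum>k<Suc n. 2 ^ k)" by (rule sum_ennreal) auto
     also have "(\<Sum>k<Suc n. 2 ^ k) = (2 * 2 ^ n - 1 :: real)" by (induction n) auto
     also have "ennreal (2 * 2 ^ n - 1) <= ennreal (2 * fs s)" using gt[of s n] True \<open>s \<in> ?I\<close> by (intro ennreal_leI) auto
     finally show ?thesis using \<open>s \<in> ?I\<close> by simp
    qed (use Suc in simp)
   qed simp
  qed
 next
  case False
  hence "s \<notin> {0<..<m k}" for k using m01(2)[of k] by auto
  thus ?thesis by simp
 qed
 have "(\<Sum>k. ennreal (2 ^ k * m k powr (1 / real d))) <= (\<Sum>k. ennreal (2 ^ k) * (\<L> s. ennreal (s powr (1 / real d - 1)) * indicator {0<..<m k} s))"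
  by (intro suminf_le summableI) (auto simp: ennreal_mult intro!: mult_left_mono lower)
 also have "... = (\<L> s. (\<Sum>k. ennreal (2 ^ k) * (ennreal (s powr (1 / real d - 1)) * indicator {0<..<m k} s)))"
  by (subst nn_integral_suminf) (auto simp: nn_integral_cmult)
 also have "... <= (\<L> s. 2 * (ennreal (fs s * s powr (1 / real d - 1)) * indicator ?I s))"
 proof (intro nn_integral_mono)
  fix s :: real
  have "(\<Sum>k. ennreal (2 ^ k) * (ennreal (s powr (1 / real d - 1)) * indicator {0<..<m k} s)) = (\<Sum>k. ennreal (2 ^ k) * indicator {0<..<m k} s) * ennreal (s powr (1 / real d - 1))"
   by (simp add: mult_ac flip: ennreal_suminf_cmult)
  also have "... <= (ennreal (2 * fs s) * indicator ?I s) * ennreal (s powr (1 / real d - 1))" by (intro mult_right_mono dyadic) auto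
  also have "... = 2 * (ennreal (fs s * s powr (1 / real d - 1)) * indicator ?I s)"
   using nn[of s] by (auto simp: ennreal_mult mult_ac split: split_indicator)
  finally show "(\<Sum>k. ennreal (2 ^ k) * (ennreal (s powr (1 / real d - 1)) * indicator {0<..<m k} s)) <= 2 * (ennreal (fs s * s powr (1 / real d - 1)) * indicator ?I s)" .
 qed
 also have "... = 2 * (\<integral>\<^sup>+s\<in>?I. ennreal (fs s * s powr (1 / real d - 1)) \<partial>lborel)"
 proof (rule nn_integral_cmult)
  have "(\<lambda>s. ennreal (fs s)) \<in> borel_measurable ?R" by measurable
  hence "(\<lambda>s. ennreal (fs s) * indicator ?I s) \<in> borel_measurable lborel"
   by (subst (asm) borel_measurable_restrict_space_iff_ennreal) auto
  hence "(\<lambda>s. (ennreal (fs s) * indicator ?I s) * ennreal (s powr (1 / real d - 1))) \<in> borel_measurable lborel" by measurable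
  also have "(\<lambda>s. (ennreal (fs s) * indicator ?I s) * ennreal (s powr (1 / real d - 1))) = (\<lambda>s. ennreal (fs s * s powr (1 / real d - 1)) * indicator ?I s)"
   using nn by (auto simp: fun_eq_iff ennreal_mult split: split_indicator)
  finally show "(\<lambda>s. ennreal (fs s * s powr (1 / real d - 1)) * indicator ?I s) \<in> borel_measurable lborel" .
 qed
 also have "... < \<infinity>" using fin by (simp add: ennreal_mult_less_top)
 finally have "(\<Sum>k. ennreal (2 ^ k * m k powr (1 / real d))) \<noteq> top" by (simp add: less_top)
 hence "summable (\<lambda>k. 2 ^ k * m k powr (1 / real d))" by (rule summable_suminf_not_top[rotated]) simp
 thus ?thesis unfolding m_def .
qed

section \<open>Dyadic tails, layer sums and sublinear growth along orbits\<close>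

context ergodic_flow
begin

text \<open>The Lorentz condition expressed by tail probabilities alone, in which form its stability
  under the flow and under finite sums is elementary.\<close>

definition dyadic_tails :: "('o => real) => bool" where
 "dyadic_tails X \<longleftrightarrow> X \<in> borel_measurable M \<and> summable (\<lambda>k. 2 ^ k * prob {\<omega>\<in>space M. 2 ^ k < X \<omega>} powr (1 / real DIM('a)))"

lemma dyadic_tails_flow:
 assumes "dyadic_tails X"
 shows "dyadic_tails (\<lambda>\<omega>. X (\<tau> v \<omega>))"
proof -
 have [measurable]: "X \<in> borel_measurable M" using assms by (simp add: dyadic_tails_def)
 have "prob {\<omega>\<in>space M. c < X (\<tau> v \<omega>)} = prob {\<omega>\<in>space M. c < X \<omega>}" for c
 proof -
  have "measure (distr M M (\<tau> v)) {\<omega>\<in>space M. c < X \<omega>} = prob (\<tau> v -` {\<omega>\<in>space M. c < X \<omega>} \<inter> space M)"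
   by (rule measure_distr[OF flow_measurable]) measurable
  moreover have "\<tau> v -` {\<omega>\<in>space M. c < X \<omega>} \<inter> space M = {\<omega>\<in>space M. c < X (\<tau> v \<omega>)}" using flow_space by auto
  ultimately show ?thesis by (simp add: flow_invariant)
 qed
 with assms show ?thesis by (simp add: dyadic_tails_def)
qed

text \<open>A sum above \<open>2 ^ Suc k\<close> has a summand above \<open>2 ^ k\<close>; the shift
  of the index only costs a constant factor.\<close>

lemma dyadic_tails_add:
 assumes X: "dyadic_tails X" and Y: "dyadic_tails Y"
 shows "dyadic_tails (\<lambda>\<omega>. X \<omega> + Y \<omega>)"
proof -
 have [measurable]: "X \<in> borel_measurable M" "Y \<in> borel_measurable M" using assms by (auto simp: dyadic_tails_def)
 let ?q = "\<lambda>X k. prob {\<omega>\<in>space M. 2 ^ k < (X \<omega> :: real)}" and ?e = "1 / real DIM('a)"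
 have e: "0 < ?e" "?e <= 1" by auto
 let ?A = "\<lambda>\<omega>. X \<omega> + Y \<omega>"
 have le: "2 ^ Suc k * ?q ?A (Suc k) powr ?e <= 4 * (2 ^ k * ?q X k powr ?e) + 4 * (2 ^ k * ?q Y k powr ?e)" for k
 proof -
  have "?q ?A (Suc k) <= prob ({\<omega>\<in>space M. 2 ^ k < X \<omega>} \<union> {\<omega>\<in>space M. 2 ^ k < Y \<omega>})"
   by (intro finite_measure_mono) auto
  also have "... <= ?q X k + ?q Y k" by (intro measure_Un_le) auto
  also have "... <= 2 * max (?q X k) (?q Y k)" by simp
  finally have "?q ?A (Suc k) powr ?e <= (2 * max (?q X k) (?q Y k)) powr ?e"
   using e by (intro powr_mono2) auto
  also have "... = 2 powr ?e * max (?q X k) (?q Y k) powr ?e" by (subst powr_mult) (auto simp: le_max_iff_disj)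
  also have "... <= 2 powr 1 * (?q X k powr ?e + ?q Y k powr ?e)" using e by (intro mult_mono powr_mono) (auto simp: max_def)
  finally have "2 ^ Suc k * ?q ?A (Suc k) powr ?e <= 2 ^ Suc k * (2 powr 1 * (?q X k powr ?e + ?q Y k powr ?e))"
   by (rule mult_left_mono) simp
  thus ?thesis by (simp add: distrib_left mult.assoc mult.left_commute)
 qed
 have "summable (\<lambda>k. 4 * (2 ^ k * ?q X k powr ?e) + 4 * (2 ^ k * ?q Y k powr ?e))"
  using X Y by (intro summable_add summable_mult) (auto simp: dyadic_tails_def)
 hence "summable (\<lambda>k. 2 ^ Suc k * ?q ?A (Suc k) powr ?e)"
  by (rule summable_comparison_test'[of _ 0]) (use le in auto)
 hence "summable (\<lambda>k. 2 ^ k * ?q ?A k powr ?e)" by (subst (asm) summable_Suc_iff)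
 thus ?thesis unfolding dyadic_tails_def by auto
qed

lemma dyadic_tails_sum:
 assumes "finite F" "\<And>v. v \<in> F ==> dyadic_tails (X v)"
 shows "dyadic_tails (\<lambda>\<omega>. \<Sum>v\<in>F. X v \<omega>)" using assms
proof (induction F rule: finite_induct)
 case empty
 have "\<not> (2::real) ^ k < 0" for k by (simp add: not_less)
 thus ?case by (simp add: dyadic_tails_def)
qed (simp add: dyadic_tails_add)

text \<open>A summable sequence has a summable \<open>d\<close>-th power; in terms of norms, L(d,1)
  is contained in L^d.\<close>

lemma dyadic_tails_moment:
 assumes X: "dyadic_tails X" and nn: "\<And>\<omega>. 0 <= X \<omega>"
 shows "(\<M> \<omega>. ennreal (X \<omega> ^ DIM('a))) < \<infinity>"
proof -
 let ?d = "DIM('a)"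
 define p where "p k = prob {\<omega>\<in>space M. 2 ^ k < X \<omega>}" for k :: nat
 define a where "a k = 2 ^ k * p k powr (1 / real ?d)" for k
 have [measurable]: "X \<in> borel_measurable M" and s: "summable a" using X unfolding dyadic_tails_def a_def[abs_def] p_def by auto
 have a0: "0 <= a k" for k by (simp add: a_def)
 have ale: "a k <= suminf a" for k using sum_le_suminf[OF s, of "{k}"] a0 by simp
 have ad: "(2 ^ Suc k) ^ ?d * p k <= (2 ^ ?d * suminf a ^ (?d - 1)) * a k" for k
 proof -
  have "p k = (p k powr (1 / real ?d)) ^ ?d" by (simp add: powr_inverse_power p_def)
  hence "(2 ^ Suc k) ^ ?d * p k = 2 ^ ?d * a k ^ ?d" by (simp add: a_def power_mult_distrib)
  also have "a k ^ ?d = a k * a k ^ (?d - 1)" using DIM_positive[where 'a='a] by (simp flip: power_Suc)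
  also have "... <= a k * suminf a ^ (?d - 1)" using a0 ale by (intro mult_left_mono power_mono) auto
  finally show ?thesis by (simp add: mult_ac)
 qed
 have pw: "ennreal (x ^ ?d) <= 1 + (\<Sum>k. ennreal ((2 ^ Suc k) ^ ?d) * indicator {2 ^ k<..} x)" if x: "0 <= x" for x :: real
 proof -
  have ex: "\<exists>n. x <= 2 ^ n" using real_arch_pow[of 2 x] by (auto intro: less_imp_le)
  define n where "n = (LEAST n. x <= 2 ^ n)"
  have n: "x <= 2 ^ n" unfolding n_def by (rule LeastI_ex[OF ex])
  show ?thesis
  proof (cases n)
   case 0
   hence "ennreal (x ^ ?d) <= ennreal 1" using n x by (intro ennreal_leI power_le_one) auto
   also have "... <= 1 + (\<Sum>k. ennreal ((2 ^ Suc k) ^ ?d) * indicator {2 ^ k<..} x)" by simp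
   finally show ?thesis .
  next
   case (Suc k)
   hence "2 ^ k < x" using not_less_Least[of k "\<lambda>n. x <= 2 ^ n"] unfolding n_def[symmetric] by auto
   hence "ennreal (x ^ ?d) <= ennreal ((2 ^ Suc k) ^ ?d) * indicator {2 ^ k<..} x"
    using power_mono[of x "2 ^ Suc k" ?d] n x Suc by (auto intro!: ennreal_leI simp: power_mult_distrib)
   also have "... <= (\<Sum>k. ennreal ((2 ^ Suc k) ^ ?d) * indicator {2 ^ k<..} x)" by (rule le_suminf_ennreal)
   finally show ?thesis by (simp add: add_increasing)
  qed
 qed
 have "(\<M> \<omega>. ennreal (X \<omega> ^ ?d)) <= (\<M> \<omega>. 1 + (\<Sum>k. ennreal ((2 ^ Suc k) ^ ?d) * indicator {\<omega>\<in>space M. 2 ^ k < X \<omega>} \<omega>))"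
 proof (intro nn_integral_mono)
  fix \<omega> assume "\<omega> \<in> space M"
  hence "indicator {\<omega>\<in>space M. 2 ^ k < X \<omega>} \<omega> = (indicator {2 ^ k<..} (X \<omega>) :: ennreal)" for k by (auto simp: indicator_def)
  thus "ennreal (X \<omega> ^ ?d) <= 1 + (\<Sum>k. ennreal ((2 ^ Suc k) ^ ?d) * indicator {\<omega>\<in>space M. 2 ^ k < X \<omega>} \<omega>)"
   using pw[OF nn] by simp
 qed
 also have "... = 1 + (\<Sum>k. ennreal ((2 ^ Suc k) ^ ?d) * emeasure M {\<omega>\<in>space M. 2 ^ k < X \<omega>})"
  by (simp add: nn_integral_add nn_integral_suminf nn_integral_cmult_indicator emeasure_space_1)
 also have "... = 1 + (\<Sum>k. ennreal ((2 ^ Suc k) ^ ?d * p k))"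
  by (simp only: emeasure_eq_measure p_def ennreal_mult[OF zero_le_power measure_nonneg] zero_le_power zero_le_numeral)
 also have "... <= 1 + (\<Sum>k. ennreal ((2 ^ ?d * suminf a ^ (?d - 1)) * a k))" by (intro add_left_mono suminf_le summableI ennreal_leI ad)
 also have "... = 1 + ennreal (\<Sum>k. (2 ^ ?d * suminf a ^ (?d - 1)) * a k)"
  using a0 suminf_nonneg[OF s a0] by (subst suminf_ennreal2) (auto intro!: summable_mult s)
 also have "... < \<infinity>" by simp
 finally show ?thesis .
qed

lemma AE_ex_avoid_of_tails:
 fixes a :: "nat => real"
 assumes D: "\<And>K. D K \<in> events" and \<eta>: "0 < \<eta>" and a: "summable a" "\<And>k. 0 <= a k" and c: "0 <= c"
  and le: "\<And>K. ennreal \<eta> * emeasure M (D K) <= ennreal c * (\<Sum>k. ennreal (a (K + k)))"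
 shows "AE \<omega> in M. \<exists>K::nat. \<omega> \<notin> D K"
proof (rule AE_ex_avoid[OF D])
 have "(\<lambda>K. \<Sum>k. a (k + K)) \<longlonglongrightarrow> 0" using suminf_exist_split[OF _ a(1)] by (intro LIMSEQ_I) simp
 hence "(\<lambda>K. ennreal (c / \<eta> * (\<Sum>k. a (k + K)))) \<longlonglongrightarrow> ennreal (c / \<eta> * 0)"
  by (intro tendsto_ennrealI tendsto_intros)
 hence lim: "(\<lambda>K. ennreal (c / \<eta> * (\<Sum>k. a (k + K)))) \<longlonglongrightarrow> 0" by simp
 have "emeasure M (D K) <= ennreal (c / \<eta> * (\<Sum>k. a (k + K)))" for K
 proof -
  have s: "summable (\<lambda>k. a (K + k))" using summable_ignore_initial_segment[OF a(1), of K] by (simp add: add.commute)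
  have "ennreal \<eta> * emeasure M (D K) <= ennreal c * ennreal (\<Sum>k. a (K + k))" using le[of K] by (subst (asm) suminf_ennreal2[OF a(2) s])
  also have "... = ennreal \<eta> * ennreal (c / \<eta> * (\<Sum>k. a (K + k)))"
   using \<eta> c suminf_nonneg[OF s a(2)] by (simp add: ennreal_mult[symmetric])
  finally have "emeasure M (D K) <= ennreal (c / \<eta> * (\<Sum>k. a (K + k)))"
   using \<eta> by (subst (asm) ennreal_mult_le_mult_iff) (auto simp: ennreal_eq_0_iff)
  thus ?thesis by (simp add: add.commute)
 qed
 thus "(\<lambda>K. emeasure M (D K)) \<longlonglongrightarrow> 0" by (intro tendsto_sandwich[OF _ _ tendsto_const lim]) auto
qed

lemma orbit_measurable: "\<omega> \<in> space M ==> (\<lambda>v. \<tau> v \<omega>) \<in> measurable borel M" by (rule measurable_flow) auto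

text \<open>The radius must be uniform over all layers, so each layer gets a random majorant
  \<open>Y k\<close> of its root divided by \<open>n\<close>, valid for all \<open>n\<close>. The
  maximal inequality bounds the expectation of \<open>Y k\<close> by a multiple of
  \<open>t k\<close>, and the weighted tails of these expectations vanish.\<close>

lemma layer_averages_nat:
 assumes X: "dyadic_tails X" and \<eta>: "0 < \<eta>"
 shows "AE \<omega> in M. \<exists>K. \<forall>n\<ge>1. layer_sum (\<lambda>v. X (\<tau> v \<omega>)) K (real n) <= ennreal (\<eta> * real n)"
proof -
 let ?d = "DIM('a)" and ?C = "10 ^ DIM('a) * unit_ball_vol (real DIM('a))"
 define p where "p k = prob {\<omega>\<in>space M. 2 ^ k < X \<omega>}" for k :: nat
 have Xm [measurable]: "X \<in> borel_measurable M" and s: "summable (\<lambda>k. 2 ^ k * p k powr (1 / real ?d))"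
  using X unfolding dyadic_tails_def p_def by auto
 have p0: "0 <= p k" for k by (simp add: p_def)
 define E where "E k = {\<omega>\<in>space M. 2 ^ k < X \<omega>}" for k :: nat
 have E [measurable]: "E k \<in> events" for k unfolding E_def by measurable
 have pE: "emeasure M (E k) = ennreal (p k)" for k by (simp add: E_def p_def emeasure_eq_measure)
 define m where "m k n \<omega> = measure lborel ({v. 2 ^ k < X (\<tau> v \<omega>)} \<inter> ball 0 (real n))" for k n \<omega>
 have me: "ennreal (m k n \<omega>) = (\<L> w. indicator (E k) (\<tau> w \<omega>) * indicator (ball (0::'a) (real n)) w)" if \<omega>: "\<omega> \<in> space M" for k n \<omega>
 proof -
  note [measurable] = orbit_measurable[OF \<omega>]
  have S: "{v. 2 ^ k < X (\<tau> v \<omega>)} \<in> sets borel" by measurable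
  have "ennreal (m k n \<omega>) = emeasure lborel ({v. 2 ^ k < X (\<tau> v \<omega>)} \<inter> ball 0 (real n))"
   unfolding m_def by (rule emeasure_ball_Int_eq_measure[symmetric])
  also have "... = (\<L> w. indicator ({v. 2 ^ k < X (\<tau> v \<omega>)} \<inter> ball 0 (real n)) w)" using S by simp
  also have "... = (\<L> w. indicator (E k) (\<tau> w \<omega>) * indicator (ball (0::'a) (real n)) w)"
   using flow_space[OF \<omega>] by (intro nn_integral_cong) (auto simp: E_def indicator_def)
  finally show ?thesis .
 qed
 show ?thesis
 proof (cases "?d = 1")
  case True
  \<comment> \<open>In dimension one the root disappears, so all layers merge into one function and
    a single maximal inequality does it.\<close>
  define F where "F K \<omega> = (\<Sum>k. ennreal (2 ^ (K + k)) * indicator (E (K + k)) \<omega>)" for K \<omega>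
  have F [measurable]: "F K \<in> borel_measurable M" for K unfolding F_def[abs_def] by measurable
  let ?D = "\<lambda>K. {\<omega>\<in>space M. \<exists>n\<ge>1. ennreal (\<eta> * real n ^ ?d) < (\<L> w. F K (\<tau> w \<omega>) * indicator (ball (0::'a) (real n)) w)}"
  have "AE \<omega> in M. \<exists>K. \<omega> \<notin> ?D K"
  proof (rule AE_ex_avoid_of_tails[OF _ \<eta> s, where c="?C"])
   show "?D K \<in> events" for K by (rule maximal_inequality(1)[OF F \<eta>])
   show "ennreal \<eta> * emeasure M (?D K) <= ennreal ?C * (\<Sum>k. ennreal (2 ^ (K + k) * p (K + k) powr (1 / real ?d)))" for K
   proof -
    have "(\<M> \<omega>. F K \<omega>) = (\<Sum>k. ennreal (2 ^ (K + k)) * emeasure M (E (K + k)))"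
     unfolding F_def by (simp add: nn_integral_suminf nn_integral_cmult)
    also have "... = (\<Sum>k. ennreal (2 ^ (K + k) * p (K + k) powr (1 / real ?d)))" using p0 True by (simp add: pE ennreal_mult)
    finally show ?thesis using maximal_inequality(2)[OF F[of K] \<eta>] by simp
   qed
  qed (auto simp: p0)
  with AE_space show ?thesis
  proof eventually_elim
   case (elim \<omega>)
   then obtain K where K: "\<omega> \<notin> ?D K" by blast
   note [measurable] = orbit_measurable[OF elim(1)]
   show ?case
   proof (intro exI allI impI)
    fix n :: nat assume n: "1 <= n"
    have "(\<Sum>k. ennreal (2 ^ (K + k)) * ennreal (m (K + k) n \<omega> powr (1 / real ?d))) = (\<Sum>k. ennreal (2 ^ (K + k)) * ennreal (m (K + k) n \<omega>))"
     using True by (simp add: m_def)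
    also have "... = (\<L> w. (\<Sum>k. ennreal (2 ^ (K + k)) * (indicator (E (K + k)) (\<tau> w \<omega>) * indicator (ball (0::'a) (real n)) w)))"
     using elim(1) by (simp add: me nn_integral_suminf nn_integral_cmult)
    also have "... = (\<L> w. F K (\<tau> w \<omega>) * indicator (ball (0::'a) (real n)) w)"
     unfolding F_def by (simp flip: ennreal_suminf_multc add: mult.assoc)
    also have "... <= ennreal (\<eta> * real n)" using K elim(1) n True by (auto simp: not_less)
    finally show "layer_sum (\<lambda>v. X (\<tau> v \<omega>)) K (real n) <= ennreal (\<eta> * real n)" unfolding m_def .
   qed
  qed
 next
  case False
  hence d2: "2 <= ?d" using DIM_positive[where 'a='a] by linarith
  \<comment> \<open>The added geometric term makes thresholds positive even for null layers and
    stays summable against \<open>2 ^ k\<close>.\<close>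
  define t where "t k = p k powr (1 / real ?d) + (1 / 4) ^ k" for k
  have t0: "0 < t k" for k unfolding t_def by (intro add_nonneg_pos) auto
  have pt: "p k <= t k ^ ?d" for k
  proof -
   have "p k = (p k powr (1 / real ?d)) ^ ?d" using p0 by (simp add: powr_inverse_power)
   also have "... <= t k ^ ?d" by (intro power_mono) (auto simp: t_def)
   finally show ?thesis .
  qed
  have "summable (\<lambda>k. 2 ^ k * p k powr (1 / real ?d) + (1 / 2) ^ k)" by (intro summable_add s summable_geometric) simp
  moreover have "2 ^ k * p k powr (1 / real ?d) + (1 / 2) ^ k = 2 ^ k * t k" for k
  proof -
   have "(2::real) ^ k * (1 / 4) ^ k = (1 / 2) ^ k" by (simp flip: power_mult_distrib)
   thus ?thesis by (simp add: t_def distrib_left)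
  qed
  ultimately have st: "summable (\<lambda>k. 2 ^ k * t k)" by simp
  define A where "A k \<theta> = {\<omega>\<in>space M. \<exists>n\<ge>1. ennreal (\<theta> * real n ^ ?d) < (\<L> w. indicator (E k) (\<tau> w \<omega>) * indicator (ball (0::'a) (real n)) w)}" for k \<theta>
  have A: "A k \<theta> \<in> events" "ennreal \<theta> * emeasure M (A k \<theta>) <= ennreal (?C * p k)" if "0 < \<theta>" for k \<theta>
   unfolding A_def using maximal_inequality[of "indicator (E k)" \<theta>] that p0 by (auto simp: pE ennreal_mult)
  define T where "T k j = (t k * 2 ^ j) ^ ?d" for k j :: nat
  have T0: "0 < T k j" for k j using t0[of k] by (simp add: T_def)
  have AT [measurable]: "A k (T k j) \<in> events" for k j using A(1)[OF T0] .
  \<comment> \<open>\<open>t k\<close> times a dyadic bound of the supremum over \<open>n\<close>: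
    the \<open>j\<close>-th indicator records that the root divided by \<open>n\<close> somewhere
    exceeds \<open>t k * 2 ^ j\<close>.\<close>
  define Y where "Y k \<omega> = ennreal (t k) * (1 + (\<Sum>j. ennreal (2 ^ j) * indicator (A k (T k j)) \<omega>))" for k \<omega>
  have Y [measurable]: "Y k \<in> borel_measurable M" for k unfolding Y_def[abs_def] by measurable
  have Yle: "ennreal (m k n \<omega> powr (1 / real ?d)) <= ennreal (real n) * Y k \<omega>" if \<omega>: "\<omega> \<in> space M" and n: "1 <= n" for k n \<omega>
  proof -
   define x where "x = m k n \<omega> powr (1 / real ?d) / (real n * t k)"
   have m0: "0 <= m k n \<omega>" by (simp add: m_def)
   have in_A: "\<omega> \<in> A k (T k j)" if "2 ^ j < x" for j
   proof -
    have "t k * 2 ^ j * real n < m k n \<omega> powr (1 / real ?d)" using that n t0[of k] by (simp add: x_def field_simps)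
    hence "(t k * 2 ^ j * real n) ^ ?d < (m k n \<omega> powr (1 / real ?d)) ^ ?d" using t0[of k] by (intro power_strict_mono) auto
    hence "T k j * real n ^ ?d < m k n \<omega>" using m0 by (simp add: T_def power_mult_distrib powr_inverse_power)
    hence "ennreal (T k j * real n ^ ?d) < ennreal (m k n \<omega>)" using T0[of k j] by (intro ennreal_lessI) (auto intro: le_less_trans[rotated])
    thus ?thesis unfolding A_def me[OF \<omega>] using \<omega> n by blast
   qed
   have "ennreal x <= 1 + dyadic_excess 0 x" using le_dyadic_excess[of x 0] by simp
   also have "dyadic_excess 0 x <= (\<Sum>j. ennreal (2 ^ j) * indicator (A k (T k j)) \<omega>)"
    unfolding dyadic_excess_def by (intro suminf_le summableI) (use in_A in \<open>auto simp: indicator_def\<close>)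
   finally have "ennreal (real n * t k) * ennreal x <= ennreal (real n * t k) * (1 + (\<Sum>j. ennreal (2 ^ j) * indicator (A k (T k j)) \<omega>))"
    by (intro mult_left_mono add_left_mono) auto
   moreover have "ennreal (real n * t k) * ennreal x = ennreal (m k n \<omega> powr (1 / real ?d))"
    using n t0[of k] by (simp add: x_def ennreal_mult[symmetric])
   ultimately show ?thesis using t0[of k] by (simp add: Y_def ennreal_mult mult.assoc)
  qed
  have Yint: "(\<M> \<omega>. Y k \<omega>) <= ennreal ((1 + 2 * ?C) * t k)" for k
  proof -
   \<comment> \<open>The maximal inequality gives probability of order \<open>2 ^ (- j * d)\<close>;
     against the weight \<open>2 ^ j\<close> this is summable since the dimension is at least
     2.\<close>
   have j: "ennreal (2 ^ j) * emeasure M (A k (T k j)) <= ennreal (?C * (1 / 2) ^ j)" for j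
   proof -
    have "ennreal (T k j) * emeasure M (A k (T k j)) <= ennreal (?C * p k)" by (rule A(2)[OF T0])
    hence "T k j * prob (A k (T k j)) <= ?C * p k" using T0[of k j] p0 by (simp add: emeasure_eq_measure ennreal_mult[symmetric])
    also have "... <= ?C * t k ^ ?d" by (intro mult_left_mono pt) auto
    finally have "t k ^ ?d * ((2 ^ j) ^ ?d * prob (A k (T k j))) <= t k ^ ?d * ?C" by (simp add: T_def power_mult_distrib mult_ac)
    hence "(2 ^ j) ^ ?d * prob (A k (T k j)) <= ?C" using t0[of k] by simp
    moreover have "(2 ^ j) ^ 2 * prob (A k (T k j)) <= (2 ^ j) ^ ?d * prob (A k (T k j))"
     using d2 by (intro mult_right_mono power_increasing) auto
    ultimately have "2 ^ j * prob (A k (T k j)) <= ?C * (1 / 2) ^ j" by (simp add: power2_eq_square power_divide field_simps)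
    thus ?thesis by (simp add: emeasure_eq_measure ennreal_mult[symmetric] ennreal_leI)
   qed
   have "(\<M> \<omega>. Y k \<omega>) = ennreal (t k) * (1 + (\<Sum>j. ennreal (2 ^ j) * emeasure M (A k (T k j))))"
    unfolding Y_def by (simp add: nn_integral_cmult nn_integral_add nn_integral_suminf emeasure_space_1)
   also have "... <= ennreal (t k) * (1 + (\<Sum>j. ennreal (?C * (1 / 2) ^ j)))"
    by (intro mult_left_mono add_left_mono suminf_le summableI j) auto
   also have "(\<Sum>j. ennreal (?C * (1 / 2) ^ j)) = ennreal (?C * 2)"
    by (subst suminf_ennreal2) (auto intro!: summable_mult summable_geometric simp: suminf_mult suminf_geometric)
   also have "ennreal (t k) * (1 + ennreal (?C * 2)) = ennreal (t k) * ennreal (1 + ?C * 2)" by (subst ennreal_plus) auto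
   also have "... = ennreal ((1 + 2 * ?C) * t k)" using t0[of k] by (subst ennreal_mult[symmetric]) (auto simp: mult_ac)
   finally show ?thesis .
  qed
  define Z where "Z K \<omega> = (\<Sum>k. ennreal (2 ^ (K + k)) * Y (K + k) \<omega>)" for K \<omega>
  have Z [measurable]: "Z K \<in> borel_measurable M" for K unfolding Z_def[abs_def] by measurable
  let ?D = "\<lambda>K. {\<omega>\<in>space M. ennreal \<eta> <= Z K \<omega>}"
  have "AE \<omega> in M. \<exists>K. \<omega> \<notin> ?D K"
  proof (rule AE_ex_avoid_of_tails[OF _ \<eta> st, where c="1 + 2 * ?C"])
   show "?D K \<in> events" for K by measurable
   show "ennreal \<eta> * emeasure M (?D K) <= ennreal (1 + 2 * ?C) * (\<Sum>k. ennreal (2 ^ (K + k) * t (K + k)))" for K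
   proof -
    have "ennreal \<eta> * emeasure M (?D K) = (\<M> \<omega>. ennreal \<eta> * indicator (?D K) \<omega>)"
     by (rule nn_integral_cmult_indicator[symmetric]) measurable
    also have "... <= (\<M> \<omega>. Z K \<omega>)" by (intro nn_integral_mono) (auto simp: indicator_def)
    also have "... = (\<Sum>k. ennreal (2 ^ (K + k)) * (\<M> \<omega>. Y (K + k) \<omega>))"
     unfolding Z_def by (simp add: nn_integral_suminf nn_integral_cmult)
    also have "... <= (\<Sum>k. ennreal (2 ^ (K + k)) * ennreal ((1 + 2 * ?C) * t (K + k)))"
     by (intro suminf_le summableI mult_left_mono Yint) auto
    also have "... = ennreal (1 + 2 * ?C) * (\<Sum>k. ennreal (2 ^ (K + k) * t (K + k)))"
    proof -
     have "ennreal (2 ^ i) * ennreal (c * t i) = ennreal c * ennreal (2 ^ i * t i)" if "0 <= c" for c i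
      using t0[of i] that by (simp add: ennreal_mult[symmetric] mult_ac)
     thus ?thesis by (simp del: ennreal_plus)
    qed
    finally show ?thesis .
   qed
  qed (auto simp: t0 less_imp_le)
  with AE_space show ?thesis
  proof eventually_elim
   case (elim \<omega>)
   then obtain K where K: "Z K \<omega> <= ennreal \<eta>" by (auto simp: not_le intro: less_imp_le)
   show ?case
   proof (intro exI allI impI)
    fix n :: nat assume n: "1 <= n"
    have "(\<Sum>k. ennreal (2 ^ (K + k)) * ennreal (m (K + k) n \<omega> powr (1 / real ?d))) <= (\<Sum>k. ennreal (2 ^ (K + k)) * (ennreal (real n) * Y (K + k) \<omega>))"
     by (intro suminf_le summableI mult_left_mono Yle elim(1) n) auto
    also have "... = ennreal (real n) * Z K \<omega>" unfolding Z_def by (simp add: mult_ac flip: ennreal_suminf_cmult)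
    also have "... <= ennreal (real n) * ennreal \<eta>" by (intro mult_left_mono K) auto
    also have "... = ennreal (\<eta> * real n)" using \<eta> by (simp add: ennreal_mult[symmetric] mult.commute)
    finally show "layer_sum (\<lambda>v. X (\<tau> v \<omega>)) K (real n) <= ennreal (\<eta> * real n)" unfolding m_def .
   qed
  qed
 qed
qed

lemma layer_averages:
 assumes X: "dyadic_tails X"
 shows "AE \<omega> in M. \<forall>\<eta>>0. \<exists>K R0. \<forall>R\<ge>R0. layer_sum (\<lambda>v. X (\<tau> v \<omega>)) K R <= ennreal (\<eta> * R)"
proof -
 have [measurable]: "X \<in> borel_measurable M" using X by (simp add: dyadic_tails_def)
 have "AE \<omega> in M. \<forall>i. \<exists>K. \<forall>n\<ge>1. layer_sum (\<lambda>v. X (\<tau> v \<omega>)) K (real n) <= ennreal (inverse (real (Suc i)) * real n)"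
  unfolding AE_all_countable by (intro allI layer_averages_nat X) simp
 with AE_space show ?thesis
 proof eventually_elim
  case (elim \<omega>)
  note [measurable] = orbit_measurable[OF elim(1)]
  show ?case
  proof (intro allI impI)
   fix \<eta> :: real assume "0 < \<eta>"
   then obtain i where i: "inverse (real (Suc i)) < \<eta> / 2" using reals_Archimedean[of "\<eta> / 2"] by auto
   obtain K where K: "\<And>n. 1 <= n ==> layer_sum (\<lambda>v. X (\<tau> v \<omega>)) K (real n) <= ennreal (inverse (real (Suc i)) * real n)"
    using elim(2) by blast
   show "\<exists>K R0. \<forall>R\<ge>R0. layer_sum (\<lambda>v. X (\<tau> v \<omega>)) K R <= ennreal (\<eta> * R)"
   proof (rule exI[of _ K], rule exI[of _ 1], intro allI impI)
    fix R :: real assume R: "1 <= R"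
    define n where "n = nat \<lceil>R\<rceil>"
    have n: "1 <= n" "R <= real n" "real n <= 2 * R" using R unfolding n_def by linarith+
    have "layer_sum (\<lambda>v. X (\<tau> v \<omega>)) K R
     <= layer_sum (\<lambda>v. X (\<tau> v \<omega>)) K (real n)"
    proof (intro suminf_le summableI mult_left_mono ennreal_leI powr_mono2)
     fix k
     have S: "{v. 2 ^ (K + k) < X (\<tau> v \<omega>)} \<in> sets borel" by measurable
     have "ennreal (measure lborel ({v. 2 ^ (K + k) < X (\<tau> v \<omega>)} \<inter> ball 0 R)) <= ennreal (measure lborel ({v. 2 ^ (K + k) < X (\<tau> v \<omega>)} \<inter> ball 0 (real n)))"
      unfolding emeasure_ball_Int_eq_measure[symmetric] using n S by (intro emeasure_mono) auto
     thus "measure lborel ({v. 2 ^ (K + k) < X (\<tau> v \<omega>)} \<inter> ball 0 R) <= measure lborel ({v. 2 ^ (K + k) < X (\<tau> v \<omega>)} \<inter> ball 0 (real n))"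
      by simp
    qed auto
    also have "... <= ennreal (inverse (real (Suc i)) * real n)" by (rule K[OF n(1)])
    also have "... <= ennreal (\<eta> * R)"
    proof (rule ennreal_leI)
     have "inverse (real (Suc i)) * real n <= \<eta> / 2 * (2 * R)" using n i \<open>0 < \<eta>\<close> by (intro mult_mono) auto
     thus "inverse (real (Suc i)) * real n <= \<eta> * R" by simp
    qed
    finally show "layer_sum (\<lambda>v. X (\<tau> v \<omega>)) K R <= ennreal (\<eta> * R)" .
   qed
  qed
 qed
qed

text \<open>By dominated convergence the truncated integrals tend to zero, and with them the
  probabilities of the exceptional events.\<close>

lemma AE_ex_avoid_of_truncation:
 fixes G :: "'o => real"
 assumes [measurable]: "G \<in> borel_measurable M" "\<And>K. N K \<in> events" and G: "(\<M> \<omega>. ennreal (G \<omega>)) < \<infinity>"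
  and N: "AE \<omega> in M. \<exists>K::nat. \<forall>k\<ge>K. \<omega> \<notin> N k" and D: "\<And>K. D K \<in> events" and c: "0 < \<theta>" "0 <= c"
  and le: "\<And>K. ennreal \<theta> * emeasure M (D K) <= ennreal c * (\<M> \<omega>. ennreal (G \<omega>) * indicator (N K) \<omega>)"
 shows "AE \<omega> in M. \<exists>K. \<omega> \<notin> D K"
proof (rule AE_ex_avoid[OF D])
 let ?I = "\<lambda>K. \<M> \<omega>. ennreal (G \<omega>) * indicator (N K) \<omega>"
 have "?I \<longlonglongrightarrow> (\<M> \<omega>. 0)"
 proof (rule nn_integral_dominated_convergence[where w="\<lambda>\<omega>. ennreal (G \<omega>)"])
  show "AE \<omega> in M. (\<lambda>K. ennreal (G \<omega>) * indicator (N K) \<omega>) \<longlonglongrightarrow> 0" using N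
  proof eventually_elim
   case (elim \<omega>)
   then obtain K where "\<forall>k\<ge>K. \<omega> \<notin> N k" by blast
   hence "\<forall>k\<ge>K. ennreal (G \<omega>) * indicator (N k) \<omega> = 0" by simp
   hence "eventually (\<lambda>K. ennreal (G \<omega>) * indicator (N K) \<omega> = 0) sequentially" unfolding eventually_sequentially by blast
   thus ?case by (rule tendsto_eventually)
  qed
 qed (use G in \<open>auto simp: indicator_def\<close>)
 from ennreal_tendsto_cmult[OF _ this, of "ennreal (c / \<theta>)"]
 have lim: "(\<lambda>K. ennreal (c / \<theta>) * ?I K) \<longlonglongrightarrow> 0" by simp
 have le': "emeasure M (D K) <= ennreal (c / \<theta>) * ?I K" for K
 proof -
  have "ennreal (1 / \<theta>) * (ennreal \<theta> * emeasure M (D K)) <= ennreal (1 / \<theta>) * (ennreal c * ?I K)"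
   by (intro mult_left_mono le) auto
  moreover have "ennreal (1 / \<theta>) * ennreal \<theta> = 1" "ennreal (1 / \<theta>) * ennreal c = ennreal (c / \<theta>)"
   using c by (auto simp: ennreal_mult[symmetric])
  ultimately show ?thesis by (simp add: mult.assoc[symmetric])
 qed
 show "(\<lambda>K. emeasure M (D K)) \<longlonglongrightarrow> 0" by (rule tendsto_sandwich[OF _ _ tendsto_const lim]) (use le' in auto)
qed

text \<open>Otherwise \<open>X\<close> would be of order \<open>norm x\<close> on almost all of a
  unit ball far away, and the truncated \<open>X ^ d\<close> would have an average over a ball of
  radius comparable to \<open>norm x\<close> too large for the maximal inequality. Asking for a
  nearby point leaves room for the almost-sure property \<open>P\<close>.\<close>

lemma AE_sublinear_point:
 assumes X [measurable]: "X \<in> borel_measurable M" and nn: "\<And>\<omega>. 0 <= X \<omega>"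
  and mom: "(\<M> \<omega>. ennreal (X \<omega> ^ DIM('a))) < \<infinity>" and P: "AE \<omega> in M. AE v in lborel. P \<omega> (v :: 'a)"
 shows "AE \<omega> in M. \<forall>\<kappa>>0. \<exists>R0. \<forall>x. R0 <= norm x --> (\<exists>v\<in>ball x 1. X (\<tau> v \<omega>) <= \<kappa> * norm v \<and> P \<omega> v)"
proof -
 let ?d = "DIM('a)" and ?b = "unit_ball_vol (real DIM('a))"
 define N where "N K = {\<omega>\<in>space M. real K < X \<omega>}" for K
 define f where "f K \<omega> = ennreal (X \<omega> ^ ?d) * indicator (N K) \<omega>" for K \<omega>
 have [measurable]: "N K \<in> events" "f K \<in> borel_measurable M" for K unfolding N_def f_def[abs_def] by measurable
 let ?D = "\<lambda>K \<theta>. {\<omega>\<in>space M. \<exists>n\<ge>1. ennreal (\<theta> * real n ^ ?d) < (\<L> w. f K (\<tau> w \<omega>) * indicator (ball (0::'a) (real n)) w)}"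
 have ev: "AE \<omega> in M. \<exists>K. \<forall>k\<ge>K. \<omega> \<notin> N k"
 proof (rule AE_I2)
  fix \<omega>
  obtain K :: nat where "X \<omega> <= real K" by (meson real_nat_ceiling_ge)
  thus "\<exists>K. \<forall>k\<ge>K. \<omega> \<notin> N k" by (intro exI[of _ K]) (auto simp: N_def not_less intro: order_trans)
 qed
 have "AE \<omega> in M. \<exists>K. \<omega> \<notin> ?D K \<theta>" if \<theta>: "0 < \<theta>" for \<theta>
 proof (rule AE_ex_avoid_of_truncation[where G="\<lambda>\<omega>. X \<omega> ^ ?d" and N=N and \<theta>=\<theta> and c="10 ^ ?d * ?b"])
  show "?D K \<theta> \<in> events" for K by (rule maximal_inequality(1)[OF _ \<theta>]) measurable
  show "ennreal \<theta> * emeasure M (?D K \<theta>) <= ennreal (10 ^ ?d * ?b) * (\<M> \<omega>. ennreal (X \<omega> ^ ?d) * indicator (N K) \<omega>)" for K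
   using maximal_inequality(2)[of "f K" \<theta>] \<theta> by (simp add: f_def)
 qed (use mom \<theta> ev in auto)
 hence "AE \<omega> in M. \<forall>i. \<exists>K. \<omega> \<notin> ?D K (inverse (real (Suc i)))" unfolding AE_all_countable by simp
 with P AE_space show ?thesis
 proof eventually_elim
  case (elim \<omega>)
  note [measurable] = orbit_measurable[OF elim(2)]
  show ?case
  proof (intro allI impI)
   fix \<kappa> :: real assume \<kappa>: "0 < \<kappa>"
   have b: "0 < ?b" by simp
   obtain i where i: "inverse (real (Suc i)) < ?b * (\<kappa> / 4) ^ ?d" using reals_Archimedean[of "?b * (\<kappa> / 4) ^ ?d"] \<kappa> b by auto
   obtain K where K: "\<omega> \<notin> ?D K (inverse (real (Suc i)))" using elim(3) by blast
   show "\<exists>R0. \<forall>x. R0 <= norm x --> (\<exists>v\<in>ball x 1. X (\<tau> v \<omega>) <= \<kappa> * norm v \<and> P \<omega> v)"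
   proof (intro exI[of _ "max 2 (2 * real K / \<kappa>)"] allI impI, rule ccontr)
    fix x :: 'a assume x: "max 2 (2 * real K / \<kappa>) <= norm x" and no: "\<not> (\<exists>v\<in>ball x 1. X (\<tau> v \<omega>) <= \<kappa> * norm v \<and> P \<omega> v)"
    define n where "n = nat \<lceil>norm x\<rceil> + 1"
    have x2: "2 <= norm x" using x by simp
    hence px: "0 < (2 * norm x) ^ ?d" by (intro zero_less_power) linarith
    have n: "1 <= n" "norm x + 1 <= real n" "real n <= 2 * norm x" using x2 unfolding n_def by linarith+
    \<comment> \<open>\<open>h = (\<kappa> / 4) * (2 * norm x)\<close> matches the choice of
      \<open>i\<close> and \<open>n <= 2 * norm x\<close>; half of \<open>\<kappa>\<close> covers
      the difference between \<open>norm v\<close> and \<open>norm x\<close>.\<close>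
    define h where "h = \<kappa> * norm x / 2"
    have h: "real K <= h" "0 <= h" using x \<kappa> by (auto simp: h_def field_simps)
    have le: "ennreal (h ^ ?d) * indicator (ball x 1) v <= f K (\<tau> v \<omega>) * indicator (ball 0 (real n)) v" if v: "P \<omega> v" for v
    proof (cases "v \<in> ball x 1")
     case True
     hence "norm x < norm v + 1" "norm v < norm x + 1"
      using norm_triangle_ineq2[of x v] norm_triangle_ineq2[of v x] by (auto simp: dist_norm norm_minus_commute)
     moreover have "h <= \<kappa> * norm v" using calculation x \<kappa> by (simp add: h_def field_simps)
     moreover have "\<kappa> * norm v < X (\<tau> v \<omega>)" using no v True by (auto simp: not_le)
     ultimately show ?thesis using h n flow_space[OF elim(2)] by (auto simp: f_def N_def indicator_def intro!: ennreal_leI power_mono)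
    qed simp
    have "ennreal (?b * h ^ ?d) = (\<L> v. ennreal (h ^ ?d) * indicator (ball x 1) v)"
     using h by (subst nn_integral_cmult_indicator) (auto simp: emeasure_ball ennreal_mult[symmetric] mult.commute)
    also have "... <= (\<L> v. f K (\<tau> v \<omega>) * indicator (ball 0 (real n)) v)"
     using elim(1) by (intro nn_integral_mono_AE) (auto elim!: eventually_mono intro: le)
    also have "... <= ennreal (inverse (real (Suc i)) * real n ^ ?d)" using K elim(2) n(1) by (auto simp: not_less)
    finally have "?b * h ^ ?d <= inverse (real (Suc i)) * real n ^ ?d" by (subst (asm) ennreal_le_iff) auto
    also have "... <= inverse (real (Suc i)) * (2 * norm x) ^ ?d" using n(3) by (intro mult_left_mono power_mono) auto
    also have "... < ?b * (\<kappa> / 4) ^ ?d * (2 * norm x) ^ ?d" by (rule mult_strict_right_mono[OF i px])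
    also have "... = ?b * h ^ ?d" unfolding mult.assoc power_mult_distrib[symmetric] by (simp add: h_def)
    finally show False by simp
   qed
  qed
 qed
qed

end

section \<open>The stationary environment\<close>

locale trapping_potential = ergodic_potential M \<tau> V0 + BM: standard_brownian_motion W B
 for M :: "'o measure" and \<tau> :: "'a::euclidean_space => 'o => 'o" and V0 :: "'o => real"
  and W :: "'w measure" and B :: "real => 'w => 'a" +
 fixes S :: "'o => real" and u :: "'o => 'a" and \<rho> \<epsilon> :: real
 assumes S_lorentz: "S \<in> lorentz_space M DIM('a)"
  and S_sup: "AE \<omega> in M. (SUP x\<in>ball 0 1. ereal (potential \<tau> V0 x \<omega>)) = ereal (S \<omega>)"
  and trap_pos: "0 < \<rho>" "0 < \<epsilon>"
  and u_measurable [measurable]: "u \<in> borel_measurable M"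
  and trap: "AE \<omega> in M. emeasure lborel ({x. potential \<tau> V0 x \<omega> > \<epsilon>} \<inter> ball (u \<omega>) \<rho>) > ennreal \<epsilon>"
  and u_moment: "integrable M (\<lambda>\<omega>. norm (u \<omega>) ^ DIM('a))"
begin

abbreviation env :: "'o => 'a => real" where
 "env \<omega> \<equiv> (\<lambda>x. potential \<tau> V0 x \<omega>)"

lemma env_measurable [measurable (raw)]:
 "f \<in> borel_measurable N ==> g \<in> measurable N M ==> (\<lambda>p. env (g p) (f p)) \<in> borel_measurable N"
 unfolding potential_def by (rule measurable_compose[OF measurable_flow potential_measurable])

lemma env_flow: "\<omega> \<in> space M ==> env (\<tau> z \<omega>) x = env \<omega> (x + z)" by (simp add: potential_def flow_add)

lemma bm_environment: "\<omega> \<in> space M ==> bm_environment W B (env \<omega>)" by unfold_locales measurable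

definition cover :: "'a set" where
 "cover = (SOME F. finite F \<and> ball 0 (BM.step_radius + 2) \<subseteq> (\<Union>v\<in>F. ball v 1))"

lemma cover: "finite cover" "ball 0 (BM.step_radius + 2) \<subseteq> (\<Union>v\<in>cover. ball v 1)"
proof -
 have "compact (cball (0::'a) (BM.step_radius + 2))" by simp
 then obtain F where "finite F" "cball (0::'a) (BM.step_radius + 2) \<subseteq> (\<Union>v\<in>F. ball v 1)"
 proof (rule compactE_image[of _ UNIV "\<lambda>v. ball v 1"])
  show "cball 0 (BM.step_radius + 2) \<subseteq> (\<Union>v. ball (v :: 'a) 1)"
  proof
   fix x :: 'a
   show "x \<in> (\<Union>v. ball (v :: 'a) 1)" by (rule UN_I[of x]) auto
  qed
 qed auto
 hence "\<exists>F. finite F \<and> ball (0::'a) (BM.step_radius + 2) \<subseteq> (\<Union>v\<in>F. ball v 1)" using ball_subset_cball by blast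
 from someI_ex[OF this] show "finite cover" "ball 0 (BM.step_radius + 2) \<subseteq> (\<Union>v\<in>cover. ball v 1)" unfolding cover_def by auto
qed

text \<open>Bounds the potential on the ball of radius \<open>step_radius + 2\<close> by finitely
  many shifts of the unit-ball supremum. Absolute values secure nonnegativity also where
  \<open>S\<close> is not that supremum.\<close>

definition local_bound :: "'o => real" where
 "local_bound \<omega> = (\<Sum>v\<in>cover. \<bar>S (\<tau> v \<omega>)\<bar>)"

lemma local_bound_nonneg: "0 <= local_bound \<omega>" unfolding local_bound_def by (simp add: sum_nonneg)

lemma local_bound_tails: "dyadic_tails local_bound" unfolding local_bound_def[abs_def]
proof (intro dyadic_tails_sum cover)
 have "S \<in> borel_measurable M" using S_lorentz by (simp add: lorentz_space_def)
 hence "dyadic_tails (\<lambda>\<omega>. \<bar>S \<omega>\<bar>)"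
  using summable_lorentz_tails[OF S_lorentz] DIM_positive[where 'a='a] by (simp add: dyadic_tails_def Suc_le_eq)
 thus "dyadic_tails (\<lambda>\<omega>. \<bar>S (\<tau> v \<omega>)\<bar>)" for v by (rule dyadic_tails_flow)
qed

lemma local_bound_measurable [measurable]: "local_bound \<in> borel_measurable M" using local_bound_tails by (simp add: dyadic_tails_def)

lemma env_le_local_bound: "AE \<omega> in M. \<forall>w\<in>ball 0 (BM.step_radius + 2). env \<omega> w <= local_bound \<omega>"
proof -
 have "AE \<omega> in M. \<forall>x\<in>ball 0 1. env \<omega> x <= \<bar>S \<omega>\<bar>" using S_sup
 proof eventually_elim
  case (elim \<omega>)
  show ?case
  proof
   fix x :: 'a assume "x \<in> ball 0 1"
   hence "ereal (env \<omega> x) <= (SUP x\<in>ball 0 1. ereal (env \<omega> x))" by (rule SUP_upper)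
   thus "env \<omega> x <= \<bar>S \<omega>\<bar>" using elim by simp
  qed
 qed
 hence "AE \<omega> in M. \<forall>v\<in>cover. \<forall>x\<in>ball 0 1. env (\<tau> v \<omega>) x <= \<bar>S (\<tau> v \<omega>)\<bar>"
  by (intro AE_finite_allI[OF cover(1)] AE_flow_at[where P="\<lambda>\<omega>. \<forall>x\<in>ball 0 1. env \<omega> x <= \<bar>S \<omega>\<bar>"])
 with AE_space show ?thesis
 proof eventually_elim
  case (elim \<omega>)
  show ?case
  proof
   fix w :: 'a assume "w \<in> ball 0 (BM.step_radius + 2)"
   then obtain v where v: "v \<in> cover" "w \<in> ball v 1" using cover(2) by auto
   hence "w - v \<in> ball 0 1" by (simp add: dist_norm norm_minus_commute)
   with elim v have "env (\<tau> v \<omega>) (w - v) <= \<bar>S (\<tau> v \<omega>)\<bar>" by blast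
   hence "env \<omega> w <= \<bar>S (\<tau> v \<omega>)\<bar>" unfolding env_flow[OF elim(1)] by simp
   also have "... <= local_bound \<omega>" unfolding local_bound_def by (rule member_le_sum) (use v cover in auto)
   finally show "env \<omega> w <= local_bound \<omega>" .
  qed
 qed
qed

lemma ball_shift:
 assumes "\<omega> \<in> space M" "\<forall>w\<in>ball 0 r. env (\<tau> v \<omega>) w <= c"
 shows "\<forall>w\<in>ball v r. env \<omega> w <= c"
proof
 fix w assume "w \<in> ball v r"
 hence "w - v \<in> ball 0 r" by (simp add: dist_norm norm_minus_commute)
 with assms(2) have "env (\<tau> v \<omega>) (w - v) <= c" by blast
 thus "env \<omega> w <= c" unfolding env_flow[OF assms(1)] by simp
qed

lemma env_le_local_bound_at: "AE \<omega> in M. \<forall>w\<in>ball v (BM.step_radius + 2). env \<omega> w <= local_bound (\<tau> v \<omega>)"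
 using AE_space AE_flow_at[OF env_le_local_bound, of v] by eventually_elim (rule ball_shift)

text \<open>One null set of environments for almost every \<open>v\<close> at once; segment
  integrals need this order of quantifiers.\<close>

lemma env_le_local_bound_AE: "AE \<omega> in M. AE v in lborel. \<forall>w\<in>ball v (BM.step_radius + 2). env \<omega> w <= local_bound (\<tau> v \<omega>)"
 using AE_space AE_flow[OF env_le_local_bound]
proof eventually_elim
 case (elim \<omega>)
 show ?case using elim(2) by eventually_elim (rule ball_shift[OF elim(1)])
qed

lemma good_environments: "AE \<omega> in M. good_environment W B (env \<omega>) \<epsilon> \<rho>"
proof -
 let ?r = "BM.step_radius + 2"
 have r: "1 < ?r" using BM.confinement_radius(1)[of 2] by (simp add: BM.step_radius_def)
 let ?P = "\<lambda>\<omega> v. \<forall>w\<in>ball v ?r. env \<omega> w <= local_bound (\<tau> v \<omega>)"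
 have tr: "AE \<omega> in M. AE v in lborel. ennreal \<epsilon> < emeasure lborel ({x. \<epsilon> < env (\<tau> v \<omega>) x} \<inter> ball (u (\<tau> v \<omega>)) \<rho>)"
  by (rule AE_flow[OF trap])
 have "(\<M> \<omega>. ennreal (norm (u \<omega>) ^ DIM('a))) < \<infinity>"
  using u_moment by (simp add: integrable_iff_bounded)
 hence "AE \<omega> in M. \<forall>\<kappa>>0. \<exists>R0. \<forall>x. R0 <= norm x --> (\<exists>v\<in>ball x 1. norm (u (\<tau> v \<omega>)) <= \<kappa> * norm v \<and>
   ennreal \<epsilon> < emeasure lborel ({x. \<epsilon> < env (\<tau> v \<omega>) x} \<inter> ball (u (\<tau> v \<omega>)) \<rho>))"
  by (intro AE_sublinear_point tr) auto
 moreover have "AE \<omega> in M. \<forall>\<kappa>>0. \<exists>R0. \<forall>x. R0 <= norm x --> (\<exists>v\<in>ball x 1. local_bound (\<tau> v \<omega>) <= \<kappa> * norm v \<and> ?P \<omega> v)"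
  by (intro AE_sublinear_point env_le_local_bound_AE dyadic_tails_moment local_bound_tails local_bound_nonneg local_bound_measurable)
 ultimately show ?thesis using AE_space env_le_local_bound_AE layer_averages[OF local_bound_tails]
 proof eventually_elim
  case (elim \<omega>)
  note [measurable] = orbit_measurable[OF elim(3)]
  interpret E: bm_environment W B "env \<omega>" by (rule bm_environment[OF elim(3)])
  \<comment> \<open>Points \<open>v\<close> without the bound form a null set, so every unit ball
    contains one with the bound; compactness then needs finitely many of them.\<close>
  have "\<exists>\<Lambda>. \<forall>w\<in>cball 0 R. env \<omega> w <= \<Lambda>" for R
  proof -
   have cov: "cball 0 R \<subseteq> (\<Union>v\<in>{v. ?P \<omega> v}. ball v 1)"
   proof
    fix w :: 'a
    have "\<exists>v\<in>ball w 1. ?P \<omega> v"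
    proof (rule ccontr)
     assume no: "\<not> (\<exists>v\<in>ball w 1. ?P \<omega> v)"
     have "AE v in lborel. v \<notin> ball w 1" using elim(4) by eventually_elim (use no in blast)
     hence "emeasure lborel (ball w 1) = emeasure lborel ({} :: 'a set)" by (intro emeasure_eq_AE) auto
     thus False using emeasure_ball[of 1 w] unit_ball_vol_pos[of "real DIM('a)"] by simp
    qed
    then obtain v where "v \<in> ball w 1" "?P \<omega> v" by blast
    thus "w \<in> (\<Union>v\<in>{v. ?P \<omega> v}. ball v 1)" by (auto simp: dist_commute)
   qed
   obtain F where F: "F \<subseteq> {v. ?P \<omega> v}" "finite F" "cball 0 R \<subseteq> (\<Union>v\<in>F. ball v 1)"
    by (rule compactE_image[OF compact_cball _ cov]) (rule open_ball)
   have "env \<omega> w <= (\<Sum>v\<in>F. local_bound (\<tau> v \<omega>))" if "w \<in> cball 0 R" for w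
   proof -
    from that F obtain v where v: "v \<in> F" "w \<in> ball v 1" by auto
    hence "w \<in> ball v ?r" using r by auto
    hence "env \<omega> w <= local_bound (\<tau> v \<omega>)" using v F(1) by blast
    also have "... <= (\<Sum>v\<in>F. local_bound (\<tau> v \<omega>))" by (rule member_le_sum) (use v F local_bound_nonneg in auto)
    finally show ?thesis .
   qed
   thus ?thesis by blast
  qed
  note bounded = this
  have sublin: "\<exists>R0. \<forall>R\<ge>R0. \<forall>w\<in>cball 0 (3 * R). env \<omega> w <= \<kappa> * R" if \<kappa>: "0 < \<kappa>" for \<kappa>
  proof -
   obtain R1 where R1: "\<And>x. R1 <= norm x ==> \<exists>v\<in>ball x 1. local_bound (\<tau> v \<omega>) <= \<kappa> / 4 * norm v \<and> ?P \<omega> v"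
    using elim(2) \<kappa> by (meson divide_pos_pos zero_less_numeral)
   obtain \<Lambda> where \<Lambda>: "\<And>w. w \<in> cball 0 R1 ==> env \<omega> w <= \<Lambda>" using bounded by blast
   show ?thesis
   proof (rule exI[of _ "max 1 (\<Lambda> / \<kappa>)"], intro allI impI ballI)
    fix R and w :: 'a assume R: "max 1 (\<Lambda> / \<kappa>) <= R" and w: "w \<in> cball 0 (3 * R)"
    show "env \<omega> w <= \<kappa> * R"
    proof (cases "R1 <= norm w")
     case True
     then obtain v where v: "v \<in> ball w 1" "local_bound (\<tau> v \<omega>) <= \<kappa> / 4 * norm v" "?P \<omega> v" using R1 by blast
     have "norm v <= 4 * R" using v(1) w R norm_triangle_ineq2[of v w] by (simp add: dist_norm norm_minus_commute)
     hence "\<kappa> / 4 * norm v <= \<kappa> / 4 * (4 * R)" using \<kappa> by (intro mult_left_mono) auto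
     moreover have "env \<omega> w <= local_bound (\<tau> v \<omega>)" using v r by (auto simp: dist_commute)
     ultimately show ?thesis using v(2) by simp
    next
     case False
     hence "env \<omega> w <= \<Lambda>" by (intro \<Lambda>) simp
     also have "\<Lambda> <= \<kappa> * R" using R \<kappa> by (simp add: field_simps)
     finally show ?thesis .
    qed
   qed
  qed
  \<comment> \<open>The trap of the environment seen from \<open>v\<close> sits at
    \<open>v + u (\<tau> v \<omega>)\<close>. Since the trap condition is known only for almost
    every \<open>v\<close>, one near \<open>y\<close> is used.\<close>
  have traps: "\<exists>R0. \<forall>y. R0 <= norm y --> (\<exists>v. dist v y <= \<kappa> * norm y \<and> ennreal \<epsilon> < emeasure lborel ({x. \<epsilon> < env \<omega> x} \<inter> ball v \<rho>))"
   if \<kappa>: "0 < \<kappa>" for \<kappa>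
  proof -
   obtain R1 where R1: "\<And>x. R1 <= norm x ==> \<exists>v\<in>ball x 1. norm (u (\<tau> v \<omega>)) <= \<kappa> / 4 * norm v \<and>
    ennreal \<epsilon> < emeasure lborel ({x. \<epsilon> < env (\<tau> v \<omega>) x} \<inter> ball (u (\<tau> v \<omega>)) \<rho>)"
    using elim(1) \<kappa> by (meson divide_pos_pos zero_less_numeral)
   show ?thesis
   proof (rule exI[of _ "max R1 (max 1 (2 / \<kappa>))"], intro allI impI)
    fix y :: 'a assume y: "max R1 (max 1 (2 / \<kappa>)) <= norm y"
    then obtain v where v: "v \<in> ball y 1" "norm (u (\<tau> v \<omega>)) <= \<kappa> / 4 * norm v"
     "ennreal \<epsilon> < emeasure lborel ({x. \<epsilon> < env (\<tau> v \<omega>) x} \<inter> ball (u (\<tau> v \<omega>)) \<rho>)" using R1 by force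
    define z where "z = v + u (\<tau> v \<omega>)"
    have y1: "1 <= norm y" "2 <= \<kappa> * norm y" using y \<kappa> by (auto simp: field_simps)
    have "norm v <= 2 * norm y" using v(1) y1 norm_triangle_ineq2[of v y] by (simp add: dist_norm norm_minus_commute)
    hence "\<kappa> / 4 * norm v <= \<kappa> / 4 * (2 * norm y)" using \<kappa> by (intro mult_left_mono) auto
    moreover have "dist z y <= dist v y + norm (u (\<tau> v \<omega>))"
     using norm_triangle_ineq[of "v - y" "u (\<tau> v \<omega>)"] by (simp add: z_def dist_norm algebra_simps)
    ultimately have "dist z y <= \<kappa> * norm y" using v y1 by (simp add: dist_commute)
    moreover have "emeasure lborel ({x. \<epsilon> < env (\<tau> v \<omega>) x} \<inter> ball (u (\<tau> v \<omega>)) \<rho>) = emeasure lborel ({x. \<epsilon> < env \<omega> x} \<inter> ball z \<rho>)"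
    proof -
     have A: "{x. \<epsilon> < env \<omega> x} \<inter> ball z \<rho> \<in> sets borel" and A': "{x. \<epsilon> < env (\<tau> v \<omega>) x} \<inter> ball (u (\<tau> v \<omega>)) \<rho> \<in> sets borel"
      using elim(3) flow_space[OF elim(3)] by (auto intro!: sets.Int borel_measurable_less[of "\<lambda>_. \<epsilon>"  borel, unfolded space_borel, simplified] env_measurable)
     have "emeasure lborel ({x. \<epsilon> < env (\<tau> v \<omega>) x} \<inter> ball (u (\<tau> v \<omega>)) \<rho>) = (\<L> x. indicator ({x. \<epsilon> < env \<omega> x} \<inter> ball z \<rho>) (v + x))"
     proof -
      have "v + x \<in> {x. \<epsilon> < env \<omega> x} \<inter> ball z \<rho> \<longleftrightarrow> x \<in> {x. \<epsilon> < env (\<tau> v \<omega>) x} \<inter> ball (u (\<tau> v \<omega>)) \<rho>" for x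
       by (simp add: env_flow[OF elim(3)] z_def dist_norm add.commute[of v x])
      hence "indicator ({x. \<epsilon> < env \<omega> x} \<inter> ball z \<rho>) (v + x) = (indicator ({x. \<epsilon> < env (\<tau> v \<omega>) x} \<inter> ball (u (\<tau> v \<omega>)) \<rho>) x :: ennreal)" for x
       unfolding indicator_def by presburger
      thus ?thesis using A' by (simp only: nn_integral_indicator sets_lborel)
     qed
     also have "... = emeasure lborel ({x. \<epsilon> < env \<omega> x} \<inter> ball z \<rho>)" using A by (subst nn_integral_lborel_shift) auto
     finally show ?thesis .
    qed
    ultimately show "\<exists>v. dist v y <= \<kappa> * norm y \<and> ennreal \<epsilon> < emeasure lborel ({x. \<epsilon> < env \<omega> x} \<inter> ball v \<rho>)"
     using v(3) by metis
   qed
  qed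
  show ?case
  proof unfold_locales
   fix \<eta> :: real assume \<eta>: "0 < \<eta>"
   show "\<exists>\<eta>'>0. \<exists>R0. \<forall>R\<ge>R0. \<forall>z x. norm z <= R --> norm x <= R --> dist z x <= \<eta>' * R --> E.reach z x (\<eta> * R)"
   proof (rule E.local_reach_of_averages[OF _ _ _ sublin _ \<eta>])
    show "(\<lambda>v. local_bound (\<tau> v \<omega>)) \<in> borel_measurable borel" by measurable
    show "AE v in lborel. ?P \<omega> v" by (rule elim(4))
   qed (use elim(5) local_bound_nonneg in auto)
  qed (use trap_pos sublin traps in auto)
 qed
qed

end

lemma AE_lborel_shift:
 fixes c :: "'a::euclidean_space"
 assumes "AE v in lborel. P v"
 shows "AE v in lborel. P (c + v)"
proof (rule AE_distrD[where f="\<lambda>v. c + v" and M'=borel and P=P])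
 show "AE v in distr lborel borel (\<lambda>v. c + v). P v" using assms by (simp only: lborel_distr_plus)
qed measurable

section \<open>Translation and measurability of the cost\<close>

context standard_brownian_motion
begin

lemma bridge_kernel_shift: "bridge_kernel (\<lambda>v. U (v + c)) t x y = bridge_kernel U t (x + c) (y + c)"
proof -
 have "brownian_bridge B t (x + c) (y + c) s w = brownian_bridge B t x y s w + c" for s w by (simp add: brownian_bridge_def)
 thus ?thesis by (simp add: bridge_kernel_def heat_kernel_def path_weight_def)
qed

lemma taboo_shift:
 assumes U: "U \<in> borel_measurable borel" and A: "A \<in> sets borel"
 shows "taboo (\<lambda>v. U (v + c)) A n x = taboo U ((+) c ` A) n (x + c)"
proof (induction n arbitrary: x)
 case 0
 have "x + c \<in> (+) c ` A \<longleftrightarrow> x \<in> A" by (auto simp: image_iff add.commute)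
 thus ?case by (simp add: indicator_def)
next
 case (Suc n)
 interpret bm_environment W B U by unfold_locales (rule U)
 have [measurable]: "(+) c ` A \<in> sets borel"
 proof -
  have "(+) c ` A = (\<lambda>v. v - c) -` A \<inter> space borel" by (force simp: image_iff)
  also have "... \<in> sets borel" using A by (intro measurable_sets) auto
  finally show ?thesis .
 qed
 have "x + c \<in> (+) c ` A \<longleftrightarrow> x \<in> A" by (auto simp: image_iff add.commute)
 hence "indicator (- A) x = (indicator (- (+) c ` A) (x + c) :: ennreal)" by (simp add: indicator_def)
 moreover have "(\<L> z. bridge_kernel U 1 (x + c) (z + c) * taboo U ((+) c ` A) n (z + c)) = (\<L> z. bridge_kernel U 1 (x + c) z * taboo U ((+) c ` A) n z)"
  unfolding add.commute[of _ c]
  by (rule nn_integral_lborel_shift[where f="\<lambda>z. bridge_kernel U 1 (c + x) z * taboo U ((+) c ` A) n z"]) measurable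
 ultimately show ?case by (simp only: taboo.simps Suc bridge_kernel_shift)
qed

lemma reach_shift:
 assumes U: "U \<in> borel_measurable borel"
 shows "bm_environment.reach W B (\<lambda>v. U (v + c)) x y C \<longleftrightarrow> bm_environment.reach W B U (x + c) (y + c) C"
proof -
 interpret U: bm_environment W B U by unfold_locales (rule U)
 have "(\<lambda>v. U (v + c)) \<in> borel_measurable borel" using U by measurable
 then interpret U': bm_environment W B "\<lambda>v. U (v + c)" by unfold_locales
 have "(+) c ` cball y 1 = cball (y + c) 1" by (simp add: cball_translation add.commute)
 hence h: "U'.skeleton_hit (cball y 1) z = U.skeleton_hit (cball (y + c) 1) (z + c)" for z
  unfolding U'.skeleton_hit_def U.skeleton_hit_def by (subst taboo_shift[OF U]) auto
 have m: "z \<in> cball x 1 \<longleftrightarrow> z + c \<in> cball (x + c) 1" for z by (simp add: dist_norm)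
 show ?thesis
 proof
  assume "U'.reach x y C"
  from AE_lborel_shift[OF this[unfolded U'.reach_def h m], of "- c"]
  show "U.reach (x + c) (y + c) C" unfolding U.reach_def by simp
 next
  assume "U.reach (x + c) (y + c) C"
  from AE_lborel_shift[OF this[unfolded U.reach_def], of c]
  show "U'.reach x y C" unfolding U'.reach_def h m by (simp add: add.commute)
 qed
qed

lemma measurable_taboo_param:
 assumes V: "(\<lambda>(\<omega>, x). V \<omega> x) \<in> borel_measurable (M \<Otimes>\<^sub>M borel)" and [measurable]: "A \<in> sets borel"
 shows "(\<lambda>(\<omega>, x). taboo (V \<omega>) A n x) \<in> borel_measurable (M \<Otimes>\<^sub>M borel)"
proof (induction n)
 case 0
 show ?case by simp
next
 case (Suc n)
 have 1: "(\<lambda>p. bridge_kernel (V (fst (fst p))) 1 (snd (fst p)) (snd p)) \<in> borel_measurable ((M \<Otimes>\<^sub>M borel) \<Otimes>\<^sub>M lborel)"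
  by (rule measurable_bridge_kernel[OF V]) auto
 have "(\<lambda>p. (fst (fst p), snd p)) \<in> measurable ((M \<Otimes>\<^sub>M (borel :: 'a measure)) \<Otimes>\<^sub>M lborel) (M \<Otimes>\<^sub>M (borel :: 'a measure))" by measurable
 from measurable_compose[OF this Suc]
 have 2: "(\<lambda>p. taboo (V (fst (fst p))) A n (snd p)) \<in> borel_measurable ((M \<Otimes>\<^sub>M (borel :: 'a measure)) \<Otimes>\<^sub>M lborel)" by simp
 have "(\<lambda>p. \<L> z. bridge_kernel (V (fst p)) 1 (snd p) z * taboo (V (fst p)) A n z) \<in> borel_measurable (M \<Otimes>\<^sub>M borel)"
  by (rule lborel.borel_measurable_nn_integral) (use borel_measurable_times_ennreal[OF 1 2] in \<open>simp add: case_prod_beta\<close>)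
 thus ?case by (simp add: case_prod_beta)
qed

end

context good_environment
begin

lemma reach_exists: "\<exists>c. reach z x c"
proof -
 obtain \<eta>' R0 where h: "0 < \<eta>'" "\<And>R z x. R0 <= R ==> norm z <= R ==> norm x <= R ==> dist z x <= \<eta>' * R ==> reach z x (1 * R)"
  using local_reach[OF zero_less_one] by blast
 define R where "R = max (max R0 (norm z)) (max (norm x) (dist z x / \<eta>'))"
 have "dist z x / \<eta>' <= R" unfolding R_def by simp
 hence "dist z x <= \<eta>' * R" using h(1) by (simp add: field_simps)
 moreover have "R0 <= R" "norm z <= R" "norm x <= R" unfolding R_def by auto
 ultimately show ?thesis using h(2) by blast
qed

lemma reach_iff_cost: "reach x y c \<longleftrightarrow> reach_cost x y <= c"
 using reach_exists[of x y] reach_reach_cost reach_cost_le reach_mono by blast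

text \<open>Local reachability in both directions and the triangle inequality. The bound is uniform
  in \<open>y\<close>, because only \<open>z\<close> and \<open>x\<close> have to lie in the
  ball.\<close>

lemma reach_cost_modulus:
 assumes "0 < \<eta>"
 shows "\<exists>\<eta>'>0. \<exists>R0. \<forall>R\<ge>R0. \<forall>z x. norm z <= R --> norm x <= R --> dist z x <= \<eta>' * R -->
  \<bar>reach_cost y z - reach_cost y x\<bar> <= \<eta> * R"
proof -
 have "\<bar>reach_cost y z - reach_cost y x\<bar> <= c" if "reach z x c" "reach x z c" for z x c
  using reach_cost_triangle[of y z _ x] reach_cost_triangle[of y x _ z] reach_exists that reach_iff_cost by (smt (verit, best))
 with local_reach[OF assms] show ?thesis by (metis dist_commute)
qed

end

context ergodic_flow
begin

lemma events_AE:
 assumes "{p \<in> space (M \<Otimes>\<^sub>M lborel). P (fst p) (snd p)} \<in> sets (M \<Otimes>\<^sub>M (lborel :: 'a measure))"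
 shows "{\<omega>\<in>space M. AE v in (lborel :: 'a measure). P \<omega> v} \<in> events"
proof -
 let ?A = "{p \<in> space (M \<Otimes>\<^sub>M lborel). \<not> P (fst p) (snd p)}"
 have N: "?A \<in> sets (M \<Otimes>\<^sub>M (lborel :: 'a measure))"
  using assms by (rule sets.sets_Collect_neg)
 have "(\<lambda>\<omega>. emeasure lborel (Pair \<omega> -` ?A)) \<in> borel_measurable M"
  by (rule lborel.measurable_emeasure_Pair[OF N])
 hence "{\<omega>\<in>space M. emeasure lborel (Pair \<omega> -` ?A) = 0} \<in> events"
  by measurable
 also have "{\<omega>\<in>space M. emeasure lborel (Pair \<omega> -` ?A) = 0} = {\<omega>\<in>space M. AE v in (lborel :: 'a measure). P \<omega> v}"
 proof (intro Collect_cong conj_cong refl)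
  fix \<omega> assume \<omega>: "\<omega> \<in> space M"
  have "Pair \<omega> -` ?A = {v \<in> space lborel. \<not> P \<omega> v}"
   using \<omega> by (auto simp: space_pair_measure)
  moreover have "Pair \<omega> -` ?A \<in> sets lborel"
   by (rule sets_Pair1[OF N])
  ultimately show "emeasure lborel (Pair \<omega> -` ?A) = 0 \<longleftrightarrow> (AE v in (lborel :: 'a measure). P \<omega> v)"
   by (subst AE_iff_measurable[OF _ refl]) auto
 qed
 finally show ?thesis .
qed

text \<open>Ergodicity is assumed for strictly invariant events, whereas the events at hand are
  invariant only up to null sets depending on \<open>y\<close>.\<close>

lemma zero_one_law:
 assumes A [measurable]: "A \<in> events" and inv: "\<And>y :: 'a. AE \<omega> in M. \<tau> y \<omega> \<in> A \<longleftrightarrow> \<omega> \<in> A"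
 shows "prob A = 0 \<or> prob A = 1"
proof -
 interpret pair_sigma_finite M "lborel :: 'a measure" by (rule pair_sigma_finite_lborel)
 have f [measurable]: "(\<lambda>p. \<tau> (snd p) (fst p)) \<in> measurable (M \<Otimes>\<^sub>M (lborel :: 'a measure)) M" by (rule measurable_flow) auto
 \<comment> \<open>Translating an orbit preserves almost-everywhere statements about it, so
   \<open>A'\<close> is strictly invariant; Fubini shows that it differs from \<open>A\<close> by a
   null set.\<close>
 define A' where "A' = {\<omega>\<in>space M. AE v in (lborel :: 'a measure). \<tau> v \<omega> \<in> A}"
 have A': "A' \<in> events" unfolding A'_def by (rule events_AE) measurable
 have "\<tau> y -` A' \<inter> space M = A'" for y
 proof (intro set_eqI)
  fix \<omega>
  have "(AE v in lborel. \<tau> (v + y) \<omega> \<in> A) \<longleftrightarrow> (AE v in lborel. \<tau> v \<omega> \<in> A)"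
  proof
   assume "AE v in lborel. \<tau> (v + y) \<omega> \<in> A"
   from AE_lborel_shift[OF this, of "- y"] show "AE v in lborel. \<tau> v \<omega> \<in> A" by simp
  next
   assume "AE v in lborel. \<tau> v \<omega> \<in> A"
   from AE_lborel_shift[OF this, of y] show "AE v in lborel. \<tau> (v + y) \<omega> \<in> A" by (simp add: add.commute)
  qed
  thus "\<omega> \<in> \<tau> y -` A' \<inter> space M \<longleftrightarrow> \<omega> \<in> A'"
   by (cases "\<omega> \<in> space M") (simp_all add: A'_def flow_space flow_add)
 qed
 hence "prob A' = 0 \<or> prob A' = 1" by (intro flow_ergodic A')
 moreover have "prob A' = prob A"
 proof (rule finite_measure_eq_AE)
  have "AE v in (lborel :: 'a measure). AE \<omega> in M. \<tau> v \<omega> \<in> A \<longleftrightarrow> \<omega> \<in> A" using inv by simp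
  hence "AE \<omega> in M. AE v in (lborel :: 'a measure). \<tau> v \<omega> \<in> A \<longleftrightarrow> \<omega> \<in> A"
   by (subst AE_commute) measurable
  with AE_space show "AE \<omega> in M. \<omega> \<in> A' \<longleftrightarrow> \<omega> \<in> A"
  proof eventually_elim
   case (elim \<omega>)
   have "(AE v in (lborel :: 'a measure). \<tau> v \<omega> \<in> A) \<longleftrightarrow> \<omega> \<in> A"
   proof (cases "\<omega> \<in> A")
    case True
    thus ?thesis using elim(2) by simp
   next
    case False
    have "\<not> (AE v in (lborel :: 'a measure). \<tau> v \<omega> \<in> A)"
    proof
     assume "AE v in (lborel :: 'a measure). \<tau> v \<omega> \<in> A"
     with elim(2) have "AE v in (lborel :: 'a measure). v \<notin> ball 0 1" by eventually_elim (use False in auto)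
     hence "emeasure lborel (ball (0::'a) 1) = emeasure lborel ({} :: 'a set)" by (intro emeasure_eq_AE) auto
     thus False using emeasure_ball[of 1 "0::'a"] unit_ball_vol_pos[of "real DIM('a)"] by simp
    qed
    thus ?thesis using False by simp
   qed
   thus ?case using elim(1) by (simp add: A'_def)
  qed
 qed (use A A' in auto)
 ultimately show ?thesis by simp
qed

end

context trapping_potential
begin

abbreviation reaches :: "'o => 'a => 'a => real => bool" where
 "reaches \<omega> \<equiv> bm_environment.reach W B (env \<omega>)"

lemma env_borel: "\<omega> \<in> space M ==> env \<omega> \<in> borel_measurable borel" by (rule bm_environment.U_measurable[OF bm_environment])

lemma reaches_flow: "\<omega> \<in> space M ==> reaches (\<tau> z \<omega>) x y c \<longleftrightarrow> reaches \<omega> (x + z) (y + z) c"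
 using BM.reach_shift[OF env_borel, of \<omega> z x y c] by (simp add: env_flow)

text \<open>An almost-everywhere condition on starts becomes an event through joint measurability of
  the hitting weight in environment and start.\<close>

lemma events_reaches [measurable]: "{\<omega>\<in>space M. reaches \<omega> x y c} \<in> events"
proof -
 have V: "(\<lambda>(\<omega>, x). env \<omega> x) \<in> borel_measurable (M \<Otimes>\<^sub>M borel)" unfolding case_prod_beta by (rule env_measurable) auto
 have [measurable]: "(\<lambda>p. BM.taboo (env (fst p)) (cball y 1) n (snd p)) \<in> borel_measurable (M \<Otimes>\<^sub>M lborel)" for n
  using BM.measurable_taboo_param[OF V, of "cball y 1" n] by (simp add: case_prod_beta)
 have [measurable]: "cball x 1 \<in> sets borel" by simp
 have "{p \<in> space (M \<Otimes>\<^sub>M lborel). snd p \<in> cball x 1 --> ennreal (exp (- c)) <= (\<Sum>n. BM.taboo (env (fst p)) (cball y 1) n (snd p))} \<in> sets (M \<Otimes>\<^sub>M lborel)"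
  by measurable
 from events_AE[OF this]
 show ?thesis by (rule back_subst[where P="\<lambda>A. A \<in> events"])
   (auto simp: bm_environment.reach_def[OF bm_environment] bm_environment.skeleton_hit_def[OF bm_environment])
qed

end

section \<open>Growth along rays\<close>

text \<open>Walk through the integers: a bad index starts a run of length \<open>m\<close> whose sum
  pays for all its \<open>m\<close> members, a good one is skipped. Runs are at most
  \<open>L\<close> long, so indices below \<open>N + L\<close> suffice.\<close>

lemma maximal_covering_nat:
 fixes a :: "nat => ennreal"
 assumes \<theta>: "0 < \<theta>"
 shows "(\<Sum>i<N. ennreal \<theta> * of_bool (\<exists>m\<in>{1..L}. ennreal (\<theta> * real m) < (\<Sum>j<m. a (k + i + j)))) <= (\<Sum>j<N + L. a (k + j))"
proof (induction N arbitrary: k rule: less_induct)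
 case (less N)
 let ?bad = "\<lambda>i. \<exists>m\<in>{1..L}. ennreal (\<theta> * real m) < (\<Sum>j<m. a (i + j))"
 let ?b = "\<lambda>i. ennreal \<theta> * of_bool (?bad i)"
 have const: "(\<Sum>i<n. ?b (k + i)) <= ennreal (\<theta> * real n)" for n
 proof -
  have "(\<Sum>i<n. ?b (k + i)) <= (\<Sum>i<n. ennreal \<theta>)" by (intro sum_mono) auto
  also have "... = ennreal (\<theta> * real n)" using \<theta> by (simp add: ennreal_of_nat_eq_real_of_nat ennreal_mult mult.commute)
  finally show ?thesis .
 qed
 consider "N = 0" | "N \<noteq> 0" "\<not> ?bad k" | m where "m \<in> {1..L}" "ennreal (\<theta> * real m) < (\<Sum>j<m. a (k + j))" by blast
 thus ?case
 proof cases
  case 1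
  thus ?thesis by simp
 next
  case 2
  then obtain N' where N': "N = 1 + N'" using not0_implies_Suc[of N] by auto
  have "(\<Sum>i<N. ?b (k + i)) = (\<Sum>i<N'. ?b (k + 1 + i))" unfolding N' sum_lessThan_add using 2 by (simp add: add.assoc)
  also have "... <= (\<Sum>j<N' + L. a (k + 1 + j))" using less[of N' "k + 1"] N' by simp
  also have "... <= (\<Sum>j<1 + (N' + L). a (k + j))" unfolding sum_lessThan_add by (simp add: add.assoc)
  finally show ?thesis by (simp add: N' add.assoc)
 next
  case (3 m)
  show ?thesis
  proof (cases "N <= m")
   case True
   have "(\<Sum>i<N. ?b (k + i)) <= ennreal (\<theta> * real N)" by (rule const)
   also have "... <= ennreal (\<theta> * real m)" using True \<theta> by (intro ennreal_leI mult_left_mono) auto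
   also have "... <= (\<Sum>j<m. a (k + j))" using 3 by simp
   also have "... <= (\<Sum>j<N + L. a (k + j))" using 3 by (intro sum_mono2) auto
   finally show ?thesis .
  next
   case False
   then obtain n where n: "N = m + n" by (metis le_add_diff_inverse nat_le_linear)
   have "(\<Sum>i<N. ?b (k + i)) = (\<Sum>i<m. ?b (k + i)) + (\<Sum>i<n. ?b (k + m + i))" unfolding n sum_lessThan_add by (simp add: add.assoc)
   also have "... <= (\<Sum>j<m. a (k + j)) + (\<Sum>j<n + L. a (k + m + j))" using less[of n "k + m"] const[of m] 3 n by (intro add_mono) auto
   also have "... = (\<Sum>j<m + (n + L). a (k + j))" unfolding sum_lessThan_add by (simp add: add.assoc)
   finally show ?thesis by (simp add: n add.assoc)
  qed
 qed
qed

context ergodic_flow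
begin

lemma orbit_maximal_inequality:
 fixes f :: "'o => ennreal" and x :: 'a
 assumes [measurable]: "f \<in> borel_measurable M" and \<theta>: "0 < \<theta>"
 defines "D \<equiv> {\<omega>\<in>space M. \<exists>m\<ge>1. ennreal (\<theta> * real m) < (\<Sum>j<m. f (\<tau> (real j *\<^sub>R x) \<omega>))}"
 shows "D \<in> events" and "ennreal \<theta> * emeasure M D <= 2 * (\<M> \<omega>. f \<omega>)"
proof -
 note [measurable] = flow_measurable
 define D' where "D' L = {\<omega>\<in>space M. \<exists>m\<in>{1..L}. ennreal (\<theta> * real m) < (\<Sum>j<m. f (\<tau> (real j *\<^sub>R x) \<omega>))}" for L
 have D' [measurable]: "D' L \<in> events" for L unfolding D'_def by measurable
 have DU: "D = (\<Union>L. D' L)" unfolding D_def D'_def by fastforce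
 thus "D \<in> events" by auto
 have bound: "ennreal \<theta> * emeasure M (D' L) <= 2 * (\<M> \<omega>. f \<omega>)" if L: "1 <= L" for L
 proof -
  \<comment> \<open>Runs starting in a window of length \<open>L\<close> end before
    \<open>2 * L\<close>, which accounts for the factor 2.\<close>
  have pw: "(\<Sum>i<L. ennreal \<theta> * indicator (D' L) (\<tau> (real i *\<^sub>R x) \<omega>)) <= (\<Sum>j<L + L. f (\<tau> (real j *\<^sub>R x) \<omega>))" if \<omega>: "\<omega> \<in> space M" for \<omega>
  proof -
   have "\<tau> (real i *\<^sub>R x) \<omega> \<in> D' L \<longleftrightarrow> (\<exists>m\<in>{1..L}. ennreal (\<theta> * real m) < (\<Sum>j<m. f (\<tau> (real (0 + i + j) *\<^sub>R x) \<omega>)))" for i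
    using \<omega> by (simp add: D'_def flow_space flow_add scaleR_add_left add.commute[of "real i *\<^sub>R x"])
   hence "indicator (D' L) (\<tau> (real i *\<^sub>R x) \<omega>) = (of_bool (\<exists>m\<in>{1..L}. ennreal (\<theta> * real m) < (\<Sum>j<m. f (\<tau> (real (0 + i + j) *\<^sub>R x) \<omega>))) :: ennreal)" for i
    by (simp only: indicator_def)
   thus ?thesis using maximal_covering_nat[OF \<theta>, of L "\<lambda>j. f (\<tau> (real j *\<^sub>R x) \<omega>)" 0 L] by simp
  qed
  have "of_nat L * (ennreal \<theta> * emeasure M (D' L)) = (\<Sum>i<L. \<M> \<omega>. ennreal \<theta> * indicator (D' L) (\<tau> (real i *\<^sub>R x) \<omega>))"
  proof -
   have "(\<M> \<omega>. ennreal \<theta> * indicator (D' L) (\<tau> (real i *\<^sub>R x) \<omega>)) = ennreal \<theta> * emeasure M (D' L)" for i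
    using nn_integral_flow[of "\<lambda>\<omega>. ennreal \<theta> * indicator (D' L) \<omega>" "real i *\<^sub>R x"] by (simp add: nn_integral_cmult_indicator)
   thus ?thesis by simp
  qed
  also have "... = (\<M> \<omega>. (\<Sum>i<L. ennreal \<theta> * indicator (D' L) (\<tau> (real i *\<^sub>R x) \<omega>)))"
   by (rule nn_integral_sum[symmetric]) measurable
  also have "... <= (\<M> \<omega>. (\<Sum>j<L + L. f (\<tau> (real j *\<^sub>R x) \<omega>)))"
   by (intro nn_integral_mono pw)
  also have "... = (\<Sum>j<L + L. \<M> \<omega>. f (\<tau> (real j *\<^sub>R x) \<omega>))" by (rule nn_integral_sum) measurable
  also have "... = of_nat L * (2 * (\<M> \<omega>. f \<omega>))"
   by (simp add: nn_integral_flow distrib_right distrib_left mult_2)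
  finally show ?thesis using L by (subst (asm) ennreal_mult_le_mult_iff) auto
 qed
 have "incseq D'" unfolding D'_def by (intro monoI) (auto; fastforce)
 hence "(\<lambda>m. emeasure M (D' m)) \<longlonglongrightarrow> emeasure M D" unfolding DU by (intro Lim_emeasure_incseq) auto
 hence "(\<lambda>m. ennreal \<theta> * emeasure M (D' m)) \<longlonglongrightarrow> ennreal \<theta> * emeasure M D"
  by (intro ennreal_tendsto_cmult) auto
 thus "ennreal \<theta> * emeasure M D <= 2 * (\<M> \<omega>. f \<omega>)"
  by (rule LIMSEQ_le_const2) (use bound in blast)
qed

text \<open>Restricting \<open>G\<close> to \<open>N K\<close> makes its integral arbitrarily small,
  so its averages along the orbit are eventually below any \<open>\<theta>\<close>, uniformly in the
  length.\<close>

lemma AE_orbit_averages_small: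
 fixes G :: "'o => real" and x :: 'a
 assumes [measurable]: "G \<in> borel_measurable M" "\<And>K. N K \<in> events" and G: "(\<M> \<omega>. ennreal (G \<omega>)) < \<infinity>"
  and N: "AE \<omega> in M. \<exists>K::nat. \<forall>k\<ge>K. \<omega> \<notin> N k" and \<theta>: "0 < \<theta>"
 shows "AE \<omega> in M. \<exists>K. \<forall>m\<ge>1. (\<Sum>j<m. ennreal (G (\<tau> (real j *\<^sub>R x) \<omega>)) * indicator (N K) (\<tau> (real j *\<^sub>R x) \<omega>)) <= ennreal (\<theta> * real m)"
proof -
 define f where "f K \<omega> = ennreal (G \<omega>) * indicator (N K) \<omega>" for K \<omega>
 have f [measurable]: "f K \<in> borel_measurable M" for K unfolding f_def[abs_def] by measurable
 let ?D = "\<lambda>K. {\<omega>\<in>space M. \<exists>m\<ge>1. ennreal (\<theta> * real m) < (\<Sum>j<m. f K (\<tau> (real j *\<^sub>R x) \<omega>))}"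
 have "AE \<omega> in M. \<exists>K. \<omega> \<notin> ?D K"
 proof (rule AE_ex_avoid_of_truncation[where G=G and N=N and \<theta>=\<theta> and c=2])
  show "?D K \<in> events" for K by (rule orbit_maximal_inequality(1)[OF f \<theta>])
  show "ennreal \<theta> * emeasure M (?D K) <= ennreal 2 * (\<M> \<omega>. ennreal (G \<omega>) * indicator (N K) \<omega>)" for K
   using orbit_maximal_inequality(2)[OF f \<theta>, of K x] by (simp add: f_def)
 qed (use G N \<theta> in auto)
 with AE_space show ?thesis by eventually_elim (auto simp: f_def not_less)
qed

end

text \<open>Moving both ends of a long path by a fixed \<open>y\<close> costs little relative to
  \<open>n\<close>; this is what makes rates along a ray insensitive to the flow.\<close>

lemma (in good_environment) reach_translate:
 fixes x y :: 'a
 assumes \<delta>: "0 < \<delta>"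
 shows "\<exists>n1. \<forall>n\<ge>n1. \<forall>C. (reach 0 (real n *\<^sub>R x) C --> reach y (real n *\<^sub>R x + y) (C + real n * \<delta>)) \<and>
  (reach y (real n *\<^sub>R x + y) C --> reach 0 (real n *\<^sub>R x) (C + real n * \<delta>))"
proof -
 define \<eta> where "\<eta> = \<delta> / 2 / (norm x + 1)"
 have x1: "0 < norm x + 1" using norm_ge_zero[of x] by linarith
 have \<eta>: "0 < \<eta>" using \<delta> x1 by (simp add: \<eta>_def)
 obtain \<eta>' R0 where h: "0 < \<eta>'" "\<And>R z x. R0 <= R ==> norm z <= R ==> norm x <= R ==> dist z x <= \<eta>' * R ==> reach z x (\<eta> * R)"
  using local_reach[OF \<eta>] by blast
 obtain n1 :: nat where n1: "max R0 (max (norm y) (norm y / \<eta>')) <= real n1" by (meson real_nat_ceiling_ge)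
 show ?thesis
 proof (intro exI[of _ n1] allI impI)
  fix n C assume n: "n1 <= n"
  define R where "R = real n * (norm x + 1)"
  have Rn: "norm x * real n + real n = R" by (simp add: R_def algebra_simps)
  have ny: "R0 <= real n" "norm y <= real n" "norm y / \<eta>' <= real n" using n1 n by linarith+
  have "real n <= R" using norm_ge_zero[of x] mult_left_mono[of 1 "norm x + 1" "real n"] by (simp add: R_def)
  hence R: "R0 <= R" "norm y <= R" "norm y / \<eta>' <= R" using ny by linarith+
  have d: "norm y <= \<eta>' * R" using R(3) h(1) by (simp add: field_simps)
  have nx: "norm (real n *\<^sub>R x) <= R" "norm (real n *\<^sub>R x + y) <= R"
   using norm_triangle_ineq[of "real n *\<^sub>R x" y] ny(2) Rn by (auto simp: mult.commute)
  have R0': "0 <= R" using x1 by (simp add: R_def)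
  have half: "\<eta> * R = real n * \<delta> / 2" using x1 by (simp add: \<eta>_def R_def field_simps)
  have moves: "reach y 0 (real n * \<delta> / 2)" "reach 0 y (real n * \<delta> / 2)"
   "reach (real n *\<^sub>R x) (real n *\<^sub>R x + y) (real n * \<delta> / 2)" "reach (real n *\<^sub>R x + y) (real n *\<^sub>R x) (real n * \<delta> / 2)"
   unfolding half[symmetric] by (intro h(2) R nx; use R0' d in \<open>simp add: dist_norm\<close>)+
  show "(reach 0 (real n *\<^sub>R x) C --> reach y (real n *\<^sub>R x + y) (C + real n * \<delta>)) \<and>
   (reach y (real n *\<^sub>R x + y) C --> reach 0 (real n *\<^sub>R x) (C + real n * \<delta>))"
   using reach_trans[OF reach_trans[OF moves(1)] moves(3)] reach_trans[OF reach_trans[OF moves(2)] moves(4)] by (simp add: algebra_simps)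
 qed
qed

section \<open>The almost sure growth rate along a ray\<close>

context trapping_potential
begin

lemma step_cost_nonneg: "0 <= BM.step_cost" by (simp add: BM.step_cost_def)

text \<open>The price of walking along a ray in unit steps. It is crude, but integrable and a
  function of the environment alone.\<close>

definition step_majorant :: "nat => 'a => 'o => real" where
 "step_majorant k x \<omega> = (\<Sum>j<k. BM.step_cost + local_bound (\<tau> (real j *\<^sub>R x) \<omega>))"

lemma step_majorant_measurable [measurable]: "step_majorant k x \<in> borel_measurable M"
 unfolding step_majorant_def[abs_def] using flow_measurable by measurable

lemma step_majorant_nonneg: "0 <= step_majorant k x \<omega>"
 unfolding step_majorant_def using local_bound_nonneg step_cost_nonneg by (intro sum_nonneg add_nonneg_nonneg) auto

lemma step_majorant_integrable: "(\<M> \<omega>. ennreal (step_majorant k x \<omega>)) < \<infinity>"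
proof -
 have "(\<M> \<omega>. ennreal (local_bound \<omega>)) <= (\<M> \<omega>. 1 + ennreal (local_bound \<omega> ^ DIM('a)))"
 proof (intro nn_integral_mono)
  fix \<omega>
  have "local_bound \<omega> <= 1 + local_bound \<omega> ^ DIM('a)"
  proof (cases "1 <= local_bound \<omega>")
   case True
   hence "local_bound \<omega> ^ 1 <= local_bound \<omega> ^ DIM('a)" by (intro power_increasing) auto
   thus ?thesis by simp
  qed (use local_bound_nonneg[of \<omega>] in \<open>auto intro: add_increasing2\<close>)
  hence "ennreal (local_bound \<omega>) <= ennreal (1 + local_bound \<omega> ^ DIM('a))" by (rule ennreal_leI)
  also have "... = 1 + ennreal (local_bound \<omega> ^ DIM('a))" using local_bound_nonneg[of \<omega>] by (subst ennreal_plus) auto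
  finally show "ennreal (local_bound \<omega>) <= 1 + ennreal (local_bound \<omega> ^ DIM('a))" .
 qed
 also have "... < \<infinity>" using dyadic_tails_moment[OF local_bound_tails local_bound_nonneg] by (simp add: nn_integral_add emeasure_space_1)
 finally have fin: "(\<M> \<omega>. ennreal (local_bound \<omega>)) < \<infinity>" .
 note [measurable] = flow_measurable
 have "ennreal (step_majorant k x \<omega>) = (\<Sum>j<k. ennreal BM.step_cost + ennreal (local_bound (\<tau> (real j *\<^sub>R x) \<omega>)))" for \<omega>
  unfolding step_majorant_def using local_bound_nonneg step_cost_nonneg by (subst sum_ennreal[symmetric]) auto
 hence "(\<M> \<omega>. ennreal (step_majorant k x \<omega>)) = (\<Sum>j<k. (\<M> \<omega>. ennreal BM.step_cost + ennreal (local_bound (\<tau> (real j *\<^sub>R x) \<omega>))))"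
  by (simp add: nn_integral_sum)
 also have "... = (\<Sum>j<k. ennreal BM.step_cost + (\<M> \<omega>. ennreal (local_bound \<omega>)))"
  using nn_integral_flow[of "\<lambda>\<omega>. ennreal (local_bound \<omega>)"] by (simp add: nn_integral_add emeasure_space_1)
 also have "... < \<infinity>" using fin by (simp add: ennreal_mult_less_top of_nat_less_top)
 finally show ?thesis .
qed

lemma reaches_step_majorant:
 assumes x: "norm x <= 1"
 shows "AE \<omega> in M. reaches \<omega> 0 (real k *\<^sub>R x) (step_majorant k x \<omega>)"
proof -
 have "AE \<omega> in M. \<forall>j::nat. \<forall>w\<in>ball (real j *\<^sub>R x) (BM.step_radius + 2). env \<omega> w <= local_bound (\<tau> (real j *\<^sub>R x) \<omega>)"
  unfolding AE_all_countable by (intro allI env_le_local_bound_at)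
 with AE_space show ?thesis
 proof eventually_elim
  case (elim \<omega>)
  interpret E: bm_environment W B "env \<omega>" by (rule bm_environment[OF elim(1)])
  show ?case
  proof (induction k)
   case 0
   show ?case by (simp add: step_majorant_def E.reach_self)
  next
   case (Suc k)
   have "E.reach (real k *\<^sub>R x) (real (Suc k) *\<^sub>R x) (BM.step_cost + local_bound (\<tau> (real k *\<^sub>R x) \<omega>))"
   proof (rule E.reach_step[OF local_bound_nonneg])
    show "dist (real k *\<^sub>R x) (real (Suc k) *\<^sub>R x) <= 1" using x by (simp add: dist_norm scaleR_add_left)
   qed (use elim(2) in auto)
   from E.reach_trans[OF Suc this] show ?case by (simp add: step_majorant_def)
  qed
 qed
qed

text \<open>The event that the lower rate along the ray is at most \<open>c\<close>. The slack
  \<open>1 / Suc i\<close> for every \<open>i\<close> lets it absorb errors of order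
  \<open>o(n)\<close>, hence translations.\<close>

definition linear_reach :: "'a => real => 'o set" where
 "linear_reach x c = {\<omega>\<in>space M. \<forall>i m. \<exists>n\<ge>m. 1 <= n \<and> reaches \<omega> 0 (real n *\<^sub>R x) (real n * (c + 1 / real (Suc i)))}"

lemma linear_reach_measurable [measurable]: "linear_reach x c \<in> events"
proof -
 have "{\<omega>\<in>space M. \<exists>n\<ge>m. 1 <= n \<and> reaches \<omega> 0 (real n *\<^sub>R x) (real n * (c + 1 / real (Suc i)))} \<in> events" for i m
  by measurable
 thus ?thesis unfolding linear_reach_def by measurable
qed

lemma linear_reach_zero_one: "prob (linear_reach x c) = 0 \<or> prob (linear_reach x c) = 1"
proof (rule zero_one_law[OF linear_reach_measurable])
 fix y :: 'a
 show "AE \<omega> in M. \<tau> y \<omega> \<in> linear_reach x c \<longleftrightarrow> \<omega> \<in> linear_reach x c"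
  using AE_space good_environments
 proof eventually_elim
  case (elim \<omega>)
  interpret E: good_environment W B "env \<omega>" \<epsilon> \<rho> by (rule elim(2))
  have tr: "reaches (\<tau> y \<omega>) 0 (real n *\<^sub>R x) C \<longleftrightarrow> E.reach y (real n *\<^sub>R x + y) C" for n C
   by (simp add: reaches_flow[OF elim(1)])
  \<comment> \<open>The slack with index \<open>Suc (2 * i)\<close> is half the slack with index
    \<open>i\<close>: one half serves the given path, the other its translation.\<close>
  have half: "c + 1 / real (Suc (Suc (2 * i))) + 1 / real (Suc (Suc (2 * i))) = c + 1 / real (Suc i)" for i by (simp add: field_simps)
  have perturb: "\<forall>i m. \<exists>n\<ge>m. 1 <= n \<and> Q n (real n * (c + 1 / real (Suc i)))"
   if P: "\<forall>i m. \<exists>n\<ge>m. 1 <= n \<and> P n (real n * (c + 1 / real (Suc i)))"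
    and PQ: "\<And>\<delta>. 0 < \<delta> ==> \<exists>n1. \<forall>n\<ge>n1. \<forall>C. P n C --> Q n (C + real n * \<delta>)" for P Q :: "nat => real => bool"
  proof (intro allI)
   fix i m
   let ?\<delta> = "1 / real (Suc (Suc (2 * i)))"
   obtain n1 where n1: "\<forall>n\<ge>n1. \<forall>C. P n C --> Q n (C + real n * ?\<delta>)" using PQ[of ?\<delta>] by auto
   obtain n where n: "max m n1 <= n" "1 <= n" "P n (real n * (c + ?\<delta>))" using P[rule_format, of "max m n1" "Suc (2 * i)"] by blast
   hence "Q n (real n * (c + ?\<delta>) + real n * ?\<delta>)" using n1 by simp
   also have "real n * (c + ?\<delta>) + real n * ?\<delta> = real n * (c + 1 / real (Suc i))" using half[of i] by (metis distrib_left)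
   finally show "\<exists>n\<ge>m. 1 <= n \<and> Q n (real n * (c + 1 / real (Suc i)))" using n by auto
  qed
  have "(\<forall>i m. \<exists>n\<ge>m. 1 <= n \<and> E.reach y (real n *\<^sub>R x + y) (real n * (c + 1 / real (Suc i)))) \<longleftrightarrow>
   (\<forall>i m. \<exists>n\<ge>m. 1 <= n \<and> E.reach 0 (real n *\<^sub>R x) (real n * (c + 1 / real (Suc i))))" (is "?L \<longleftrightarrow> ?R")
  proof
   assume ?L
   thus ?R by (rule perturb[of "\<lambda>n. E.reach y (real n *\<^sub>R x + y)" "\<lambda>n. E.reach 0 (real n *\<^sub>R x)"])
     (use E.reach_translate[of _ x y] in blast)
  next
   assume ?R
   thus ?L by (rule perturb[of "\<lambda>n. E.reach 0 (real n *\<^sub>R x)" "\<lambda>n. E.reach y (real n *\<^sub>R x + y)"])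
     (use E.reach_translate[of _ x y] in blast)
  qed
  thus ?case unfolding linear_reach_def mem_Collect_eq tr using elim(1) flow_space[OF elim(1), of y] by blast
 qed
qed

text \<open>Every good environment has a finite rate, but the bound may depend on the environment.
  By the zero-one law all integer levels having probability 0 would be contradictory.\<close>

lemma ex_linear_reach: "\<exists>c. prob (linear_reach x c) = 1"
proof (rule ccontr)
 assume "\<not> ?thesis"
 hence "prob (linear_reach x (real k)) = 0" for k using linear_reach_zero_one by blast
 hence "AE \<omega> in M. \<omega> \<notin> linear_reach x (real k)" for k by (intro AE_not_in) (auto simp: null_sets_def emeasure_eq_measure)
 hence "AE \<omega> in M. \<forall>k. \<omega> \<notin> linear_reach x (real k)" unfolding AE_all_countable by blast
 moreover have "AE \<omega> in M. \<exists>k. \<omega> \<in> linear_reach x (real k)" using AE_space good_environments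
 proof eventually_elim
  case (elim \<omega>)
  interpret E: good_environment W B "env \<omega>" \<epsilon> \<rho> by (rule elim(2))
  obtain C R0 where C: "0 <= C" "0 < R0" "\<And>y. R0 <= norm y ==> E.reach 0 y (C * norm y)" using E.reach_linear by blast
  obtain k :: nat where k: "C * norm x <= real k" by (meson real_nat_ceiling_ge)
  have "\<omega> \<in> linear_reach x (real k)" unfolding linear_reach_def
  proof (intro CollectI conjI allI elim(1))
   fix i m
   obtain n0 :: nat where n0: "R0 / norm x <= real n0" by (meson real_nat_ceiling_ge)
   define n where "n = Suc (max m n0)"
   have "E.reach 0 (real n *\<^sub>R x) (real n * (real k + 1 / real (Suc i)))"
   proof (cases "x = 0")
    case False
    have "R0 / norm x <= real n" using n0 by (simp add: n_def)
    hence "E.reach 0 (real n *\<^sub>R x) (C * norm (real n *\<^sub>R x))" using False by (intro C) (simp add: field_simps)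
    thus ?thesis
    proof (rule E.reach_mono)
     have "real n * (C * norm x) <= real n * (real k + 1 / real (Suc i))" using k by (intro mult_left_mono) (auto intro: add_increasing2)
     thus "C * norm (real n *\<^sub>R x) <= real n * (real k + 1 / real (Suc i))" by (simp add: mult_ac)
    qed
   qed (simp add: E.reach_self)
   thus "\<exists>n\<ge>m. 1 <= n \<and> E.reach 0 (real n *\<^sub>R x) (real n * (real k + 1 / real (Suc i)))"
    by (intro exI[of _ n]) (simp add: n_def)
  qed
  thus ?case by blast
 qed
 ultimately have "AE \<omega> in M. False" by eventually_elim blast
 thus False by simp
qed

text \<open>The almost sure value of the lower rate; it turns out to be the limit.\<close>

definition time_constant :: "'a => real" where
 "time_constant x = Inf {c. prob (linear_reach x c) = 1}"

lemma linear_reach_neg: "c < 0 ==> linear_reach x c = {}"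
proof (rule equals0I)
 fix \<omega> assume c: "c < 0" and \<omega>: "\<omega> \<in> linear_reach x c"
 then interpret E: bm_environment W B "env \<omega>" by (intro bm_environment) (simp add: linear_reach_def)
 obtain i where i: "inverse (real (Suc i)) < - c" using c reals_Archimedean[of "- c"] by auto
 obtain n where n: "1 <= n" "E.reach 0 (real n *\<^sub>R x) (real n * (c + 1 / real (Suc i)))" using \<omega> unfolding linear_reach_def by blast
 from E.reach_nonneg[OF n(2)] n(1) i show False by (simp add: zero_le_mult_iff inverse_eq_divide)
qed

lemma time_constant_bdd: "bdd_below {c. prob (linear_reach x c) = 1}"
 using linear_reach_neg[of _ x] by (intro bdd_belowI[of _ 0]) (auto simp: not_less[symmetric])

lemma AE_reaches_infinitely_often:
 assumes \<delta>: "0 < \<delta>"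
 shows "AE \<omega> in M. \<exists>n\<ge>1. reaches \<omega> 0 (real n *\<^sub>R x) (real n * (time_constant x + \<delta>))"
proof -
 obtain c where c: "prob (linear_reach x c) = 1" "c < time_constant x + \<delta>"
  using cInf_lessD[of "{c. prob (linear_reach x c) = 1}" "time_constant x + \<delta>"] ex_linear_reach[of x] \<delta>
  unfolding time_constant_def by auto
 then obtain i where i: "inverse (real (Suc i)) < time_constant x + \<delta> - c" using reals_Archimedean[of "time_constant x + \<delta> - c"] by auto
 have "AE \<omega> in M. \<omega> \<in> linear_reach x c" using c(1) by (simp add: prob_eq_1)
 thus ?thesis
 proof eventually_elim
  case (elim \<omega>)
  then interpret E: bm_environment W B "env \<omega>" by (intro bm_environment) (simp add: linear_reach_def)
  obtain n where n: "1 <= n" "E.reach 0 (real n *\<^sub>R x) (real n * (c + 1 / real (Suc i)))" using elim unfolding linear_reach_def by blast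
  have "real n * (c + 1 / real (Suc i)) <= real n * (time_constant x + \<delta>)"
   using i by (intro mult_left_mono) (auto simp: inverse_eq_divide)
  from n(1) E.reach_mono[OF n(2) this] show ?case by blast
 qed
qed

lemma AE_eventually_not_reaches:
 assumes \<delta>: "0 < \<delta>"
 shows "AE \<omega> in M. \<exists>m. \<forall>n\<ge>m. \<not> reaches \<omega> 0 (real n *\<^sub>R x) (real n * (time_constant x - \<delta>))"
proof -
 have "time_constant x - \<delta> \<notin> {c. prob (linear_reach x c) = 1}"
  using cInf_lower[OF _ time_constant_bdd[of x], of "time_constant x - \<delta>"] \<delta> unfolding time_constant_def by auto
 hence "prob (linear_reach x (time_constant x - \<delta>)) = 0" using linear_reach_zero_one by blast
 hence "AE \<omega> in M. \<omega> \<notin> linear_reach x (time_constant x - \<delta>)"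
  by (intro AE_not_in) (auto simp: null_sets_def emeasure_eq_measure)
 with AE_space show ?thesis
 proof eventually_elim
  case (elim \<omega>)
  interpret E: bm_environment W B "env \<omega>" by (rule bm_environment[OF elim(1)])
  obtain i m where m: "\<And>n. m <= n ==> 1 <= n ==> \<not> E.reach 0 (real n *\<^sub>R x) (real n * (time_constant x - \<delta> + 1 / real (Suc i)))"
   using elim unfolding linear_reach_def by blast
  show ?case
  proof (intro exI[of _ "Suc m"] allI impI notI)
   fix n assume n: "Suc m <= n" "E.reach 0 (real n *\<^sub>R x) (real n * (time_constant x - \<delta>))"
   have "real n * (time_constant x - \<delta>) <= real n * (time_constant x - \<delta> + 1 / real (Suc i))" by (intro mult_left_mono) auto
   from E.reach_mono[OF n(2) this] m[of n] n(1) show False by simp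
  qed
 qed
qed

lemma time_constant_nonneg: "0 <= time_constant x" unfolding time_constant_def
proof (rule cInf_greatest)
 show "{c. prob (linear_reach x c) = 1} \<noteq> {}" using ex_linear_reach by auto
 show "0 <= c" if "c \<in> {c. prob (linear_reach x c) = 1}" for c using that linear_reach_neg[of c x] by (auto simp: not_less[symmetric])
qed

text \<open>A path along the ray is built greedily: from \<open>m x\<close> jump to a nearby \<open>(m + j) x\<close> which is reached at nearly
 the optimal rate, and if there is none within distance \<open>K\<close>, move on to \<open>(m + 1) x\<close> at an integrable cost. By the
 maximal inequality the steps of the second kind contribute little.\<close>

lemma AE_eventually_reaches:
 assumes \<delta>: "0 < \<delta>"
 shows "AE \<omega> in M. \<exists>n0. \<forall>n\<ge>n0. reaches \<omega> 0 (real n *\<^sub>R x) (real n * (time_constant x + \<delta>))"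
proof -
 \<comment> \<open>\<open>x\<close> is divided into \<open>Suc k\<close> steps of length at most 1,
   so that \<open>G\<close> is an integrable price for going from 0 to \<open>x\<close>.\<close>
 define k where "k = nat \<lceil>norm x\<rceil>"
 have k: "norm x <= real (Suc k)" unfolding k_def by linarith
 define G where "G = step_majorant (Suc k) (x /\<^sub>R real (Suc k))"
 have G0: "0 <= G \<omega>" for \<omega> by (simp add: G_def step_majorant_nonneg)
 have [measurable]: "G \<in> borel_measurable M" by (simp add: G_def)
 have Gint: "(\<M> \<omega>. ennreal (G \<omega>)) < \<infinity>" by (simp only: G_def step_majorant_integrable)
 have "AE \<omega> in M. reaches \<omega> 0 x (G \<omega>)"
  using reaches_step_majorant[of "x /\<^sub>R real (Suc k)" "Suc k"] k by (simp add: G_def divide_inverse_commute[symmetric])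
 hence step: "AE \<omega> in M. \<forall>j::nat. reaches (\<tau> (real j *\<^sub>R x) \<omega>) 0 x (G (\<tau> (real j *\<^sub>R x) \<omega>))"
  unfolding AE_all_countable by (intro allI AE_flow_at[where P="\<lambda>\<omega>. reaches \<omega> 0 x (G \<omega>)"])
 \<comment> \<open>Four errors of size \<open>\<theta>\<close> per step: excess of the good jumps
   over the optimal rate, bad steps, correction of the end point, and overshoot by at most
   \<open>K\<close>.\<close>
 define \<theta> where "\<theta> = \<delta> / 4"
 have \<theta>: "0 < \<theta>" using \<delta> by (simp add: \<theta>_def)
 define c where "c = time_constant x + \<theta>"
 have c0: "0 <= c" using time_constant_nonneg[of x] \<theta> by (simp add: c_def)
 define N where "N K = {\<omega>\<in>space M. \<forall>n\<in>{1..K}. \<not> reaches \<omega> 0 (real n *\<^sub>R x) (real n * c)}" for K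
 have [measurable]: "N K \<in> events" for K unfolding N_def by measurable
 have "AE \<omega> in M. \<exists>K. \<forall>k\<ge>K. \<omega> \<notin> N k" using AE_reaches_infinitely_often[OF \<theta>, of x]
 proof eventually_elim
  case (elim \<omega>)
  then obtain n where "1 <= n" "reaches \<omega> 0 (real n *\<^sub>R x) (real n * c)" unfolding c_def by blast
  thus ?case by (intro exI[of _ n]) (auto simp: N_def)
 qed
 hence "AE \<omega> in M. \<exists>K. \<forall>m\<ge>1. (\<Sum>j<m. ennreal (G (\<tau> (real j *\<^sub>R x) \<omega>)) * indicator (N K) (\<tau> (real j *\<^sub>R x) \<omega>)) <= ennreal (\<theta> * real m)"
  by (intro AE_orbit_averages_small Gint \<theta>) auto
 with AE_space good_environments step show ?thesis
 proof eventually_elim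
  case (elim \<omega>)
  interpret E: good_environment W B "env \<omega>" \<epsilon> \<rho> by (rule elim(2))
  obtain K where K: "\<And>m. 1 <= m ==> (\<Sum>j<m. ennreal (G (\<tau> (real j *\<^sub>R x) \<omega>)) * indicator (N K) (\<tau> (real j *\<^sub>R x) \<omega>)) <= ennreal (\<theta> * real m)"
   using elim(4) by blast
  define g where "g j = G (\<tau> (real j *\<^sub>R x) \<omega>) * indicator (N K) (\<tau> (real j *\<^sub>R x) \<omega>)" for j :: nat
  have g0: "0 <= g j" for j using G0 by (simp add: g_def)
  have gsum: "(\<Sum>j<m. g j) <= \<theta> * real m" if "1 <= m" for m
  proof -
   have "ennreal (\<Sum>j<m. g j) = (\<Sum>j<m. ennreal (G (\<tau> (real j *\<^sub>R x) \<omega>)) * indicator (N K) (\<tau> (real j *\<^sub>R x) \<omega>))"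
    using g0 G0 by (subst sum_ennreal[symmetric]) (auto simp: g_def indicator_def intro!: sum.cong)
   with K[OF that] have "ennreal (\<Sum>j<m. g j) <= ennreal (\<theta> * real m)" by (simp only:)
   thus ?thesis using \<theta> by (subst (asm) ennreal_le_iff) auto
  qed
  have tr: "reaches (\<tau> (real m *\<^sub>R x) \<omega>) 0 (real j *\<^sub>R x) C \<longleftrightarrow> E.reach (real m *\<^sub>R x) (real (m + j) *\<^sub>R x) C" for m j C
   by (simp add: reaches_flow[OF elim(1)] scaleR_add_left add.commute)
  \<comment> \<open>Jumps need not land on \<open>n x\<close>, so the statement allows an overshoot
    of at most \<open>K\<close>. The sum of \<open>g\<close> grows with \<open>m\<close>, so
    intermediate indices may be counted without harm.\<close>
  have greedy: "\<exists>m. n <= m \<and> m <= n + K \<and> E.reach 0 (real m *\<^sub>R x) (real m * c + (\<Sum>j<m. g j))" for n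
  proof (induction n)
   case 0
   show ?case by (intro exI[of _ 0]) (simp add: E.reach_self)
  next
   case (Suc n)
   then obtain m where m: "n <= m" "m <= n + K" "E.reach 0 (real m *\<^sub>R x) (real m * c + (\<Sum>j<m. g j))" by blast
   show ?case
   proof (cases "m = n")
    case False
    thus ?thesis using m by (intro exI[of _ m]) auto
   next
    case True
    show ?thesis
    proof (cases "\<tau> (real m *\<^sub>R x) \<omega> \<in> N K")
     case inN: True
     have "E.reach (real m *\<^sub>R x) (real (m + 1) *\<^sub>R x) (g m)" using elim(3)[rule_format, of m] tr[of m 1] inN by (simp add: g_def)
     from E.reach_trans[OF m(3) this]
     have "E.reach 0 (real (m + 1) *\<^sub>R x) (real (m + 1) * c + (\<Sum>j<m + 1. g j))"
      by (rule E.reach_mono) (use c0 in \<open>simp add: algebra_simps\<close>)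
     thus ?thesis using True by (intro exI[of _ "m + 1"]) auto
    next
     case False
     then obtain j where j: "j \<in> {1..K}" "reaches (\<tau> (real m *\<^sub>R x) \<omega>) 0 (real j *\<^sub>R x) (real j * c)"
      using flow_space[OF elim(1)] by (auto simp: N_def)
     from E.reach_trans[OF m(3) j(2)[unfolded tr]]
     have "E.reach 0 (real (m + j) *\<^sub>R x) (real (m + j) * c + (\<Sum>i<m + j. g i))"
     proof (rule E.reach_mono)
      have "(\<Sum>i<m. g i) <= (\<Sum>i<m + j. g i)" using g0 by (intro sum_mono2) auto
      thus "real m * c + (\<Sum>j<m. g j) + real j * c <= real (m + j) * c + (\<Sum>i<m + j. g i)" by (simp add: algebra_simps)
     qed
     thus ?thesis using True j(1) by (intro exI[of _ "m + j"]) auto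
    qed
   qed
  qed
  have x1: "0 < norm x + 1" using norm_ge_zero[of x] by linarith
  define \<eta> where "\<eta> = \<theta> / (norm x + 1)"
  have \<eta>: "0 < \<eta>" using \<theta> x1 by (simp add: \<eta>_def)
  obtain \<eta>' R0 where h: "0 < \<eta>'" "\<And>R z x. R0 <= R ==> norm z <= R ==> norm x <= R ==> dist z x <= \<eta>' * R ==> E.reach z x (\<eta> * R)"
   using E.local_reach[OF \<eta>] by blast
  obtain n0 :: nat where n0: "max R0 (max (real K * norm x / \<eta>') (real K * (c + 2 * \<theta>) / \<theta>)) <= real n0" by (meson real_nat_ceiling_ge)
  show ?case
  proof (intro exI[of _ "Suc n0"] allI impI)
   fix n assume n: "Suc n0 <= n"
   hence n': "R0 <= real n" "real K * norm x / \<eta>' <= real n" "real K * (c + 2 * \<theta>) / \<theta> <= real n" using n0 by linarith+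
   obtain m where m: "n <= m" "m <= n + K" "E.reach 0 (real m *\<^sub>R x) (real m * c + (\<Sum>j<m. g j))" using greedy by blast
   \<comment> \<open>A scale containing both the actual end point \<open>m x\<close> and the desired
     one \<open>n x\<close>, whose distance is bounded independently of \<open>n\<close>.\<close>
   define R where "R = real (n + K) * (norm x + 1)"
   have nK: "real (n + K) <= R" using norm_ge_zero[of x] mult_left_mono[of 1 "norm x + 1" "real (n + K)"] by (simp add: R_def)
   hence "real n <= R" by simp
   have "norm (real i *\<^sub>R x) <= R" if "i <= n + K" for i
   proof -
    have "real i * norm x <= real (n + K) * (norm x + 1)" using that by (intro mult_mono) auto
    thus ?thesis by (simp add: R_def)
   qed
   moreover have "dist (real m *\<^sub>R x) (real n *\<^sub>R x) <= \<eta>' * R"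
   proof -
    have "dist (real m *\<^sub>R x) (real n *\<^sub>R x) = (real m - real n) * norm x" using m(1) by (simp add: dist_norm flip: scaleR_diff_left)
    also have "... <= real K * norm x" using m(2) by (intro mult_right_mono) auto
    also have "... <= \<eta>' * real n" using n'(2) h(1) by (simp add: field_simps)
    also have "... <= \<eta>' * R" using \<open>real n <= R\<close> h(1) by (intro mult_left_mono) auto
    finally show ?thesis .
   qed
   ultimately have "E.reach (real m *\<^sub>R x) (real n *\<^sub>R x) (\<eta> * R)"
    using n'(1) \<open>real n <= R\<close> m(2) by (intro h(2)) auto
   moreover have "\<eta> * R = \<theta> * real (n + K)" using x1 by (simp add: \<eta>_def R_def field_simps)
   ultimately have "E.reach 0 (real n *\<^sub>R x) (real m * c + (\<Sum>j<m. g j) + \<theta> * real (n + K))" using E.reach_trans[OF m(3)] by simp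
   thus "E.reach 0 (real n *\<^sub>R x) (real n * (time_constant x + \<delta>))"
   proof (rule E.reach_mono)
    have "(\<Sum>j<m. g j) <= \<theta> * real m" using m(1) n by (intro gsum) auto
    also have "... <= \<theta> * real (n + K)" using m(2) \<theta> by (intro mult_left_mono) (auto simp del: of_nat_add)
    finally have "real m * c + (\<Sum>j<m. g j) + \<theta> * real (n + K) <= real (n + K) * c + \<theta> * real (n + K) + \<theta> * real (n + K)"
     using m(2) c0 by (intro add_mono mult_right_mono) auto
    also have "... = real n * (c + 2 * \<theta>) + real K * (c + 2 * \<theta>)" by (simp add: algebra_simps)
    also have "real K * (c + 2 * \<theta>) <= real n * \<theta>" using n'(3) \<theta> by (simp add: field_simps)
    also have "real n * (c + 2 * \<theta>) + real n * \<theta> = real n * (time_constant x + \<delta>)" by (simp add: c_def \<theta>_def algebra_simps)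
    finally show "real m * c + (\<Sum>j<m. g j) + \<theta> * real (n + K) <= real n * (time_constant x + \<delta>)" by simp
   qed
  qed
 qed
qed

section \<open>From rays to all directions\<close>

abbreviation cost :: "'o => 'a => real" where
 "cost \<omega> \<equiv> bm_environment.reach_cost W B (env \<omega>) 0"

abbreviation ray_limit :: "'o => 'a => bool" where
 "ray_limit \<omega> x \<equiv> ((\<lambda>r. cost \<omega> (r *\<^sub>R x) / r) \<longlongrightarrow> time_constant x) at_top"

text \<open>Upper and lower rate agree along integers; the equicontinuity of the cost fills in real
  multiples.\<close>

lemma AE_ray_limit: "AE \<omega> in M. ray_limit \<omega> x"
proof -
 have "AE \<omega> in M. \<forall>i. \<exists>n0. \<forall>n\<ge>n0. reaches \<omega> 0 (real n *\<^sub>R x) (real n * (time_constant x + inverse (real (Suc i))))"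
  unfolding AE_all_countable by (intro allI AE_eventually_reaches) simp
 moreover have "AE \<omega> in M. \<forall>i. \<exists>n0. \<forall>n\<ge>n0. \<not> reaches \<omega> 0 (real n *\<^sub>R x) (real n * (time_constant x - inverse (real (Suc i))))"
  unfolding AE_all_countable by (intro allI AE_eventually_not_reaches) simp
 ultimately show ?thesis using good_environments
 proof eventually_elim
  case (elim \<omega>)
  interpret E: good_environment W B "env \<omega>" \<epsilon> \<rho> by (rule elim(3))
  have x1: "0 < norm x + 1" using norm_ge_zero[of x] by linarith
  show ?case
  proof (rule tendstoI)
   fix e :: real assume e: "0 < e"
   obtain i where i: "inverse (real (Suc i)) < e / 4" using reals_Archimedean[of "e / 4"] e by auto
   obtain n1 where n1: "\<And>n. n1 <= n ==> E.reach 0 (real n *\<^sub>R x) (real n * (time_constant x + inverse (real (Suc i))))" using elim(1) by blast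
   obtain n2 where n2: "\<And>n. n2 <= n ==> \<not> E.reach 0 (real n *\<^sub>R x) (real n * (time_constant x - inverse (real (Suc i))))" using elim(2) by blast
   define \<eta> where "\<eta> = e / 4 / (norm x + 1)"
   have \<eta>: "0 < \<eta>" using e x1 by (simp add: \<eta>_def)
   obtain \<eta>' R0 where h: "0 < \<eta>'" "\<And>R z x. R0 <= R ==> norm z <= R ==> norm x <= R ==> dist z x <= \<eta>' * R ==> \<bar>E.reach_cost 0 z - E.reach_cost 0 x\<bar> <= \<eta> * R"
    using E.reach_cost_modulus[OF \<eta>, of 0] by blast
   \<comment> \<open>A sum of nonnegative terms exceeds each of the thresholds needed for the three
     errors below.\<close>
   define r0 where "r0 = 1 + \<bar>R0\<bar> + \<bar>norm x / \<eta>'\<bar> + real n1 + real n2 + \<bar>4 * time_constant x / e\<bar>"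
   have "dist (E.reach_cost 0 (r *\<^sub>R x) / r) (time_constant x) < e" if r: "r0 <= r" for r
   proof -
    have r': "1 <= r" "R0 <= r" "norm x / \<eta>' <= r" "real n1 + 1 <= r" "real n2 + 1 <= r" "4 * time_constant x / e <= r"
     using r unfolding r0_def by linarith+
    define n where "n = nat \<lfloor>r\<rfloor>"
    have n: "real n <= r" "r <= real n + 1" "n1 <= n" "n2 <= n" using r' unfolding n_def by linarith+
    define R where "R = r * (norm x + 1)"
    have rR: "r <= R" using norm_ge_zero[of x] mult_left_mono[of 1 "norm x + 1" r] r'(1) by (simp add: R_def)
    have "\<bar>E.reach_cost 0 (r *\<^sub>R x) - E.reach_cost 0 (real n *\<^sub>R x)\<bar> <= \<eta> * R"
    proof (rule h(2))
     show "R0 <= R" using r'(2) rR by simp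
     have "r * norm x <= R" using r' by (simp add: R_def)
     thus "norm (r *\<^sub>R x) <= R" using r'(1) by simp
     have "real n * norm x <= r * norm x" using n(1) by (intro mult_right_mono) auto
     with \<open>r * norm x <= R\<close> show "norm (real n *\<^sub>R x) <= R" by simp
     have "dist (r *\<^sub>R x) (real n *\<^sub>R x) = (r - real n) * norm x" using n(1) by (simp add: dist_norm flip: scaleR_diff_left)
     also have "... <= 1 * norm x" using n by (intro mult_right_mono) auto
     also have "... <= \<eta>' * r" using r'(3) h(1) by (simp add: field_simps)
     also have "... <= \<eta>' * R" using rR h(1) by (intro mult_left_mono) auto
     finally show "dist (r *\<^sub>R x) (real n *\<^sub>R x) <= \<eta>' * R" .
    qed
    also have "\<eta> * R = e / 4 * r" using x1 by (simp add: \<eta>_def R_def field_simps)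
    finally have 1: "\<bar>E.reach_cost 0 (r *\<^sub>R x) - E.reach_cost 0 (real n *\<^sub>R x)\<bar> <= e / 4 * r" .
    have 2: "\<bar>E.reach_cost 0 (real n *\<^sub>R x) - real n * time_constant x\<bar> <= e / 4 * r"
    proof -
     have "real n * inverse (real (Suc i)) <= r * (e / 4)" using n(1) i r'(1) by (intro mult_mono) auto
     also have "r * (e / 4) = e / 4 * r" by (rule mult.commute)
     finally have "real n * inverse (real (Suc i)) <= e / 4 * r" .
     moreover have "E.reach_cost 0 (real n *\<^sub>R x) <= real n * time_constant x + real n * inverse (real (Suc i))"
      using n1[OF n(3)] unfolding E.reach_iff_cost by (simp add: distrib_left)
     moreover have "real n * time_constant x - real n * inverse (real (Suc i)) < E.reach_cost 0 (real n *\<^sub>R x)"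
      using n2[OF n(4)] unfolding E.reach_iff_cost by (simp add: right_diff_distrib not_le)
     ultimately show ?thesis by linarith
    qed
    have 3: "\<bar>real n * time_constant x - r * time_constant x\<bar> <= e / 4 * r"
    proof -
     have "\<bar>real n * time_constant x - r * time_constant x\<bar> = (r - real n) * time_constant x"
      using n(1) time_constant_nonneg[of x] by (simp add: abs_mult flip: left_diff_distrib)
     also have "... <= 1 * time_constant x" using n time_constant_nonneg by (intro mult_right_mono) auto
     also have "... <= e / 4 * r" using r'(6) e by (simp add: field_simps)
     finally show ?thesis .
    qed
    have "\<bar>E.reach_cost 0 (r *\<^sub>R x) - r * time_constant x\<bar> < e * r" using 1 2 3 mult_pos_pos[OF e, of r] r'(1) by linarith
    moreover have "E.reach_cost 0 (r *\<^sub>R x) / r - time_constant x = (E.reach_cost 0 (r *\<^sub>R x) - r * time_constant x) / r"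
     using r'(1) by (simp add: field_simps)
    ultimately show ?thesis using r'(1) by (simp add: dist_real_def pos_divide_less_eq)
   qed
   thus "\<forall>\<^sub>F r in at_top. dist (E.reach_cost 0 (r *\<^sub>R x) / r) (time_constant x) < e"
    unfolding eventually_at_top_linorder by blast
  qed
 qed
qed

text \<open>The constants are deterministic, so one environment in which both limits exist is enough
  to compare them.\<close>

lemma time_constant_scaleR:
 assumes s: "0 < s"
 shows "time_constant (s *\<^sub>R x) = s * time_constant x"
proof -
 have "AE \<omega> in M. ray_limit \<omega> x \<and> ray_limit \<omega> (s *\<^sub>R x)" by (rule eventually_conj[OF AE_ray_limit AE_ray_limit])
 then obtain \<omega> where l: "ray_limit \<omega> x" "ray_limit \<omega> (s *\<^sub>R x)" using eventually_happens'[OF ae_filter_bot] by blast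
 have "filterlim (\<lambda>r. r * s) at_top at_top" by (rule filterlim_at_top_mult_tendsto_pos[OF tendsto_const s filterlim_ident])
 from tendsto_mult[OF tendsto_const[of s] filterlim_compose[OF l(1) this]]
 have "((\<lambda>r. s * (cost \<omega> ((r * s) *\<^sub>R x) / (r * s))) \<longlongrightarrow> s * time_constant x) at_top" .
 moreover have "s * (cost \<omega> ((r * s) *\<^sub>R x) / (r * s)) = cost \<omega> (r *\<^sub>R s *\<^sub>R x) / r" for r using s by simp
 ultimately show ?thesis using tendsto_unique[OF _ l(2)] by simp
qed

text \<open>Continuity of the rate inherited from the cost. The limits are assumed in the given
  environment, because no single environment is known to have them for all directions.\<close>

lemma time_constant_modulus:
 assumes G: "good_environment W B (env \<omega>) \<epsilon> \<rho>" and \<eta>: "0 < \<eta>"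
 shows "\<exists>\<eta>'>0. \<forall>z x. ray_limit \<omega> z --> ray_limit \<omega> x --> norm z <= 3 --> norm x <= 3 --> dist z x <= \<eta>' -->
  \<bar>time_constant z - time_constant x\<bar> <= \<eta>"
proof -
 interpret E: good_environment W B "env \<omega>" \<epsilon> \<rho> by (rule G)
 obtain \<eta>' R0 where h: "0 < \<eta>'" "\<And>R z x. R0 <= R ==> norm z <= R ==> norm x <= R ==> dist z x <= \<eta>' * R ==> \<bar>E.reach_cost 0 z - E.reach_cost 0 x\<bar> <= \<eta> / 3 * R"
  using E.reach_cost_modulus[of "\<eta> / 3" 0] \<eta> by (metis divide_pos_pos zero_less_numeral)
 show ?thesis
 proof (intro exI[of _ "3 * \<eta>'"] conjI allI impI)
  fix z x assume l: "ray_limit \<omega> z" "ray_limit \<omega> x" and n: "norm z <= 3" "norm x <= 3" "dist z x <= 3 * \<eta>'"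
  have ev: "\<forall>\<^sub>F r in at_top. \<bar>cost \<omega> (r *\<^sub>R z) / r - cost \<omega> (r *\<^sub>R x) / r\<bar> <= \<eta>"
   using eventually_ge_at_top[of "max R0 1"]
  proof eventually_elim
   case (elim r)
   have "\<bar>cost \<omega> (r *\<^sub>R z) - cost \<omega> (r *\<^sub>R x)\<bar> <= \<eta> / 3 * (3 * r)"
   proof (rule h(2))
    show "dist (r *\<^sub>R z) (r *\<^sub>R x) <= \<eta>' * (3 * r)"
     using mult_left_mono[OF n(3), of r] elim by (simp add: dist_norm mult_ac flip: scaleR_diff_right)
   qed (use elim n mult_left_mono[OF n(1), of r] mult_left_mono[OF n(2), of r] in auto)
   moreover have "cost \<omega> (r *\<^sub>R z) / r - cost \<omega> (r *\<^sub>R x) / r = (cost \<omega> (r *\<^sub>R z) - cost \<omega> (r *\<^sub>R x)) / r"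
    by (simp add: diff_divide_distrib)
   ultimately show ?case using elim by (simp add: pos_divide_le_eq)
  qed
  show "\<bar>time_constant z - time_constant x\<bar> <= \<eta>" by (rule tendsto_upperbound[OF tendsto_rabs[OF tendsto_diff[OF l]] ev]) simp
 qed (use h(1) in simp)
qed

text \<open>Limits hold simultaneously for a countable dense set of directions. Finitely many of
  them approximate the sphere, and equicontinuity on both sides covers the directions in
  between.\<close>

lemma AE_cost_asymptotics:
 "AE \<omega> in M. \<forall>\<kappa>>0. \<exists>R0. \<forall>y. R0 <= norm y --> \<bar>cost \<omega> y - time_constant y\<bar> <= \<kappa> * norm y"
proof -
 obtain Q :: "'a set" where Q: "countable Q" "\<And>X. open X ==> X \<noteq> {} ==> \<exists>q\<in>Q. q \<in> X"
  using countable_dense_exists by blast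
 let ?typical = "\<lambda>\<omega>. good_environment W B (env \<omega>) \<epsilon> \<rho> \<and> (\<forall>q\<in>Q. ray_limit \<omega> q)"
 have ty: "AE \<omega> in M. ?typical \<omega>" using good_environments AE_ray_limit by (simp add: AE_ball_countable[OF Q(1)])
 from ty show ?thesis
 proof eventually_elim
  case (elim \<omega>)
  then interpret E: good_environment W B "env \<omega>" \<epsilon> \<rho> by simp
  show ?case
  proof (intro allI impI)
   fix \<kappa> :: real assume \<kappa>: "0 < \<kappa>"
   hence k4: "0 < \<kappa> / 4" and k8: "0 < \<kappa> / 8" by simp_all
   obtain \<eta>1 where \<eta>1: "0 < \<eta>1" "\<And>z x. ray_limit \<omega> z ==> ray_limit \<omega> x ==> norm z <= 3 ==> norm x <= 3 ==> dist z x <= \<eta>1 ==>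
     \<bar>time_constant z - time_constant x\<bar> <= \<kappa> / 4" using time_constant_modulus[OF conjunct1[OF elim] k4] by blast
   obtain \<eta>2 R2 where \<eta>2: "0 < \<eta>2" "\<And>R z x. R2 <= R ==> norm z <= R ==> norm x <= R ==> dist z x <= \<eta>2 * R ==> \<bar>E.reach_cost 0 z - E.reach_cost 0 x\<bar> <= \<kappa> / 8 * R"
    using E.reach_cost_modulus[OF k8, of 0] by blast
   define \<sigma> where "\<sigma> = min 1 (min (\<eta>1 / 2) \<eta>2)"
   have \<sigma>: "0 < \<sigma>" "\<sigma> <= 1" "\<sigma> <= \<eta>1 / 2" "\<sigma> <= \<eta>2" using \<eta>1(1) \<eta>2(1) by (auto simp: \<sigma>_def)
   have cov: "sphere 0 1 \<subseteq> (\<Union>q\<in>Q. ball q \<sigma>)"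
   proof
    fix e :: 'a
    obtain q where "q \<in> Q" "q \<in> ball e \<sigma>" using Q(2)[of "ball e \<sigma>"] \<sigma>(1) by auto
    thus "e \<in> (\<Union>q\<in>Q. ball q \<sigma>)" by (auto simp: dist_commute)
   qed
   obtain F where F: "F \<subseteq> Q" "finite F" "sphere 0 1 \<subseteq> (\<Union>q\<in>F. ball q \<sigma>)"
    by (rule compactE_image[OF compact_sphere _ cov]) (rule open_ball)
   have "\<forall>\<^sub>F r in at_top. \<forall>q\<in>F. \<bar>cost \<omega> (r *\<^sub>R q) / r - time_constant q\<bar> < \<kappa> / 4"
   proof (intro eventually_ball_finite F(2) ballI)
    fix q assume "q \<in> F"
    hence "ray_limit \<omega> q" using elim F(1) by blast
    from tendstoD[OF this, of "\<kappa> / 4"] \<kappa>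
    show "\<forall>\<^sub>F r in at_top. \<bar>cost \<omega> (r *\<^sub>R q) / r - time_constant q\<bar> < \<kappa> / 4" by (simp add: dist_real_def)
   qed
   then obtain R1 where R1: "\<And>r q. R1 <= r ==> q \<in> F ==> \<bar>cost \<omega> (r *\<^sub>R q) / r - time_constant q\<bar> < \<kappa> / 4"
    unfolding eventually_at_top_linorder by blast
   show "\<exists>R0. \<forall>y. R0 <= norm y --> \<bar>cost \<omega> y - time_constant y\<bar> <= \<kappa> * norm y"
   proof (intro exI[of _ "max 1 (max R1 R2)"] allI impI)
    fix y :: 'a assume y: "max 1 (max R1 R2) <= norm y"
    define r where "r = norm y"
    have r: "1 <= r" "R1 <= r" "R2 <= 2 * r" using y by (auto simp: r_def)
    define e where "e = y /\<^sub>R r"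
    have "y \<noteq> 0" using y by auto
    hence e: "norm e = 1" "y = r *\<^sub>R e" using y by (auto simp: e_def r_def)
    then obtain q where q: "q \<in> F" "dist q e < \<sigma>" using F(3) by auto
    have nq: "norm q <= 2" using q(2) \<sigma>(2) e(1) norm_triangle_ineq2[of q e] by (simp add: dist_norm)
    have 1: "\<bar>cost \<omega> (r *\<^sub>R e) - cost \<omega> (r *\<^sub>R q)\<bar> <= \<kappa> / 8 * (2 * r)"
    proof (rule \<eta>2(2)[OF r(3)])
     have "dist (r *\<^sub>R e) (r *\<^sub>R q) = r * dist q e" using r(1) by (simp add: dist_norm norm_minus_commute flip: scaleR_diff_right)
     also have "... <= r * \<eta>2" using q(2) \<sigma>(4) r(1) by (intro mult_left_mono) auto
     also have "... <= \<eta>2 * (2 * r)" using r(1) \<eta>2(1) by simp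
     finally show "dist (r *\<^sub>R e) (r *\<^sub>R q) <= \<eta>2 * (2 * r)" .
    qed (use r(1) e(1) nq mult_left_mono[OF nq, of r] in auto)
    have 2: "\<bar>cost \<omega> (r *\<^sub>R q) - r * time_constant q\<bar> <= \<kappa> / 4 * r"
    proof -
     have "cost \<omega> (r *\<^sub>R q) / r - time_constant q = (cost \<omega> (r *\<^sub>R q) - r * time_constant q) / r" using r(1) by (simp add: field_simps)
     thus ?thesis using R1[OF r(2) q(1)] r(1) by (simp add: pos_divide_less_eq)
    qed
    \<comment> \<open>The direction \<open>e\<close> depends on \<open>y\<close>, so its limit may
      fail in \<open>\<omega>\<close>. Another environment having it links \<open>e\<close> to a
      nearby \<open>p\<close> in \<open>Q\<close>, and \<open>p\<close> is compared with
      \<open>q\<close> in \<open>\<omega>\<close>; this works because time constants do not depend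
      on the environment.\<close>
    have 3: "\<bar>time_constant q - time_constant e\<bar> <= \<kappa> / 2"
    proof -
     obtain \<omega>' where \<omega>': "?typical \<omega>'" "ray_limit \<omega>' e"
      using eventually_happens'[OF ae_filter_bot eventually_conj[OF ty AE_ray_limit[of e]]] by blast
     obtain \<eta>3 where \<eta>3: "0 < \<eta>3" "\<And>z x. ray_limit \<omega>' z ==> ray_limit \<omega>' x ==> norm z <= 3 ==> norm x <= 3 ==> dist z x <= \<eta>3 ==>
       \<bar>time_constant z - time_constant x\<bar> <= \<kappa> / 4" using time_constant_modulus[OF conjunct1[OF \<omega>'(1)] k4] by blast
     have "ball e (min \<sigma> \<eta>3) \<noteq> {}" using \<sigma>(1) \<eta>3(1) by (simp add: min_def)
     from Q(2)[OF open_ball this] obtain p where p: "p \<in> Q" "dist e p < min \<sigma> \<eta>3" by auto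
     have np: "norm p <= 2" using p(2) \<sigma>(2) e(1) norm_triangle_ineq2[of p e] by (simp add: dist_norm norm_minus_commute)
     have "\<bar>time_constant e - time_constant p\<bar> <= \<kappa> / 4" using \<omega>' p np e(1) by (intro \<eta>3(2)) auto
     moreover have "\<bar>time_constant q - time_constant p\<bar> <= \<kappa> / 4"
     proof (rule \<eta>1(2))
      show "dist q p <= \<eta>1" using dist_triangle[of q p e] q(2) p(2) \<sigma>(3) by simp
     qed (use elim p q F(1) np nq in auto)
     ultimately show ?thesis by linarith
    qed
    have 4: "\<bar>r * time_constant q - r * time_constant e\<bar> <= \<kappa> / 2 * r"
     using mult_left_mono[OF 3, of r] r(1) by (simp add: abs_mult mult.commute flip: right_diff_distrib)
    have "\<bar>a - d\<bar> <= \<kappa> * r" if "\<bar>a - b\<bar> <= \<kappa> / 8 * (2 * r)" "\<bar>b - c\<bar> <= \<kappa> / 4 * r" "\<bar>c - d\<bar> <= \<kappa> / 2 * r" for a b c d :: real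
    proof -
     have "\<bar>a - d\<bar> <= \<bar>a - b\<bar> + \<bar>b - c\<bar> + \<bar>c - d\<bar>" by linarith
     also have "... <= \<kappa> / 8 * (2 * r) + \<kappa> / 4 * r + \<kappa> / 2 * r" by (intro add_mono that)
     also have "... = \<kappa> * r" by (simp add: field_simps)
     finally show ?thesis .
    qed
    from this[OF 1 2 4] have "\<bar>cost \<omega> y - r * time_constant e\<bar> <= \<kappa> * r" unfolding e(2)[symmetric] .
    moreover have "time_constant y = r * time_constant e" unfolding e(2) using r(1) by (intro time_constant_scaleR) simp
    ultimately show "\<bar>cost \<omega> y - time_constant y\<bar> <= \<kappa> * norm y" by (simp add: r_def)
   qed
  qed
 qed
qed

text \<open>The travel cost differs from \<open>cost\<close> by an arbitrarily small multiple of the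
  distance, provided the target is far away; \<open>x \<noteq> 0\<close> makes the ray leave every
  ball. Uniqueness of the limit resolves the definite description.\<close>

lemma lyapunov_exponent_eq:
 assumes x: "x \<noteq> 0"
 shows "lyapunov_exponent W B M \<tau> V0 x = time_constant x"
proof -
 let ?T = "\<lambda>\<omega> r. ereal (1 / r) * travel_cost W B (env \<omega>) 0 (r *\<^sub>R x)"
 have lim: "AE \<omega> in M. (?T \<omega> \<longlongrightarrow> ereal (time_constant x)) at_top" using good_environments AE_ray_limit[of x]
 proof eventually_elim
  case (elim \<omega>)
  interpret E: good_environment W B "env \<omega>" \<epsilon> \<rho> by (rule elim(1))
  let ?t = "\<lambda>r. real_of_ereal (travel_cost W B (env \<omega>) 0 (r *\<^sub>R x))"
  have near: "\<forall>\<^sub>F r in at_top. travel_cost W B (env \<omega>) 0 (r *\<^sub>R x) = ereal (?t r) \<and> \<bar>?t r / r - cost \<omega> (r *\<^sub>R x) / r\<bar> <= e" if e: "0 < e" for e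
  proof -
   have "0 < e / norm x" using e x by simp
   from E.travel_cost_bounds[OF this] obtain R0 where R0: "\<And>y. R0 <= norm y ==>
     ereal (E.reach_cost 0 y - e / norm x * norm y) <= travel_cost W B (env \<omega>) 0 y \<and> travel_cost W B (env \<omega>) 0 y <= ereal (E.reach_cost 0 y + e / norm x * norm y)"
    by blast
   show ?thesis using eventually_ge_at_top[of "max 1 (R0 / norm x)"]
   proof eventually_elim
    case (elim r)
    hence r: "1 <= r" "R0 <= r * norm x" using x by (auto simp: field_simps)
    have nr: "e / norm x * norm (r *\<^sub>R x) = e * r" "R0 <= norm (r *\<^sub>R x)" using r x by auto
    have b: "ereal (cost \<omega> (r *\<^sub>R x) - e * r) <= travel_cost W B (env \<omega>) 0 (r *\<^sub>R x)" "travel_cost W B (env \<omega>) 0 (r *\<^sub>R x) <= ereal (cost \<omega> (r *\<^sub>R x) + e * r)"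
     using R0[OF nr(2)] unfolding nr(1) by auto
    hence t: "travel_cost W B (env \<omega>) 0 (r *\<^sub>R x) = ereal (?t r)"
     by (cases "travel_cost W B (env \<omega>) 0 (r *\<^sub>R x)") auto
    have "\<bar>?t r - cost \<omega> (r *\<^sub>R x)\<bar> <= e * r" using b by (subst (asm) (1 2) t) (auto simp: abs_le_iff)
    moreover have "?t r / r - cost \<omega> (r *\<^sub>R x) / r = (?t r - cost \<omega> (r *\<^sub>R x)) / r" by (simp add: diff_divide_distrib)
    ultimately have "\<bar>?t r / r - cost \<omega> (r *\<^sub>R x) / r\<bar> <= e" using r(1) by (simp add: pos_divide_le_eq)
    with t show ?case by blast
   qed
  qed
  have "((\<lambda>r. ?t r / r) \<longlongrightarrow> time_constant x) at_top"
  proof (rule tendstoI)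
   fix e :: real assume e: "0 < e"
   hence e2: "0 < e / 2" by simp
   show "\<forall>\<^sub>F r in at_top. dist (?t r / r) (time_constant x) < e" using near[OF e2] tendstoD[OF elim(2) e2] unfolding dist_real_def
   proof eventually_elim
    case (elim r)
    thus ?case by linarith
   qed
  qed
  hence "((\<lambda>r. ereal (?t r / r)) \<longlongrightarrow> ereal (time_constant x)) at_top" by simp
  moreover have "\<forall>\<^sub>F r in at_top. ereal (?t r / r) = ?T \<omega> r"
   using near[OF zero_less_one] by eventually_elim (metis divide_inverse_commute inverse_eq_divide times_ereal.simps(1))
  ultimately show ?case by (rule Lim_transform_eventually)
 qed
 show ?thesis unfolding lyapunov_exponent_def
 proof (rule the_equality)
  fix l assume "AE \<omega> in M. (?T \<omega> \<longlongrightarrow> ereal l) at_top"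
  then obtain \<omega> where "(?T \<omega> \<longlongrightarrow> ereal l) at_top" "(?T \<omega> \<longlongrightarrow> ereal (time_constant x)) at_top"
   using eventually_happens'[OF ae_filter_bot eventually_conj[OF _ lim]] by blast
  hence "ereal l = ereal (time_constant x)" by (rule tendsto_unique[rotated]) simp
  thus "l = time_constant x" by simp
 qed (rule lim)
qed

text \<open>Shared by travel cost and Green function, since only their distance to
  \<open>cost\<close> matters. The bounds also show that the extended real values are finite far
  out.\<close>

lemma asymptotics_of_bounds:
 fixes T :: "'a => ereal"
 assumes T: "\<And>\<kappa>. 0 < \<kappa> ==> \<exists>R0. \<forall>y. R0 <= norm y --> ereal (cost \<omega> y - \<kappa> * norm y) <= T y \<and> T y <= ereal (cost \<omega> y + \<kappa> * norm y)"
  and c: "\<forall>\<kappa>>0. \<exists>R0. \<forall>y. R0 <= norm y --> \<bar>cost \<omega> y - time_constant y\<bar> <= \<kappa> * norm y"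
 shows "((\<lambda>x. ereal (1 / norm x) * \<bar>T x - ereal (lyapunov_exponent W B M \<tau> V0 x)\<bar>) \<longlongrightarrow> 0) at_infinity"
proof -
 let ?l = "lyapunov_exponent W B M \<tau> V0" and ?t = "\<lambda>x. real_of_ereal (T x)"
 have near: "\<forall>\<^sub>F x in at_infinity. T x = ereal (?t x) \<and> \<bar>?t x - ?l x\<bar> / norm x <= e" if e: "0 < e" for e
 proof -
  have e2: "0 < e / 2" using e by simp
  obtain R1 where R1: "\<And>y. R1 <= norm y ==> ereal (cost \<omega> y - e / 2 * norm y) <= T y \<and> T y <= ereal (cost \<omega> y + e / 2 * norm y)"
   using T[OF e2] by blast
  obtain R2 where R2: "\<And>y. R2 <= norm y ==> \<bar>cost \<omega> y - time_constant y\<bar> <= e / 2 * norm y" using c e2 by blast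
  have "T x = ereal (?t x) \<and> \<bar>?t x - ?l x\<bar> / norm x <= e" if x: "max 1 (max R1 R2) <= norm x" for x
  proof -
   have x0: "x \<noteq> 0" using x by auto
   have b: "ereal (cost \<omega> x - e / 2 * norm x) <= T x" "T x <= ereal (cost \<omega> x + e / 2 * norm x)" using R1 x by auto
   hence t: "T x = ereal (?t x)" by (cases "T x") auto
   have "cost \<omega> x - e / 2 * norm x <= ?t x" "?t x <= cost \<omega> x + e / 2 * norm x"
    using b by (simp_all only: t[symmetric] flip: ereal_less_eq(3))
   moreover have "\<bar>cost \<omega> x - ?l x\<bar> <= e / 2 * norm x" using R2 x by (simp add: lyapunov_exponent_eq[OF x0])
   ultimately have "\<bar>?t x - ?l x\<bar> <= e * norm x" by linarith
   thus ?thesis using t x0 by (simp add: pos_divide_le_eq)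
  qed
  thus ?thesis unfolding eventually_at_infinity by blast
 qed
 have "((\<lambda>x. \<bar>?t x - ?l x\<bar> / norm x) \<longlongrightarrow> 0) at_infinity"
 proof (rule tendstoI)
  fix e :: real assume "0 < e"
  hence "0 < e / 2" by simp
  from near[OF this] show "\<forall>\<^sub>F x in at_infinity. dist (\<bar>?t x - ?l x\<bar> / norm x) 0 < e"
  proof eventually_elim
   case (elim x)
   have "0 <= \<bar>?t x - ?l x\<bar> / norm x" by simp
   with elim \<open>0 < e\<close> show ?case unfolding dist_real_def by linarith
  qed
 qed
 hence "((\<lambda>x. ereal (\<bar>?t x - ?l x\<bar> / norm x)) \<longlongrightarrow> ereal 0) at_infinity" by (simp only: lim_ereal)
 moreover have "\<forall>\<^sub>F x in at_infinity. ereal (\<bar>?t x - ?l x\<bar> / norm x) = ereal (1 / norm x) * \<bar>T x - ereal (?l x)\<bar>"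
  using near[OF zero_less_one]
 proof eventually_elim
  case (elim x)
  hence "T x - ereal (?l x) = ereal (?t x - ?l x)" by (metis minus_ereal_def ereal_minus(1))
  thus ?case by simp
 qed
 ultimately have "((\<lambda>x. ereal (1 / norm x) * \<bar>T x - ereal (?l x)\<bar>) \<longlongrightarrow> ereal 0) at_infinity"
  by (rule Lim_transform_eventually)
 thus ?thesis by (simp only: zero_ereal_def)
qed

lemma shape_theorem:
 "(AE \<omega> in M. ((\<lambda>x. ereal (1 / norm x) * \<bar>travel_cost W B (env \<omega>) 0 x - ereal (lyapunov_exponent W B M \<tau> V0 x)\<bar>) \<longlongrightarrow> 0) at_infinity) \<and>
  (AE \<omega> in M. ((\<lambda>x. ereal (1 / norm x) * \<bar>neg_log (green_function W B (env \<omega>) 0 x) - ereal (lyapunov_exponent W B M \<tau> V0 x)\<bar>) \<longlongrightarrow> 0) at_infinity)"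
proof
 show "AE \<omega> in M. ((\<lambda>x. ereal (1 / norm x) * \<bar>travel_cost W B (env \<omega>) 0 x - ereal (lyapunov_exponent W B M \<tau> V0 x)\<bar>) \<longlongrightarrow> 0) at_infinity"
  using good_environments AE_cost_asymptotics
 proof eventually_elim
  case (elim \<omega>)
  interpret E: good_environment W B "env \<omega>" \<epsilon> \<rho> by (rule elim(1))
  show ?case by (rule asymptotics_of_bounds[OF E.travel_cost_bounds elim(2)])
 qed
 show "AE \<omega> in M. ((\<lambda>x. ereal (1 / norm x) * \<bar>neg_log (green_function W B (env \<omega>) 0 x) - ereal (lyapunov_exponent W B M \<tau> V0 x)\<bar>) \<longlongrightarrow> 0) at_infinity"
  using good_environments AE_cost_asymptotics
 proof eventually_elim
  case (elim \<omega>)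
  interpret E: good_environment W B "env \<omega>" \<epsilon> \<rho> by (rule elim(1))
  show ?case by (rule asymptotics_of_bounds[OF E.green_function_bounds elim(2)])
 qed
qed

end

theorem theorem2p2:
  fixes M :: "'o measure" and \<tau> :: "'a::euclidean_space \<Rightarrow> 'o \<Rightarrow> 'o" and V0 :: "'o \<Rightarrow> real"
    and W :: "'w measure" and B :: "real \<Rightarrow> 'w \<Rightarrow> 'a"
    and S :: "'o \<Rightarrow> real" and u :: "'o \<Rightarrow> 'a" and \<rho> \<epsilon> :: real
  assumes "ergodic_potential M \<tau> V0"
    and "standard_brownian_motion W B"
    and "S \<in> lorentz_space M DIM('a)"
    and "AE \<omega> in M. (SUP x\<in>ball 0 1. ereal (potential \<tau> V0 x \<omega>)) = ereal (S \<omega>)"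
    and "0 < \<rho>" and "0 < \<epsilon>"
    and "u \<in> borel_measurable M"
    and "AE \<omega> in M. emeasure lborel ({x. potential \<tau> V0 x \<omega> > \<epsilon>} \<inter> ball (u \<omega>) \<rho>) > ennreal \<epsilon>"
    and "integrable M (\<lambda>\<omega>. norm (u \<omega>) ^ DIM('a))"
  shows "(AE \<omega> in M. ((\<lambda>x. ereal (1 / norm x) *
             \<bar>travel_cost W B (\<lambda>z. potential \<tau> V0 z \<omega>) 0 x
               - ereal (lyapunov_exponent W B M \<tau> V0 x)\<bar>) \<longlongrightarrow> 0) at_infinity) \<and>
         (AE \<omega> in M. ((\<lambda>x. ereal (1 / norm x) *
             \<bar>neg_log (green_function W B (\<lambda>z. potential \<tau> V0 z \<omega>) 0 x)
               - ereal (lyapunov_exponent W B M \<tau> V0 x)\<bar>) \<longlongrightarrow> 0) at_infinity)"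
proof -
  interpret trapping_potential M \<tau> V0 W B S u \<rho> \<epsilon>
    by (intro trapping_potential.intro trapping_potential_axioms.intro assms)
  show ?thesis by (rule shape_theorem)
qed

end
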